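(* For each of the following eight maps, define parameters $k$ and $m$ as indicated: (1) the RSK map $\varphi$ on ${\rm Mat}(\mathbf a,\mathbf b)$: $k=\max\{\ell(\mathbf a),\ell(\mathbf b)\}$, $m=\max\{\sum_i a_i,\sum_j b_j\}$; (2) the jeu de taquin map $\psi$, (3) the Littlewood–Robinson map $\phi$, (5) the Schützenberger involution for normal shapes $\xi^{N}$, (6) the reversal map $\chi$, each on tableaux of shape $\lambda/\mu$ (with $\mu=\varnothing$ for $\xi^N$) and weight $\mathbf a$: $k=\ell(\mathbf a)$, $m=\lambda_1$; (4) the tableau switching map $\zeta$ on ${\rm YT}(\pi/\mu,\mathbf d)\times{\rm YT}(\lambda/\pi,\mathbf c)$: $k=\max\{\ell(\mathbf c),\ell(\mathbf d)\}$, $m=\lambda_1$; (7) the first and (8) second fundamental symmetry maps $\rho_1,\rho_2$ on ${\rm LR}(\lambda/\mu,\nu)$: $k=\ell(\nu)$, $m=\lambda_1$. Then the image under each of these maps can be computed at a cost of $O(k^3\log m)$.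
   Context: Tableaux. A partition is $\lambda=(\lambda_1\ge\cdots\ge\lambda_\ell\ge0)$; $[\lambda/\mu]=\{(i,j):\mu_i<j\le\lambda_i\}$ for $\mu\subset\lambda$ (English notation). A tableau of shape $\lambda/\mu$ is a map $A:[\lambda/\mu]\to\{1,2,\dots\}$ weakly increasing along rows, strictly increasing down columns; weight $\mathbf a$, $a_r$ = number of $r$'s (a vector of specified length $m'$, possibly with zeros); ${\rm YT}(\lambda/\mu,\mathbf a)$ is the set of these; $\mathbf a^*=(a_{m'},\dots,a_1)$; $\ell(\mathbf a)$ is the length of $\mathbf a$. Recording matrix $c_{i,j}$ = number of $j$'s in row $i$. ${\rm Can}(\lambda)$: row $i$ filled with $i$'s. ${\rm word}(A)$: rows read right to left, top row first; $A$ is LR if each initial segment of ${\rm word}(A)$ has at least as many $r$'s as $(r+1)$'s for all $r$; ${\rm LR}(\lambda/\mu,\nu)$ = LR tableaux of shape $\lambda/\mu$, weight $\nu$. Maps. RSK: ${\rm Mat}(\mathbf a,\mathbf b)$ = $k\times k$ nonnegative integer matrices with row sums $\mathbf a$, column sums $\mathbf b$; $\varphi(V)=(P,Q)$ by Schensted row insertion of the second coordinates of the lexicographically ordered pairs $(i,j)$ (each repeated $v_{i,j}$ times), $P$ the insertion tableau, $Q$ the recording tableau recording the $i$'s. $\psi$: jeu de taquin rectification. $\zeta(B,A)=(A',B')$ for $B\in{\rm YT}(\pi/\mu,\mathbf d)$, $A\in{\rm YT}(\lambda/\pi,\mathbf c)$ is Benkart–Sottile–Stroomer tableau switching: cells of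 $B$ processed in decreasing order of entries (equal entries right to left), the current $A$-part sliding (jeu de taquin) into each processed cell until the hole reaches the outer boundary, where the $B$-entry is placed; $A'\in{\rm YT}(\sigma/\mu,\mathbf c)$, $B'\in{\rm YT}(\lambda/\sigma,\mathbf d)$. Littlewood–Robinson: $(A',B')=\zeta({\rm Can}(\mu),A)$, $\sigma$ = shape of $A'$, $(B'',C')=\zeta({\rm Can}(\sigma),B')$, $\phi(A)=(A',C')$. $\xi^{N}(A)=\psi(A^\bullet)$ where $A^\bullet$ is $A$ rotated by $180^\circ$ in its bounding rectangle with each entry $x$ replaced by $m'+1-x$. Reversal: $(A',C')=\zeta({\rm Can}(\mu),A)$, $(C'',A'')=\zeta(\xi^{N}(A'),C')$, $\chi(A)=A''$. $\rho_1(A)$ = second component of $\zeta({\rm Can}(\mu),A)$ for $A\in{\rm LR}(\lambda/\mu,\nu)$. $\rho_2=\tau^{-1}\circ\xi^{N}\circ\gamma$, where, with $l=\ell(\lambda)$, $c_{0,0}=0$, $c_{i,0}=\mu_i$, $c_{r,j}=0$ for $r>l$, $\gamma(A)$ is the tableau of shape $\mu$ with recording matrix $d_{i,j}=\sum_{q=0}^{l-j}c_{l-j+i,q}-\sum_{q=0}^{l-j+1}c_{l-j+1+i,q}$, and $\tau(B)$ for $B\in{\rm LR}(\lambda/\nu,\mu)$ with recording matrix $(c'_{i,j})$ is the tableau of shape $\mu$ with recording matrix $e_{i,j}=c'_{j,i}$. Encoding and cost. Tableaux are given by Gelfand–Tsetlin arrays ($a_{i,0}=\mu_i$, $a_{i,j}=\mu_i+$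 number of entries $\le j$ in row $i$), matrices and partitions as integer arrays; cost is measured as running time in bit operations on these encodings.
   Formalization: For ψ, φ, ζ, χ, ρ₁, ρ₂ the bound uses max{k, ℓ(λ)} instead of k (false if ℓ(λ) far exceeds k, as ℓ(λ) rows must be read or written); log m is read as log(m+2), k as max{1,k}; loop counters and subscripts cost one unit each. *)

theory Defs
  imports
    Complex_Main
    "HOL-Library.While_Combinator"
    "HOL-Library.Product_Lexorder"
    "HOL-Library.Log_Nat"
begin

section \<open>Partitions and tableaux\<close>

text \<open>
  Rows, columns and letters are numbered from 1.  A partition is a function whose value at 0 is
  never used.  A tableau is a function of row and column that is 0 outside its shape.
  A skew tableau carries its inner shape, since rows without entries do not determine it.
\<close>

type_synonym ptn = "nat \<Rightarrow> nat"
type_synonym tab = "nat \<Rightarrow> nat \<Rightarrow> nat"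
type_synonym skew = "ptn \<times> tab"

definition is_partition :: "ptn \<Rightarrow> bool" where
  "is_partition \<Lambda> \<longleftrightarrow> (\<forall>i\<ge>1. \<Lambda> (Suc i) \<le> \<Lambda> i) \<and> finite {i. 1 \<le> i \<and> \<Lambda> i \<noteq> 0}"

definition plen :: "ptn \<Rightarrow> nat" where
  "plen \<Lambda> = card {i. 1 \<le> i \<and> \<Lambda> i \<noteq> 0}"

definition contains :: "ptn \<Rightarrow> ptn \<Rightarrow> bool" where
  "contains \<Lambda> \<mu> \<longleftrightarrow> is_partition \<Lambda> \<and> is_partition \<mu> \<and> (\<forall>i\<ge>1. \<mu> i \<le> \<Lambda> i)"

definition empty_ptn :: ptn where
  "empty_ptn = (\<lambda>_. 0)"

definition cells :: "ptn \<Rightarrow> ptn \<Rightarrow> (nat \<times> nat) set" where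
  "cells \<Lambda> \<mu> = {(i, j). 1 \<le> i \<and> \<mu> i < j \<and> j \<le> \<Lambda> i}"

text \<open>Weights are vectors of a specified length, possibly with zeros.\<close>

definition entry :: "nat list \<Rightarrow> nat \<Rightarrow> nat" where
  "entry a r = (if 1 \<le> r \<and> r \<le> length a then a ! (r - 1) else 0)"

definition parts :: "ptn \<Rightarrow> nat list" where
  "parts \<mu> = map \<mu> [1..<Suc (plen \<mu>)]"

definition YT :: "ptn \<Rightarrow> ptn \<Rightarrow> nat list \<Rightarrow> tab set" where
  "YT \<Lambda> \<mu> a = {A.
     (\<forall>i j. A i j \<noteq> 0 \<longleftrightarrow> (i, j) \<in> cells \<Lambda> \<mu>) \<and>
     (\<forall>i j j'. (i, j) \<in> cells \<Lambda> \<mu> \<longrightarrow> (i, j') \<in> cells \<Lambda> \<mu> \<longrightarrow> j < j' \<longrightarrow> A i j \<le> A i j') \<and>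
     (\<forall>i i' j. (i, j) \<in> cells \<Lambda> \<mu> \<longrightarrow> (i', j) \<in> cells \<Lambda> \<mu> \<longrightarrow> i < i' \<longrightarrow> A i j < A i' j) \<and>
     (\<forall>i j. A i j \<le> length a) \<and>
     (\<forall>r\<in>{1..length a}. card {(i, j). A i j = r} = entry a r)}"

definition word :: "ptn \<Rightarrow> ptn \<Rightarrow> tab \<Rightarrow> nat list" where
  "word \<Lambda> \<mu> A = concat (map (\<lambda>i. map (A i) (rev [Suc (\<mu> i)..<Suc (\<Lambda> i)])) [1..<Suc (plen \<Lambda>)])"

definition LR :: "ptn \<Rightarrow> ptn \<Rightarrow> nat list \<Rightarrow> tab set" where
  "LR \<Lambda> \<mu> \<nu> = {A \<in> YT \<Lambda> \<mu> \<nu>.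
     \<forall>p. \<forall>r\<ge>1. count_list (take p (word \<Lambda> \<mu> A)) (Suc r) \<le> count_list (take p (word \<Lambda> \<mu> A)) r}"

definition Can :: "ptn \<Rightarrow> skew" where
  "Can \<mu> = (empty_ptn, \<lambda>i j. if (i, j) \<in> cells \<mu> empty_ptn then i else 0)"

definition outer :: "skew \<Rightarrow> ptn" where
  "outer = (\<lambda>(\<mu>, A) i. \<mu> i + card {j. A i j \<noteq> 0})"

text \<open>Recording matrix; only meaningful for a letter \<open>r \<ge> 1\<close>.\<close>

definition rec_mat :: "tab \<Rightarrow> nat \<Rightarrow> nat \<Rightarrow> nat" where
  "rec_mat A i r = card {j. A i j = r}"

text \<open>
  The filling with inner shape \<open>\<pi>\<close>, weakly increasing rows, letters at most \<open>l\<close> and recording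
  matrix \<open>d\<close>.
\<close>

definition filling :: "ptn \<Rightarrow> nat \<Rightarrow> (nat \<Rightarrow> nat \<Rightarrow> nat) \<Rightarrow> tab" where
  "filling \<pi> l d i j =
     (if 1 \<le> i \<and> \<pi> i < j \<and> j \<le> \<pi> i + (\<Sum>q=1..l. d i q)
      then LEAST r. j \<le> \<pi> i + (\<Sum>q=1..r. d i q) else 0)"


section \<open>Robinson--Schensted--Knuth\<close>

definition Mat :: "nat list \<Rightarrow> nat list \<Rightarrow> (nat \<Rightarrow> nat \<Rightarrow> nat) set" where
  "Mat a b = {V. let k = max (length a) (length b) in
     (\<forall>i\<in>{1..k}. (\<Sum>j=1..k. V i j) = entry a i) \<and>
     (\<forall>j\<in>{1..k}. (\<Sum>i=1..k. V i j) = entry b j)}"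

text \<open>Insertion of \<open>x\<close> into a row, together with the bumped entry, if any.\<close>

fun row_insert :: "nat \<Rightarrow> nat list \<Rightarrow> nat list \<times> nat option" where
  "row_insert x [] = ([x], None)"
| "row_insert x (y # ys) =
     (if x < y then (x # ys, Some y)
      else let (r, z) = row_insert x ys in (y # r, z))"

text \<open>Insertion of \<open>j\<close> into \<open>P\<close>, recording \<open>i\<close> in the new cell of \<open>Q\<close>; tableaux as lists of rows.\<close>

fun rsk_insert :: "nat \<Rightarrow> nat \<Rightarrow> nat list list \<Rightarrow> nat list list \<Rightarrow> nat list list \<times> nat list list" where
  "rsk_insert i j (p # P) (q # Q) =
     (case row_insert j p of
        (p', None) \<Rightarrow> (p' # P, (q @ [i]) # Q)
      | (p', Some z) \<Rightarrow> (let (P', Q') = rsk_insert i z P Q in (p' # P', q # Q')))"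
| "rsk_insert i j _ _ = ([[j]], [[i]])"

definition biword :: "nat \<Rightarrow> (nat \<Rightarrow> nat \<Rightarrow> nat) \<Rightarrow> (nat \<times> nat) list" where
  "biword k V =
     concat (map (\<lambda>i. concat (map (\<lambda>j. replicate (V i j) (i, j)) [1..<Suc k])) [1..<Suc k])"

definition tab_of_rows :: "nat list list \<Rightarrow> tab" where
  "tab_of_rows R i j =
     (if 1 \<le> i \<and> i \<le> length R \<and> 1 \<le> j \<and> j \<le> length (R ! (i - 1)) then R ! (i - 1) ! (j - 1) else 0)"

definition RSK :: "nat \<Rightarrow> (nat \<Rightarrow> nat \<Rightarrow> nat) \<Rightarrow> skew \<times> skew" where
  "RSK k V =
     (let (P, Q) = fold (\<lambda>(i, j) (P, Q). rsk_insert i j P Q) (biword k V) ([], [])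
      in ((empty_ptn, tab_of_rows P), (empty_ptn, tab_of_rows Q)))"


section \<open>Slides, rectification and tableau switching\<close>

definition upd :: "tab \<Rightarrow> nat \<Rightarrow> nat \<Rightarrow> nat \<Rightarrow> tab" where
  "upd A i j x = A(i := (A i)(j := x))"

text \<open>Slide into the hole \<open>(i, j)\<close>; the result contains the final position of the hole.\<close>

definition slide :: "tab \<times> nat \<times> nat \<Rightarrow> tab \<times> nat \<times> nat" where
  "slide = while
     (\<lambda>(A, i, j). A i (Suc j) \<noteq> 0 \<or> A (Suc i) j \<noteq> 0)
     (\<lambda>(A, i, j).
        let r = A i (Suc j); d = A (Suc i) j in
        if d \<noteq> 0 \<and> (r = 0 \<or> d \<le> r)
        then (upd (upd A i j d) (Suc i) j 0, Suc i, j)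
        else (upd (upd A i j r) i (Suc j) 0, i, Suc j))"

text \<open>
  The result does not depend on the order in which the cells of the inner shape are vacated;
  here this is done from the last row upwards, from right to left in each row.
\<close>

definition rectify :: "skew \<Rightarrow> skew" where
  "rectify = (\<lambda>(\<mu>, A).
     (empty_ptn,
      fold (\<lambda>(i, j) A. fst (slide (A, i, j))) (rev (sorted_list_of_set (cells \<mu> empty_ptn))) A))"

text \<open>
  The triples (entry, column, row) of \<open>B\<close> are sorted lexicographically, so that reversing the list
  processes the cells in decreasing order of entries, equal entries from right to left.
\<close>

definition switch :: "skew \<Rightarrow> skew \<Rightarrow> skew \<times> skew" where
  "switch = (\<lambda>(\<mu>, B) (\<pi>, A).
     let (A', B') =
       fold (\<lambda>(x, j, i) (A, B'). let (A, i', j') = slide (A, i, j) in (A, upd B' i' j' x))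
         (rev (sorted_list_of_set {(B i j, j, i) | i j. B i j \<noteq> 0}))
         (A, \<lambda>_ _. 0)
     in ((\<mu>, A'), (outer (\<mu>, A'), B')))"


section \<open>The other maps\<close>

definition littlewood_robinson :: "skew \<Rightarrow> skew \<times> skew" where
  "littlewood_robinson = (\<lambda>(\<mu>, A).
     let (A', B') = switch (Can \<mu>) (\<mu>, A);
         (B'', C') = switch (Can (outer A')) B'
     in (A', C'))"

text \<open>\<open>k\<close> is the length of the weight; for tableaux of normal shape.\<close>

definition rotate_tab :: "nat \<Rightarrow> skew \<Rightarrow> skew" where
  "rotate_tab k = (\<lambda>(\<mu>, A).
     let \<Lambda> = outer (\<mu>, A); n = plen \<Lambda>; N = \<Lambda> 1 in
     (\<lambda>i. if 1 \<le> i \<and> i \<le> n then N - \<Lambda> (n + 1 - i) else 0,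
      \<lambda>i j. if 1 \<le> i \<and> i \<le> n \<and> 1 \<le> j \<and> j \<le> N \<and> A (n + 1 - i) (N + 1 - j) \<noteq> 0
            then k + 1 - A (n + 1 - i) (N + 1 - j) else 0))"

definition xi :: "nat \<Rightarrow> skew \<Rightarrow> skew" where
  "xi k A = rectify (rotate_tab k A)"

definition reversal :: "nat \<Rightarrow> skew \<Rightarrow> skew" where
  "reversal k = (\<lambda>(\<mu>, A).
     let (A', C') = switch (Can \<mu>) (\<mu>, A);
         (C'', A'') = switch (xi k A') C'
     in A'')"

definition rho1 :: "skew \<Rightarrow> skew" where
  "rho1 = (\<lambda>(\<mu>, A). snd (switch (Can \<mu>) (\<mu>, A)))"

text \<open>The subtraction below does not truncate on Littlewood--Richardson tableaux.\<close>

definition gamma :: "nat \<Rightarrow> skew \<Rightarrow> skew" where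
  "gamma l = (\<lambda>(\<mu>, A).
     let c = (\<lambda>i q. if i = 0 \<or> l < i then 0 else if q = 0 then \<mu> i else rec_mat A i q);
         d = (\<lambda>i j. (\<Sum>q=0..l-j. c (l - j + i) q) - (\<Sum>q=0..l-j+1. c (l - j + 1 + i) q))
     in (empty_ptn, filling empty_ptn l d))"

definition tau :: "nat \<Rightarrow> tab \<Rightarrow> skew" where
  "tau l B = (empty_ptn, filling empty_ptn l (\<lambda>i j. rec_mat B j i))"

definition rho2 :: "ptn \<Rightarrow> nat list \<Rightarrow> skew \<Rightarrow> skew" where
  "rho2 \<Lambda> \<nu> = (\<lambda>(\<mu>, A).
     let l = plen \<Lambda> in
     (entry \<nu>, inv_into (LR \<Lambda> (entry \<nu>) (parts \<mu>)) (tau l) (xi l (gamma l (\<mu>, A)))))"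


section \<open>Computations and their cost in bit operations\<close>

text \<open>
  Programs work on integer arrays (each with two indices) and on index registers.  Operations on
  array entries are charged the bit lengths of their operands (logarithmic cost criterion).
  Index registers serve only as loop counters and subscripts: they can be reset, copied,
  incremented, decremented and compared, at unit cost, and never receive array entries.
\<close>

type_synonym arr = "nat \<Rightarrow> nat \<Rightarrow> int"

record store =
  idx :: "nat \<Rightarrow> nat"
  mem :: "nat \<Rightarrow> arr"

text \<open>\<open>Ref x u v\<close> is the entry of array \<open>x\<close> whose subscripts are held in registers \<open>u\<close> and \<open>v\<close>.\<close>

datatype ref = Ref nat nat nat

datatype test =
    IdxLess nat nat
  | ValLess ref ref

datatype com =
    Skip
  | IdxZero nat
  | IdxCopy nat nat
  | IdxSucc nat
  | IdxPred nat
  | Const ref int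
  | Copy ref ref
  | Add ref ref ref
  | Sub ref ref ref
  | Seq com com
  | Cond test com com
  | While test com

fun val :: "store \<Rightarrow> ref \<Rightarrow> int" where
  "val s (Ref x u v) = mem s x (idx s u) (idx s v)"

fun set_idx :: "nat \<Rightarrow> nat \<Rightarrow> store \<Rightarrow> store" where
  "set_idx u n s = s\<lparr>idx := (idx s)(u := n)\<rparr>"

fun set_val :: "ref \<Rightarrow> int \<Rightarrow> store \<Rightarrow> store" where
  "set_val (Ref x u v) z s =
     s\<lparr>mem := (mem s)(x := (mem s x)(idx s u := (mem s x (idx s u))(idx s v := z)))\<rparr>"

definition bits :: "int \<Rightarrow> nat" where
  "bits z = nat (bitlen \<bar>z\<bar>)"

fun holds :: "test \<Rightarrow> store \<Rightarrow> bool" where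
  "holds (IdxLess u v) s \<longleftrightarrow> idx s u < idx s v"
| "holds (ValLess x y) s \<longleftrightarrow> val s x < val s y"

fun test_cost :: "test \<Rightarrow> store \<Rightarrow> nat" where
  "test_cost (IdxLess u v) s = 1"
| "test_cost (ValLess x y) s = 1 + bits (val s x) + bits (val s y)"

text \<open>\<open>run p s t s'\<close>: started in \<open>s\<close>, the program \<open>p\<close> halts in \<open>s'\<close> after \<open>t\<close> bit operations.\<close>

inductive run :: "com \<Rightarrow> store \<Rightarrow> nat \<Rightarrow> store \<Rightarrow> bool" where
  "run Skip s 1 s"
| "run (IdxZero u) s 1 (set_idx u 0 s)"
| "run (IdxCopy u v) s 1 (set_idx u (idx s v) s)"
| "run (IdxSucc u) s 1 (set_idx u (idx s u + 1) s)"
| "run (IdxPred u) s 1 (set_idx u (idx s u - 1) s)"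
| "run (Const x z) s (1 + bits z) (set_val x z s)"
| "run (Copy x y) s (1 + bits (val s y)) (set_val x (val s y) s)"
| "run (Add x y z) s (1 + bits (val s y) + bits (val s z)) (set_val x (val s y + val s z) s)"
| "run (Sub x y z) s (1 + bits (val s y) + bits (val s z)) (set_val x (val s y - val s z) s)"
| "run p s t s' \<Longrightarrow> run q s' t' s'' \<Longrightarrow> run (Seq p q) s (t + t') s''"
| "holds b s \<Longrightarrow> run p s t s' \<Longrightarrow> run (Cond b p q) s (test_cost b s + t) s'"
| "\<not> holds b s \<Longrightarrow> run q s t s' \<Longrightarrow> run (Cond b p q) s (test_cost b s + t) s'"
| "\<not> holds b s \<Longrightarrow> run (While b p) s (test_cost b s) s"
| "holds b s \<Longrightarrow> run p s t s' \<Longrightarrow> run (While b p) s' t' s'' \<Longrightarrow>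
     run (While b p) s (test_cost b s + t + t') s''"

definition mat_array :: "nat \<Rightarrow> (nat \<Rightarrow> nat \<Rightarrow> nat) \<Rightarrow> arr" where
  "mat_array k V i j = (if 1 \<le> i \<and> i \<le> k \<and> 1 \<le> j \<and> j \<le> k then int (V i j) else 0)"

text \<open>
  The Gelfand--Tsetlin array of a tableau with rows \<open>1..n\<close> and letters \<open>1..k\<close>.
\<close>

definition gt_array :: "nat \<Rightarrow> nat \<Rightarrow> skew \<Rightarrow> arr" where
  "gt_array n k = (\<lambda>(\<mu>, A) i j.
     if 1 \<le> i \<and> i \<le> n \<and> j \<le> k then int (\<mu> i + card {c. 1 \<le> A i c \<and> A i c \<le> j}) else 0)"

text \<open>
  Initially the registers \<open>0, 1, \<dots>\<close> hold the dimensions and the arrays \<open>0, 1, \<dots>\<close> the input;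
  everything else is 0.  The output is expected in the arrays following those of the input.
\<close>

definition input_store :: "nat list \<Rightarrow> arr list \<Rightarrow> store" where
  "input_store dims ins =
     \<lparr>idx = (\<lambda>u. if u < length dims then dims ! u else 0),
      mem = (\<lambda>x. if x < length ins then ins ! x else (\<lambda>_ _. 0))\<rparr>"

definition computes :: "com \<Rightarrow> nat list \<Rightarrow> arr list \<Rightarrow> arr list \<Rightarrow> real \<Rightarrow> bool" where
  "computes p dims ins outs T \<longleftrightarrow>
     (\<exists>t s. run p (input_store dims ins) t s \<and> real t \<le> T \<and>
        (\<forall>x<length outs. mem s (length ins + x) = outs ! x))"

text \<open>
  Twice \<open>k^3 log m\<close> is an upper bound for this when \<open>k \<ge> 1\<close> and \<open>m \<ge> 2\<close>.  The adjustments only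
  matter for \<open>k = 0\<close> and \<open>m \<le> 1\<close>, where \<open>k^3 log m\<close> vanishes or is undefined.

  For skew tableaux, \<open>k\<close> has to be at least the number \<open>n\<close> of nonzero rows of the outer shape,
  since the arrays have \<open>n\<close> rows: the tableau of shape
  \<open>(n, n - 1, \<dots>, 1) / (n - 1, \<dots>, 1, 0)\<close> and weight \<open>(n)\<close> has a weight of length 1.
\<close>

definition cube_log :: "nat \<Rightarrow> nat \<Rightarrow> real" where
  "cube_log k m = real (max 1 k) ^ 3 * log 2 (real m + 2)"

end

theory Submission
  imports Defs
begin

text \<open>
  A tableau is a chain of partitions, the regions occupied by the letters up to \<open>j\<close>, in which
  consecutive partitions interlace. Sliding one strip through another replaces row \<open>i + 1\<close> of the
  middle one of three consecutive partitions \<open>\<pi>, \<alpha>, \<beta>\<close> by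
  \<open>min (\<pi> i) (\<beta> (i + 1)) + max (\<pi> (i + 1)) (\<beta> (i + 2)) - \<alpha> (i + 1)\<close>,
  a Bender--Knuth toggle. Switching tableaux with \<open>d\<close> and \<open>c\<close> letters therefore takes \<open>d * c\<close> toggles
  of at most \<open>n\<close> rows each, that is \<open>O(k ^ 3)\<close> operations on numbers of \<open>O(log m)\<close> bits.
  Rectification is switching with a canonical tableau, and the remaining maps on tableaux are
  compositions of switches with linear transformations of the arrays. For \<open>\<rho>\<^sub>2\<close> one has to know that
  the Littlewood--Richardson tableau read off from the evacuated tableau exists; this holds because
  toggles preserve bounds on the crystal string lengths, in terms of which the Littlewood--Richardson
  condition is expressed.

  For RSK, a whole weakly increasing word with multiplicities \<open>w\<close> is inserted into a row at once: if
  \<open>R j\<close> counts the entries up to \<open>j\<close>, the new row satisfies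
  \<open>R' (j + 1) = max (R' j) (R (j + 1)) + w (j + 1)\<close>.
\<close>

text \<open>The switch is defined by slides of single cells, each running through all letters of the
  second tableau, whereas a toggle moves a whole strip past a single letter. Exchanging these two
  loops is the main work: only the row of the hole after each letter is recorded, and the holes left
  by a strip are shown to cross one letter as the toggle formula predicts. Two further facts are not
  visible in the toggles. The reversal feeds the evacuated tableau back into a switch, so evacuation
  must keep the shape; this is a statement about filling a rectangle, and it holds because the
  displaced canonical tableau remains Yamanouchi. And \<open>rho2\<close> is defined by an inverse
  given only by choice, so the tableau that it selects has to be constructed and shown unique before
  it can be computed. As to the cost, registers can only be incremented and decremented, so a
  subscript that is a sum or a difference takes linear time; tables with quadratically many entries
  can afford this.\<close>

section \<open>Interlacing partitions and toggles\<close>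

definition interlace :: "ptn \<Rightarrow> ptn \<Rightarrow> bool" where
  "interlace \<alpha> \<beta> \<longleftrightarrow> (\<forall>i. \<alpha> i \<le> \<beta> i \<and> \<beta> (Suc i) \<le> \<alpha> i)"

lemma interlaceD: "interlace \<alpha> \<beta> \<Longrightarrow> \<alpha> i \<le> \<beta> i" "interlace \<alpha> \<beta> \<Longrightarrow> \<beta> (Suc i) \<le> \<alpha> i"
  by (auto simp: interlace_def)

fun toggle :: "ptn \<Rightarrow> ptn \<Rightarrow> ptn \<Rightarrow> ptn" where
  "toggle \<pi> \<alpha> \<beta> 0 = \<alpha> 0"
| "toggle \<pi> \<alpha> \<beta> (Suc i) =
     min (\<pi> i) (\<beta> (Suc i)) + max (\<pi> (Suc i)) (\<beta> (Suc (Suc i))) - \<alpha> (Suc i)"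

text \<open>The natural subtraction does not truncate: interlacing bounds
  \<open>\<alpha> (Suc i)\<close> by both arguments of the minimum.\<close>

lemma toggle_int:
  assumes "interlace \<pi> \<alpha>" "interlace \<alpha> \<beta>"
  shows "int (toggle \<pi> \<alpha> \<beta> (Suc i)) = min (int (\<pi> i)) (int (\<beta> (Suc i)))
    + max (int (\<pi> (Suc i))) (int (\<beta> (Suc (Suc i)))) - int (\<alpha> (Suc i))"
  using interlaceD(1)[OF assms(1), of "Suc i"] interlaceD(2)[OF assms(1), of i]
    interlaceD(1)[OF assms(2), of "Suc i"] interlaceD(2)[OF assms(2), of "Suc i"]
  by (auto simp: min_def max_def)

text \<open>Interlacing with both neighbours confines row i + 1 of the middle partition to the
  interval from the maximum to the minimum in the toggle formula. The toggle reflects this interval,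
  so the new row stays in it.\<close>

lemma interlace_toggle:
  assumes "interlace \<pi> \<alpha>" "interlace \<alpha> \<beta>"
  shows "interlace \<pi> (toggle \<pi> \<alpha> \<beta>)" "interlace (toggle \<pi> \<alpha> \<beta>) \<beta>"
proof -
  have A: "\<pi> i \<le> \<alpha> i" "\<alpha> (Suc i) \<le> \<pi> i" "\<alpha> i \<le> \<beta> i" "\<beta> (Suc i) \<le> \<alpha> i" for i
    using assms by (auto simp: interlace_def)
  have B: "toggle \<pi> \<alpha> \<beta> (Suc i) \<le> min (\<pi> i) (\<beta> (Suc i))"
     "max (\<pi> (Suc i)) (\<beta> (Suc (Suc i))) \<le> toggle \<pi> \<alpha> \<beta> (Suc i)" for i
    using A(1)[of "Suc i"] A(2)[of i] A(3)[of "Suc i"] A(4)[of "Suc i"] by auto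
  have C: "\<pi> i \<le> toggle \<pi> \<alpha> \<beta> i \<and> toggle \<pi> \<alpha> \<beta> (Suc i) \<le> \<pi> i \<and> toggle \<pi> \<alpha> \<beta> i \<le> \<beta> i
      \<and> \<beta> (Suc i) \<le> toggle \<pi> \<alpha> \<beta> i" for i
  proof (cases i)
    case 0
    then show ?thesis using A[of 0] B[of 0] by simp
  next
    case (Suc j)
    then show ?thesis using B[of j] B[of i] by simp
  qed
  then show "interlace \<pi> (toggle \<pi> \<alpha> \<beta>)" "interlace (toggle \<pi> \<alpha> \<beta>) \<beta>"
    by (auto simp: interlace_def)
qed

text \<open>
  Row 0 of every partition in a chain holds a common upper bound, which plays the role of the
  infinitely long row above the diagram.
\<close>

definition chain :: "nat \<Rightarrow> nat \<Rightarrow> nat \<Rightarrow> (nat \<Rightarrow> ptn) \<Rightarrow> bool" where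
  "chain M n L D \<longleftrightarrow>
     (\<forall>j\<le>L. D j 0 = M \<and> (\<forall>i>n. D j i = 0) \<and> (\<forall>i. D j (Suc i) \<le> D j i)) \<and>
     (\<forall>j<L. interlace (D j) (D (Suc j)))"

lemma chain_row0: "chain M n L D \<Longrightarrow> j \<le> L \<Longrightarrow> D j 0 = M"
  and chain_rows: "chain M n L D \<Longrightarrow> j \<le> L \<Longrightarrow> i > n \<Longrightarrow> D j i = 0"
  and chain_dec: "chain M n L D \<Longrightarrow> j \<le> L \<Longrightarrow> D j (Suc i) \<le> D j i"
  and chain_interlace: "chain M n L D \<Longrightarrow> j < L \<Longrightarrow> interlace (D j) (D (Suc j))"
  by (auto simp: chain_def)

lemma chain_antimono:
  assumes "chain M n L D" "j \<le> L" "i \<le> i'"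
  shows "D j i' \<le> D j i"
  using assms(3)
proof (induction i' rule: dec_induct)
  case (step i')
  then show ?case using chain_dec[OF assms(1,2), of i'] by simp
qed simp

lemma chain_le: "chain M n L D \<Longrightarrow> j \<le> L \<Longrightarrow> D j i \<le> M"
  using chain_antimono[of M n L D j 0 i] chain_row0 by fastforce

lemma chain_mono:
  assumes "chain M n L D" "j \<le> j'" "j' \<le> L"
  shows "D j i \<le> D j' i"
  using assms(2,3)
proof (induction j' rule: dec_induct)
  case (step j')
  then show ?case using interlaceD(1)[OF chain_interlace[OF assms(1), of j'], of i] by simp
qed simp

lemma chain_toggle:
  assumes D: "interlace \<pi> \<alpha>" "interlace \<alpha> \<beta>" "\<alpha> 0 = M" "\<And>i. i > n \<Longrightarrow> \<beta> i = 0"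
  shows "toggle \<pi> \<alpha> \<beta> 0 = M" "\<And>i. i > n \<Longrightarrow> toggle \<pi> \<alpha> \<beta> i = 0"
    "toggle \<pi> \<alpha> \<beta> (Suc i) \<le> toggle \<pi> \<alpha> \<beta> i"
proof -
  note I = interlace_toggle[OF D(1,2)]
  show "toggle \<pi> \<alpha> \<beta> 0 = M" using D by simp
  show "toggle \<pi> \<alpha> \<beta> i = 0" if "i > n" for i
    using interlaceD(1)[OF I(2), of i] D(4)[OF that] by simp
  show "toggle \<pi> \<alpha> \<beta> (Suc i) \<le> toggle \<pi> \<alpha> \<beta> i"
    using interlaceD(2)[OF I(1), of i] interlaceD(1)[OF I(1), of i] by simp
qed

section \<open>Switching as a growth diagram\<close>

definition tog :: "nat \<Rightarrow> (nat \<Rightarrow> ptn) \<Rightarrow> nat \<Rightarrow> ptn" where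
  "tog p D = D(p := toggle (D (p - 1)) (D p) (D (Suc p)))"

lemma chain_tog:
  assumes "chain M n L D" "1 \<le> p" "p < L"
  shows "chain M n L (tog p D)"
proof -
  obtain q where q: "p = Suc q" using assms(2) by (cases p) auto
  have I: "interlace (D q) (D p)" "interlace (D p) (D (Suc p))"
    using chain_interlace[OF assms(1), of q] chain_interlace[OF assms(1), of p] assms q by auto
  note T = chain_toggle[OF I, of M n] and J = interlace_toggle[OF I]
  have z: "\<And>i. i > n \<Longrightarrow> D (Suc p) i = 0" "D p 0 = M" using assms by (auto simp: chain_def)
  show ?thesis
    unfolding chain_def
  proof (intro conjI allI impI)
    fix j assume j: "j < L"
    show "interlace (tog p D j) (tog p D (Suc j))"
      using chain_interlace[OF assms(1) j] J q by (auto simp: tog_def)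
  qed (use assms T z q in \<open>auto simp: tog_def chain_def\<close>)
qed

text \<open>Toggling shape x exchanges the strips x and x + 1, so c toggles at consecutive positions
  carry strip x past c strips.\<close>

fun pass :: "nat \<Rightarrow> nat \<Rightarrow> (nat \<Rightarrow> ptn) \<Rightarrow> nat \<Rightarrow> ptn" where
  "pass x 0 D = D"
| "pass x (Suc c) D = tog (x + c) (pass x c D)"

text \<open>The last strip of the first tableau, number d, goes first: it borders on the second
  tableau, and it consists of the cells with the largest letter, which the switch processes
  first.\<close>

fun switches :: "nat \<Rightarrow> nat \<Rightarrow> nat \<Rightarrow> (nat \<Rightarrow> ptn) \<Rightarrow> nat \<Rightarrow> ptn" where
  "switches d c 0 D = D"
| "switches d c (Suc y) D = pass (d - y) c (switches d c y D)"

lemma chain_pass: "chain M n L D \<Longrightarrow> 1 \<le> x \<Longrightarrow> x + c \<le> L \<Longrightarrow> chain M n L (pass x c D)"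
  by (induction c) (auto intro!: chain_tog)

lemma chain_switches:
  "chain M n L D \<Longrightarrow> y \<le> d \<Longrightarrow> d + c \<le> L \<Longrightarrow> chain M n L (switches d c y D)"
  by (induction y) (auto intro!: chain_pass)

text \<open>
  The growth diagram of the switch: \<open>grid d D y j\<close> is the shape reached after \<open>d - y\<close> strips of the
  first tableau followed by the first \<open>j\<close> strips of the second one.
\<close>

fun grid :: "nat \<Rightarrow> (nat \<Rightarrow> ptn) \<Rightarrow> nat \<Rightarrow> nat \<Rightarrow> ptn" where
  "grid d D 0 j = D (d + j)"
| "grid d D (Suc y) 0 = D (d - Suc y)"
| "grid d D (Suc y) (Suc j) = toggle (grid d D (Suc y) j) (grid d D y j) (grid d D y (Suc j))"

lemma grid_0 [simp]: "grid d D y 0 = D (d - y)"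
  by (cases y) auto

text \<open>A pass works from left to right: when position x + j is toggled, its left neighbour is
  already new and its right neighbour still old. These are the shapes from which the growth diagram
  computes its next row.\<close>

lemma pass_grid:
  assumes "1 \<le> x" "G' 0 = D (x - 1)"
    "\<And>j. j < c \<Longrightarrow> G' (Suc j) = toggle (G' j) (D (x + j)) (D (x + Suc j))"
  shows "pass x c D p = (if x \<le> p \<and> p < x + c then G' (p + 1 - x) else D p)"
  using assms(3)
proof (induction c arbitrary: p)
  case (Suc c)
  have IH: "pass x c D p = (if x \<le> p \<and> p < x + c then G' (p + 1 - x) else D p)" for p
    using Suc by auto
  have "pass x c D (x + c - 1) = G' c"
    using IH[of "x + c - 1"] assms(1,2) by (cases "c = 0") auto
  then show ?case
    using Suc.prems[of c] assms(1) IH[of "x + c"] IH[of "Suc (x + c)"] IH[of p]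
    by (auto simp: tog_def Suc_diff_le less_Suc_eq)
qed auto

text \<open>After y passes the chain is a lattice path in the growth diagram: through the first
  column from row d to row y, along row y, and through the last column from row y to row 0. The last
  clause keeps track of the shapes that no later pass touches.\<close>

lemma switches_grid_aux:
  "y \<le> d \<Longrightarrow> (\<forall>p\<le>d - y. switches d c y D p = D p) \<and>
    (\<forall>j\<le>c. switches d c y D (d - y + j) = grid d D y j) \<and>
    (\<forall>z\<le>y. switches d c y D (d - z + c) = grid d D z c)"
proof (induction y)
  case (Suc y)
  have y: "Suc (d - Suc y) = d - y" "d - y - 1 = d - Suc y" "1 \<le> d - y" "y \<le> d" using Suc.prems by auto
  note IH = Suc.IH[OF y(4)]
  have IH1: "switches d c y D p = D p" if "p \<le> d - y" for p
    using IH that by blast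
  have IH2: "switches d c y D (d - y + j) = grid d D y j" if "j \<le> c" for j
    using IH that by blast
  have IH3: "switches d c y D (d - z + c) = grid d D z c" if "z \<le> y" for z
    using IH that by blast
  have P: "switches d c (Suc y) D p =
     (if d - y \<le> p \<and> p < d - y + c then grid d D (Suc y) (p + 1 - (d - y)) else switches d c y D p)" for p
    unfolding switches.simps
  proof (rule pass_grid)
    show "1 \<le> d - y" using y by simp
    show "grid d D (Suc y) 0 = switches d c y D (d - y - 1)" using IH1[of "d - Suc y"] y by simp
    show "grid d D (Suc y) (Suc j) = toggle (grid d D (Suc y) j) (switches d c y D (d - y + j))
        (switches d c y D (d - y + Suc j))" if "j < c" for j
      using IH2[of j] IH2[of "Suc j"] that by simp
  qed
  have 2: "switches d c (Suc y) D (d - Suc y + j) = grid d D (Suc y) j" if "j \<le> c" for j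
  proof (cases j)
    case 0
    have "d - Suc y < d - y" "d - Suc y \<le> d - y" using y(3) by auto
    then show ?thesis using IH1[of "d - Suc y"] 0 by (subst P) simp
  next
    case (Suc i)
    then have "d - Suc y + j = d - y + i" using y by simp
    moreover have "switches d c (Suc y) D (d - y + i) = grid d D (Suc y) (Suc i)"
      using that Suc by (subst P) simp
    ultimately show ?thesis using Suc by metis
  qed
  have 3: "switches d c (Suc y) D (d - z + c) = grid d D z c" if "z \<le> y" for z
    using IH3[OF that] that by (subst P) auto
  show ?case
  proof (intro conjI allI impI)
    show "switches d c (Suc y) D p = D p" if "p \<le> d - Suc y" for p
      using IH1[of p] that y(3) by (subst P) auto
    show "switches d c (Suc y) D (d - z + c) = grid d D z c" if "z \<le> Suc y" for z
      using 2[of c] 3[of z] that by (cases "z = Suc y") (auto simp del: switches.simps)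
  qed (rule 2)
qed auto

lemma switches_grid:
  assumes "y \<le> d"
  shows "p \<le> d - y \<Longrightarrow> switches d c y D p = D p"
    "j \<le> c \<Longrightarrow> switches d c y D (d - y + j) = grid d D y j"
    "z \<le> y \<Longrightarrow> switches d c y D (d - z + c) = grid d D z c"
  using switches_grid_aux[OF assms] by auto

text \<open>In the end the path is row d followed by the last column, so the first c strips form the
  image of the second tableau and the last d strips that of the first one.\<close>

lemma switches_final:
  "j \<le> c \<Longrightarrow> switches d c d D j = grid d D d j"
  "x \<le> d \<Longrightarrow> switches d c d D (c + x) = grid d D (d - x) c"
  using switches_grid(2)[of d d j c D] switches_grid(3)[of d d "d - x" c D] by (auto simp: add.commute)

text \<open>Each row is a segment of an intermediate chain. Vertical neighbours in an inner column
  need not be neighbours in such a chain; for them the toggle is followed along the row.\<close>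

lemma grid_interlace:
  assumes D: "chain M n (d + c) D"
  shows "y \<le> d \<Longrightarrow> j \<le> c \<Longrightarrow> grid d D y j 0 = M \<and> (\<forall>i>n. grid d D y j i = 0)"
    "y \<le> d \<Longrightarrow> j < c \<Longrightarrow> interlace (grid d D y j) (grid d D y (Suc j))"
    "y < d \<Longrightarrow> j \<le> c \<Longrightarrow> interlace (grid d D (Suc y) j) (grid d D y j)"
proof -
  have C: "chain M n (d + c) (switches d c y D)" if "y \<le> d" for y
    using chain_switches[OF D that] by simp
  show "grid d D y j 0 = M \<and> (\<forall>i>n. grid d D y j i = 0)" if "y \<le> d" "j \<le> c"
    using chain_row0[OF C[OF that(1)], of "d - y + j"] chain_rows[OF C[OF that(1)], of "d - y + j"]
      switches_grid(2)[OF that, of D] that by simp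
  show I2: "interlace (grid d D y j) (grid d D y (Suc j))" if "y \<le> d" "j < c" for y j
    using chain_interlace[OF C[OF that(1)], of "d - y + j"] switches_grid(2)[OF that(1), of j c D]
     switches_grid(2)[OF that(1), of "Suc j" c D] that by auto
  show "interlace (grid d D (Suc y) j) (grid d D y j)" if "y < d" "j \<le> c" for j
    using that(2)
  proof (induction j)
    case 0
    have "Suc (d - Suc y) = d - y" using that by simp
    then show ?case using chain_interlace[OF D, of "d - Suc y"] that unfolding grid_0 by simp
  next
    case (Suc j)
    have "interlace (grid d D (Suc y) j) (grid d D y j)" using Suc by simp
    then show ?case using interlace_toggle(2)[OF _ I2[of y j]] Suc.prems that by simp
  qed
qed

section \<open>Row sums under toggles, weights and string bounds\<close>

lemma sum_1_Suc: "(\<Sum>s=1..Suc r. f s) = (\<Sum>s=1..r. f s) + f (Suc r)" for f :: "nat \<Rightarrow> int"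
  by simp

text \<open>The maximum in row i and the minimum in row i + 1 have the same arguments and add up to
  \<open>\<pi> i + \<beta> (Suc i)\<close>, so only the last maximum leaves a correction. The
  assumption \<open>z\<close> makes the first minimum equal to \<open>\<beta> 1\<close>.\<close>

lemma sum_toggle:
  assumes I: "interlace \<pi> \<alpha>" "interlace \<alpha> \<beta>" and z: "\<beta> 0 = \<pi> 0"
  shows "(\<Sum>i=1..r. int (toggle \<pi> \<alpha> \<beta> i)) =
    (\<Sum>i=1..r. int (\<pi> i) + int (\<beta> i) - int (\<alpha> i)) + max 0 (int (\<beta> (Suc r)) - int (\<pi> r))"
proof (induction r)
  case 0
  have "\<beta> 1 \<le> \<pi> 0" using interlaceD(1)[OF I(2), of 0] interlaceD(2)[OF I(2), of 0] z by simp
  then show ?case by simp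
next
  case (Suc r)
  have m: "min (int (\<pi> r)) (int (\<beta> (Suc r))) + max 0 (int (\<beta> (Suc r)) - int (\<pi> r)) = int (\<beta> (Suc r))"
    "max (int (\<pi> (Suc r))) (int (\<beta> (Suc (Suc r)))) =
      int (\<pi> (Suc r)) + max 0 (int (\<beta> (Suc (Suc r))) - int (\<pi> (Suc r)))"
    by (simp_all add: min_def max_def)
  show ?case unfolding sum_1_Suc Suc toggle_int[OF I] m(2) using m(1) by simp
qed

lemma sum_toggle_all:
  assumes I: "interlace \<pi> \<alpha>" "interlace \<alpha> \<beta>" and 0: "\<beta> 0 = \<pi> 0" "\<beta> (Suc n) = 0"
  shows "(\<Sum>i=1..n. int (toggle \<pi> \<alpha> \<beta> i)) =
    (\<Sum>i=1..n. int (\<pi> i)) + (\<Sum>i=1..n. int (\<beta> i)) - (\<Sum>i=1..n. int (\<alpha> i))"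
  using sum_toggle[OF I 0(1), of n] 0(2) by (simp add: sum_subtractf sum.distrib)

text \<open>A toggle replaces the size of the middle partition by the sum of the sizes of its
  neighbours minus its own, so opposite sides of a square of the growth diagram are strips of equal
  size. This makes both weights invariant under the switch.\<close>

lemma grid_weight:
  assumes D: "chain M n (d + c) D" and "y < d" "j < c"
  shows "(\<Sum>i=1..n. int (grid d D (Suc y) (Suc j) i)) - (\<Sum>i=1..n. int (grid d D (Suc y) j i))
    = (\<Sum>i=1..n. int (grid d D y (Suc j) i)) - (\<Sum>i=1..n. int (grid d D y j i))"
proof -
  note I = grid_interlace[OF D]
  have "(\<Sum>i=1..n. int (grid d D (Suc y) (Suc j) i)) = (\<Sum>i=1..n. int (grid d D (Suc y) j i))
    + (\<Sum>i=1..n. int (grid d D y (Suc j) i)) - (\<Sum>i=1..n. int (grid d D y j i))"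
    unfolding grid.simps(3)
    by (rule sum_toggle_all) (use I assms in auto)
  then show ?thesis by simp
qed

lemma grid_weight_row:
  assumes D: "chain M n (d + c) D" and "y \<le> d" "j < c"
  shows "(\<Sum>i=1..n. int (grid d D y (Suc j) i)) - (\<Sum>i=1..n. int (grid d D y j i))
    = (\<Sum>i=1..n. int (D (Suc (d + j)) i)) - (\<Sum>i=1..n. int (D (d + j) i))"
  using assms(2) by (induction y) (use grid_weight[OF D _ assms(3)] in auto)

lemma grid_weight_col:
  assumes D: "chain M n (d + c) D" and "y < d" "j \<le> c"
  shows "(\<Sum>i=1..n. int (grid d D y j i)) - (\<Sum>i=1..n. int (grid d D (Suc y) j i))
    = (\<Sum>i=1..n. int (D (d - y) i)) - (\<Sum>i=1..n. int (D (d - Suc y) i))"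
  using assms(3)
proof (induction j)
  case (Suc j)
  then show ?case using grid_weight[OF D assms(2), of j] by simp
qed simp

text \<open>
  For three consecutive shapes of a tableau, \<open>eps_le K\<close> says that the crystal string length
  \<open>\<epsilon>\<close> of the two letters involved is at most \<open>K\<close>.
\<close>

definition eps_le :: "int \<Rightarrow> ptn \<Rightarrow> ptn \<Rightarrow> ptn \<Rightarrow> bool" where
  "eps_le K \<alpha> \<beta> \<gamma> \<longleftrightarrow> (\<forall>r. (\<Sum>s=1..Suc r. int (\<gamma> s) - int (\<beta> s)) - (\<Sum>s=1..r. int (\<beta> s) - int (\<alpha> s)) \<le> K)"

text \<open>By \<open>sum_toggle\<close> the new left-hand side is the old one plus Y minus X, the
  corrections of the two toggles. If Y vanishes, the old bound at r suffices. Otherwise the toggle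
  formula for row r + 1 turns the expression into something that is at most the old one at r +
  1.\<close>

lemma eps_le_inward:
  assumes I: "interlace \<pi> \<alpha>" "interlace \<alpha> \<beta>" "interlace \<beta> \<gamma>" and 0: "\<beta> 0 = \<pi> 0" "\<gamma> 0 = \<alpha> 0"
    and E: "eps_le K \<alpha> \<beta> \<gamma>"
  shows "eps_le K \<pi> (toggle \<pi> \<alpha> \<beta>) (toggle (toggle \<pi> \<alpha> \<beta>) \<beta> \<gamma>)"
  unfolding eps_le_def
proof
  fix r
  let ?a = "toggle \<pi> \<alpha> \<beta>"
  let ?b = "toggle ?a \<beta> \<gamma>"
  note J = interlace_toggle[OF I(1,2)]
  have s1: "(\<Sum>s=1..r. int (?a s)) = (\<Sum>i=1..r. int (\<pi> i) + int (\<beta> i) - int (\<alpha> i)) + max 0 (int (\<beta> (Suc r)) - int (\<pi> r))"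
    by (rule sum_toggle[OF I(1,2) 0(1)])
  have s2: "(\<Sum>s=1..Suc r. int (?b s)) = (\<Sum>i=1..Suc r. int (?a i) + int (\<gamma> i) - int (\<beta> i)) + max 0 (int (\<gamma> (Suc (Suc r))) - int (?a (Suc r)))"
    by (rule sum_toggle[OF J(2) I(3)]) (use 0 in simp)
  have e1: "(\<Sum>s=1..Suc r. int (\<gamma> s) - int (\<beta> s)) - (\<Sum>s=1..r. int (\<beta> s) - int (\<alpha> s)) \<le> K"
    and e2: "(\<Sum>s=1..Suc (Suc r). int (\<gamma> s) - int (\<beta> s)) - (\<Sum>s=1..Suc r. int (\<beta> s) - int (\<alpha> s)) \<le> K"
    using E unfolding eps_le_def by blast+
  have a: "int (?a (Suc r)) = min (int (\<pi> r)) (int (\<beta> (Suc r)))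
    + max (int (\<pi> (Suc r))) (int (\<beta> (Suc (Suc r)))) - int (\<alpha> (Suc r))"
    by (rule toggle_int[OF I(1,2)])
  show "(\<Sum>s=1..Suc r. int (?b s) - int (?a s)) - (\<Sum>s=1..r. int (?a s) - int (\<pi> s)) \<le> K"
  proof -
    define X Y mn mx where d: "X = max 0 (int (\<beta> (Suc r)) - int (\<pi> r))"
      "Y = max 0 (int (\<gamma> (Suc (Suc r))) - int (?a (Suc r)))"
      "mn = min (int (\<pi> r)) (int (\<beta> (Suc r)))"
      "mx = max (int (\<pi> (Suc r))) (int (\<beta> (Suc (Suc r))))"
    have "X \<ge> 0" "mn + X = int (\<beta> (Suc r))" "mx \<ge> int (\<beta> (Suc (Suc r)))"
      "Y = 0 \<or> Y = int (\<gamma> (Suc (Suc r))) - int (?a (Suc r))"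
      by (simp_all add: d min_def max_def del: toggle.simps)
    then show ?thesis
      using s1[folded d] s2[folded d] e1 e2 a[folded d] unfolding sum_subtractf sum.distrib sum_1_Suc
      by (elim disjE) linarith+
  qed
qed

text \<open>The argument of \<open>eps_le_inward\<close> with the two corrections in opposite roles:
  a nonzero X leads to the old bound at r - 1. For r = 0 there is no such bound, but then X vanishes
  because row 0 bounds the first rows.\<close>

lemma eps_le_outward:
  assumes I: "interlace \<pi> \<alpha>" "interlace \<alpha> \<beta>" "interlace \<beta> \<gamma>" and 0: "\<beta> 0 = \<pi> 0" "\<gamma> 0 = \<alpha> 0"
    and E: "eps_le K \<pi> \<alpha> \<beta>"
  shows "eps_le K (toggle \<pi> \<alpha> (toggle \<alpha> \<beta> \<gamma>)) (toggle \<alpha> \<beta> \<gamma>) \<gamma>"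
  unfolding eps_le_def
proof
  fix r
  let ?b = "toggle \<alpha> \<beta> \<gamma>"
  let ?a = "toggle \<pi> \<alpha> ?b"
  note J = interlace_toggle[OF I(2,3)]
  have s1: "(\<Sum>s=1..r. int (?a s)) = (\<Sum>i=1..r. int (\<pi> i) + int (?b i) - int (\<alpha> i)) + max 0 (int (?b (Suc r)) - int (\<pi> r))"
    by (rule sum_toggle[OF I(1) J(1)]) (use 0 in simp)
  have s2: "(\<Sum>s=1..Suc r. int (?b s)) = (\<Sum>i=1..Suc r. int (\<alpha> i) + int (\<gamma> i) - int (\<beta> i)) + max 0 (int (\<gamma> (Suc (Suc r))) - int (\<alpha> (Suc r)))"
    by (rule sum_toggle[OF I(2,3) 0(2)])
  have e1: "(\<Sum>s=1..Suc r. int (\<beta> s) - int (\<alpha> s)) - (\<Sum>s=1..r. int (\<alpha> s) - int (\<pi> s)) \<le> K"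
    using E unfolding eps_le_def by blast
  have b: "int (?b (Suc r)) = min (int (\<alpha> r)) (int (\<gamma> (Suc r)))
    + max (int (\<alpha> (Suc r))) (int (\<gamma> (Suc (Suc r)))) - int (\<beta> (Suc r))"
    by (rule toggle_int[OF I(2,3)])
  show "(\<Sum>s=1..Suc r. int (\<gamma> s) - int (?b s)) - (\<Sum>s=1..r. int (?b s) - int (?a s)) \<le> K"
  proof (cases r)
    case 0
    have "?b 1 \<le> \<pi> 0" using interlaceD(1)[OF J(2), of 1] interlaceD(2)[OF I(3), of 0] assms(4) by simp
    then have "int (?b (Suc 0)) \<le> int (\<pi> 0)" by simp
    then show ?thesis using s1 s2 e1 b 0 unfolding 0 sum_subtractf sum.distrib sum_1_Suc by simp
  next
    case (Suc r')
    have e2: "(\<Sum>s=1..r. int (\<beta> s) - int (\<alpha> s)) - (\<Sum>s=1..r'. int (\<alpha> s) - int (\<pi> s)) \<le> K"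
      using E Suc unfolding eps_le_def by blast
    show ?thesis
    proof -
      define X Y mn mx where d: "X = max 0 (int (?b (Suc r)) - int (\<pi> r))"
        "Y = max 0 (int (\<gamma> (Suc (Suc r))) - int (\<alpha> (Suc r)))"
        "mn = min (int (\<alpha> r)) (int (\<gamma> (Suc r)))"
        "mx = max (int (\<alpha> (Suc r))) (int (\<gamma> (Suc (Suc r))))"
      have "Y \<ge> 0" "mx = int (\<alpha> (Suc r)) + Y" "mn \<le> int (\<alpha> r)"
        "X = 0 \<or> X = int (?b (Suc r)) - int (\<pi> r)"
        by (simp_all add: d min_def max_def del: toggle.simps)
      moreover have r: "(\<Sum>s=1..r. int (\<alpha> s)) = (\<Sum>s=1..r'. int (\<alpha> s)) + int (\<alpha> r)"
        "(\<Sum>s=1..r. int (\<pi> s)) = (\<Sum>s=1..r'. int (\<pi> s)) + int (\<pi> r)"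
        by (simp_all add: Suc)
      ultimately show ?thesis
        using s1[folded d] s2[folded d] e1 e2 b[folded d] r unfolding sum_subtractf sum.distrib sum_1_Suc
        by (elim disjE) linarith+
    qed
  qed
qed

lemma grid_eps_row:
  assumes D: "chain M n (d + c) D" and "y \<le> d" "Suc (Suc j) \<le> c"
    and E: "eps_le K (D (d + j)) (D (d + Suc j)) (D (d + Suc (Suc j)))"
  shows "eps_le K (grid d D y j) (grid d D y (Suc j)) (grid d D y (Suc (Suc j)))"
  using assms(2)
proof (induction y)
  case (Suc y)
  note I = grid_interlace[OF D]
  have y: "y < d" "y \<le> d" "Suc y \<le> d" and j: "j < c" "Suc j < c" "j \<le> c" "Suc j \<le> c" "Suc (Suc j) \<le> c"
    using Suc.prems assms(3) by auto
  have 0: "grid d D y (Suc j) 0 = grid d D (Suc y) j 0" "grid d D y (Suc (Suc j)) 0 = grid d D y j 0"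
    using I(1)[OF y(2) j(3)] I(1)[OF y(2) j(4)] I(1)[OF y(2) j(5)] I(1)[OF y(3) j(3)] by simp_all
  show ?case
    unfolding grid.simps(3)
    by (rule eps_le_inward[OF I(3)[OF y(1) j(3)] I(2)[OF y(2) j(1)] I(2)[OF y(2) j(2)] 0 Suc.IH[OF y(2)]])
qed (use E in simp)

text \<open>Here the three shapes lie in one column and belong to the first tableau; one step to the
  right is \<open>eps_le_outward\<close>.\<close>

lemma grid_eps_col:
  assumes D: "chain M n (d + c) D" and "Suc y < d" "j \<le> c"
    and E: "eps_le K (D (d - Suc (Suc y))) (D (d - Suc y)) (D (d - y))"
  shows "eps_le K (grid d D (Suc (Suc y)) j) (grid d D (Suc y) j) (grid d D y j)"
  using assms(3)
proof (induction j)
  case (Suc j)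
  note I = grid_interlace[OF D]
  have y: "Suc y < d" "y < d" "y \<le> d" "Suc y \<le> d" "Suc (Suc y) \<le> d" and j: "j < c" "j \<le> c" "Suc j \<le> c"
    using Suc.prems assms(2) by auto
  have 0: "grid d D y j 0 = grid d D (Suc (Suc y)) j 0" "grid d D y (Suc j) 0 = grid d D (Suc y) j 0"
    using I(1)[OF y(3) j(2)] I(1)[OF y(3) j(3)] I(1)[OF y(4) j(2)] I(1)[OF y(5) j(2)] by simp_all
  show ?case
    unfolding grid.simps(3)
    by (rule eps_le_outward[OF I(3)[OF y(1) j(2)] I(3)[OF y(2) j(2)] I(2)[OF y(3) j(1)] 0 Suc.IH[OF j(2)]])
qed (use E in simp)

section \<open>Yamanouchi fillings of a complement in a rectangle\<close>

text \<open>
  A Yamanouchi filling of the complement of \<open>S 0\<close> in the rectangle with \<open>n\<close> rows of length \<open>N\<close>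
  is constant along diagonals, so that its weight determines \<open>S 0\<close>.
\<close>

lemma rectangle_yamanouchi:
  assumes S: "chain M n n S" and top: "\<And>i. 1 \<le> i \<Longrightarrow> i \<le> n \<Longrightarrow> S n i = N"
    and E: "\<And>t. Suc (Suc t) \<le> n \<Longrightarrow> eps_le 0 (S t) (S (Suc t)) (S (Suc (Suc t)))"
  shows "t + e \<le> n \<Longrightarrow> 1 \<le> t \<Longrightarrow> S t (t + e) = (if e = 0 then N else S 0 e)"
proof -
  have up: "S (Suc t) (Suc i) \<le> S t i" if "Suc t \<le> n" for t i
    using interlaceD(2)[OF chain_interlace[OF S, of t]] that by simp
  have diag: "S t t = N" if "1 \<le> t" "t \<le> n" for t
  proof (rule antisym)
    show "S t t \<le> N" using chain_mono[OF S, of t n t] top[of t] that by simp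
    have "t + m \<le> n \<Longrightarrow> S (t + m) (t + m) \<le> S t t" for m
    proof (induction m)
      case (Suc m)
      then show ?case using up[of "t + m" "t + m"] by simp
    qed simp
    from this[of "n - t"] show "N \<le> S t t" using that top[of n] by simp
  qed
  \<comment> \<open>Strip t + 1 has \<open>c t s\<close> cells in row s; the rows up to t are
    already full.\<close>
  define c where "c t s = int (S (Suc t) s) - int (S t s)" for t s
  have low: "S t s = N" if "1 \<le> s" "s \<le> t" "t \<le> n" for t s
    using diag[of s] diag[of t] chain_mono[OF S, of s t s] chain_mono[OF S, of t n s] top[of s] that by simp
  have zero: "c t s = 0" if "1 \<le> s" "s \<le> t" "Suc t \<le> n" for t s
    using low[of s t] low[of s "Suc t"] that by (simp add: c_def)
  have main: "\<forall>t. t + e \<le> n \<longrightarrow> 1 \<le> t \<longrightarrow> S t (t + e) = (if e = 0 then N else S 0 e)" for e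
  proof (induction e rule: less_induct)
    case (less e)
    show ?case
    proof (cases e)
      case 0
      then show ?thesis using diag by simp
    next
      case (Suc f)
      have prev: "S t (t + g) = (if g = 0 then N else S 0 g)" if "g \<le> f" "t + g \<le> n" "1 \<le> t" for g t
        using less[of g] that Suc by simp
      define v where "v g = int (if g = 0 then N else S 0 g)" for g
      have cg: "c t (Suc t + g) = v g - v (Suc g)" if "g < f" "Suc t + g \<le> n" for t g
      proof -
        have "S t (Suc (t + g)) = S 0 (Suc g)"
          by (cases t) (use prev[of "Suc g" t] that in auto)
        then show ?thesis using prev[of g "Suc t"] that by (simp add: c_def v_def)
      qed
      have cf: "c t (Suc t + f) = v f - int (S t (t + e))" if "Suc t + f \<le> n" for t
        using prev[of f "Suc t"] that Suc by (simp add: c_def v_def)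
      \<comment> \<open>One inequality is interlacing. For the other the string bound is taken at r
        = \<open>Suc t + f\<close>: by the induction hypothesis the terms on the earlier diagonals
        cancel, and one term of each sum remains.\<close>
      have step: "S (Suc t) (Suc t + e) = S t (t + e)" if t: "Suc t + e \<le> n" for t
      proof (rule antisym)
        show "S (Suc t) (Suc t + e) \<le> S t (t + e)" using up[of t "t + e"] t by simp
        have "sum (c (Suc t)) {1..Suc (Suc t + f)} - sum (c t) {1..Suc t + f} \<le> 0"
        proof -
          have "\<forall>r. sum (c (Suc t)) {1..Suc r} - sum (c t) {1..r} \<le> 0"
            using E[of t] t Suc unfolding eps_le_def c_def by simp
          then show ?thesis using spec[of _ "Suc t + f"] by fastforce
        qed
        moreover have split: "sum (c t) {1..Suc t + f} = (\<Sum>g<f. v g - v (Suc g)) + c t (Suc t + f)"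
          if "Suc t + f \<le> n" for t
        proof -
          have "sum (c t) {1..Suc t + f} = sum (c t) {1..t} + sum (c t) {Suc t..Suc t + f}"
          proof -
            have "{1..Suc t + f} = {1..t} \<union> {Suc t..Suc t + f}" by auto
            then show ?thesis by (simp only:) (rule sum.union_disjoint, auto)
          qed
          also have "sum (c t) {1..t} = 0" using zero that by (intro sum.neutral) auto
          also have "sum (c t) {Suc t..Suc t + f} = (\<Sum>g=0..f. c t (Suc t + g))"
            using sum.shift_bounds_cl_nat_ivl[of "c t" 0 "Suc t" f] by (simp add: add.commute)
          also have "\<dots> = (\<Sum>g<f. c t (Suc t + g)) + c t (Suc t + f)"
            by (simp add: atLeast0AtMost lessThan_Suc_atMost[symmetric] del: sum.lessThan_Suc) simp
          also have "(\<Sum>g<f. c t (Suc t + g)) = (\<Sum>g<f. v g - v (Suc g))"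
            using cg that by (intro sum.cong) auto
          finally show ?thesis by simp
        qed
        ultimately have "c (Suc t) (Suc (Suc t) + f) \<le> c t (Suc t + f)"
          using split[of t] split[of "Suc t"] t Suc by simp
        then show "S t (t + e) \<le> S (Suc t) (Suc t + e)"
          using cf[of t] cf[of "Suc t"] t Suc by simp
      qed
      have "t + e \<le> n \<Longrightarrow> S t (t + e) = S 0 e" for t
        by (induction t) (use step in auto)
      then show ?thesis using Suc by simp
    qed
  qed
  then show "t + e \<le> n \<Longrightarrow> 1 \<le> t \<Longrightarrow> S t (t + e) = (if e = 0 then N else S 0 e)" by blast
qed

text \<open>In the canonical tableau a letter occurs only in the row of its own number, so each of
  the two sums has at most one nonzero term.\<close>

lemma eps_le_canonical:
  assumes "\<And>i. 1 \<le> i \<Longrightarrow> \<alpha> i = (if i \<le> t then \<mu> i else 0)"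
    "\<And>i. 1 \<le> i \<Longrightarrow> \<beta> i = (if i \<le> Suc t then \<mu> i else 0)"
    "\<And>i. 1 \<le> i \<Longrightarrow> \<gamma> i = (if i \<le> Suc (Suc t) then \<mu> i else 0)"
    "\<mu> (Suc (Suc t)) \<le> \<mu> (Suc t)"
  shows "eps_le 0 \<alpha> \<beta> \<gamma>"
proof -
  have 1: "(\<Sum>s=1..r. int (\<gamma> s) - int (\<beta> s)) = (if Suc (Suc t) \<le> r then int (\<mu> (Suc (Suc t))) else 0)" for r
  proof (induction r)
    case (Suc r)
    then show ?case using assms(2)[of "Suc r"] assms(3)[of "Suc r"]
      by (cases "Suc r" "Suc (Suc t)" rule: linorder_cases) simp_all
  qed simp
  have 2: "(\<Sum>s=1..r. int (\<beta> s) - int (\<alpha> s)) = (if Suc t \<le> r then int (\<mu> (Suc t)) else 0)" for r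
  proof (induction r)
    case (Suc r)
    then show ?case using assms(1)[of "Suc r"] assms(2)[of "Suc r"]
      by (cases "Suc r" "Suc t" rule: linorder_cases) simp_all
  qed simp
  show ?thesis unfolding eps_le_def 1 2 using assms(4) by auto
qed

text \<open>The canonical tableau stays Yamanouchi while it is pushed to the boundary of the
  rectangle, and then \<open>rectangle_yamanouchi\<close> expresses its weight by the shape that it
  leaves free. As the weight is still given by the rows of \<open>D n\<close>, that shape is the
  rotated complement of \<open>D n\<close>. This is the reason why evacuation keeps the
  shape.\<close>

theorem grid_rectangle:
  assumes D: "chain M n (n + k) D"
    and can: "\<And>j i. j \<le> n \<Longrightarrow> 1 \<le> i \<Longrightarrow> D j i = (if i \<le> j then D n i else 0)"
    and top: "\<And>i. 1 \<le> i \<Longrightarrow> i \<le> n \<Longrightarrow> D (n + k) i = N"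
    and i: "1 \<le> i" "i \<le> n"
  shows "grid n D n k i = N - D n (n + 1 - i)"
proof -
  define S where "S t = grid n D (n - t) k" for t
  have Ssw: "S t = switches n k n D (k + t)" if "t \<le> n" for t
    using switches_final(2)[of t n k D] that by (simp add: S_def)
  have C: "chain M n (n + k) (switches n k n D)"
    using chain_switches[OF D, of n n k] by simp
  have S: "chain M n n S"
    using C Ssw by (simp add: chain_def)
  have Stop: "S n i = N" if "1 \<le> i" "i \<le> n" for i
    using top[OF that] by (simp add: S_def)
  have E: "eps_le 0 (S t) (S (Suc t)) (S (Suc (Suc t)))" if t: "Suc (Suc t) \<le> n" for t
  proof -
    obtain y where "n = Suc (Suc t) + y" using t le_Suc_ex by blast
    then have y: "Suc y < n" "n - t = Suc (Suc y)" "n - Suc t = Suc y" "n - Suc (Suc t) = y"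
      "n - y = Suc (Suc t)" "n - Suc y = Suc t" "n - Suc (Suc y) = t"
      by simp_all
    have "eps_le 0 (D t) (D (Suc t)) (D (Suc (Suc t)))"
      by (rule eps_le_canonical[where \<mu> = "D n" and t = t]) (use can[of t] can[of "Suc t"] can[of "Suc (Suc t)"] t chain_dec[OF D, of n "Suc t"] in auto)
    then have "eps_le 0 (grid n D (Suc (Suc y)) k) (grid n D (Suc y) k) (grid n D y k)"
      by (intro grid_eps_col[OF D]) (use y in auto)
    then show ?thesis by (simp add: S_def y)
  qed
  note R = rectangle_yamanouchi[OF S Stop E]
  define v where "v e = int (if e = 0 then N else S 0 e)" for e
  \<comment> \<open>Letter t determines row i: its strip is spread over the rows t, ..., n with
    sizes v 0 - v 1, v 1 - v 2, and so on, which add up to N - v i.\<close>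
  define t where "t = n + 1 - i"
  have t: "1 \<le> t" "t \<le> n" "n - t + 1 = i" using i by (auto simp: t_def)
  have T: "int (S t i) - int (S (t - 1) i) = v (i - t) - v (Suc i - t)" if "t \<le> i" "i \<le> n" for i
    using R[of t "i - t"] R[of "t - 1" "Suc i - t"] that t by (cases "t = 1") (auto simp: v_def Suc_diff_le)
  have T0: "S t i = N \<and> S (t - 1) i = N" if "1 \<le> i" "i < t" for i
  proof -
    have *: "S u i = N" if "i \<le> u" "u \<le> n" for u
      using R[of i 0] chain_mono[OF S, of i u i] chain_mono[OF S, of u n i] Stop[of i] that \<open>1 \<le> i\<close> by simp
    show ?thesis using *[of t] *[of "t - 1"] that t by simp
  qed
  have "r \<le> n \<Longrightarrow> (\<Sum>i=1..r. int (S t i) - int (S (t - 1) i)) = (if r < t then 0 else int N - v (Suc r - t))" for r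
  proof (induction r)
    case 0
    then show ?case using t by simp
  next
    case (Suc r)
    then show ?case
      using T[of "Suc r"] T0[of "Suc r"] by (auto simp: v_def Suc_diff_le not_less less_Suc_eq)
  qed
  from this[of n] have "(\<Sum>i=1..n. int (S t i)) - (\<Sum>i=1..n. int (S (t - 1) i)) = int N - v i"
    using t by (simp add: sum_subtractf Suc_diff_le)
  moreover have "(\<Sum>i=1..n. int (S t i)) - (\<Sum>i=1..n. int (S (t - 1) i))
    = (\<Sum>i=1..n. int (D t i)) - (\<Sum>i=1..n. int (D (t - 1) i))"
  proof -
    have "n - (t - 1) = Suc (n - t)" "n - (n - t) = t" "n - Suc (n - t) = t - 1" "n - t < n" using t by auto
    then show ?thesis using grid_weight_col[OF D, of "n - t" k] by (simp add: S_def)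
  qed
  moreover have "(\<Sum>i=1..r. int (D t i) - int (D (t - 1) i)) = (if r < t then 0 else int (D n t))" for r
  proof (induction r)
    case (Suc r)
    then show ?case using can[of t "Suc r"] can[of "t - 1" "Suc r"] t
      by (cases "Suc r" t rule: linorder_cases) auto
  qed (use t in simp)
  from this[of n] have "(\<Sum>i=1..n. int (D t i)) - (\<Sum>i=1..n. int (D (t - 1) i)) = int (D n t)"
    using t by (simp add: sum_subtractf)
  ultimately have "int N - v i = int (D n t)" by simp
  then show ?thesis using i by (simp add: v_def S_def t_def)
qed

section \<open>Tableaux as chains of partitions\<close>

definition tab_of :: "nat \<Rightarrow> (nat \<Rightarrow> ptn) \<Rightarrow> tab" where
  "tab_of k G i c = (if 1 \<le> i \<and> G 0 i < c \<and> c \<le> G k i then LEAST r. c \<le> G r i else 0)"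

lemma tab_of_eq_0: "tab_of k G i c = 0 \<longleftrightarrow> \<not> (1 \<le> i \<and> G 0 i < c \<and> c \<le> G k i)"
proof -
  have "(LEAST r. c \<le> G r i) \<noteq> 0" if "G 0 i < c" "c \<le> G k i"
    using LeastI[of "\<lambda>r. c \<le> G r i" k] that by (metis leD)
  then show ?thesis by (auto simp: tab_of_def)
qed

text \<open>The hypothesis compares membership of the single cell (i, c): the chains before and
  after a slide have different shapes but agree on most cells.\<close>

lemma tab_of_cong:
  assumes "\<And>r. r \<le> k \<Longrightarrow> c \<le> G r i \<longleftrightarrow> c \<le> G' r i"
  shows "tab_of k G i c = tab_of k G' i c"
proof -
  have "(LEAST r. c \<le> G r i) = (LEAST r. c \<le> G' r i)" if k: "c \<le> G k i"
  proof (rule Least_equality[symmetric])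
    have "(LEAST r. c \<le> G r i) \<le> k" using k by (rule Least_le)
    moreover have "c \<le> G (LEAST r. c \<le> G r i) i" using k by (rule LeastI)
    ultimately show "c \<le> G' (LEAST r. c \<le> G r i) i" using assms by blast
    fix y assume y: "c \<le> G' y i"
    show "(LEAST r. c \<le> G r i) \<le> y"
    proof (cases "y \<le> k")
      case True
      then show ?thesis using assms y by (intro Least_le) blast
    next
      case False
      then show ?thesis using \<open>(LEAST r. c \<le> G r i) \<le> k\<close> by simp
    qed
  qed
  moreover have "G 0 i < c \<longleftrightarrow> G' 0 i < c" using assms[of 0] by auto
  moreover have "c \<le> G k i \<longleftrightarrow> c \<le> G' k i" using assms[of k] by simp
  ultimately show ?thesis by (simp add: tab_of_def)
qed

lemma tab_of_cong': "(\<And>r i. r \<le> k \<Longrightarrow> 1 \<le> i \<Longrightarrow> G r i = G' r i) \<Longrightarrow> tab_of k G = tab_of k G'"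
proof (intro ext)
  fix i c assume *: "\<And>r i. r \<le> k \<Longrightarrow> 1 \<le> i \<Longrightarrow> G r i = G' r i"
  show "tab_of k G i c = tab_of k G' i c"
  proof (cases "1 \<le> i")
    case True
    then show ?thesis using * by (intro tab_of_cong) simp
  qed (simp add: tab_of_def)
qed

lemma tab_of_eq_Suc:
  assumes G: "chain M n k G"
  shows "tab_of k G i c = Suc r \<longleftrightarrow> 1 \<le> i \<and> r < k \<and> G r i < c \<and> c \<le> G (Suc r) i"
proof
  assume *: "tab_of k G i c = Suc r"
  then have c: "1 \<le> i" "G 0 i < c" "c \<le> G k i" "Suc r = (LEAST r. c \<le> G r i)"
    by (auto simp: tab_of_def split: if_splits)
  have "Suc r \<le> k" unfolding c(4) by (rule Least_le) (rule c)
  moreover have "c \<le> G (Suc r) i" unfolding c(4) by (rule LeastI[of _ k]) (rule c)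
  moreover have "\<not> c \<le> G r i" using not_less_Least[of r "\<lambda>r. c \<le> G r i"] c(4) by auto
  ultimately show "1 \<le> i \<and> r < k \<and> G r i < c \<and> c \<le> G (Suc r) i" using c by auto
next
  assume *: "1 \<le> i \<and> r < k \<and> G r i < c \<and> c \<le> G (Suc r) i"
  have "(LEAST r. c \<le> G r i) = Suc r"
  proof (rule Least_equality)
    fix y assume y: "c \<le> G y i"
    show "Suc r \<le> y"
    proof (rule ccontr)
      assume "\<not> Suc r \<le> y"
      then show False using chain_mono[OF G, of y r i] * y by simp
    qed
  qed (use * in simp)
  moreover have "G 0 i < c" "c \<le> G k i"
    using chain_mono[OF G, of 0 r i] chain_mono[OF G, of "Suc r" k i] * by simp_all
  ultimately show "tab_of k G i c = Suc r" using * by (simp add: tab_of_def)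
qed

lemma tab_of_le: "chain M n k G \<Longrightarrow> tab_of k G i c \<le> k"
  using tab_of_eq_Suc[of M n k G i c "tab_of k G i c - 1"] by (cases "tab_of k G i c") auto

lemma card_tab_of:
  assumes G: "chain M n k G" and "j \<le> k" "1 \<le> i"
  shows "{c. 1 \<le> tab_of k G i c \<and> tab_of k G i c \<le> j} = {G 0 i<..G j i}"
proof (rule set_eqI)
  fix c
  show "c \<in> {c. 1 \<le> tab_of k G i c \<and> tab_of k G i c \<le> j} \<longleftrightarrow> c \<in> {G 0 i<..G j i}"
  proof (cases "tab_of k G i c")
    case 0
    then show ?thesis using tab_of_eq_0[of k G i c] assms chain_mono[OF G, of j k i] by auto
  next
    case (Suc r)
    then have *: "r < k" "G r i < c" "c \<le> G (Suc r) i" using tab_of_eq_Suc[OF G] by auto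
    show ?thesis
      using * Suc chain_mono[OF G, of 0 r i] chain_mono[OF G, of "Suc r" j i] chain_mono[OF G, of j r i] assms
      by (cases "Suc r \<le> j") auto
  qed
qed

lemma gt_array_tab_of:
  assumes G: "chain M n k G" and \<mu>: "\<And>i. 1 \<le> i \<Longrightarrow> \<mu> i = G 0 i" and "l \<le> k"
  shows "gt_array N l (\<mu>, tab_of k G) i j = (if 1 \<le> i \<and> i \<le> N \<and> j \<le> l then int (G j i) else 0)"
  using card_tab_of[OF G, of j i] \<mu>[of i] chain_mono[OF G, of 0 j i] assms(3) by (simp add: gt_array_def)

text \<open>Applied to the cells of a row with entries up to j, which thus form an interval starting
  at the inner boundary, and to the nonzero parts of a partition.\<close>

lemma initial_segment:
  fixes X :: "nat set"
  assumes "finite X" "\<And>c. c \<in> X \<Longrightarrow> a < c" "\<And>c c'. c \<in> X \<Longrightarrow> a < c' \<Longrightarrow> c' < c \<Longrightarrow> c' \<in> X"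
  shows "X = {a<..a + card X}"
proof (cases "X = {}")
  case False
  have "X = {a<..Max X}"
  proof (rule set_eqI)
    fix x
    show "x \<in> X \<longleftrightarrow> x \<in> {a<..Max X}"
      using assms(2)[of x] assms(3)[of "Max X" x] Max_in[OF assms(1) False] Max_ge[OF assms(1), of x]
      by (cases "x = Max X") auto
  qed
  then show ?thesis
    by (metis add_diff_inverse_nat assms(2) card_greaterThanAtMost not_less_iff_gr_or_eq Max_in assms(1) False)
qed simp

lemma plen_iff:
  assumes "is_partition \<Lambda>" "1 \<le> i"
  shows "\<Lambda> i \<noteq> 0 \<longleftrightarrow> i \<le> plen \<Lambda>"
proof -
  let ?X = "{i. 1 \<le> i \<and> \<Lambda> i \<noteq> 0}"
  have dec: "1 \<le> c' \<Longrightarrow> c' \<le> c \<Longrightarrow> \<Lambda> c \<le> \<Lambda> c'" for c c'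
    using assms(1) by (induction c) (auto simp: is_partition_def le_Suc_eq intro: le_trans)
  have "?X = {0<..0 + card ?X}"
  proof (rule initial_segment)
    show "finite ?X" using assms(1) by (simp add: is_partition_def)
    fix c c' assume "c \<in> ?X" "0 < c'" "c' < c"
    then show "c' \<in> ?X" using dec[of c' c] by auto
  qed auto
  then have "i \<in> ?X \<longleftrightarrow> i \<in> {0<..0 + card ?X}" by simp
  then show ?thesis using assms(2) by (simp add: plen_def)
qed

lemma partition_antimono:
  assumes "is_partition \<Lambda>" "1 \<le> i" "i \<le> i'"
  shows "\<Lambda> i' \<le> \<Lambda> i"
  using assms(3) by (induction i' rule: dec_induct) (use assms(1,2) in \<open>auto simp: is_partition_def intro: le_trans\<close>)

definition gt_chain :: "nat \<Rightarrow> skew \<Rightarrow> nat \<Rightarrow> ptn" where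
  "gt_chain M = (\<lambda>(\<mu>, A) j i. if i = 0 then M else \<mu> i + card {c. 1 \<le> A i c \<and> A i c \<le> j})"

text \<open>Column strictness makes the rows of the Gelfand--Tsetlin array interlace, and the
  tableau is recovered from them. M and n are upper bounds only, so that tableaux of different
  shapes can be given the same bounds and their chains joined.\<close>

lemma YT_chain:
  assumes c: "contains \<Lambda> \<mu>" and A: "A \<in> YT \<Lambda> \<mu> a" and M: "\<Lambda> 1 \<le> M" and n: "plen \<Lambda> \<le> n"
  defines "G \<equiv> gt_chain M (\<mu>, A)"
  shows "chain M n (length a) G" "A = tab_of (length a) G"
    "\<And>i. 1 \<le> i \<Longrightarrow> G 0 i = \<mu> i" "\<And>i. 1 \<le> i \<Longrightarrow> G (length a) i = \<Lambda> i"
    "\<And>i c j. 1 \<le> i \<Longrightarrow> 1 \<le> A i c \<and> A i c \<le> j \<longleftrightarrow> \<mu> i < c \<and> c \<le> G j i"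
proof -
  have A1: "A i j \<noteq> 0 \<longleftrightarrow> (i, j) \<in> cells \<Lambda> \<mu>" for i j using A by (simp add: YT_def)
  have A2: "A i j \<le> A i j'" if "(i, j) \<in> cells \<Lambda> \<mu>" "(i, j') \<in> cells \<Lambda> \<mu>" "j < j'" for i j j'
    using A that unfolding YT_def by blast
  have A3: "A i j < A i' j" if "(i, j) \<in> cells \<Lambda> \<mu>" "(i', j) \<in> cells \<Lambda> \<mu>" "i < i'" for i i' j
    using A that unfolding YT_def by blast
  have A4: "A i j \<le> length a" for i j using A by (simp add: YT_def)
  have p: "is_partition \<Lambda>" "is_partition \<mu>" "\<And>i. 1 \<le> i \<Longrightarrow> \<mu> i \<le> \<Lambda> i" using c by (auto simp: contains_def)
  have seg: "{c. 1 \<le> A i c \<and> A i c \<le> j} = {\<mu> i<..\<mu> i + card {c. 1 \<le> A i c \<and> A i c \<le> j}}" for i j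
  proof (rule initial_segment)
    have "{c. 1 \<le> A i c \<and> A i c \<le> j} \<subseteq> {..\<Lambda> i}"
      using A1 by (fastforce simp: cells_def)
    then show "finite {c. 1 \<le> A i c \<and> A i c \<le> j}" using finite_subset by blast
    fix c assume "c \<in> {c. 1 \<le> A i c \<and> A i c \<le> j}"
    then have c: "(i, c) \<in> cells \<Lambda> \<mu>" "A i c \<le> j" using A1[of i c] by auto
    then show "\<mu> i < c" by (auto simp: cells_def)
    fix c' assume c': "\<mu> i < c'" "c' < c"
    then have "(i, c') \<in> cells \<Lambda> \<mu>" using c by (auto simp: cells_def)
    then show "c' \<in> {c. 1 \<le> A i c \<and> A i c \<le> j}" using A1[of i c'] A2[of i c' c] c c' by auto
  qed
  have iff: "1 \<le> A i c \<and> A i c \<le> j \<longleftrightarrow> \<mu> i < c \<and> c \<le> G j i" if "1 \<le> i" for i j c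
  proof -
    have "c \<in> {c. 1 \<le> A i c \<and> A i c \<le> j} \<longleftrightarrow> c \<in> {\<mu> i<..\<mu> i + card {c. 1 \<le> A i c \<and> A i c \<le> j}}"
      using seg by blast
    then show ?thesis using that by (simp add: G_def gt_chain_def)
  qed
  show "1 \<le> A i c \<and> A i c \<le> j \<longleftrightarrow> \<mu> i < c \<and> c \<le> G j i" if "1 \<le> i" for i j c using iff[OF that] .
  have fin: "finite {c. 1 \<le> A i c \<and> A i c \<le> j}" for i j using seg[of i j] by (metis finite_greaterThanAtMost)
  have G0: "G 0 i = \<mu> i" if "1 \<le> i" for i
  proof -
    have "{c. 1 \<le> A i c \<and> A i c \<le> 0} = {}" by auto
    then have "card {c. 1 \<le> A i c \<and> A i c \<le> 0} = 0" by (simp only: card.empty)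
    then show ?thesis using that by (simp add: G_def gt_chain_def)
  qed
  show "G 0 i = \<mu> i" if "1 \<le> i" for i using G0[OF that] .
  have Gk: "G (length a) i = \<Lambda> i" if i: "1 \<le> i" for i
  proof -
    have "{c. 1 \<le> A i c \<and> A i c \<le> length a} = {\<mu> i<..\<Lambda> i}"
    proof (rule set_eqI)
      fix c show "c \<in> {c. 1 \<le> A i c \<and> A i c \<le> length a} \<longleftrightarrow> c \<in> {\<mu> i<..\<Lambda> i}"
        using A1[of i c] A4[of i c] i by (auto simp: cells_def)
    qed
    then show ?thesis using i p(3)[OF i] by (simp add: G_def gt_chain_def)
  qed
  show "G (length a) i = \<Lambda> i" if "1 \<le> i" for i using Gk[OF that] .
  have mono: "G j i \<le> G (Suc j) i" for i j
  proof -
    have "card {c. 1 \<le> A i c \<and> A i c \<le> j} \<le> card {c. 1 \<le> A i c \<and> A i c \<le> Suc j}"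
      by (rule card_mono[OF fin]) auto
    then show ?thesis by (simp add: G_def gt_chain_def)
  qed
  have up: "G (Suc j) (Suc i) \<le> G j i" for i j
  proof (cases "i = 0")
    case True
    have "G (Suc j) 1 \<le> \<Lambda> 1"
    proof (rule ccontr)
      assume *: "\<not> G (Suc j) 1 \<le> \<Lambda> 1"
      then have "1 \<le> A 1 (G (Suc j) 1)" using iff[of 1 "G (Suc j) 1" "Suc j"] p(3)[of 1] by auto
      then show False using A1[of 1 "G (Suc j) 1"] * by (auto simp: cells_def)
    qed
    then show ?thesis using True M by (simp add: G_def gt_chain_def)
  next
    case False
    show ?thesis
    proof (rule ccontr)
      let ?c = "G (Suc j) (Suc i)"
      \<comment> \<open>The last cell of row i + 1 in shape j + 1 has an entry of at most j + 1. If
        it stuck out, the cell above it would contain an entry of at most j and yet lie outside of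
        row i of shape j.\<close>
      assume *: "\<not> ?c \<le> G j i"
      have m: "\<mu> (Suc i) \<le> \<mu> i" "\<Lambda> (Suc i) \<le> \<Lambda> i" using p False by (auto simp: is_partition_def)
      have "\<mu> i \<le> G j i" using False by (simp add: G_def gt_chain_def)
      then have "1 \<le> A (Suc i) ?c \<and> A (Suc i) ?c \<le> Suc j" using iff[of "Suc i" ?c "Suc j"] * m by auto
      moreover from this have cs: "(Suc i, ?c) \<in> cells \<Lambda> \<mu>" using A1[of "Suc i" ?c] by auto
      moreover have "(i, ?c) \<in> cells \<Lambda> \<mu>" using cs * m \<open>\<mu> i \<le> G j i\<close> False by (auto simp: cells_def)
      ultimately have "1 \<le> A i ?c \<and> A i ?c \<le> j" using A3[of i ?c "Suc i"] A1[of i ?c] by auto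
      then show False using iff[of i ?c j] * False by auto
    qed
  qed
  have z: "G j i = 0" if "n < i" for i j
  proof -
    have i: "1 \<le> i" using that by simp
    have L: "\<Lambda> i = 0" using plen_iff[OF p(1) i] that n by auto
    have "A i c = 0" for c using A1[of i c] L by (auto simp: cells_def)
    then have "card {c. 1 \<le> A i c \<and> A i c \<le> j} = 0" by simp
    then show ?thesis using p(3)[OF i] L i by (simp add: G_def gt_chain_def)
  qed
  show C: "chain M n (length a) G"
    unfolding chain_def interlace_def
  proof (intro conjI allI impI)
    show "G j (Suc i) \<le> G j i" for j i using mono[of j "Suc i"] up[of j i] by simp
    show "G j 0 = M" for j by (simp add: G_def gt_chain_def)
  qed (use mono up z in auto)
  show "A = tab_of (length a) G"
  proof (intro ext)
    fix i c
    show "A i c = tab_of (length a) G i c"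
    proof (cases "1 \<le> i \<and> A i c \<noteq> 0")
      case True
      have i: "1 \<le> i" using True by simp
      have *: "\<mu> i < c" "c \<le> G (length a) i" "c \<le> G (A i c) i"
        using iff[OF i, of c "length a"] iff[OF i, of c "A i c"] A4[of i c] True by auto
      have "(LEAST r. c \<le> G r i) = A i c"
      proof (rule Least_equality)
        show "c \<le> G (A i c) i" by fact
        fix y assume "c \<le> G y i"
        then show "A i c \<le> y" using iff[OF i, of c y] * by simp
      qed
      then show ?thesis using * G0[OF i] i by (simp add: tab_of_def)
    next
      case False
      have "A i c = 0" using False A1[of i c] by (auto simp: cells_def)
      moreover have "tab_of (length a) G i c = 0"
        unfolding tab_of_eq_0 using iff[of i c "length a"] G0[of i] False by auto
      ultimately show ?thesis by simp
    qed
  qed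
qed

section \<open>Slides\<close>

text \<open>When the letters up to j have moved, the hole is the last cell of row
  \<open>hole G h j\<close> of shape j. Letter j + 1 lies directly below it iff its strip reaches
  the same column in the next row; then it moves up, otherwise all letters j + 1 in the row of the
  hole move left. A strip is horizontal, so the hole descends at most once per letter.\<close>

fun hole :: "(nat \<Rightarrow> ptn) \<Rightarrow> nat \<Rightarrow> nat \<Rightarrow> nat" where
  "hole G h 0 = h"
| "hole G h (Suc j) =
     (if G (Suc j) (Suc (hole G h j)) = G j (hole G h j) then Suc (hole G h j) else hole G h j)"

definition shrink :: "(nat \<Rightarrow> ptn) \<Rightarrow> nat \<Rightarrow> nat \<Rightarrow> ptn" where
  "shrink G h j = (G j)(hole G h j := G j (hole G h j) - 1)"

lemma hole_mono: "j \<le> j' \<Longrightarrow> hole G h j \<le> hole G h j'"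
  by (induction j' rule: dec_induct) auto

lemma hole_ge: "h \<le> hole G h j"
  using hole_mono[of 0 j G h] by simp

lemma hole_corner:
  assumes G: "chain M n k G" and h: "G 0 (Suc h) < G 0 h" and "j \<le> k"
  shows "G j (Suc (hole G h j)) < G j (hole G h j)"
  using assms(3)
proof (induction j)
  case (Suc j)
  let ?g = "hole G h j"
  have I: "interlace (G j) (G (Suc j))" using chain_interlace[OF G, of j] Suc by simp
  have c: "G j (Suc ?g) < G j ?g" using Suc by simp
  show ?case
  proof (cases "G (Suc j) (Suc ?g) = G j ?g")
    case True
    then show ?thesis using c interlaceD(2)[OF I, of "Suc ?g"] by simp
  next
    case False
    then show ?thesis using interlaceD(2)[OF I, of ?g] interlaceD(1)[OF I, of ?g] by simp
  qed
qed (use h in simp)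

lemma chain_shrink:
  assumes G: "chain M n k G" and h: "1 \<le> h" "G 0 (Suc h) < G 0 h"
  shows "chain M n k (shrink G h)"
  unfolding chain_def
proof (intro conjI allI impI)
  fix j i assume j: "j \<le> k"
  show "shrink G h j 0 = M" using hole_ge[of h G j] h chain_row0[OF G j] by (simp add: shrink_def)
  show "shrink G h j i = 0" if "n < i" using chain_rows[OF G j that] by (auto simp: shrink_def)
  show "shrink G h j (Suc i) \<le> shrink G h j i"
    using chain_dec[OF G j, of i] hole_corner[OF G h(2) j] by (auto simp: shrink_def)
next
  fix j assume j: "j < k"
  let ?g = "hole G h j"
  have I: "interlace (G j) (G (Suc j))" using chain_interlace[OF G j] .
  have c: "G j (Suc ?g) < G j ?g" using hole_corner[OF G h(2), of j] j by simp
  show "interlace (shrink G h j) (shrink G h (Suc j))"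
    unfolding interlace_def
  proof (intro allI conjI)
    fix i
    have a: "G j i \<le> G (Suc j) i" "G (Suc j) (Suc i) \<le> G j i" using interlaceD[OF I] by auto
    show "shrink G h j i \<le> shrink G h (Suc j) i"
      using a c by (auto simp: shrink_def)
    show "shrink G h (Suc j) (Suc i) \<le> shrink G h j i"
      using a c by (auto simp: shrink_def)
  qed
qed

lemma slide_right:
  assumes "A i (Suc j) \<noteq> 0" "A (Suc i) j = 0 \<or> A i (Suc j) < A (Suc i) j"
  shows "slide (A, i, j) = slide (upd (upd A i j (A i (Suc j))) i (Suc j) 0, i, Suc j)"
  unfolding slide_def by (subst while_unfold) (use assms in \<open>auto simp: Let_def\<close>)

lemma slide_down:
  assumes "A (Suc i) j \<noteq> 0" "A i (Suc j) = 0 \<or> A (Suc i) j \<le> A i (Suc j)"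
  shows "slide (A, i, j) = slide (upd (upd A i j (A (Suc i) j)) (Suc i) j 0, Suc i, j)"
  unfolding slide_def by (subst while_unfold) (use assms in \<open>auto simp: Let_def\<close>)

lemma slide_stop: "A i (Suc j) = 0 \<Longrightarrow> A (Suc i) j = 0 \<Longrightarrow> slide (A, i, j) = (A, i, j)"
  unfolding slide_def by (subst while_unfold) auto

text \<open>
  The tableau in the middle of a slide from \<open>T\<close> to \<open>T'\<close>: since the hole only moves right and down,
  the cells before the hole, row by row, have their final entries and the cells after it still have
  their initial ones.
\<close>

definition sliding :: "tab \<Rightarrow> tab \<Rightarrow> nat \<Rightarrow> nat \<Rightarrow> tab" where
  "sliding T T' i c = (\<lambda>i' c'.
     if i' < i \<or> i' = i \<and> c' < c then T' i' c' else if i' = i \<and> c' = c then 0 else T i' c')"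

lemma sliding_right:
  "T i (Suc c) = T' i c \<Longrightarrow>
    upd (upd (sliding T T' i c) i c (T i (Suc c))) i (Suc c) 0 = sliding T T' i (Suc c)"
  by (auto simp: sliding_def upd_def fun_eq_iff less_Suc_eq)

text \<open>In the row-by-row order the hole jumps over the rest of row i and the beginning of row i
  + 1; on these cells the two tableaux have to agree.\<close>

lemma sliding_down:
  assumes "T (Suc i) c = T' i c" "\<And>c'. c < c' \<Longrightarrow> T i c' = T' i c'" "\<And>c'. c' < c \<Longrightarrow> T (Suc i) c' = T' (Suc i) c'"
  shows "upd (upd (sliding T T' i c) i c (T (Suc i) c)) (Suc i) c 0 = sliding T T' (Suc i) c"
  using assms by (auto simp: sliding_def upd_def fun_eq_iff less_Suc_eq)

lemma tab_of_shrink: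
  assumes "\<And>r. r \<le> k \<Longrightarrow> hole G h r = i \<Longrightarrow> c \<noteq> G r i"
  shows "tab_of k (shrink G h) i c = tab_of k G i c"
  using assms by (intro tab_of_cong) (force simp: shrink_def)

text \<open>Letter t + 1 causes either one step down or a run of steps to the right, as
  \<open>hole\<close> predicts. If it is below the hole, the right neighbour is absent or at least t
  + 1, and a tie moves the hole down.\<close>

lemma slide_letter:
  assumes G: "chain M n k G" and h: "1 \<le> h" "G 0 (Suc h) < G 0 h" and t: "t < k"
  defines "T \<equiv> tab_of k G" and "T' \<equiv> tab_of k (shrink G h)"
  defines "i \<equiv> hole G h t" and "i' \<equiv> hole G h (Suc t)"
  shows "slide (sliding T T' i (G t i), i, G t i) = slide (sliding T T' i' (G (Suc t) i'), i', G (Suc t) i')"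
proof -
  have I: "interlace (G t) (G (Suc t))" using chain_interlace[OF G t] .
  have c: "G t (Suc i) < G t i" unfolding i_def using hole_corner[OF G h(2), of t] t by simp
  have C': "chain M n k (shrink G h)" by (rule chain_shrink[OF G h])
  have i1: "1 \<le> i" using hole_ge[of h G t] h by (simp add: i_def)
  note T = tab_of_eq_Suc[OF G] and T' = tab_of_eq_Suc[OF C']
  have right0: "T i (Suc c) = 0 \<or> Suc t \<le> T i (Suc c)" if "G t i \<le> c" for c
  proof (cases "T i (Suc c)")
    case (Suc r)
    then have "Suc c \<le> G (Suc r) i" "r < k" using T[of i "Suc c" r] by (auto simp: T_def)
    then show ?thesis using chain_mono[OF G, of "Suc r" t i] that t Suc by (cases "Suc r \<le> t") auto
  qed simp
  show ?thesis
  proof (cases "G (Suc t) (Suc i) = G t i")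
    case True
    then have i': "i' = Suc i" by (simp add: i_def i'_def)
    have d: "T (Suc i) (G t i) = Suc t" using T[of "Suc i" "G t i" t] c True t by (simp add: T_def)
    have d': "T' i (G t i) = Suc t"
      using T'[of i "G t i" t] i1 t i' c interlaceD(1)[OF I, of i]
      unfolding T'_def shrink_def i_def[symmetric] i'_def[symmetric] by simp
    have "slide (sliding T T' i (G t i), i, G t i) = slide (sliding T T' (Suc i) (G t i), Suc i, G t i)"
    proof -
      have *: "sliding T T' i (G t i) (Suc i) (G t i) = T (Suc i) (G t i)"
        "sliding T T' i (G t i) i (Suc (G t i)) = T i (Suc (G t i))" by (auto simp: sliding_def)
      have "upd (upd (sliding T T' i (G t i)) i (G t i) (T (Suc i) (G t i))) (Suc i) (G t i) 0
          = sliding T T' (Suc i) (G t i)"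
      proof (rule sliding_down)
        show "T (Suc i) (G t i) = T' i (G t i)" using d d' by simp
        show "T i c' = T' i c'" if c': "G t i < c'" for c'
          unfolding T_def T'_def
        proof (rule tab_of_shrink[symmetric])
          fix r assume r: "r \<le> k" "hole G h r = i"
          have "r \<le> t" using hole_mono[of "Suc t" r G h] r i' by (cases "r \<le> t") (auto simp: i'_def)
          then show "c' \<noteq> G r i" using chain_mono[OF G, of r t i] c' t by auto
        qed
        show "T (Suc i) c' = T' (Suc i) c'" if c': "c' < G t i" for c'
          unfolding T_def T'_def
        proof (rule tab_of_shrink[symmetric])
          fix r assume r: "r \<le> k" "hole G h r = Suc i"
          have "Suc t \<le> r" using hole_mono[of r t G h] r by (cases "Suc t \<le> r") (auto simp: i_def)
          then show "c' \<noteq> G r (Suc i)" using chain_mono[OF G, of "Suc t" r "Suc i"] c' r True by auto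
        qed
      qed
      then show ?thesis
        using slide_down[of "sliding T T' i (G t i)" i "G t i"] d right0[of "G t i"] unfolding * by auto
    qed
    then show ?thesis using i' True by simp
  next
    case False
    then have i': "i' = i" by (simp add: i_def i'_def)
    have lt: "G (Suc t) (Suc i) < G t i" using False interlaceD(2)[OF I, of i] by simp
    \<comment> \<open>During the run to the right the cell below the hole is empty or contains a
      letter above t + 1, so no step leads down. The run may be empty.\<close>
    have step: "slide (sliding T T' i c, i, c) = slide (sliding T T' i (Suc c), i, Suc c)"
      if c: "G t i \<le> c" "c < G (Suc t) i" for c
    proof -
      have r: "T i (Suc c) = Suc t" using T[of i "Suc c" t] c t i1 by (simp add: T_def)
      have r': "T' i c = Suc t"
        using T'[of i c t] i1 t i' c lt
        unfolding T'_def shrink_def i_def[symmetric] i'_def[symmetric] by simp linarith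
      have d: "T (Suc i) c = 0 \<or> Suc t < T (Suc i) c"
      proof (cases "T (Suc i) c")
        case (Suc r)
        then have "c \<le> G (Suc r) (Suc i)" "r < k" using T[of "Suc i" c r] by (auto simp: T_def)
        then show ?thesis using chain_mono[OF G, of "Suc r" "Suc t" "Suc i"] lt c t Suc
          by (cases "r \<le> t") auto
      qed simp
      have *: "sliding T T' i c (Suc i) c = T (Suc i) c"
        "sliding T T' i c i (Suc c) = T i (Suc c)" by (auto simp: sliding_def)
      have "upd (upd (sliding T T' i c) i c (T i (Suc c))) i (Suc c) 0 = sliding T T' i (Suc c)"
        by (rule sliding_right) (use r r' in simp)
      then show ?thesis using slide_right[of "sliding T T' i c" i c] r d unfolding * by auto
    qed
    have "c \<le> G (Suc t) i \<Longrightarrow> slide (sliding T T' i (G t i), i, G t i) = slide (sliding T T' i c, i, c)"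
      if "G t i \<le> c" for c
      using that by (induction c rule: dec_induct) (use step in auto)
    from this[of "G (Suc t) i"] show ?thesis using interlaceD(1)[OF I, of i] i' by simp
  qed
qed

text \<open>The letters are followed one by one. At the start all cells before the hole have their
  final entries; after the last letter both neighbours of the hole are empty, so the slide stops at
  a corner of the outer shape.\<close>

theorem slide_tab_of:
  assumes G: "chain M n k G" and h: "1 \<le> h" "G 0 (Suc h) < G 0 h"
  shows "slide (tab_of k G, h, G 0 h) = (tab_of k (shrink G h), hole G h k, G k (hole G h k))"
proof -
  let ?T = "tab_of k G" and ?T' = "tab_of k (shrink G h)"
  define s where "s t = (sliding ?T ?T' (hole G h t) (G t (hole G h t)), hole G h t, G t (hole G h t))" for t
  have "t \<le> k \<Longrightarrow> slide (s 0) = slide (s t)" for t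
    by (induction t) (use slide_letter[OF G h] in \<open>auto simp: s_def simp del: hole.simps\<close>)
  then have 1: "slide (s 0) = slide (s k)" by simp
  have e: "?T' i c = ?T i c" if "i < h \<or> i = h \<and> c < G 0 h" for i c
  proof (rule tab_of_shrink)
    fix r assume r: "r \<le> k" "hole G h r = i"
    then have "i = h" using hole_ge[of h G r] that by auto
    then show "c \<noteq> G r i" using chain_mono[OF G, of 0 r h] that r by auto
  qed
  have "sliding ?T ?T' h (G 0 h) = ?T"
    using tab_of_eq_0[of k G h "G 0 h"] by (auto simp: sliding_def fun_eq_iff e)
  then have 2: "s 0 = (?T, h, G 0 h)" by (simp add: s_def)
  let ?g = "hole G h k"
  have z: "?T ?g (Suc (G k ?g)) = 0" "?T (Suc ?g) (G k ?g) = 0"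
    using tab_of_eq_0[of k G ?g "Suc (G k ?g)"] tab_of_eq_0[of k G "Suc ?g" "G k ?g"] hole_corner[OF G h(2), of k]
    by auto
  have e': "?T' i c = ?T i c" if "i > ?g" for i c
  proof (rule tab_of_shrink)
    fix r assume "r \<le> k" "hole G h r = i"
    then show "c \<noteq> G r i" using hole_mono[of r k G h] that by simp
  qed
  have e2: "?T' ?g c = 0 \<and> ?T ?g c = 0" if "c > G k ?g" for c
    using that by (auto simp: tab_of_eq_0 shrink_def)
  have e3: "?T' ?g (G k ?g) = 0"
    using hole_corner[OF G h(2), of k] by (auto simp: tab_of_eq_0 shrink_def)
  have s: "sliding ?T ?T' ?g (G k ?g) = ?T'"
  proof (intro ext)
    fix i c show "sliding ?T ?T' ?g (G k ?g) i c = ?T' i c"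
      using e'[of i c] e2[of c] e3 by (cases i ?g rule: linorder_cases; cases c "G k ?g" rule: linorder_cases) (auto simp: sliding_def)
  qed
  have "?T' ?g (Suc (G k ?g)) = 0" "?T' (Suc ?g) (G k ?g) = 0" using z e' e2 by auto
  then have "slide (?T', ?g, G k ?g) = (?T', ?g, G k ?g)" by (rule slide_stop)
  then show ?thesis using 1 2 by (simp add: s_def s)
qed

section \<open>Sliding into horizontal strips\<close>

fun dec :: "ptn \<Rightarrow> nat list \<Rightarrow> ptn" where
  "dec \<alpha> [] = \<alpha>"
| "dec \<alpha> (h # hs) = dec (\<alpha>(h := \<alpha> h - 1)) hs"

fun shrinks :: "nat list \<Rightarrow> (nat \<Rightarrow> ptn) \<Rightarrow> nat \<Rightarrow> ptn" where
  "shrinks [] G = G"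
| "shrinks (h # hs) G = shrinks hs (shrink G h)"

text \<open>All holes of a strip cross one letter before any of them meets the next. With each hole
  the two shapes around that letter lose a cell, the inner one where the hole was and the outer one
  where it is now.\<close>

fun transit :: "ptn \<Rightarrow> ptn \<Rightarrow> nat list \<Rightarrow> nat list" where
  "transit \<alpha> \<beta> [] = []"
| "transit \<alpha> \<beta> (h # hs) =
     (let g = if \<beta> (Suc h) = \<alpha> h then Suc h else h
      in g # transit (\<alpha>(h := \<alpha> h - 1)) (\<beta>(g := \<beta> g - 1)) hs)"

fun holes :: "(nat \<Rightarrow> ptn) \<Rightarrow> nat \<Rightarrow> nat list \<Rightarrow> nat list" where
  "holes G 0 hs = hs"
| "holes G (Suc j) hs = transit (G j) (G (Suc j)) (holes G j hs)"

fun removable :: "ptn \<Rightarrow> nat list \<Rightarrow> bool" where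
  "removable \<alpha> [] \<longleftrightarrow> True"
| "removable \<alpha> (h # hs) \<longleftrightarrow> 1 \<le> h \<and> \<alpha> (Suc h) < \<alpha> h \<and> removable (\<alpha>(h := \<alpha> h - 1)) hs"

fun removed :: "ptn \<Rightarrow> nat list \<Rightarrow> (nat \<times> nat) list" where
  "removed \<alpha> [] = []"
| "removed \<alpha> (h # hs) = (h, \<alpha> h) # removed (\<alpha>(h := \<alpha> h - 1)) hs"

text \<open>Rows from top to bottom, because the switch treats equal entries from right to left and
  in a horizontal strip lower rows lie further to the left.\<close>

definition strip_rows :: "(nat \<Rightarrow> nat) \<Rightarrow> nat \<Rightarrow> nat \<Rightarrow> nat list" where
  "strip_rows m a b = concat (map (\<lambda>i. replicate (m i) i) [a..<b])"

lemma strip_rows_Cons: "a < b \<Longrightarrow> strip_rows m a b = replicate (m a) a @ strip_rows m (Suc a) b"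
  by (simp add: strip_rows_def upt_conv_Cons)

lemma strip_rows_Nil: "b \<le> a \<Longrightarrow> strip_rows m a b = []"
  by (simp add: strip_rows_def)

lemma holes_Nil [simp]: "holes G j [] = []"
  by (induction j) auto

text \<open>This exchanges the two loops: \<open>holes\<close> takes all holes through one letter
  after the other, whereas a slide takes one hole through all letters. The remaining holes see the
  shapes shrunk by the first one.\<close>

lemma holes_Cons: "holes G j (h # hs) = hole G h j # holes (shrink G h) j hs"
proof (induction j)
  case (Suc j)
  then show ?case by (simp add: Let_def shrink_def[of G h j] shrink_def[of G h "Suc j"])
qed simp

lemma shrinks_eq: "shrinks hs G j = dec (G j) (holes G j hs)"
proof (induction hs arbitrary: G)
  case (Cons h hs)
  then show ?case
    by (simp add: holes_Cons shrink_def[of G h j] fun_upd_same fun_upd_other del: fun_upd_apply)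
qed simp

lemma dec_append: "dec \<alpha> (xs @ ys) = dec (dec \<alpha> xs) ys"
  by (induction xs arbitrary: \<alpha>) auto

lemma dec_replicate: "dec \<alpha> (replicate x h) = \<alpha>(h := \<alpha> h - x)"
  by (induction x arbitrary: \<alpha>) auto

lemma dec_le: "dec \<alpha> hs i \<le> \<alpha> i"
proof (induction hs arbitrary: \<alpha>)
  case (Cons h hs)
  have "dec (\<alpha>(h := \<alpha> h - 1)) hs i \<le> (\<alpha>(h := \<alpha> h - 1)) i" by (rule Cons)
  also have "\<dots> \<le> \<alpha> i" by simp
  finally show ?case by simp
qed simp

lemma dec_strip_rows: "dec \<alpha> (strip_rows m a b) i = (if a \<le> i \<and> i < b then \<alpha> i - m i else \<alpha> i)"
proof (induction "b - a" arbitrary: a \<alpha>)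
  case 0
  then show ?case by (simp add: strip_rows_Nil)
next
  case (Suc x)
  then have "a < b" "x = b - Suc a" by simp_all
  then show ?case using Suc.hyps(1)[of "Suc a"]
    by (auto simp: strip_rows_Cons dec_append dec_replicate)
qed

lemma removable_replicate:
  "1 \<le> h \<Longrightarrow> \<alpha> (Suc h) + x \<le> \<alpha> h \<Longrightarrow> removable (\<alpha>(h := \<alpha> h - x)) L \<Longrightarrow> removable \<alpha> (replicate x h @ L)"
proof (induction x arbitrary: \<alpha>)
  case (Suc x)
  then show ?case using Suc.IH[of "\<alpha>(h := \<alpha> h - 1)"]
    by (simp del: fun_upd_apply add: fun_upd_same fun_upd_other)
qed simp

lemma removed_replicate:
  "x \<le> \<alpha> h \<Longrightarrow> removed \<alpha> (replicate x h @ L)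
    = map (Pair h) (rev [Suc (\<alpha> h - x)..<Suc (\<alpha> h)]) @ removed (\<alpha>(h := \<alpha> h - x)) L"
proof (induction x arbitrary: \<alpha>)
  case (Suc x)
  have "[Suc (\<alpha> h - Suc x)..<Suc (\<alpha> h)] = [Suc (\<alpha> h - Suc x)..<\<alpha> h] @ [\<alpha> h]"
    using Suc.prems by simp
  then show ?case using Suc.IH[of "\<alpha>(h := \<alpha> h - 1)"] Suc.prems 
    by (cases "\<alpha> h") (simp_all del: upt_Suc fun_upd_apply add: fun_upd_same fun_upd_other)
qed simp

lemma transit_stay:
  "\<beta> (Suc h) + x \<le> \<alpha> h \<Longrightarrow> transit \<alpha> \<beta> (replicate x h @ L)
    = replicate x h @ transit (\<alpha>(h := \<alpha> h - x)) (\<beta>(h := \<beta> h - x)) L"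
proof (induction x arbitrary: \<alpha> \<beta>)
  case (Suc x)
  then show ?case using Suc.IH[of "\<beta>(h := \<beta> h - 1)" "\<alpha>(h := \<alpha> h - 1)"]
    by (simp del: fun_upd_apply add: fun_upd_same fun_upd_other)
qed simp

text \<open>A hole that moves down takes one cell from each side of the equation, which therefore
  still holds for the next hole in the same row.\<close>

lemma transit_down:
  "x = 0 \<or> \<beta> (Suc h) = \<alpha> h \<Longrightarrow> transit \<alpha> \<beta> (replicate x h @ L)
    = replicate x (Suc h) @ transit (\<alpha>(h := \<alpha> h - x)) (\<beta>(Suc h := \<beta> (Suc h) - x)) L"
proof (induction x arbitrary: \<alpha> \<beta>)
  case (Suc x)
  then show ?case using Suc.IH[of "\<beta>(Suc h := \<beta> (Suc h) - 1)" "\<alpha>(h := \<alpha> h - 1)"]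
    by (simp del: fun_upd_apply add: fun_upd_same fun_upd_other)
qed simp

lemma removable_strip:
  assumes I: "interlace \<pi> \<alpha>" and "1 \<le> h"
  shows "removable (\<lambda>i. if 1 \<le> i \<and> i < h then \<pi> i else \<alpha> i) (strip_rows (\<lambda>i. \<alpha> i - \<pi> i) h b)"
  using assms(2)
proof (induction "b - h" arbitrary: h)
  case 0
  then show ?case by (simp add: strip_rows_Nil)
next
  case (Suc x)
  then have h: "h < b" "x = b - Suc h" by simp_all
  let ?a = "\<lambda>i. if 1 \<le> i \<and> i < h then \<pi> i else \<alpha> i"
  have e: "?a(h := ?a h - (\<alpha> h - \<pi> h)) = (\<lambda>i. if 1 \<le> i \<and> i < Suc h then \<pi> i else \<alpha> i)"
    using interlaceD(1)[OF I, of h] Suc.prems by (auto simp: less_Suc_eq fun_eq_iff)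
  show ?case
    unfolding strip_rows_Cons[OF h(1)]
  proof (rule removable_replicate)
    show "?a (Suc h) + (\<alpha> h - \<pi> h) \<le> ?a h"
      using interlaceD[OF I, of h] by simp
    show "removable (?a(h := ?a h - (\<alpha> h - \<pi> h))) (strip_rows (\<lambda>i. \<alpha> i - \<pi> i) (Suc h) b)"
      unfolding e using Suc.hyps(1)[OF h(2)] by simp
  qed (use Suc in simp)
qed

lemma removed_strip:
  assumes I: "\<And>i. \<pi> i \<le> \<alpha> i" and "\<And>i. a \<le> i \<Longrightarrow> \<alpha>' i = \<alpha> i"
  shows "removed \<alpha>' (strip_rows (\<lambda>i. \<alpha> i - \<pi> i) a b) =
    concat (map (\<lambda>i. map (Pair i) (rev [Suc (\<pi> i)..<Suc (\<alpha> i)])) [a..<b])"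
  using assms(2)
proof (induction "b - a" arbitrary: a \<alpha>')
  case 0
  then show ?case by (simp add: strip_rows_Nil)
next
  case (Suc x)
  then have a: "a < b" "x = b - Suc a" by simp_all
  have "\<alpha> a - \<pi> a \<le> \<alpha>' a" "\<alpha>' a - (\<alpha> a - \<pi> a) = \<pi> a" "\<alpha>' a = \<alpha> a" using Suc.prems[of a] I[of a] by simp_all
  then show ?case
    unfolding strip_rows_Cons[OF a(1)] upt_conv_Cons[OF a(1)]
    using Suc.hyps(1)[OF a(2), of "\<alpha>'(a := \<pi> a)"] Suc.prems
    by (simp add: removed_replicate del: upt_Suc)
qed

text \<open>The holes are followed row by row: the prefix consists of those that have come down from
  row h - 1, and the two shapes account for all holes that started above row h. In row h a hole
  stays as long as its column exceeds \<open>max (\<pi> h) (\<beta> (Suc h))\<close>; the others go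
  down. Counting the holes that end up in row h gives the toggle formula.\<close>

lemma transit_strip:
  assumes I: "interlace \<pi> \<alpha>" "interlace \<alpha> \<beta>" and z: "\<And>i. n < i \<Longrightarrow> \<beta> i = 0" and 0: "\<beta> 0 = \<pi> 0"
    and "1 \<le> h" "h \<le> Suc n"
  shows "replicate (\<beta> h - \<pi> (h - 1)) h @
      transit (\<lambda>i. if 1 \<le> i \<and> i < h then \<pi> i else \<alpha> i)
        (\<lambda>i. if 1 \<le> i \<and> i < h then toggle \<pi> \<alpha> \<beta> i else if i = h then min (\<pi> (h - 1)) (\<beta> h) else \<beta> i)
        (strip_rows (\<lambda>i. \<alpha> i - \<pi> i) h (Suc n))
    = strip_rows (\<lambda>i. \<beta> i - toggle \<pi> \<alpha> \<beta> i) h (Suc n)"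
  using assms(5,6)
proof (induction "Suc n - h" arbitrary: h)
  case 0
  then show ?case using z[of h] by (simp add: strip_rows_Nil)
next
  case (Suc x)
  then have h: "h < Suc n" "x = Suc n - Suc h" "1 \<le> h" by simp_all
  then obtain g where g: "h = Suc g" by (cases h) auto
  let ?t = "toggle \<pi> \<alpha> \<beta>"
  let ?a = "\<lambda>i. if 1 \<le> i \<and> i < h then \<pi> i else \<alpha> i"
  let ?b = "\<lambda>i. if 1 \<le> i \<and> i < h then ?t i else if i = h then min (\<pi> (h - 1)) (\<beta> h) else \<beta> i"
  \<comment> \<open>Of the \<open>\<alpha> h - \<pi> h\<close> holes in row h, p stay and q go down;
    q is 0 if row h + 1 of \<beta> does not reach beyond \<pi> h.\<close>
  define p q where "p = \<alpha> h - max (\<pi> h) (\<beta> (Suc h))" and "q = \<beta> (Suc h) - \<pi> h"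
  have b: "\<pi> h \<le> \<alpha> h" "\<alpha> (Suc h) \<le> \<pi> h" "\<alpha> h \<le> \<beta> h" "\<beta> (Suc h) \<le> \<alpha> h" "\<alpha> h \<le> \<pi> (h - 1)"
    using interlaceD[OF I(1), of h] interlaceD[OF I(2), of h] interlaceD(2)[OF I(1), of g] g by auto
  have t: "?t h = min (\<pi> (h - 1)) (\<beta> h) + max (\<pi> h) (\<beta> (Suc h)) - \<alpha> h" using g by simp
  have pq: "\<alpha> h - \<pi> h = p + q" "(\<beta> h - \<pi> (h - 1)) + p = \<beta> h - ?t h"
    using b unfolding p_def q_def t by (auto simp: max_def min_def)
  have e1: "?a(h := ?a h - p, h := (?a(h := ?a h - p)) h - q) = (\<lambda>i. if 1 \<le> i \<and> i < Suc h then \<pi> i else \<alpha> i)"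
    using b h(3) by (auto simp: p_def q_def fun_eq_iff max_def)
  have e2: "?b(h := ?b h - p, Suc h := (?b(h := ?b h - p)) (Suc h) - q) =
     (\<lambda>i. if 1 \<le> i \<and> i < Suc h then ?t i else if i = Suc h then min (\<pi> (Suc h - 1)) (\<beta> (Suc h)) else \<beta> i)"
  proof
    fix i
    have "min (\<pi> (h - 1)) (\<beta> h) - p = ?t h" unfolding t p_def using b by (auto simp: max_def min_def)
    moreover have "\<beta> (Suc h) - q = min (\<pi> h) (\<beta> (Suc h))" by (auto simp: q_def min_def)
    ultimately show "(?b(h := ?b h - p, Suc h := (?b(h := ?b h - p)) (Suc h) - q)) i =
     (if 1 \<le> i \<and> i < Suc h then ?t i else if i = Suc h then min (\<pi> (Suc h - 1)) (\<beta> (Suc h)) else \<beta> i)"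
      using h(3) by (auto simp: less_Suc_eq)
  qed
  have "transit ?a ?b (strip_rows (\<lambda>i. \<alpha> i - \<pi> i) h (Suc n)) =
     transit ?a ?b (replicate p h @ (replicate q h @ strip_rows (\<lambda>i. \<alpha> i - \<pi> i) (Suc h) (Suc n)))"
    unfolding strip_rows_Cons[OF h(1)] pq(1) replicate_add by simp
  also have "\<dots> = replicate p h @ transit (?a(h := ?a h - p)) (?b(h := ?b h - p))
      (replicate q h @ strip_rows (\<lambda>i. \<alpha> i - \<pi> i) (Suc h) (Suc n))"
    by (rule transit_stay) (use b in \<open>auto simp: p_def max_def\<close>)
  also have "transit (?a(h := ?a h - p)) (?b(h := ?b h - p))
      (replicate q h @ strip_rows (\<lambda>i. \<alpha> i - \<pi> i) (Suc h) (Suc n)) =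
      replicate q (Suc h) @ transit (?a(h := ?a h - p, h := (?a(h := ?a h - p)) h - q))
        (?b(h := ?b h - p, Suc h := (?b(h := ?b h - p)) (Suc h) - q))
        (strip_rows (\<lambda>i. \<alpha> i - \<pi> i) (Suc h) (Suc n))"
    by (rule transit_down) (use b in \<open>auto simp: p_def q_def max_def\<close>)
  also have "\<dots> = strip_rows (\<lambda>i. \<beta> i - ?t i) (Suc h) (Suc n)"
    unfolding e1 e2 using Suc.hyps(1)[OF h(2)] h(1) by (simp add: q_def)
  finally show ?case
    unfolding strip_rows_Cons[OF h(1)] pq(2)[symmetric] replicate_add by simp
qed

lemma holes_strip:
  assumes G: "chain M n k G" and H: "H 0 0 = M" "interlace (H 0) (G 0)"
    "\<And>j. j < k \<Longrightarrow> H (Suc j) = toggle (H j) (G j) (G (Suc j))" and "j \<le> k"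
  shows "H j 0 = M \<and> interlace (H j) (G j) \<and>
    holes G j (strip_rows (\<lambda>i. G 0 i - H 0 i) 1 (Suc n)) = strip_rows (\<lambda>i. G j i - H j i) 1 (Suc n)"
  using assms(5)
proof (induction j)
  case (Suc j)
  have IH: "H j 0 = M" "interlace (H j) (G j)"
    "holes G j (strip_rows (\<lambda>i. G 0 i - H 0 i) 1 (Suc n)) = strip_rows (\<lambda>i. G j i - H j i) 1 (Suc n)"
    using Suc by auto
  have I: "interlace (G j) (G (Suc j))" using chain_interlace[OF G, of j] Suc.prems by simp
  have HS: "H (Suc j) = toggle (H j) (G j) (G (Suc j))" using H(3)[of j] Suc.prems by simp
  have r: "G j 0 = M" "G (Suc j) 0 = M" "\<And>i. n < i \<Longrightarrow> G (Suc j) i = 0"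
    using chain_row0[OF G] chain_rows[OF G] Suc.prems by auto
  have c: "G (Suc j) 1 \<le> H j 0" using interlaceD(2)[OF I, of 0] r IH by simp
  have e: "(\<lambda>i. if 1 \<le> i \<and> i < (1::nat) then toggle (H j) (G j) (G (Suc j)) i
      else if i = 1 then min (H j (1 - 1)) (G (Suc j) 1) else G (Suc j) i) = G (Suc j)"
    "(\<lambda>i. if 1 \<le> i \<and> i < (1::nat) then H j i else G j i) = G j"
    using c by (auto simp: fun_eq_iff)
  have "holes G (Suc j) (strip_rows (\<lambda>i. G 0 i - H 0 i) 1 (Suc n)) =
      transit (G j) (G (Suc j)) (strip_rows (\<lambda>i. G j i - H j i) 1 (Suc n))"
    using IH by simp
  also have "\<dots> = strip_rows (\<lambda>i. G (Suc j) i - H (Suc j) i) 1 (Suc n)"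
    using transit_strip[where n = n and h = 1, OF IH(2) I r(3)] r IH(1) c unfolding HS e by simp
  finally show ?case using IH(2) I r interlace_toggle(2)[OF IH(2) I] unfolding HS by simp
qed (use H in simp)

text \<open>Thus the slides into one strip replace the chain of the second tableau by the next row
  of the growth diagram.\<close>

lemma shrinks_strip:
  assumes G: "chain M n k G" and H: "H 0 0 = M" "interlace (H 0) (G 0)"
    "\<And>j. j < k \<Longrightarrow> H (Suc j) = toggle (H j) (G j) (G (Suc j))" and "j \<le> k"
  shows "shrinks (strip_rows (\<lambda>i. G 0 i - H 0 i) 1 (Suc n)) G j = H j"
proof
  fix i
  note * = holes_strip[OF assms]
  have "H j i \<le> G j i" using * interlaceD(1) by blast
  moreover have "G j 0 = M" "n < i \<Longrightarrow> G j i = 0" using chain_row0[OF G assms(5)] chain_rows[OF G assms(5)] by auto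
  ultimately show "shrinks (strip_rows (\<lambda>i. G 0 i - H 0 i) 1 (Suc n)) G j i = H j i"
    using * by (cases "i = 0") (auto simp: shrinks_eq dec_strip_rows)
qed

section \<open>The switch carried out one letter at a time\<close>

definition switch_step :: "nat \<times> nat \<times> nat \<Rightarrow> tab \<times> tab \<Rightarrow> tab \<times> tab" where
  "switch_step = (\<lambda>(x, j, i) (A, B'). let (A, i', j') = slide (A, i, j) in (A, upd B' i' j' x))"

lemma switch_eq:
  "switch (\<mu>, B) (\<pi>, A) =
     (let (A', B') = fold switch_step (rev (sorted_list_of_set {(B i j, j, i) | i j. B i j \<noteq> 0})) (A, \<lambda>_ _. 0)
      in ((\<mu>, A'), (outer (\<mu>, A'), B')))"
  by (simp add: switch_def switch_step_def)

text \<open>The holes arrive at row ends of the outer shape, so the cells that receive x are those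
  by which the outer shape shrinks.\<close>

lemma switch_step_strip:
  assumes "chain M n k G" "removable (G 0) hs"
  shows "fold switch_step (map (\<lambda>(i, j). (x, j, i)) (removed (G 0) hs)) (tab_of k G, B) =
    (tab_of k (shrinks hs G), \<lambda>i c. if 1 \<le> i \<and> shrinks hs G k i < c \<and> c \<le> G k i then x else B i c)"
  using assms
proof (induction hs arbitrary: G B)
  case Nil
  then show ?case by (auto simp: fun_eq_iff)
next
  case (Cons h hs)
  let ?g = "hole G h k"
  have h: "1 \<le> h" "G 0 (Suc h) < G 0 h" using Cons.prems by auto
  have C: "chain M n k (shrink G h)" by (rule chain_shrink[OF Cons.prems(1) h])
  have 0: "(G 0)(h := G 0 h - 1) = shrink G h 0" by (simp add: shrink_def)
  have rem: "removable (shrink G h 0) hs" using Cons.prems(2) by (simp add: shrink_def)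
  have st: "switch_step (x, G 0 h, h) (tab_of k G, B) = (tab_of k (shrink G h), upd B ?g (G k ?g) x)"
    unfolding switch_step_def by (simp add: slide_tab_of[OF Cons.prems(1) h])
  have le: "shrinks hs (shrink G h) k i \<le> shrink G h k i" for i unfolding shrinks_eq by (rule dec_le)
  have g: "1 \<le> ?g" "0 < G k ?g" using hole_ge[of h G k] h hole_corner[OF Cons.prems(1) h(2), of k] by auto
  have "fold switch_step (map (\<lambda>(i, j). (x, j, i)) (removed (G 0) (h # hs))) (tab_of k G, B) =
     (tab_of k (shrinks hs (shrink G h)),
      \<lambda>i c. if 1 \<le> i \<and> shrinks hs (shrink G h) k i < c \<and> c \<le> shrink G h k i then x else upd B ?g (G k ?g) x i c)"
    using Cons.IH[OF C rem] st 0 by simp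
  moreover have "(\<lambda>i c. if 1 \<le> i \<and> shrinks hs (shrink G h) k i < c \<and> c \<le> shrink G h k i then x else upd B ?g (G k ?g) x i c)
     = (\<lambda>i c. if 1 \<le> i \<and> shrinks hs (shrink G h) k i < c \<and> c \<le> G k i then x else B i c)"
  proof (intro ext)
    fix i c
    show "(if 1 \<le> i \<and> shrinks hs (shrink G h) k i < c \<and> c \<le> shrink G h k i then x else upd B ?g (G k ?g) x i c)
      = (if 1 \<le> i \<and> shrinks hs (shrink G h) k i < c \<and> c \<le> G k i then x else B i c)"
    proof (cases "i = ?g")
      case True
      have "shrink G h k i = G k i - 1" using True by (simp add: shrink_def)
      then show ?thesis using le[of i] g True by (cases "c = G k ?g") (auto simp: upd_def)
    next
      case False
      then have "shrink G h k i = G k i" by (simp add: shrink_def)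
      then show ?thesis using False by (simp add: upd_def)
    qed
  qed
  ultimately show ?case by simp
qed

lemma sorted_wrt_concat:
  "sorted_wrt P (concat xss) \<longleftrightarrow> (\<forall>xs\<in>set xss. sorted_wrt P xs) \<and>
     sorted_wrt (\<lambda>xs ys. \<forall>x\<in>set xs. \<forall>y\<in>set ys. P x y) xss"
  by (induction xss) (auto simp: sorted_wrt_append)

lemma rev_sorted_list_of_set:
  fixes L :: "'a :: linorder list"
  assumes "sorted_wrt (\<lambda>x y. y < x) L"
  shows "rev (sorted_list_of_set (set L)) = L"
proof -
  have "sorted_wrt (<) (rev L)" using assms by (simp add: sorted_wrt_rev)
  then have "sorted_list_of_set (set L) = rev L"
    by (intro strict_sorted_equal) auto
  then show ?thesis by simp
qed

definition letter_cells :: "nat \<Rightarrow> (nat \<Rightarrow> ptn) \<Rightarrow> nat \<Rightarrow> (nat \<times> nat \<times> nat) list" where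
  "letter_cells n D x = concat (map (\<lambda>i. map (\<lambda>j. (x, j, i)) (rev [Suc (D (x - 1) i)..<Suc (D x i)])) [1..<Suc n])"

lemma set_letter_cells:
  "set (letter_cells n D x) = {(x, j, i) | i j. 1 \<le> i \<and> i \<le> n \<and> D (x - 1) i < j \<and> j \<le> D x i}"
  by (auto simp: letter_cells_def Suc_le_eq less_Suc_eq_le simp del: upt_Suc)

text \<open>For a fixed letter the strip is horizontal, so all columns in lower rows are smaller;
  rows from top to bottom, each from right to left, thus list the triples in decreasing
  order.\<close>

lemma cells_in_order:
  assumes D: "chain M n d D"
  shows "sorted_wrt (\<lambda>p q. q < p) (concat (map (letter_cells n D) (rev [1..<Suc d])))"
    "set (concat (map (letter_cells n D) (rev [1..<Suc d]))) = {(tab_of d D i j, j, i) | i j. tab_of d D i j \<noteq> 0}"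
proof -
  have 1: "sorted_wrt (\<lambda>p q. q < p) (letter_cells n D x)" if x: "1 \<le> x" "x \<le> d" for x
  proof -
    have I: "interlace (D (x - 1)) (D x)" using chain_interlace[OF D, of "x - 1"] x by simp
    have le: "D x i' \<le> D (x - 1) i" if "i < i'" for i i'
      using chain_antimono[OF D, of x "Suc i" i'] interlaceD(2)[OF I, of i] that x by simp
    show ?thesis
      unfolding letter_cells_def sorted_wrt_concat
    proof (intro conjI)
      show "\<forall>xs\<in>set (map (\<lambda>i. map (\<lambda>j. (x, j, i)) (rev [Suc (D (x - 1) i)..<Suc (D x i)])) [1..<Suc n]).
          sorted_wrt (\<lambda>p q. q < p) xs"
        by (auto simp: sorted_wrt_map sorted_wrt_rev simp del: upt_Suc)
      show "sorted_wrt (\<lambda>xs ys. \<forall>a\<in>set xs. \<forall>b\<in>set ys. b < a)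
        (map (\<lambda>i. map (\<lambda>j. (x, j, i)) (rev [Suc (D (x - 1) i)..<Suc (D x i)])) [1..<Suc n])"
        unfolding sorted_wrt_map
        by (rule sorted_wrt_mono_rel[OF _ sorted_wrt_upt]) (use le in \<open>fastforce simp del: upt_Suc\<close>)
    qed
  qed
  show "sorted_wrt (\<lambda>p q. q < p) (concat (map (letter_cells n D) (rev [1..<Suc d])))"
    unfolding sorted_wrt_concat
  proof (intro conjI)
    show "\<forall>xs\<in>set (map (letter_cells n D) (rev [1..<Suc d])). sorted_wrt (\<lambda>p q. q < p) xs"
      using 1 by auto
    show "sorted_wrt (\<lambda>xs ys. \<forall>a\<in>set xs. \<forall>b\<in>set ys. b < a) (map (letter_cells n D) (rev [1..<Suc d]))"
      unfolding sorted_wrt_map sorted_wrt_rev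
      by (rule sorted_wrt_mono_rel[OF _ sorted_wrt_upt]) (auto simp: set_letter_cells)
  qed
  have "(\<exists>x. 1 \<le> x \<and> x \<le> d \<and> p \<in> set (letter_cells n D x)) \<longleftrightarrow>
      (\<exists>i j. p = (tab_of d D i j, j, i) \<and> tab_of d D i j \<noteq> 0)" for p
  proof
    assume "\<exists>x. 1 \<le> x \<and> x \<le> d \<and> p \<in> set (letter_cells n D x)"
    then obtain x i j where *: "1 \<le> x" "x \<le> d" "p = (x, j, i)" "1 \<le> i" "i \<le> n" "D (x - 1) i < j" "j \<le> D x i"
      by (auto simp: set_letter_cells)
    then have "tab_of d D i j = x" using tab_of_eq_Suc[OF D, of i j "x - 1"] by simp
    then show "\<exists>i j. p = (tab_of d D i j, j, i) \<and> tab_of d D i j \<noteq> 0" using * by auto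
  next
    assume "\<exists>i j. p = (tab_of d D i j, j, i) \<and> tab_of d D i j \<noteq> 0"
    then obtain i j r where *: "p = (Suc r, j, i)" "tab_of d D i j = Suc r" by (metis not0_implies_Suc)
    then have **: "1 \<le> i" "r < d" "D r i < j" "j \<le> D (Suc r) i" using tab_of_eq_Suc[OF D, of i j r] by auto
    then have "i \<le> n" using chain_rows[OF D, of "Suc r" i] by (cases "i \<le> n") auto
    then show "\<exists>x. 1 \<le> x \<and> x \<le> d \<and> p \<in> set (letter_cells n D x)"
      using * ** by (intro exI[of _ "Suc r"]) (auto simp: set_letter_cells)
  qed
  moreover have "set (concat (map (letter_cells n D) (rev [1..<Suc d]))) =
      {p. \<exists>x. 1 \<le> x \<and> x \<le> d \<and> p \<in> set (letter_cells n D x)}"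
    by (auto simp: less_Suc_eq_le simp del: upt_Suc)
  ultimately show "set (concat (map (letter_cells n D) (rev [1..<Suc d]))) = {(tab_of d D i j, j, i) | i j. tab_of d D i j \<noteq> 0}"
    by simp
qed

lemma chain_grid_row:
  assumes D: "chain M n (d + c) D" and y: "y \<le> d"
  shows "chain M n c (grid d D y)"
proof -
  have "chain M n (d + c) (switches d c y D)" using chain_switches[OF D y] by simp
  moreover have "grid d D y j = switches d c y D (d - y + j)" if "j \<le> c" for j
    using switches_grid(2)[OF y that] by simp
  ultimately show ?thesis unfolding chain_def by (auto simp: Suc_le_eq)
qed

lemma chain_grid_col:
  assumes D: "chain M n (d + c) D"
  shows "chain M n d (\<lambda>x. grid d D (d - x) c)"
proof -
  have "chain M n (d + c) (switches d c d D)" using chain_switches[OF D order_refl] by simp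
  moreover have "grid d D (d - x) c = switches d c d D (c + x)" if "x \<le> d" for x
    using switches_final(2)[OF that, of c D] by simp
  ultimately show ?thesis unfolding chain_def by (auto simp: Suc_le_eq)
qed

text \<open>Each letter of the first tableau, from d down to 1, advances the growth diagram by one
  row. The images of the two tableaux are its last row and its last column.\<close>

theorem switch_tab_of:
  assumes D: "chain M n (d + c) D"
  shows "switch (\<mu>, tab_of d D) (\<pi>, tab_of c (\<lambda>j. D (d + j))) =
    ((\<mu>, tab_of c (grid d D d)), (outer (\<mu>, tab_of c (grid d D d)), tab_of d (\<lambda>x. grid d D (d - x) c)))"
proof -
  have Dd: "chain M n d D" using D by (auto simp: chain_def)
  let ?E = "\<lambda>x. grid d D (d - x) c"
  note E = chain_grid_col[OF D]
  \<comment> \<open>After y rounds the letters above d - y have been placed; they fill the cells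
    outside of \<open>grid d D y c\<close>, the outer shape at that moment.\<close>
  define B where "B y = (\<lambda>i l. if grid d D y c i < l then tab_of d ?E i l else 0)" for y
  have "y \<le> d \<Longrightarrow> fold switch_step (concat (map (letter_cells n D) (rev [Suc (d - y)..<Suc d])))
      (tab_of c (grid d D 0), \<lambda>_ _. 0) = (tab_of c (grid d D y), B y)" for y
  proof (induction y)
    case 0
    have "B 0 = (\<lambda>_ _. 0)" by (auto simp: B_def fun_eq_iff tab_of_eq_0)
    then show ?case by simp
  next
    case (Suc y)
    define x where "x = d - y"
    have x: "1 \<le> x" "x \<le> d" "d - Suc y = x - 1" "d - x = y" "d - (x - 1) = Suc y" using Suc.prems by (auto simp: x_def)
    let ?G = "grid d D y" and ?H = "grid d D (Suc y)"
    have G: "chain M n c ?G" by (rule chain_grid_row[OF D]) (use Suc.prems in simp)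
    have I: "interlace (?H 0) (?G 0)" using grid_interlace(3)[OF D, of y 0] Suc.prems by simp
    have HM: "?H 0 0 = M" using grid_interlace(1)[OF D, of "Suc y" 0] Suc.prems by simp
    define hs where "hs = strip_rows (\<lambda>i. ?G 0 i - ?H 0 i) 1 (Suc n)"
    have sh: "shrinks hs ?G j = ?H j" if "j \<le> c" for j
      unfolding hs_def by (rule shrinks_strip[where H = ?H, OF G HM I _ that]) simp
    have rem: "removable (?G 0) hs"
    proof -
      have "(\<lambda>i. if 1 \<le> i \<and> i < 1 then ?H 0 i else ?G 0 i) = ?G 0" by (auto simp: fun_eq_iff)
      then show ?thesis using removable_strip[OF I, of 1 "Suc n"] unfolding hs_def by (simp only:)
    qed
    have list: "letter_cells n D x = map (\<lambda>(i, j). (x, j, i)) (removed (?G 0) hs)"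
      unfolding hs_def by (subst removed_strip)
        (use interlaceD(1)[OF I] in \<open>simp_all add: letter_cells_def map_concat comp_def x x_def[symmetric] del: upt_Suc\<close>)
    have "fold switch_step (letter_cells n D x) (tab_of c ?G, B y) =
      (tab_of c (shrinks hs ?G), \<lambda>i l. if 1 \<le> i \<and> shrinks hs ?G c i < l \<and> l \<le> ?G c i then x else B y i l)"
      unfolding list by (rule switch_step_strip[OF G rem])
    also have "tab_of c (shrinks hs ?G) = tab_of c ?H"
      by (rule tab_of_cong') (use sh in simp)
    also have "(\<lambda>i l. if 1 \<le> i \<and> shrinks hs ?G c i < l \<and> l \<le> ?G c i then x else B y i l) = B (Suc y)"
    proof (intro ext)
      fix i l
      have t: "tab_of d ?E i l = x \<longleftrightarrow> 1 \<le> i \<and> ?H c i < l \<and> l \<le> ?G c i"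
        using tab_of_eq_Suc[OF E, of i l "x - 1"] x by (auto simp del: grid.simps)
      have le: "?H c i \<le> ?G c i" using interlaceD(1)[OF grid_interlace(3)[OF D, of y c]] Suc.prems by simp
      show "(if 1 \<le> i \<and> shrinks hs ?G c i < l \<and> l \<le> ?G c i then x else B y i l) = B (Suc y) i l"
        using t le sh[of c] by (cases "1 \<le> i") (auto simp: B_def tab_of_def simp del: grid.simps)
    qed
    finally have step: "fold switch_step (letter_cells n D x) (tab_of c ?G, B y) = (tab_of c ?H, B (Suc y))" .
    have "[Suc (d - Suc y)..<Suc d] = x # [Suc (d - y)..<Suc d]"
    proof -
      have "Suc (d - Suc y) = d - y" using Suc.prems by linarith
      then show ?thesis using Suc.prems by (simp add: upt_conv_Cons x_def del: upt_Suc)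
    qed
    then show ?case using Suc step by (simp del: upt_Suc grid.simps)
  qed
  from this[of d] have F: "fold switch_step (concat (map (letter_cells n D) (rev [1..<Suc d])))
      (tab_of c (\<lambda>j. D (d + j)), \<lambda>_ _. 0) = (tab_of c (grid d D d), B d)"
    by (simp add: ext[of "grid d D 0" "\<lambda>j. D (d + j)"] del: upt_Suc)
  have Bd: "B d = tab_of d ?E"
  proof (intro ext)
    fix i l show "B d i l = tab_of d ?E i l"
      using tab_of_eq_0[of d ?E i l] by (auto simp: B_def)
  qed
  have L: "rev (sorted_list_of_set {(tab_of d D i j, j, i) | i j. tab_of d D i j \<noteq> 0})
     = concat (map (letter_cells n D) (rev [1..<Suc d]))"
    using rev_sorted_list_of_set[OF cells_in_order(1)[OF Dd]] unfolding cells_in_order(2)[OF Dd] .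
  show ?thesis
    unfolding switch_eq L F Bd by simp
qed

section \<open>Rectification, evacuation and reversal in terms of chains\<close>

definition canon :: "nat \<Rightarrow> ptn \<Rightarrow> nat \<Rightarrow> ptn" where
  "canon M \<mu> j i = (if i = 0 then M else if i \<le> j then \<mu> i else 0)"

text \<open>The canonical tableau is given n letters, the last of which do not occur if its shape
  has fewer than n rows. So the number of strips does not depend on the length of the shape.\<close>

definition prepend_canon :: "nat \<Rightarrow> nat \<Rightarrow> (nat \<Rightarrow> ptn) \<Rightarrow> nat \<Rightarrow> ptn" where
  "prepend_canon n M G j = (if j < n then canon M (G 0) j else G (j - n))"

text \<open>Both results of the switch with a canonical tableau in one chain: the shapes 0, ..., k
  are the rectification, the shapes k, ..., k + n the displaced canonical tableau.\<close>

definition jdt :: "nat \<Rightarrow> nat \<Rightarrow> nat \<Rightarrow> (nat \<Rightarrow> ptn) \<Rightarrow> nat \<Rightarrow> ptn" where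
  "jdt n k M G = switches n k n (prepend_canon n M G)"

lemma chain_part:
  assumes "chain M n L D" "a + l \<le> L"
  shows "chain M n l (\<lambda>j. D (a + j))"
  unfolding chain_def
proof (intro conjI allI impI)
  fix j assume j: "j < l"
  show "interlace (D (a + j)) (D (a + Suc j))"
    using chain_interlace[OF assms(1), of "a + j"] j assms(2) by simp
next
  fix j assume j: "j \<le> l"
  then have j': "a + j \<le> L" using assms(2) by simp
  show "D (a + j) 0 = M" using chain_row0[OF assms(1) j'] .
  show "D (a + j) i = 0" if "n < i" for i using chain_rows[OF assms(1) j' that] .
  show "D (a + j) (Suc i) \<le> D (a + j) i" for i using chain_dec[OF assms(1) j'] .
qed

lemma outer_tab_of:
  assumes G: "chain M n k G" and "1 \<le> i" "\<mu> i = G 0 i"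
  shows "outer (\<mu>, tab_of k G) i = G k i"
proof -
  have e: "{j. tab_of k G i j \<noteq> 0} = {G 0 i<..G k i}"
  proof (rule set_eqI)
    show "j \<in> {j. tab_of k G i j \<noteq> 0} \<longleftrightarrow> j \<in> {G 0 i<..G k i}" for j
      using tab_of_eq_0[of k G i j] assms(2) by auto
  qed
  have "outer (\<mu>, tab_of k G) i = \<mu> i + card {G 0 i<..G k i}" unfolding outer_def e[symmetric] by simp
  then show ?thesis using chain_mono[OF G, of 0 k i] assms(3) by simp
qed

lemma prepend_canon_at: 
  assumes G: "chain M n k G" and "j \<le> n"
  shows "prepend_canon n M G j = canon M (G 0) j"
proof (cases "j = n")
  case True
  then show ?thesis using chain_row0[OF G, of 0] chain_rows[OF G, of 0]
    by (auto simp: prepend_canon_def canon_def fun_eq_iff)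
qed (use assms in \<open>simp add: prepend_canon_def\<close>)

lemma chain_prepend_canon:
  assumes G: "chain M n k G"
  shows "chain M n (n + k) (prepend_canon n M G)"
proof -
  have d: "G 0 (Suc i) \<le> G 0 i" "G 0 i \<le> M" for i using chain_dec[OF G, of 0] chain_le[OF G, of 0] by auto
  have z: "n < i \<Longrightarrow> G 0 i = 0" for i using chain_rows[OF G, of 0] by simp
  show ?thesis
    unfolding chain_def
  proof (intro conjI allI impI)
    fix j i assume j: "j \<le> n + k"
    show "prepend_canon n M G j 0 = M"
      using chain_row0[OF G, of "j - n"] j by (auto simp: prepend_canon_def canon_def)
    show "prepend_canon n M G j i = 0" if "n < i"
      using chain_rows[OF G, of "j - n" i] j z that by (auto simp: prepend_canon_def canon_def)
    show "prepend_canon n M G j (Suc i) \<le> prepend_canon n M G j i"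
      using chain_dec[OF G, of "j - n" i] j d by (auto simp: prepend_canon_def canon_def)
  next
    fix j assume j: "j < n + k"
    show "interlace (prepend_canon n M G j) (prepend_canon n M G (Suc j))"
    proof (cases "j < n")
      case True
      then show ?thesis using d prepend_canon_at[OF G, of j] prepend_canon_at[OF G, of "Suc j"]
        by (auto simp: interlace_def canon_def)
    next
      case False
      then show ?thesis using chain_interlace[OF G, of "j - n"] j by (simp add: prepend_canon_def Suc_diff_le)
    qed
  qed
qed

lemma Can_tab_of:
  assumes G: "chain M n k G" and \<mu>: "\<And>i. 1 \<le> i \<Longrightarrow> \<mu> i = G 0 i"
  shows "Can \<mu> = (empty_ptn, tab_of n (prepend_canon n M G))"
proof -
  have "(if (i, j) \<in> cells \<mu> empty_ptn then i else 0) = tab_of n (prepend_canon n M G) i j" for i j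
  proof (cases "1 \<le> i \<and> i \<le> n")
    case True
    then obtain i' where i': "i = Suc i'" by (cases i) auto
    note C = chain_part[OF chain_prepend_canon[OF G], of 0 n, simplified]
    have "tab_of n (prepend_canon n M G) i j = i \<longleftrightarrow> 0 < j \<and> j \<le> G 0 i"
      using tab_of_eq_Suc[OF C, of i j i'] prepend_canon_at[OF G, of i'] prepend_canon_at[OF G, of "Suc i'"] True i'
      by (auto simp: canon_def)
    moreover have "tab_of n (prepend_canon n M G) i j = 0 \<longleftrightarrow> \<not> (0 < j \<and> j \<le> G 0 i)"
      using tab_of_eq_0[of n "prepend_canon n M G" i j] prepend_canon_at[OF G, of 0] prepend_canon_at[OF G, of n] True
      by (auto simp: canon_def)
    ultimately show ?thesis using True \<mu>[of i] by (auto simp: cells_def empty_ptn_def)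
  next
    case False
    have "1 \<le> i \<Longrightarrow> \<mu> i = 0 \<and> prepend_canon n M G n i = 0"
      using False \<mu>[of i] chain_rows[OF G, of 0 i] prepend_canon_at[OF G, of n] by (auto simp: canon_def)
    then show ?thesis using False tab_of_eq_0[of n "prepend_canon n M G" i j]
      by (cases "1 \<le> i") (auto simp: cells_def empty_ptn_def)
  qed
  then show ?thesis by (auto simp: Can_def fun_eq_iff)
qed

lemma jdt_chain:
  assumes G: "chain M n k G"
  shows "chain M n (n + k) (jdt n k M G)" "\<And>i. 1 \<le> i \<Longrightarrow> jdt n k M G 0 i = 0" "jdt n k M G (k + n) = G k"
proof -
  note C = chain_prepend_canon[OF G]
  show "chain M n (n + k) (jdt n k M G)" unfolding jdt_def by (rule chain_switches[OF C]) auto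
  show "jdt n k M G 0 i = 0" if "1 \<le> i" for i
    using switches_grid(1)[of n n 0 k "prepend_canon n M G"] prepend_canon_at[OF G, of 0] that
    by (simp add: jdt_def canon_def)
  show "jdt n k M G (k + n) = G k"
    using switches_final(2)[of n n k "prepend_canon n M G"] by (simp add: jdt_def prepend_canon_def)
qed

lemma switch_Can:
  assumes G: "chain M n k G" and \<mu>: "\<And>i. 1 \<le> i \<Longrightarrow> \<mu> i = G 0 i"
  shows "switch (Can \<mu>) (\<mu>, tab_of k G) = ((empty_ptn, tab_of k (jdt n k M G)),
     (outer (empty_ptn, tab_of k (jdt n k M G)), tab_of n (\<lambda>x. jdt n k M G (k + x))))"
proof -
  let ?D = "prepend_canon n M G"
  note C = chain_prepend_canon[OF G]
  have "tab_of k G = tab_of k (\<lambda>j. ?D (n + j))" by (simp add: prepend_canon_def)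
  moreover have "tab_of k (grid n ?D n) = tab_of k (jdt n k M G)"
    by (rule tab_of_cong') (simp add: jdt_def switches_final(1))
  moreover have "tab_of n (\<lambda>x. grid n ?D (n - x) k) = tab_of n (\<lambda>x. jdt n k M G (k + x))"
    by (rule tab_of_cong') (simp add: jdt_def switches_final(2))
  ultimately show ?thesis
    using switch_tab_of[OF C, of empty_ptn \<mu>] Can_tab_of[OF G \<mu>] by simp
qed

lemma sorted_list_of_set_map:
  assumes "finite S" "\<And>x y. x \<in> S \<Longrightarrow> y \<in> S \<Longrightarrow> x < y \<Longrightarrow> f x < f y"
  shows "sorted_list_of_set (f ` S) = map f (sorted_list_of_set S)"
proof (rule strict_sorted_equal[symmetric, THEN sym])
  show "sorted_wrt (<) (map f (sorted_list_of_set S))"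
    unfolding sorted_wrt_map
    by (rule sorted_wrt_mono_rel[OF _ strict_sorted_list_of_set]) (use assms in auto)
qed (use assms in auto)

text \<open>For a canonical tableau the triples are (i, j, i), ordered like the pairs (i, j); so
  both functions vacate the cells in the same order and perform the same slides.\<close>

lemma rectify_switch_Can:
  assumes p: "is_partition \<mu>"
  shows "rectify (\<mu>, A) = (empty_ptn, snd (fst (switch (Can \<mu>) (\<mu>, A))))"
proof -
  have fin: "finite (cells \<mu> empty_ptn)"
  proof (rule finite_subset)
    show "cells \<mu> empty_ptn \<subseteq> {1..plen \<mu>} \<times> {..\<mu> 1}"
    proof
      fix x assume "x \<in> cells \<mu> empty_ptn"
      then obtain i j where "x = (i, j)" "1 \<le> i" "0 < j" "j \<le> \<mu> i" by (auto simp: cells_def empty_ptn_def)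
      then show "x \<in> {1..plen \<mu>} \<times> {..\<mu> 1}" using plen_iff[OF p, of i] partition_antimono[OF p, of 1 i] by auto
    qed
  qed simp
  let ?f = "\<lambda>(i, j). (i, j, i) :: nat \<times> nat \<times> nat"
  define C :: tab where "C = (\<lambda>i j. if (i, j) \<in> cells \<mu> empty_ptn then i else 0)"
  have "{(C i j, j, i) | i j. C i j \<noteq> 0} = ?f ` cells \<mu> empty_ptn"
    by (auto simp: C_def cells_def split: if_splits)
  then have L: "rev (sorted_list_of_set {(C i j, j, i) | i j. C i j \<noteq> 0}) = map ?f (rev (sorted_list_of_set (cells \<mu> empty_ptn)))"
  proof -
    have "sorted_list_of_set (?f ` cells \<mu> empty_ptn) = map ?f (sorted_list_of_set (cells \<mu> empty_ptn))"
      by (rule sorted_list_of_set_map[OF fin]) auto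
    then show ?thesis using \<open>_ = ?f ` cells \<mu> empty_ptn\<close> by (simp add: rev_map)
  qed
  have "fst (fold switch_step (map ?f xs) (A, B)) = fold (\<lambda>(i, j) A. fst (slide (A, i, j))) xs A"
    for xs A B
  proof (induction xs arbitrary: A B)
    case (Cons x xs)
    obtain i j where x: "x = (i, j)" by force
    obtain A' i' j' where s: "slide (A, i, j) = (A', i', j')" by (metis prod_cases3)
    show ?case using Cons[of A' "upd B i' j' i"] by (simp add: x s switch_step_def)
  qed simp
  from this[of "rev (sorted_list_of_set (cells \<mu> empty_ptn))" A "\<lambda>_ _. 0"]
  have "fst (fold switch_step (rev (sorted_list_of_set {(C i j, j, i) | i j. C i j \<noteq> 0})) (A, \<lambda>_ _. 0)) =
    fold (\<lambda>(i, j) A. fst (slide (A, i, j))) (rev (sorted_list_of_set (cells \<mu> empty_ptn))) A"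
    unfolding L .
  then show ?thesis
    unfolding Can_def C_def[symmetric] switch_eq by (simp add: rectify_def case_prod_beta Let_def)
qed

lemma partition_chain:
  assumes "chain M n L D" "j \<le> L" "\<And>i. 1 \<le> i \<Longrightarrow> \<mu> i = D j i"
  shows "is_partition \<mu>"
proof -
  have "{i. 1 \<le> i \<and> \<mu> i \<noteq> 0} \<subseteq> {..n}" using assms(3) chain_rows[OF assms(1,2)] by (fastforce simp: not_less)
  then have "finite {i. 1 \<le> i \<and> \<mu> i \<noteq> 0}" by (rule finite_subset) simp
  moreover have "\<mu> (Suc i) \<le> \<mu> i" if "1 \<le> i" for i
    using chain_dec[OF assms(1,2), of i] assms(3)[of i] assms(3)[of "Suc i"] that by simp
  ultimately show ?thesis by (simp add: is_partition_def)
qed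

lemma plen_le_chain:
  assumes "chain M n L D" "j \<le> L" "\<And>i. 1 \<le> i \<Longrightarrow> \<mu> i = D j i"
  shows "plen \<mu> \<le> n"
proof (rule ccontr)
  assume "\<not> plen \<mu> \<le> n"
  then have p: "n < plen \<mu>" "1 \<le> plen \<mu>" by simp_all
  have "\<mu> (plen \<mu>) \<noteq> 0" using plen_iff[OF partition_chain[OF assms] p(2)] by simp
  moreover have "\<mu> (plen \<mu>) = 0" using assms(3)[OF p(2)] chain_rows[OF assms(1,2) p(1)] by simp
  ultimately show False by simp
qed

lemma rectify_tab_of:
  assumes G: "chain M n k G" and \<mu>: "\<And>i. 1 \<le> i \<Longrightarrow> \<mu> i = G 0 i"
  shows "rectify (\<mu>, tab_of k G) = (empty_ptn, tab_of k (jdt n k M G))"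
proof -
  have "is_partition \<mu>" by (rule partition_chain[OF G, of 0]) (use \<mu> in auto)
  then show ?thesis using rectify_switch_Can switch_Can[OF G \<mu>] by simp
qed

section \<open>Rotation, evacuation and reversal of chains\<close>

definition rot :: "nat \<Rightarrow> nat \<Rightarrow> nat \<Rightarrow> (nat \<Rightarrow> ptn) \<Rightarrow> nat \<Rightarrow> ptn" where
  "rot N p k G j i = (if i = 0 then N else if i \<le> p then N - G (k - j) (p + 1 - i) else 0)"

lemma chain_rot:
  assumes G: "chain M n k G" and p: "p \<le> n" and N: "\<And>j i. 1 \<le> i \<Longrightarrow> j \<le> k \<Longrightarrow> G j i \<le> N"
  shows "chain N p k (rot N p k G)"
  unfolding chain_def
proof (intro conjI allI impI)
  fix j i assume j: "j \<le> k"
  show "rot N p k G j (Suc i) \<le> rot N p k G j i"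
    using chain_dec[OF G, of "k - j" "p - i"] j by (auto simp: rot_def Suc_diff_le intro!: diff_le_mono2)
next
  fix j assume j: "j < k"
  then have e: "k - j = Suc (k - Suc j)" by simp
  have I: "interlace (G (k - Suc j)) (G (k - j))" using chain_interlace[OF G, of "k - Suc j"] j e by simp
  show "interlace (rot N p k G j) (rot N p k G (Suc j))"
    unfolding interlace_def
  proof (intro allI conjI)
    fix i
    show "rot N p k G j i \<le> rot N p k G (Suc j) i"
      using interlaceD(1)[OF I, of "p + 1 - i"] by (auto simp: rot_def intro!: diff_le_mono2)
    show "rot N p k G (Suc j) (Suc i) \<le> rot N p k G j i"
      using interlaceD(2)[OF I, of "p - i"] by (auto simp: rot_def Suc_diff_le intro!: diff_le_mono2)
  qed
qed (auto simp: rot_def)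

text \<open>Replacing r + 1 by k - r reverses the order of the shapes, and rotation complements each
  of them. The inner shape computed by \<open>rotate_tab\<close> is 0 at row 0, where the chain has
  its bound; hence the case distinction.\<close>

lemma rotate_tab_of:
  assumes G: "chain M n k G" and 0: "\<And>i. 1 \<le> i \<Longrightarrow> G 0 i = 0" and p: "p = plen (G k)"
  shows "rotate_tab k (empty_ptn, tab_of k G) =
     (\<lambda>i. if i = 0 then 0 else rot (G k 1) p k G 0 i, tab_of k (rot (G k 1) p k G))"
proof -
  let ?N = "G k 1" and ?R = "rot (G k 1) p k G"
  have out: "outer (empty_ptn, tab_of k G) i = G k i" if "1 \<le> i" for i
    by (rule outer_tab_of[OF G that]) (use 0 that in \<open>simp add: empty_ptn_def\<close>)
  have pl: "plen (outer (empty_ptn, tab_of k G)) = p"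
  proof -
    have "{i. 1 \<le> i \<and> outer (empty_ptn, tab_of k G) i \<noteq> 0} = {i. 1 \<le> i \<and> G k i \<noteq> 0}" using out by auto
    then show ?thesis unfolding p plen_def by (simp only:)
  qed
  have pn: "p \<le> n" using plen_le_chain[OF G, of k "G k"] p by simp
  have N: "G j i \<le> ?N" if "1 \<le> i" "j \<le> k" for i j
    using chain_antimono[OF G that(2), of 1 i] chain_mono[OF G that(2), of 1] that by simp
  have R: "chain ?N p k ?R" by (rule chain_rot[OF G pn]) (use N in auto)
  have t: "(if 1 \<le> i \<and> i \<le> p \<and> 1 \<le> j \<and> j \<le> ?N \<and> tab_of k G (p + 1 - i) (?N + 1 - j) \<noteq> 0
            then k + 1 - tab_of k G (p + 1 - i) (?N + 1 - j) else 0) = tab_of k ?R i j" for i j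
  proof (cases "1 \<le> i \<and> i \<le> p \<and> 1 \<le> j \<and> j \<le> ?N")
    case True
    define i' where "i' = p + 1 - i"
    have i': "1 \<le> i'" using True by (auto simp: i'_def)
    have Rj: "?R r i = ?N - G (k - r) i'" for r using True by (simp add: rot_def i'_def)
    show ?thesis
    proof (cases "tab_of k G i' (?N + 1 - j)")
      case 0
      then have "?N + 1 - j > G k i'" using tab_of_eq_0[of k G i' "?N + 1 - j"] True i' assms(2)[of i'] by auto
      then have "tab_of k ?R i j = 0" using tab_of_eq_0[of k ?R i j] Rj[of 0] True by auto
      then show ?thesis using 0 by (simp add: i'_def)
    next
      case (Suc r)
      then have *: "r < k" "G r i' < ?N + 1 - j" "?N + 1 - j \<le> G (Suc r) i'" using tab_of_eq_Suc[OF G] by auto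
      define q where "q = k - Suc r"
      have q: "k - q = Suc r" "k - Suc q = r" "q < k" using * by (auto simp: q_def)
      have "?R q i < j" "j \<le> ?R (Suc q) i"
        using * True N[OF i', of "Suc r"] unfolding Rj q by linarith+
      then have "tab_of k ?R i j = Suc q"
        using tab_of_eq_Suc[OF R, of i j q] q True by simp
      then show ?thesis using Suc True q by (simp add: i'_def)
    qed
  next
    case False
    then have "tab_of k ?R i j = 0" using tab_of_eq_0[of k ?R i j] chain_rows[OF R, of k i]
      by (auto simp: rot_def)
    then show ?thesis using False by auto
  qed
  have s: "(if 1 \<le> i \<and> i \<le> p then ?N - outer (empty_ptn, tab_of k G) (p + 1 - i) else 0) =
     (if i = 0 then 0 else ?R 0 i)" for i
    using out[of "p + 1 - i"] by (auto simp: rot_def)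
  have o1: "outer (empty_ptn, tab_of k G) 1 = ?N" using out[of 1] by simp
  show ?thesis
    unfolding rotate_tab_def prod.case Let_def pl o1 s t ..
qed

definition evac :: "nat \<Rightarrow> (nat \<Rightarrow> ptn) \<Rightarrow> nat \<Rightarrow> ptn" where
  "evac k G = (let N = G k 1; p = plen (G k) in jdt p k N (rot N p k G))"

text \<open>The inner shape of \<open>G\<close> is empty, so the rotated tableau has a rectangle as
  its outer shape. Then \<open>grid_rectangle\<close> gives the shape of the rectification, and
  complementing twice returns the shape of \<open>G\<close>. The number of rows and the bound of the
  new chain are the dimensions of that rectangle.\<close>

theorem xi_tab_of:
  assumes G: "chain M n k G" and 0: "\<And>i. 1 \<le> i \<Longrightarrow> G 0 i = 0"
  shows "xi k (empty_ptn, tab_of k G) = (empty_ptn, tab_of k (evac k G))"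
    "chain (G k 1) (plen (G k)) k (evac k G)" "\<And>i. 1 \<le> i \<Longrightarrow> evac k G 0 i = 0"
    "\<And>i. 1 \<le> i \<Longrightarrow> evac k G k i = G k i"
proof -
  define p N where "p = plen (G k)" and "N = G k 1"
  let ?R = "rot N p k G"
  have pn: "p \<le> n" using plen_le_chain[OF G, of k "G k"] p_def by simp
  have N: "G j i \<le> N" if "1 \<le> i" "j \<le> k" for i j
    using chain_antimono[OF G that(2), of 1 i] chain_mono[OF G that(2), of 1] that N_def by simp
  have R: "chain N p k ?R" by (rule chain_rot[OF G pn]) (use N in auto)
  have E: "evac k G = jdt p k N ?R" by (simp add: evac_def Let_def p_def N_def)
  show "xi k (empty_ptn, tab_of k G) = (empty_ptn, tab_of k (evac k G))"
  proof -
    have "rotate_tab k (empty_ptn, tab_of k G) = (\<lambda>i. if i = 0 then 0 else ?R 0 i, tab_of k ?R)"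
      unfolding N_def by (rule rotate_tab_of[OF G 0 p_def])
    then show ?thesis unfolding xi_def E by (simp only:) (rule rectify_tab_of[OF R], simp)
  qed
  have J: "chain N p (p + k) (evac k G)" unfolding E by (rule jdt_chain(1)[OF R])
  then show "chain (G k 1) (plen (G k)) k (evac k G)"
    using chain_part[OF J, of 0 k] by (simp add: p_def N_def)
  show "evac k G 0 i = 0" if "1 \<le> i" for i unfolding E by (rule jdt_chain(2)[OF R that])
  show "evac k G k i = G k i" if i: "1 \<le> i" for i
  proof (cases "i \<le> p")
    case True
    have "grid p (prepend_canon p N ?R) p k i = N - prepend_canon p N ?R p (p + 1 - i)"
    proof (rule grid_rectangle[OF chain_prepend_canon[OF R]])
      show "prepend_canon p N ?R j i = (if i \<le> j then prepend_canon p N ?R p i else 0)" if "j \<le> p" "1 \<le> i" for j i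
        using prepend_canon_at[OF R, of j] prepend_canon_at[OF R, of p] that by (auto simp: canon_def)
      show "prepend_canon p N ?R (p + k) i = N" if "1 \<le> i" "i \<le> p" for i
        using 0[of "p + 1 - i"] that by (simp add: prepend_canon_def rot_def)
    qed (use True i in auto)
    also have "\<dots> = G k i"
      using True i N[of i k] diff_le_self[of p "i - 1"] prepend_canon_at[OF R, of p] by (simp add: canon_def rot_def)
    finally show ?thesis unfolding E jdt_def using switches_final(1)[of k k p] by simp
  next
    case False
    then have "G k i = 0" using plen_iff[OF partition_chain[OF G, of k "G k"] i] p_def by simp
    moreover have "evac k G k i = 0" using chain_rows[OF J, of k i] False by simp
    ultimately show ?thesis by simp
  qed
qed

text \<open>Evacuation takes place in the bounding rectangle; to be continued by another chain, its
  result has to be given the same bound and number of rows.\<close>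

lemma chain_widen:
  assumes X: "chain N p k X" and "N \<le> M" "p \<le> n"
  shows "chain M n k (\<lambda>j i. if i = 0 then M else X j i)"
  unfolding chain_def
proof (intro conjI allI impI)
  fix j i assume j: "j \<le> k"
  show "(if Suc i = 0 then M else X j (Suc i)) \<le> (if i = 0 then M else X j i)"
    using chain_dec[OF X j, of i] chain_le[OF X j, of "Suc i"] assms(2) by auto
  show "(if i = 0 then M else X j i) = 0" if "n < i" using chain_rows[OF X j, of i] assms(3) that by auto
next
  fix j assume j: "j < k"
  note I = chain_interlace[OF X j]
  show "interlace (\<lambda>i. if i = 0 then M else X j i) (\<lambda>i. if i = 0 then M else X (Suc j) i)"
    unfolding interlace_def using interlaceD[OF I] chain_le[OF X, of "Suc j"] j assms(2)
    by (auto intro: le_trans)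
qed simp

text \<open>The evacuated tableau and the displaced canonical one fit together because evacuation
  keeps the shape, and the second switch acts on this joint chain. A chain determines the inner
  shape of the result only from row 1 on, hence the existential quantifier.\<close>

theorem reversal_tab_of:
  assumes G: "chain M n k G" and \<mu>: "\<And>i. 1 \<le> i \<Longrightarrow> \<mu> i = G 0 i"
  defines "S \<equiv> jdt n k M G"
  defines "D \<equiv> \<lambda>j i. if j < k then (if i = 0 then M else evac k S j i) else S j i"
  shows "chain M n (k + n) D" "\<exists>\<mu>'. (\<forall>i\<ge>1. \<mu>' i = switches k n k D n i) \<and>
     reversal k (\<mu>, tab_of k G) = (\<mu>', tab_of k (\<lambda>x. switches k n k D (n + x)))"
proof -
  have S: "chain M n (k + n) S" unfolding S_def using jdt_chain(1)[OF G] by (simp add: add.commute)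
  have Sk: "chain M n k S" using chain_part[OF S, of 0 k] by simp
  have S0: "S 0 i = 0" if "1 \<le> i" for i unfolding S_def by (rule jdt_chain(2)[OF G that])
  note X = xi_tab_of[OF Sk S0]
  have pn: "plen (S k) \<le> n" using plen_le_chain[OF Sk, of k "S k"] by simp
  have W: "chain M n k (\<lambda>j i. if i = 0 then M else evac k S j i)"
    by (rule chain_widen[OF X(2) _ pn]) (use chain_le[OF Sk] in auto)
  have at_k: "(\<lambda>i. if i = 0 then M else evac k S k i) = S k"
    using X(4) chain_row0[OF Sk, of k] by (auto simp: fun_eq_iff)
  have Dle: "D j = (\<lambda>i. if i = 0 then M else evac k S j i)" if "j \<le> k" for j
    using that at_k by (cases "j = k") (auto simp: D_def)
  have Dge: "D j = S j" if "k \<le> j" for j using that by (simp add: D_def)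
  show C: "chain M n (k + n) D"
    unfolding chain_def
  proof (intro conjI allI impI)
    fix j i assume j: "j \<le> k + n"
    show "D j 0 = M" using chain_row0[OF S j] by (simp add: D_def)
    show "D j i = 0" if "n < i" using chain_rows[OF S j that] chain_rows[OF W _ that, of j] that by (auto simp: D_def)
    show "D j (Suc i) \<le> D j i" using chain_dec[OF S j, of i] chain_dec[OF W, of j i] by (auto simp: D_def)
  next
    fix j assume j: "j < k + n"
    show "interlace (D j) (D (Suc j))"
      using chain_interlace[OF S j] chain_interlace[OF W, of j] Dle[of j] Dle[of "Suc j"] Dge[of j] Dge[of "Suc j"]
      by (cases "j < k") auto
  qed
  have 1: "switch (Can \<mu>) (\<mu>, tab_of k G) = ((empty_ptn, tab_of k S), (outer (empty_ptn, tab_of k S), tab_of n (\<lambda>x. S (k + x))))"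
    unfolding S_def by (rule switch_Can[OF G \<mu>])
  have 2: "tab_of k (evac k S) = tab_of k D" by (rule tab_of_cong') (simp add: Dle)
  have 3: "tab_of n (\<lambda>x. S (k + x)) = tab_of n (\<lambda>x. D (k + x))" by (simp add: Dge)
  let ?T = "switches k n k D"
  have 4: "tab_of n (grid k D k) = tab_of n ?T" "tab_of k (\<lambda>x. grid k D (k - x) n) = tab_of k (\<lambda>x. ?T (n + x))"
    by (rule tab_of_cong', simp add: switches_final)+
  have T: "chain M n (k + n) ?T" using chain_switches[OF C order_refl] by simp
  have T0: "?T 0 i = 0" if "1 \<le> i" for i
  proof -
    have "?T 0 = D 0" using switches_grid(1)[of k k 0 n D] by simp
    then show ?thesis using Dle[of 0] X(3) that by simp
  qed
  have "outer (empty_ptn, tab_of n ?T) i = ?T n i" if "1 \<le> i" for i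
    using outer_tab_of[OF chain_part[OF T, of 0 n, simplified] that, of empty_ptn] T0[OF that]
    by (simp add: empty_ptn_def)
  moreover have "reversal k (\<mu>, tab_of k G) = (outer (empty_ptn, tab_of n ?T), tab_of k (\<lambda>x. ?T (n + x)))"
    unfolding reversal_def using 1 X(1) switch_tab_of[OF C, of empty_ptn "outer (empty_ptn, tab_of k S)"] 2 3 4
    by simp
  ultimately show "\<exists>\<mu>'. (\<forall>i\<ge>1. \<mu>' i = ?T n i) \<and>
     reversal k (\<mu>, tab_of k G) = (\<mu>', tab_of k (\<lambda>x. ?T (n + x)))" by blast
qed

theorem littlewood_robinson_tab_of:
  assumes G: "chain M n k G" and \<mu>: "\<And>i. 1 \<le> i \<Longrightarrow> \<mu> i = G 0 i"
  defines "S \<equiv> jdt n k M G"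
  defines "T \<equiv> jdt n n M (\<lambda>x. S (k + x))"
  shows "chain M n n (\<lambda>x. S (k + x))"
    "littlewood_robinson (\<mu>, tab_of k G) =
      ((empty_ptn, tab_of k S), (outer (empty_ptn, tab_of n T), tab_of n (\<lambda>x. T (n + x))))"
    "\<And>i. 1 \<le> i \<Longrightarrow> outer (empty_ptn, tab_of k S) i = S k i"
proof -
  have S: "chain M n (k + n) S" unfolding S_def using jdt_chain(1)[OF G] by (simp add: add.commute)
  show C: "chain M n n (\<lambda>x. S (k + x))" by (rule chain_part[OF S]) simp
  show o: "outer (empty_ptn, tab_of k S) i = S k i" if "1 \<le> i" for i
    using outer_tab_of[OF chain_part[OF S, of 0 k, simplified] that, of empty_ptn] jdt_chain(2)[OF G that]
    by (simp add: empty_ptn_def S_def)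
  have 1: "switch (Can \<mu>) (\<mu>, tab_of k G) =
      ((empty_ptn, tab_of k S), (outer (empty_ptn, tab_of k S), tab_of n (\<lambda>x. S (k + x))))"
    unfolding S_def by (rule switch_Can[OF G \<mu>])
  have 2: "switch (Can (outer (empty_ptn, tab_of k S))) (outer (empty_ptn, tab_of k S), tab_of n (\<lambda>x. S (k + x))) =
      ((empty_ptn, tab_of n T), (outer (empty_ptn, tab_of n T), tab_of n (\<lambda>x. T (n + x))))"
    unfolding T_def by (rule switch_Can[OF C]) (use o in simp)
  show "littlewood_robinson (\<mu>, tab_of k G) =
      ((empty_ptn, tab_of k S), (outer (empty_ptn, tab_of n T), tab_of n (\<lambda>x. T (n + x))))"
    unfolding littlewood_robinson_def by (simp add: 1 2)
qed

section \<open>Littlewood--Richardson tableaux\<close>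

definition row_word :: "ptn \<Rightarrow> ptn \<Rightarrow> tab \<Rightarrow> nat \<Rightarrow> nat list" where
  "row_word \<Lambda> \<mu> A i = map (A i) (rev [Suc (\<mu> i)..<Suc (\<Lambda> i)])"

definition rows_word :: "ptn \<Rightarrow> ptn \<Rightarrow> tab \<Rightarrow> nat \<Rightarrow> nat list" where
  "rows_word \<Lambda> \<mu> A r = concat (map (row_word \<Lambda> \<mu> A) [1..<Suc r])"

lemma word_eq_rows_word: "word \<Lambda> \<mu> A = rows_word \<Lambda> \<mu> A (plen \<Lambda>)"
  by (simp add: word_def rows_word_def row_word_def[abs_def])

lemma rows_word_Suc: "rows_word \<Lambda> \<mu> A (Suc r) = rows_word \<Lambda> \<mu> A r @ row_word \<Lambda> \<mu> A (Suc r)"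
  by (simp add: rows_word_def)

lemma rows_word_prefix: "r \<le> m \<Longrightarrow> \<exists>w. rows_word \<Lambda> \<mu> A m = rows_word \<Lambda> \<mu> A r @ w"
proof (induction m rule: dec_induct)
  case (step m)
  then show ?case by (metis append_assoc rows_word_Suc)
qed simp

lemma YT_D:
  assumes "A \<in> YT \<Lambda> \<mu> a"
  shows "A i j \<noteq> 0 \<longleftrightarrow> (i, j) \<in> cells \<Lambda> \<mu>"
    "(i, j) \<in> cells \<Lambda> \<mu> \<Longrightarrow> (i, j') \<in> cells \<Lambda> \<mu> \<Longrightarrow> j < j' \<Longrightarrow> A i j \<le> A i j'"
    "A i j \<le> length a"
    "1 \<le> r \<Longrightarrow> r \<le> length a \<Longrightarrow> card {(i, j). A i j = r} = entry a r"
proof -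
  note * = assms[unfolded YT_def mem_Collect_eq]
  show "A i j \<noteq> 0 \<longleftrightarrow> (i, j) \<in> cells \<Lambda> \<mu>" using *[THEN conjunct1] by simp
  show "A i j \<le> A i j'" if "(i, j) \<in> cells \<Lambda> \<mu>" "(i, j') \<in> cells \<Lambda> \<mu>" "j < j'"
    using *[THEN conjunct2, THEN conjunct1] that by simp
  show "A i j \<le> length a" using *[THEN conjunct2, THEN conjunct2, THEN conjunct2, THEN conjunct1] by simp
  show "card {(i, j). A i j = r} = entry a r" if "1 \<le> r" "r \<le> length a"
    using *[THEN conjunct2, THEN conjunct2, THEN conjunct2, THEN conjunct2] that by simp
qed

lemma count_row_word:
  assumes A: "A \<in> YT \<Lambda> \<mu> a" and "1 \<le> i" "1 \<le> t"
  shows "count_list (row_word \<Lambda> \<mu> A i) t = rec_mat A i t"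
proof -
  have "count_list (row_word \<Lambda> \<mu> A i) t = length (filter (\<lambda>j. A i j = t) (rev [Suc (\<mu> i)..<Suc (\<Lambda> i)]))"
    unfolding row_word_def by (induction "rev [Suc (\<mu> i)..<Suc (\<Lambda> i)]" rule: list.induct)
      (simp_all add: count_list_eq_length_filter filter_map comp_def eq_commute)
  also have "\<dots> = card (set (filter (\<lambda>j. A i j = t) (rev [Suc (\<mu> i)..<Suc (\<Lambda> i)])))"
    by (rule distinct_card[symmetric]) simp
  also have "set (filter (\<lambda>j. A i j = t) (rev [Suc (\<mu> i)..<Suc (\<Lambda> i)])) = {j. A i j = t}"
  proof (rule set_eqI)
    show "j \<in> set (filter (\<lambda>j. A i j = t) (rev [Suc (\<mu> i)..<Suc (\<Lambda> i)])) \<longleftrightarrow> j \<in> {j. A i j = t}" for j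
      using YT_D(1)[OF A, of i j] assms(2,3) by (auto simp: cells_def Suc_le_eq less_Suc_eq_le simp del: upt_Suc)
  qed
  finally show ?thesis by (simp add: rec_mat_def)
qed

lemma count_rows_word:
  assumes "A \<in> YT \<Lambda> \<mu> a" "1 \<le> t"
  shows "count_list (rows_word \<Lambda> \<mu> A r) t = (\<Sum>i=1..r. rec_mat A i t)"
proof (induction r)
  case 0
  then show ?case by (simp add: rows_word_def)
next
  case (Suc r)
  then show ?case using count_row_word[OF assms(1) _ assms(2), of "Suc r"] by (simp add: rows_word_Suc count_list_append)
qed

lemma count_takeWhile:
  "sorted_wrt (\<ge>) xs \<Longrightarrow> count_list (takeWhile (\<lambda>x. t < x) xs) (Suc t) = count_list xs (Suc t)"
proof (induction xs)
  case (Cons x xs)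
  have "count_list xs (Suc t) = 0" if "\<not> t < x"
    using Cons.prems that by (fastforce simp: count_list_0_iff)
  then show ?case using Cons by auto
qed simp

lemma count_takeWhile_0: "count_list (takeWhile (\<lambda>x. t < x) xs) t = 0"
  for t :: nat
  using set_takeWhileD[of t "\<lambda>x. t < x" xs] by (auto simp: count_list_0_iff)

lemma row_word_decreasing:
  assumes A: "A \<in> YT \<Lambda> \<mu> a" and "1 \<le> i"
  shows "sorted_wrt (\<ge>) (row_word \<Lambda> \<mu> A i)"
  unfolding row_word_def sorted_wrt_map sorted_wrt_rev
proof (rule sorted_wrt_mono_rel[OF _ sorted_wrt_upt])
  fix j j' assume "j \<in> set [Suc (\<mu> i)..<Suc (\<Lambda> i)]" "j' \<in> set [Suc (\<mu> i)..<Suc (\<Lambda> i)]" "j < j'"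
  then show "A i j' \<ge> A i j"
    using assms(2) by (intro YT_D(2)[OF A]) (auto simp: cells_def)
qed

text \<open>The reading word is cut within row r + 1, behind the letters above t. As the row is read
  from right to left, the prefix contains all its letters t + 1 and none of its letters t.\<close>

lemma LR_row_sums:
  assumes A: "A \<in> LR \<Lambda> \<mu> a" and \<Lambda>: "is_partition \<Lambda>" and t: "1 \<le> t"
  shows "(\<Sum>i=1..Suc r. rec_mat A i (Suc t)) \<le> (\<Sum>i=1..r. rec_mat A i t)"
proof -
  have Y: "A \<in> YT \<Lambda> \<mu> a" and L: "count_list (take p (word \<Lambda> \<mu> A)) (Suc t) \<le> count_list (take p (word \<Lambda> \<mu> A)) t" for p
    using A t by (auto simp: LR_def)
  have main: "(\<Sum>i=1..Suc r. rec_mat A i (Suc t)) \<le> (\<Sum>i=1..r. rec_mat A i t)" if r: "Suc r \<le> plen \<Lambda>" for r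
  proof -
    let ?w = "row_word \<Lambda> \<mu> A (Suc r)"
    let ?v = "takeWhile (\<lambda>x. t < x) ?w"
    obtain w where w: "word \<Lambda> \<mu> A = rows_word \<Lambda> \<mu> A (Suc r) @ w"
      using rows_word_prefix[OF r] by (metis word_eq_rows_word)
    obtain u where u: "?w = ?v @ u" by (metis takeWhile_dropWhile_id)
    have "word \<Lambda> \<mu> A = (rows_word \<Lambda> \<mu> A r @ ?v) @ (u @ w)"
      using w u by (simp add: rows_word_Suc)
    then have "take (length (rows_word \<Lambda> \<mu> A r @ ?v)) (word \<Lambda> \<mu> A) = rows_word \<Lambda> \<mu> A r @ ?v"
      by (metis append_eq_conv_conj)
    then have "count_list (rows_word \<Lambda> \<mu> A r @ ?v) (Suc t) \<le> count_list (rows_word \<Lambda> \<mu> A r @ ?v) t"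
      using L[of "length (rows_word \<Lambda> \<mu> A r @ ?v)"] by simp
    moreover have "count_list ?v (Suc t) = rec_mat A (Suc r) (Suc t)"
      using count_takeWhile[OF row_word_decreasing[OF Y, of "Suc r"]] count_row_word[OF Y, of "Suc r" "Suc t"] by simp
    ultimately show ?thesis
      using count_rows_word[OF Y, of t r] count_rows_word[OF Y, of "Suc t" r] t
      by (simp add: count_takeWhile_0)
  qed
  have zero: "rec_mat A i s = 0" if "plen \<Lambda> < i" "1 \<le> s" for i s
  proof -
    have "\<Lambda> i = 0" using plen_iff[OF \<Lambda>, of i] that by auto
    then have "A i j \<noteq> s" for j using YT_D(1)[OF Y, of i j] that by (auto simp: cells_def)
    then show ?thesis by (simp add: rec_mat_def)
  qed
  show ?thesis
  proof (induction r)
    case 0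
    then show ?case using main[of 0] zero[of 1 "Suc t"] by (cases "1 \<le> plen \<Lambda>") auto
  next
    case (Suc r)
    show ?case
    proof (cases "Suc (Suc r) \<le> plen \<Lambda>")
      case False
      then have "rec_mat A (Suc (Suc r)) (Suc t) = 0" using zero by simp
      then show ?thesis using Suc by simp
    qed (rule main)
  qed
qed

lemma rows_word_take: "\<exists>r q. take p (rows_word \<Lambda> \<mu> A m) = rows_word \<Lambda> \<mu> A r @ take q (row_word \<Lambda> \<mu> A (Suc r))"
proof (induction m)
  case 0
  then show ?case by (intro exI[of _ 0]) (simp add: rows_word_def)
next
  case (Suc m)
  show ?case
  proof (cases "p \<le> length (rows_word \<Lambda> \<mu> A m)")
    case True
    then show ?thesis using Suc by (simp add: rows_word_Suc)
  next
    case False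
    then show ?thesis
      by (intro exI[of _ m] exI[of _ "p - length (rows_word \<Lambda> \<mu> A m)"]) (simp add: rows_word_Suc)
  qed
qed

text \<open>A prefix ends within some row r + 1. Counting this row completely for t + 1 and not at
  all for t makes the condition stronger, and it becomes the assumed inequality.\<close>

lemma LR_I:
  assumes Y: "A \<in> YT \<Lambda> \<mu> a"
    and s: "\<And>r t. 1 \<le> t \<Longrightarrow> (\<Sum>i=1..Suc r. rec_mat A i (Suc t)) \<le> (\<Sum>i=1..r. rec_mat A i t)"
  shows "A \<in> LR \<Lambda> \<mu> a"
proof -
  have "count_list (take p (word \<Lambda> \<mu> A)) (Suc t) \<le> count_list (take p (word \<Lambda> \<mu> A)) t" if t: "1 \<le> t" for p t
  proof -
    obtain r q where w: "take p (word \<Lambda> \<mu> A) = rows_word \<Lambda> \<mu> A r @ take q (row_word \<Lambda> \<mu> A (Suc r))"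
      using rows_word_take[of p \<Lambda> \<mu> A "plen \<Lambda>"] by (auto simp: word_eq_rows_word)
    have "count_list (take p (word \<Lambda> \<mu> A)) (Suc t) \<le> (\<Sum>i=1..Suc r. rec_mat A i (Suc t))"
    proof -
      have "count_list (row_word \<Lambda> \<mu> A (Suc r)) (Suc t) = 
         count_list (take q (row_word \<Lambda> \<mu> A (Suc r))) (Suc t) + count_list (drop q (row_word \<Lambda> \<mu> A (Suc r))) (Suc t)"
        by (metis append_take_drop_id count_list_append)
      then show ?thesis using count_rows_word[OF Y, of "Suc t" r] count_row_word[OF Y, of "Suc r" "Suc t"]
        by (simp add: w count_list_append)
    qed
    also have "\<dots> \<le> (\<Sum>i=1..r. rec_mat A i t)" by (rule s[OF t])
    also have "\<dots> \<le> count_list (take p (word \<Lambda> \<mu> A)) t"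
      using count_rows_word[OF Y t, of r] by (simp add: w count_list_append)
    finally show ?thesis .
  qed
  then show ?thesis using Y by (simp add: LR_def)
qed

section \<open>From chains and recording matrices back to tableaux\<close>

lemma YT_tab_of:
  assumes G: "chain M n (length a) G"
    and c: "\<And>i j. 1 \<le> i \<Longrightarrow> \<mu> i < j \<and> j \<le> \<Lambda> i \<longleftrightarrow> G 0 i < j \<and> j \<le> G (length a) i"
    and w: "\<And>r. r < length a \<Longrightarrow> entry a (Suc r) = (\<Sum>i=1..n. G (Suc r) i - G r i)"
  shows "tab_of (length a) G \<in> YT \<Lambda> \<mu> a"
proof -
  let ?k = "length a"
  let ?A = "tab_of ?k G"
  note E = tab_of_eq_Suc[OF G]
  have nz: "?A i j \<noteq> 0 \<longleftrightarrow> (i, j) \<in> cells \<Lambda> \<mu>" for i j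
    using tab_of_eq_0[of ?k G i j] c[of i j] by (auto simp: cells_def)
  have obt: "\<exists>r. ?A i j = Suc r \<and> r < ?k \<and> G r i < j \<and> j \<le> G (Suc r) i" if "(i, j) \<in> cells \<Lambda> \<mu>" for i j
    using nz[of i j] E[of i j "?A i j - 1"] that by (intro exI[of _ "?A i j - 1"]) simp
  have row: "?A i j \<le> ?A i j'" if cell: "(i, j) \<in> cells \<Lambda> \<mu>" "(i, j') \<in> cells \<Lambda> \<mu>" "j < j'" for i j j'
  proof -
    obtain r where r1: "?A i j = Suc r" "r < ?k" "G r i < j" using obt[OF cell(1)] by blast
    obtain r' where r2: "?A i j' = Suc r'" "r' < ?k" "j' \<le> G (Suc r') i" using obt[OF cell(2)] by blast
    note r = r1 r2
    show ?thesis
    proof (rule ccontr)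
      assume "\<not> ?A i j \<le> ?A i j'"
      then show False using r that chain_mono[OF G, of "Suc r'" r i] by simp
    qed
  qed
  have col: "?A i j < ?A i' j" if cell: "(i, j) \<in> cells \<Lambda> \<mu>" "(i', j) \<in> cells \<Lambda> \<mu>" "i < i'" for i i' j
  proof -
    obtain r where r1: "?A i j = Suc r" "r < ?k" "G r i < j" using obt[OF cell(1)] by blast
    obtain r' where r2: "?A i' j = Suc r'" "r' < ?k" "j \<le> G (Suc r') i'" using obt[OF cell(2)] by blast
    note r = r1 r2
    have "G (Suc r') i' \<le> G (Suc r') (Suc i)" using chain_antimono[OF G, of "Suc r'" "Suc i" i'] r that by simp
    moreover have "G (Suc r') (Suc i) \<le> G r' i" using interlaceD(2)[OF chain_interlace[OF G r(5)], of i] .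
    ultimately have "G r i < G r' i" using r by simp
    then show ?thesis using r chain_mono[OF G, of r' r i] by (cases "r' \<le> r") auto
  qed
  have wt: "card {(i, j). ?A i j = r} = entry a r" if r: "r \<in> {1..?k}" for r
  proof -
    obtain q where q: "r = Suc q" "q < ?k" using r by (cases r) auto
    have "{(i, j). ?A i j = r} = Sigma {1..n} (\<lambda>i. {G q i<..G (Suc q) i})"
    proof (rule set_eqI)
      fix x :: "nat \<times> nat" obtain i j where x: "x = (i, j)" by force
      have "i \<le> n" if "G q i < j" "j \<le> G (Suc q) i"
        using chain_rows[OF G, of "Suc q" i] that q by (cases "i \<le> n") auto
      then show "x \<in> {(i, j). ?A i j = r} \<longleftrightarrow> x \<in> Sigma {1..n} (\<lambda>i. {G q i<..G (Suc q) i})"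
        using E[of i j q] q x by auto
    qed
    then show ?thesis using w[OF q(2)] q by (simp add: card_SigmaI)
  qed
  show ?thesis unfolding YT_def using nz row col tab_of_le[OF G] wt by auto
qed

lemma rec_mat_gt_chain:
  assumes c: "contains \<Lambda> \<mu>" and A: "A \<in> YT \<Lambda> \<mu> a" and "1 \<le> i"
  shows "gt_chain M (\<mu>, A) (Suc t) i = gt_chain M (\<mu>, A) t i + rec_mat A i (Suc t)"
proof -
  have fin: "finite {c. 1 \<le> A i c \<and> A i c \<le> t}" for t
  proof (rule finite_subset)
    show "{c. 1 \<le> A i c \<and> A i c \<le> t} \<subseteq> {..\<Lambda> i}" using YT_D(1)[OF A, of i] by (fastforce simp: cells_def)
  qed simp
  have "{c. 1 \<le> A i c \<and> A i c \<le> Suc t} = {c. 1 \<le> A i c \<and> A i c \<le> t} \<union> {c. A i c = Suc t}"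
    by (auto simp: le_Suc_eq)
  moreover have "finite {c. A i c = Suc t}" by (rule finite_subset[OF _ fin[of "Suc t"]]) auto
  ultimately have "card {c. 1 \<le> A i c \<and> A i c \<le> Suc t} = card {c. 1 \<le> A i c \<and> A i c \<le> t} + card {c. A i c = Suc t}"
    using fin[of t] by (simp add: card_Un_disjoint disjoint_iff)
  then show ?thesis using assms(3) by (simp add: gt_chain_def rec_mat_def)
qed

lemma gt_chain_sum:
  assumes c: "contains \<Lambda> \<mu>" and A: "A \<in> YT \<Lambda> \<mu> a" and i: "1 \<le> i"
  shows "gt_chain M (\<mu>, A) t i = \<mu> i + (\<Sum>q=1..t. rec_mat A i q)"
proof (induction t)
  case 0
  have "card {c. 1 \<le> A i c \<and> A i c \<le> 0} = 0" by (simp add: card_eq_0_iff)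
  then show ?case using i by (simp add: gt_chain_def)
next
  case (Suc t)
  then show ?case using rec_mat_gt_chain[OF assms] by simp
qed

text \<open>A variant of \<open>card_tab_of\<close> that assumes monotonicity in the letter only: in
  the proof that \<open>tau\<close> is injective, its images are not known to come from
  chains.\<close>

lemma card_tab_of_mono:
  assumes "\<And>j j'. j \<le> j' \<Longrightarrow> j' \<le> k \<Longrightarrow> G j i \<le> G j' i" and "j \<le> k" "1 \<le> i"
  shows "{c. 1 \<le> tab_of k G i c \<and> tab_of k G i c \<le> j} = {G 0 i<..G j i}"
proof (rule set_eqI)
  fix c
  show "c \<in> {c. 1 \<le> tab_of k G i c \<and> tab_of k G i c \<le> j} \<longleftrightarrow> c \<in> {G 0 i<..G j i}"
  proof (cases "G 0 i < c \<and> c \<le> G k i")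
    case True
    then have t: "tab_of k G i c = (LEAST r. c \<le> G r i)" using assms(3) by (simp add: tab_of_def)
    have nz: "1 \<le> tab_of k G i c" using tab_of_eq_0[of k G i c] True assms(3) by simp
    have l: "c \<le> G (LEAST r. c \<le> G r i) i" by (rule LeastI[of _ k]) (use True in simp)
    have "tab_of k G i c \<le> j \<longleftrightarrow> c \<le> G j i"
    proof
      assume "tab_of k G i c \<le> j"
      then show "c \<le> G j i" using l assms(1)[OF _ assms(2)] le_trans unfolding t by blast
    next
      assume "c \<le> G j i"
      then show "tab_of k G i c \<le> j" unfolding t by (rule Least_le)
    qed
    then show ?thesis using nz True by simp
  next
    case False
    then show ?thesis using tab_of_eq_0[of k G i c] assms(1)[OF assms(2) order_refl] assms(2) by auto
  qed
qed

lemma filling_tab_of: "filling empty_ptn l d = tab_of l (\<lambda>r i. \<Sum>q=1..r. d i q)"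
  by (auto simp: filling_def tab_of_def empty_ptn_def fun_eq_iff)

text \<open>The differences of the Gelfand--Tsetlin array of \<open>tau B\<close> are the entries of
  the recording matrix of \<open>B\<close>, and these determine \<open>B\<close> within its shape.
  Injectivity ensures that the inverse chosen in \<open>rho2\<close> is the tableau constructed
  later.\<close>

lemma tau_inj:
  assumes c: "contains \<Lambda> \<mu>" and B: "B \<in> YT \<Lambda> \<mu> a" "B' \<in> YT \<Lambda> \<mu> a" and e: "tau (plen \<Lambda>) B = tau (plen \<Lambda>) B'"
  shows "B = B'"
proof -
  let ?n = "plen \<Lambda>"
  let ?Y = "\<lambda>B r i. \<Sum>q=1..r. rec_mat B q i"
  have eq: "tab_of ?n (?Y B) = tab_of ?n (?Y B')"
    using e by (simp add: tau_def filling_tab_of)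
  have Y: "?Y B r i = ?Y B' r i" if "r \<le> ?n" "1 \<le> i" for r i
  proof -
    have "{c. 1 \<le> tab_of ?n (?Y C) i c \<and> tab_of ?n (?Y C) i c \<le> r} = {?Y C 0 i<..?Y C r i}" for C
      by (rule card_tab_of_mono) (use that in \<open>auto intro!: sum_mono2\<close>)
    from this[of B] this[of B'] have "{?Y B 0 i<..?Y B r i} = {?Y B' 0 i<..?Y B' r i}" unfolding eq by simp
    then have "card {?Y B 0 i<..?Y B r i} = card {?Y B' 0 i<..?Y B' r i}" by simp
    then show ?thesis by simp
  qed
  have r: "rec_mat B i q = rec_mat B' i q" if "1 \<le> i" "1 \<le> q" for i q
  proof (cases "i \<le> ?n")
    case True
    have "(\<Sum>j=1..i. rec_mat C j q) = (\<Sum>j=1..i - 1. rec_mat C j q) + rec_mat C i q" for C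
      using \<open>1 \<le> i\<close> by (cases i) auto
    then show ?thesis using Y[of i q] Y[of "i - 1" q] True that by simp
  next
    case False
    then have "\<Lambda> i = 0" using plen_iff[of \<Lambda> i] c that by (auto simp: contains_def)
    then have "C \<in> YT \<Lambda> \<mu> a \<Longrightarrow> C i j \<noteq> q" for C j using YT_D(1)[of C \<Lambda> \<mu> a i j] that by (auto simp: cells_def)
    then show ?thesis using B by (simp add: rec_mat_def)
  qed
  have "B = tab_of (length a) (gt_chain (\<Lambda> 1) (\<mu>, B))" by (rule YT_chain(2)[OF c B(1)]) auto
  also have "\<dots> = tab_of (length a) (gt_chain (\<Lambda> 1) (\<mu>, B'))"
  proof (rule tab_of_cong')
    fix t i :: nat assume "1 \<le> i"
    then show "gt_chain (\<Lambda> 1) (\<mu>, B) t i = gt_chain (\<Lambda> 1) (\<mu>, B') t i"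
      using r unfolding gt_chain_sum[OF c B(1) \<open>1 \<le> i\<close>] gt_chain_sum[OF c B(2) \<open>1 \<le> i\<close>] by simp
  qed
  also have "\<dots> = B'" by (rule YT_chain(2)[OF c B(2), symmetric]) auto
  finally show ?thesis .
qed


section \<open>The second fundamental symmetry map\<close>

lemma plen_cong: "(\<And>i. 1 \<le> i \<Longrightarrow> \<mu> i = \<nu> i) \<Longrightarrow> plen \<mu> = plen \<nu>"
  unfolding plen_def by (metis (mono_tags, lifting) Collect_cong)

locale LR_tableau =
  fixes \<Lambda> \<mu> :: ptn and \<nu> :: "nat list" and A :: tab
  assumes con: "contains \<Lambda> \<mu>" and \<nu>_part: "is_partition (entry \<nu>)" and LR: "A \<in> LR \<Lambda> \<mu> \<nu>"
begin

definition n where "n = plen \<Lambda>"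
definition p where "p = plen \<mu>"
definition M where "M = \<Lambda> 1"
definition G where "G = gt_chain M (\<mu>, A)"

text \<open>The partial sums of the recording matrix that defines \<open>gamma\<close> telescope to
  this: apart from row 0, shape j is shape n - j of \<open>A\<close> with its first n - j rows
  removed.\<close>

definition Gam :: "nat \<Rightarrow> ptn" where
  "Gam j i = (if i = 0 then M else G (n - j) (n - j + i))"

definition X where "X = evac n Gam"

lemma YT: "A \<in> YT \<Lambda> \<mu> \<nu>" using LR by (simp add: LR_def)

lemma parts: "is_partition \<Lambda>" "is_partition \<mu>" using con by (auto simp: contains_def)

lemma G_chain: "chain M n (length \<nu>) G"
  and G_0: "1 \<le> i \<Longrightarrow> G 0 i = \<mu> i"
  and G_top: "1 \<le> i \<Longrightarrow> G (length \<nu>) i = \<Lambda> i"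
  and A_eq: "A = tab_of (length \<nu>) G"
  using YT_chain[OF con YT, of M n] by (auto simp: M_def n_def G_def)

lemma G_rec: "1 \<le> i \<Longrightarrow> G (Suc t) i = G t i + rec_mat A i (Suc t)"
  unfolding G_def by (rule rec_mat_gt_chain[OF con YT])

lemma G_row0 [simp]: "G t 0 = M" by (simp add: G_def gt_chain_def)

text \<open>\<open>Gam\<close> refers to shapes up to number n, which may exceed the number of
  letters; from the last letter on the shapes are constant.\<close>

lemma G_ge: assumes "length \<nu> \<le> t" shows "G t i = G (length \<nu>) i"
proof -
  have "A i c \<le> t" for c using YT_D(3)[OF YT, of i c] assms by simp
  then have "{c. 1 \<le> A i c \<and> A i c \<le> t} = {c. 1 \<le> A i c \<and> A i c \<le> length \<nu>}"
    using YT_D(3)[OF YT, of i] by auto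
  then show ?thesis by (simp only: G_def gt_chain_def prod.case)
qed

lemma G_interlace: "interlace (G t) (G (Suc t))"
proof (cases "t < length \<nu>")
  case True
  then show ?thesis by (rule chain_interlace[OF G_chain])
next
  case False
  have "G t = G (length \<nu>)" "G (Suc t) = G (length \<nu>)" by (rule ext, rule G_ge, use False in simp)+
  then show ?thesis using chain_dec[OF G_chain order_refl] by (simp add: interlace_def)
qed

lemma G_rows: "n < i \<Longrightarrow> G t i = 0"
  using chain_rows[OF G_chain, of "min t (length \<nu>)" i] G_ge[of t i] by (cases "t \<le> length \<nu>") auto

lemma eps_G: "eps_le 0 (G t) (G (Suc t)) (G (Suc (Suc t)))"
  unfolding eps_le_def
proof
  fix r
  have "(\<Sum>i=1..Suc r. rec_mat A i (Suc (Suc t))) \<le> (\<Sum>i=1..r. rec_mat A i (Suc t))"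
    by (rule LR_row_sums[OF LR parts(1)]) simp
  then have "int (\<Sum>i=1..Suc r. rec_mat A i (Suc (Suc t))) \<le> int (\<Sum>i=1..r. rec_mat A i (Suc t))"
    by (simp only: of_nat_le_iff)
  moreover have "(\<Sum>s=1..r. int (G (Suc t) s) - int (G t s)) = int (\<Sum>i=1..r. rec_mat A i (Suc t))" for r t
    unfolding of_nat_sum by (rule sum.cong) (use G_rec in auto)
  ultimately show "(\<Sum>s=1..Suc r. int (G (Suc (Suc t)) s) - int (G (Suc t) s)) - (\<Sum>s=1..r. int (G (Suc t) s) - int (G t s)) \<le> 0"
    by (simp only:)
qed

text \<open>Rows of a Littlewood--Richardson tableau only contain letters up to their index.\<close>

lemma G_diag: assumes "1 \<le> s" "s \<le> t" shows "G t s = \<Lambda> s"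
proof -
  have z: "(\<Sum>i=1..t. rec_mat A i (Suc t)) = 0" for t
  proof (induction t)
    case (Suc t)
    then show ?case using LR_row_sums[OF LR parts(1), of "Suc t" t] by simp
  qed simp
  have "G (t + d) s = G t s" for d
  proof (induction d)
    case (Suc d)
    have "rec_mat A s (Suc (t + d)) = 0" using z[of "t + d"] assms by simp
    then show ?case using Suc G_rec[of s "t + d"] assms by simp
  qed simp
  from this[of "length \<nu>"] show ?thesis using G_ge[of "t + length \<nu>" s] G_top[OF assms(1)] by simp
qed

definition H :: "nat \<Rightarrow> nat \<Rightarrow> int" where
  "H t b = (\<Sum>u=1..b. int (G t u))"

lemma H_Suc: "H t (Suc b) = H t b + int (G t (Suc b))" by (simp add: H_def)

lemma H_const: "(\<And>u. b < u \<Longrightarrow> G t u = 0) \<Longrightarrow> H t (b + d) = H t b"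
  by (induction d) (auto simp: H_Suc)

lemma entry_tot: "int (entry \<nu> (Suc t)) = H (Suc t) n - H t n"
proof -
  have "H (Suc t) n - H t n = (\<Sum>u=1..n. int (rec_mat A u (Suc t)))"
    unfolding H_def sum_subtractf[symmetric] by (rule sum.cong) (use G_rec in auto)
  also have "\<dots> = int (\<Sum>u=1..n. rec_mat A u (Suc t))" by simp
  also have "(\<Sum>u=1..n. rec_mat A u (Suc t)) = entry \<nu> (Suc t)"
  proof (cases "Suc t \<le> length \<nu>")
    case True
    have "{(i, j). A i j = Suc t} = Sigma {1..n} (\<lambda>i. {j. A i j = Suc t})"
    proof (rule set_eqI)
      fix x :: "nat \<times> nat" obtain i j where x: "x = (i, j)" by force
      have "1 \<le> i \<and> i \<le> n" if "A i j = Suc t"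
      proof -
        have c: "1 \<le> i" "j \<le> \<Lambda> i" "0 < j" using YT_D(1)[OF YT, of i j] that by (auto simp: cells_def)
        then show ?thesis using plen_iff[OF parts(1), of i] by (auto simp: n_def)
      qed
      then show "x \<in> {(i, j). A i j = Suc t} \<longleftrightarrow> x \<in> Sigma {1..n} (\<lambda>i. {j. A i j = Suc t})" using x by auto
    qed
    moreover have "finite {j. A i j = Suc t}" for i
    proof (rule finite_subset)
      show "{j. A i j = Suc t} \<subseteq> {..\<Lambda> i}" using YT_D(1)[OF YT, of i] by (fastforce simp: cells_def)
    qed simp
    ultimately show ?thesis using YT_D(4)[OF YT, of "Suc t"] True by (simp add: rec_mat_def card_SigmaI)
  next
    case False
    have "A i j \<noteq> Suc t" for i j using YT_D(3)[OF YT, of i j] False by auto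
    then show ?thesis using False by (simp add: rec_mat_def entry_def)
  qed
  finally show ?thesis by simp
qed

text \<open>Removing as many rows as the number of the shape exchanges the two interlacing
  inequalities of \<open>G\<close>.\<close>

lemma Gam_chain: "chain M n n Gam"
  unfolding chain_def
proof (intro conjI allI impI)
  fix j i assume j: "j \<le> n"
  show "Gam j 0 = M" by (simp add: Gam_def)
  show "Gam j i = 0" if "n < i" using G_rows[of "n - j + i" "n - j"] that by (simp add: Gam_def)
  have "G t (Suc i) \<le> G t i" for t i
    using interlaceD(2)[OF G_interlace, of t i] interlaceD(1)[OF G_interlace, of t "Suc i"] by simp
  then have dec: "i \<le> i' \<Longrightarrow> G t i' \<le> G t i" for t i i' by (rule lift_Suc_antimono_le)
  show "Gam j (Suc i) \<le> Gam j i"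
    using dec[of "n - j + i" "n - j + Suc i" "n - j"] dec[of 0 "n - j + 1" "n - j"] by (simp add: Gam_def)
next
  fix j assume j: "j < n"
  define t where "t = n - Suc j"
  have t: "n - j = Suc t" "n - Suc j = t" using j by (auto simp: t_def)
  note I = interlaceD[OF G_interlace[of t]]
  have "G t (Suc i) \<le> G t i" for i using I(1)[of "Suc i"] I(2)[of i] by simp
  then have dec: "i \<le> i' \<Longrightarrow> G t i' \<le> G t i" for i i' by (rule lift_Suc_antimono_le)
  show "interlace (Gam j) (Gam (Suc j))"
    unfolding interlace_def Gam_def t
  proof (intro allI conjI)
    fix i
    show "(if i = 0 then M else G (Suc t) (Suc t + i)) \<le> (if i = 0 then M else G t (t + i))"
      using I(2)[of "t + i"] by simp
    show "(if Suc i = 0 then M else G t (t + Suc i)) \<le> (if i = 0 then M else G (Suc t) (Suc t + i))"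
      using I(1)[of "t + Suc i"] dec[of 0 "t + 1"] by simp
  qed
qed

lemma Gam_0: "1 \<le> i \<Longrightarrow> Gam 0 i = 0"
  using G_rows[of "n + i" n] by (simp add: Gam_def)

lemma Gam_n: "1 \<le> i \<Longrightarrow> Gam n i = \<mu> i"
  using G_0 by (simp add: Gam_def)

lemma p_le_n: "p \<le> n"
  using plen_le_chain[OF G_chain, of 0 \<mu>] G_0 by (simp add: p_def)

lemma plen_Gam: "plen (Gam n) = p"
  unfolding p_def by (rule plen_cong) (rule Gam_n)

lemma gamma_eq: "gamma n (\<mu>, A) = (empty_ptn, tab_of n Gam)"
proof -
  define c where "c = (\<lambda>i q. if i = 0 \<or> n < i then 0 else if q = 0 then \<mu> i else rec_mat A i q)"
  have c: "(\<Sum>q=0..t. c i q) = G t i" if i: "1 \<le> i" for t i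
  proof (cases "n < i")
    case True
    then show ?thesis using G_rows[of i t] by (simp add: c_def)
  next
    case False
    show ?thesis
    proof (induction t)
      case 0
      then show ?case using False i G_0[OF i] by (simp add: c_def)
    next
      case (Suc t)
      then show ?case using False i G_rec[OF i, of t] by (simp add: c_def)
    qed
  qed
  define d where "d = (\<lambda>i j. (\<Sum>q=0..n-j. c (n - j + i) q) - (\<Sum>q=0..n-j+1. c (n - j + 1 + i) q))"
  have s: "(\<Sum>q=1..r. d i q) = Gam r i" if i: "1 \<le> i" and "r \<le> n" for i r
    using that(2)
  proof (induction r)
    case 0
    then show ?case using Gam_0[OF i] by simp
  next
    case (Suc r)
    have e: "n - Suc r + 1 = n - r" using Suc.prems by simp
    have "d i (Suc r) = G (n - Suc r) (n - Suc r + i) - G (n - r) (n - r + i)"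
      unfolding d_def e by (subst (1 2) c) (use i in auto)
    then have "d i (Suc r) = Gam (Suc r) i - Gam r i" using i by (simp add: Gam_def)
    moreover have "Gam r i \<le> Gam (Suc r) i" using chain_mono[OF Gam_chain, of r "Suc r" i] Suc.prems by simp
    ultimately show ?case using Suc by simp
  qed
  have "gamma n (\<mu>, A) = (empty_ptn, filling empty_ptn n d)"
    by (simp add: gamma_def d_def c_def Let_def)
  also have "filling empty_ptn n d = tab_of n Gam"
    unfolding filling_tab_of by (rule tab_of_cong') (rule s)
  finally show ?thesis .
qed

lemma X_chain: "chain (\<mu> 1) p n X"
  and X_0: "1 \<le> i \<Longrightarrow> X 0 i = 0"
  and X_n: "1 \<le> i \<Longrightarrow> X n i = \<mu> i"
  and xi_gamma: "xi n (gamma n (\<mu>, A)) = (empty_ptn, tab_of n X)"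
  using xi_tab_of[OF Gam_chain Gam_0] Gam_n plen_Gam by (simp_all add: X_def gamma_eq)

section \<open>String bounds for the rotated chain and its rectification\<close>

definition F :: "nat \<Rightarrow> ptn" where "F = rot (\<mu> 1) p n Gam"

lemma F_chain: "chain (\<mu> 1) p n F"
  unfolding F_def
proof (rule chain_rot[OF Gam_chain p_le_n])
  fix j i :: nat assume i: "1 \<le> i" and j: "j \<le> n"
  have "Gam j i \<le> Gam n 1"
    using chain_antimono[OF Gam_chain j i] chain_mono[OF Gam_chain j order_refl, of 1] by simp
  then show "Gam j i \<le> \<mu> 1" using Gam_n[of 1] by simp
qed

lemma X_grid: "j \<le> n \<Longrightarrow> X j = grid p (prepend_canon p (\<mu> 1) F) p j"
  using plen_Gam Gam_n[of 1] switches_final(1)[of j n p "prepend_canon p (\<mu> 1) F"]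
  by (simp add: X_def evac_def jdt_def F_def Let_def)

text \<open>Row s of the rotated chain is \<mu> 1 minus row t + p + 1 - s of \<open>G t\<close>, so
  a sum of first rows becomes a sum of last rows of \<open>G t\<close>, in which the rows below t +
  p vanish.\<close>

lemma F_sum:
  assumes t: "t \<le> n" and "r \<le> p"
  shows "(\<Sum>s=1..r. int (F t s)) = int r * int (\<mu> 1) - (H t n - H t (t + p - r))"
  using assms(2)
proof (induction r)
  case 0
  have z: "G t u = 0" if "t + p < u" for u
  proof -
    define i where "i = u - t"
    have i: "u = t + i" "p < i" using that by (auto simp: i_def)
    have "Gam (n - t) i \<le> Gam n i" using chain_mono[OF Gam_chain, of "n - t" n i] by simp
    also have "\<dots> = 0" using Gam_n[of i] plen_iff[OF parts(2), of i] i by (simp add: p_def)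
    finally show ?thesis using t i by (simp add: Gam_def)
  qed
  have "H t (t + p) = H t (t + p + n)" using H_const[of "t + p" t n] z by simp
  also have "\<dots> = H t n" using H_const[of n t "t + p"] G_rows by (simp add: add.commute)
  finally show ?case by simp
next
  case (Suc r)
  define b where "b = t + p - Suc r"
  have b: "t + p - r = Suc b" "b = t + (p - r) - 1" "Suc b = t + (p - r)" using Suc.prems by (auto simp: b_def)
  have "1 \<le> p - r" using Suc.prems by simp
  then have "Gam (n - t) (p - r) \<le> Gam n 1"
    using chain_antimono[OF Gam_chain, of "n - t" 1 "p - r"] chain_mono[OF Gam_chain, of "n - t" n 1] Suc.prems by simp
  then have le: "G t (Suc b) \<le> \<mu> 1" using Gam_n[of 1] t Suc.prems b(3) by (simp add: Gam_def)
  have "F t (Suc r) = \<mu> 1 - G t (Suc b)"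
    using t Suc.prems b(3) by (simp add: F_def rot_def Gam_def)
  then have "int (F t (Suc r)) = int (\<mu> 1) - int (G t (Suc b))" using le by simp
  then show ?case using Suc H_Suc[of t b] unfolding b_def[symmetric] b(1) by (simp add: algebra_simps)
qed

lemma F_sum_ge:
  assumes t: "t \<le> n" and "p \<le> r"
  shows "(\<Sum>s=1..r. int (F t s)) = int p * int (\<mu> 1) - (H t n - H t t)"
  using assms(2)
proof (induction r rule: dec_induct)
  case base
  then show ?case using F_sum[OF t order_refl] by simp
next
  case (step r)
  then show ?case using chain_rows[OF F_chain t, of "Suc r"] by simp
qed

text \<open>Sums over last rows are totals minus sums over first rows. The totals contribute the
  difference of two parts of \<nu>; the rest is the Littlewood--Richardson inequality of
  \<open>A\<close> at b = t + p - r. For r \<ge> p interlacing of \<open>G\<close> is used in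
  addition.\<close>

lemma eps_F:
  assumes t: "Suc (Suc t) \<le> n"
  shows "eps_le (int (entry \<nu> (Suc t)) - int (entry \<nu> (Suc (Suc t)))) (F t) (F (Suc t)) (F (Suc (Suc t)))"
  unfolding eps_le_def
proof
  fix r
  have E: "H (Suc (Suc t)) (Suc b) - H (Suc t) (Suc b) - (H (Suc t) b - H t b) \<le> 0" for b
    using eps_G[of t] unfolding eps_le_def H_def sum_subtractf by blast
  show "(\<Sum>s=1..Suc r. int (F (Suc (Suc t)) s) - int (F (Suc t) s)) - (\<Sum>s=1..r. int (F (Suc t) s) - int (F t s))
    \<le> int (entry \<nu> (Suc t)) - int (entry \<nu> (Suc (Suc t)))"
  proof (cases "Suc r \<le> p")
    case True
    define b where "b = t + p - r"
    have b: "Suc (Suc t) + p - Suc r = Suc b" "Suc t + p - Suc r = b" "Suc t + p - r = Suc b" "t + p - r = b"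
      using True by (auto simp: b_def)
    have r: "r \<le> p" "t \<le> n" "Suc t \<le> n" using True t by auto
    show ?thesis
      unfolding sum_subtractf F_sum[OF t True] F_sum[OF r(3) True] F_sum[OF r(3) r(1)] F_sum[OF r(2) r(1)] b entry_tot
      using E[of b] by simp
  next
    case False
    then have r: "p \<le> r" "p \<le> Suc r" "t \<le> n" "Suc t \<le> n" using t by auto
    have "G (Suc t) (Suc (Suc t)) \<le> G t (Suc t)" using interlaceD(2)[OF G_interlace] .
    then show ?thesis
      unfolding sum_subtractf F_sum_ge[OF t r(2)] F_sum_ge[OF r(4) r(2)] F_sum_ge[OF r(4) r(1)] F_sum_ge[OF r(3) r(1)] entry_tot
      using E[of "Suc t"] H_Suc[of t t] H_Suc[of "Suc t" "Suc t"] by simp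
  qed
qed

lemma eps_X:
  assumes t: "Suc (Suc t) \<le> n"
  shows "eps_le (int (entry \<nu> (Suc t)) - int (entry \<nu> (Suc (Suc t)))) (X t) (X (Suc t)) (X (Suc (Suc t)))"
proof -
  let ?D = "prepend_canon p (\<mu> 1) F"
  have D: "?D (p + j) = F j" for j by (simp add: prepend_canon_def)
  show ?thesis
    using grid_eps_row[OF chain_prepend_canon[OF F_chain], of p t] eps_F[OF t] t X_grid[of t] X_grid[of "Suc t"] X_grid[of "Suc (Suc t)"]
    by (simp only: D order_refl simp_thms)
qed

text \<open>Weights survive rectification, so the cells may be counted in the rotated chain. By
  \<open>G_diag\<close> the rows of \<open>G\<close> that \<open>Gam\<close> omits contribute
  exactly row t + 1 of \<Lambda>.\<close>

lemma X_weight: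
  assumes "Suc t \<le> n"
  shows "(\<Sum>q=1..p. int (X (Suc t) q) - int (X t q)) = int (\<Lambda> (Suc t)) - int (entry \<nu> (Suc t))"
proof -
  let ?D = "prepend_canon p (\<mu> 1) F"
  have D: "?D (p + j) = F j" for j by (simp add: prepend_canon_def)
  have t: "t \<le> n" "t < n" using assms by auto
  have "(\<Sum>q=1..p. int (X (Suc t) q) - int (X t q)) = (\<Sum>q=1..p. int (F (Suc t) q)) - (\<Sum>q=1..p. int (F t q))"
    using grid_weight_row[OF chain_prepend_canon[OF F_chain] order_refl t(2)] X_grid[OF assms] X_grid[OF t(1)] D[of t] D[of "Suc t"]
    by (simp add: sum_subtractf)
  also have "\<dots> = (H t n - H t t) - (H (Suc t) n - H (Suc t) (Suc t))"
    using F_sum[OF assms order_refl] F_sum[OF t(1) order_refl] by simp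
  also have "H (Suc t) (Suc t) - H t t = int (\<Lambda> (Suc t))"
  proof -
    have "H (Suc t) t = H t t" unfolding H_def by (rule sum.cong) (use G_diag in auto)
    then show ?thesis using H_Suc[of "Suc t" t] G_diag[of "Suc t" "Suc t"] by simp
  qed
  then have "(H t n - H t t) - (H (Suc t) n - H (Suc t) (Suc t)) = int (\<Lambda> (Suc t)) - (H (Suc t) n - H t n)" by simp
  finally show ?thesis using entry_tot[of t] by simp
qed

section \<open>The preimage of the evacuated tableau under tau\<close>

text \<open>\<open>tau\<close> transposes the recording matrix, so letter q must occur in row i of
  the preimage as often as letter i in row q of \<open>X\<close>. Together with the inner shape
  \<nu> this prescribes all shapes.\<close>

definition Bc :: "nat \<Rightarrow> ptn" where
  "Bc j i = (if i = 0 then M else if i \<le> n then entry \<nu> i + (\<Sum>q=1..j. X i q - X (i - 1) q) else 0)"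

lemma X_mono: "i \<le> n \<Longrightarrow> X (i - 1) q \<le> X i q"
  using chain_mono[OF X_chain, of "i - 1" i q] by simp

lemma Bc_int: "1 \<le> i \<Longrightarrow> i \<le> n \<Longrightarrow> int (Bc j i) = int (entry \<nu> i) + (\<Sum>q=1..j. int (X i q) - int (X (i - 1) q))"
  using X_mono[of i] by (simp add: Bc_def of_nat_diff)

lemma Bc_top: assumes "1 \<le> i" "i \<le> n" shows "Bc p i = \<Lambda> i"
  using Bc_int[OF assms, of p] X_weight[of "i - 1"] assms by simp

text \<open>Interlacing in the rows from 1 on is the string bound \<open>eps_X\<close>: the
  difference of the parts of \<nu> on its right-hand side accounts for the inner shape.\<close>

lemma Bc_chain: "chain M n p Bc"
proof -
  have mono: "Bc j i \<le> Bc (Suc j) i" for j i by (simp add: Bc_def)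
  have mono_le: "j \<le> j' \<Longrightarrow> Bc j i \<le> Bc j' i" for j j' i
    by (rule lift_Suc_mono_le[of "\<lambda>j. Bc j i"]) (rule mono)
  have up: "Bc (Suc j) (Suc i) \<le> Bc j i" if j: "j < p" for j i
  proof -
    consider "i = 0" "1 \<le> n" | "1 \<le> i" "Suc i \<le> n" | "n < Suc i" by linarith
    then show ?thesis
    proof cases
      case 1
      have "Bc (Suc j) 1 \<le> M" using mono_le[of "Suc j" p 1] Bc_top[of 1] 1 j by (simp add: M_def)
      then show ?thesis using 1 by (simp add: Bc_def)
    next
      case 2
      obtain t where t: "i = Suc t" using 2 by (cases i) auto
      have "(\<Sum>s=1..Suc j. int (X (Suc i) s) - int (X i s)) - (\<Sum>s=1..j. int (X i s) - int (X t s)) 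
          \<le> int (entry \<nu> i) - int (entry \<nu> (Suc i))"
        using eps_X[of t] 2 t unfolding eps_le_def by blast
      then have "int (Bc (Suc j) (Suc i)) \<le> int (Bc j i)"
        using Bc_int[of "Suc i" "Suc j"] Bc_int[of i j] 2 t by simp
      then show ?thesis by simp
    next
      case 3
      then show ?thesis by (simp add: Bc_def)
    qed
  qed
  have dec: "Bc j (Suc i) \<le> Bc j i" if j: "j \<le> p" for j i
  proof (cases j)
    case (Suc j')
    then show ?thesis using up[of j' i] mono[of j' i] j by simp
  next
    case 0
    consider "i = 0" "1 \<le> n" | "1 \<le> i" "Suc i \<le> n" | "n < Suc i" by linarith
    then show ?thesis
    proof cases
      case 1
      then show ?thesis using mono_le[of 0 p 1] Bc_top[of 1] 0 by (simp add: M_def Bc_def)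
    next
      case 2
      then show ?thesis using \<nu>_part 0 by (simp add: Bc_def is_partition_def)
    next
      case 3
      then show ?thesis by (simp add: Bc_def)
    qed
  qed
  show ?thesis
    unfolding chain_def interlace_def
  proof (intro conjI allI impI)
    show "Bc j 0 = M" for j by (simp add: Bc_def)
    show "Bc j i = 0" if "n < i" for j i using that by (simp add: Bc_def)
  qed (use mono up dec in auto)
qed

lemma entry_0: "n < i \<Longrightarrow> entry \<nu> i = 0"
proof -
  assume i: "n < i"
  have "H i n = H (i - 1) n" unfolding H_def by (rule sum.cong) (use G_diag i in auto)
  then show ?thesis using entry_tot[of "i - 1"] i by simp
qed

lemma contains_\<nu>: "contains \<Lambda> (entry \<nu>)"
proof -
  have "entry \<nu> i \<le> \<Lambda> i" if "1 \<le> i" for i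
  proof (cases "i \<le> n")
    case True
    have "Bc 0 i \<le> Bc p i" using chain_mono[OF Bc_chain, of 0 p i] by simp
    then show ?thesis using Bc_top[OF that True] True that by (simp add: Bc_def)
  qed (simp add: entry_0)
  then show ?thesis using parts(1) \<nu>_part by (simp add: contains_def)
qed

definition B where "B = tab_of p Bc"

lemma length_parts: "length (Defs.parts \<mu>) = p" by (simp add: Defs.parts_def p_def del: upt_Suc)

lemma B_YT: "B \<in> YT \<Lambda> (entry \<nu>) (Defs.parts \<mu>)"
  unfolding B_def length_parts[symmetric]
proof (rule YT_tab_of)
  show "chain M n (length (Defs.parts \<mu>)) Bc" unfolding length_parts by (rule Bc_chain)
  show "entry \<nu> i < j \<and> j \<le> \<Lambda> i \<longleftrightarrow> Bc 0 i < j \<and> j \<le> Bc (length (Defs.parts \<mu>)) i" if "1 \<le> i" for i j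
  proof (cases "i \<le> n")
    case True
    then show ?thesis using Bc_top[OF that True] that unfolding length_parts by (simp add: Bc_def)
  next
    case False
    then have "\<Lambda> i = 0" using plen_iff[OF parts(1) that] by (simp add: n_def)
    then show ?thesis using False that unfolding length_parts by (auto simp: Bc_def)
  qed
  show "entry (Defs.parts \<mu>) (Suc r) = (\<Sum>i=1..n. Bc (Suc r) i - Bc r i)" if r: "r < length (Defs.parts \<mu>)" for r
  proof -
    have "(\<Sum>i=1..m. Bc (Suc r) i - Bc r i) = X m (Suc r)" if "m \<le> n" for m
      using that
    proof (induction m)
      case 0
      then show ?case using X_0 by simp
    next
      case (Suc m)
      then show ?case using X_mono[of "Suc m" "Suc r"] by (simp add: Bc_def)
    qed
    from this[of n] have "(\<Sum>i=1..n. Bc (Suc r) i - Bc r i) = \<mu> (Suc r)" using X_n by simp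
    then show ?thesis using r unfolding length_parts
      by (simp add: entry_def Defs.parts_def p_def nth_append del: upt_Suc)
  qed
qed

lemma rec_mat_B:
  assumes "1 \<le> i" "1 \<le> t"
  shows "rec_mat B i t = (if i \<le> n \<and> t \<le> p then X i t - X (i - 1) t else 0)"
proof (cases "t \<le> p")
  case True
  obtain r where r: "t = Suc r" using assms by (cases t) auto
  have "B i j = t \<longleftrightarrow> Bc r i < j \<and> j \<le> Bc (Suc r) i" for j
    using tab_of_eq_Suc[OF Bc_chain, of i j r] assms True r by (simp add: B_def)
  then have "{j. B i j = t} = {Bc r i<..Bc (Suc r) i}"
    by (intro set_eqI) (simp only: mem_Collect_eq greaterThanAtMost_iff)
  then have "rec_mat B i t = Bc (Suc r) i - Bc r i" by (simp add: rec_mat_def)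
  then show ?thesis using True assms r by (simp add: Bc_def)
next
  case False
  then have "B i j \<noteq> t" for j using tab_of_le[OF Bc_chain, of i j] by (auto simp: B_def)
  then show ?thesis using False by (simp add: rec_mat_def)
qed

lemma B_row_sum: assumes "1 \<le> t" "t \<le> p" shows "(\<Sum>i=1..r. rec_mat B i t) = X (min r n) t"
proof (induction r)
  case 0
  then show ?case using X_0 assms by simp
next
  case (Suc r)
  show ?case
  proof (cases "Suc r \<le> n")
    case True
    then show ?thesis using Suc rec_mat_B[of "Suc r" t] X_mono[of "Suc r" t] assms by (simp add: min_def)
  next
    case False
    then have "min (Suc r) n = n" "min r n = n" by auto
    then show ?thesis using Suc False rec_mat_B[of "Suc r" t] assms by simp
  qed
qed

text \<open>For t \<le> p the letters t in the first r \<le> n rows number \<open>X r t\<close>, so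
  the condition is one of the interlacing inequalities of \<open>X\<close>. Transposing the
  recording matrix exchanges interlacing and the Littlewood--Richardson condition.\<close>

lemma B_LR: "B \<in> LR \<Lambda> (entry \<nu>) (Defs.parts \<mu>)"
proof (rule LR_I[OF B_YT])
  fix r t :: nat assume t: "1 \<le> t"
  show "(\<Sum>i=1..Suc r. rec_mat B i (Suc t)) \<le> (\<Sum>i=1..r. rec_mat B i t)"
  proof (cases "Suc t \<le> p")
    case True
    have "X (min (Suc r) n) (Suc t) \<le> X (min r n) t"
    proof (cases "r < n")
      case True
      then show ?thesis using interlaceD(2)[OF chain_interlace[OF X_chain True], of t] by simp
    next
      case False
      then show ?thesis using chain_dec[OF X_chain order_refl, of t] by simp
    qed
    then show ?thesis using B_row_sum[of "Suc t" "Suc r"] B_row_sum[of t r] True t by simp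
  next
    case False
    then have "(\<Sum>i=1..Suc r. rec_mat B i (Suc t)) = 0" using rec_mat_B[of _ "Suc t"] t by (intro sum.neutral) auto
    then show ?thesis by simp
  qed
qed

lemma tau_B: "tau n B = (empty_ptn, tab_of n X)"
proof -
  have "tab_of n (\<lambda>r i. \<Sum>q=1..r. rec_mat B q i) = tab_of n X"
  proof (rule tab_of_cong')
    fix r i :: nat assume r: "r \<le> n" "1 \<le> i"
    show "(\<Sum>q=1..r. rec_mat B q i) = X r i"
    proof (cases "i \<le> p")
      case True
      then show ?thesis using B_row_sum[of i r] r by simp
    next
      case False
      then have "(\<Sum>q=1..r. rec_mat B q i) = 0" using rec_mat_B[of _ i] r by (intro sum.neutral) auto
      then show ?thesis using chain_rows[OF X_chain r(1), of i] False by simp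
    qed
  qed
  then show ?thesis by (simp add: tau_def filling_tab_of)
qed

lemma rho2_eq: "rho2 \<Lambda> \<nu> (\<mu>, A) = (entry \<nu>, B)"
proof -
  have "inj_on (tau n) (LR \<Lambda> (entry \<nu>) (Defs.parts \<mu>))"
  proof (rule inj_onI)
    fix C C' assume "C \<in> LR \<Lambda> (entry \<nu>) (Defs.parts \<mu>)" "C' \<in> LR \<Lambda> (entry \<nu>) (Defs.parts \<mu>)" "tau n C = tau n C'"
    then show "C = C'" using tau_inj[OF contains_\<nu>, of C "Defs.parts \<mu>" C'] by (simp add: LR_def n_def)
  qed
  then have "inv_into (LR \<Lambda> (entry \<nu>) (Defs.parts \<mu>)) (tau n) (tau n B) = B"
    using B_LR by (rule inv_into_f_f)
  then show ?thesis
    unfolding rho2_def by (simp add: Let_def n_def[symmetric] xi_gamma tau_B)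
qed

theorem gt_array_rho2:
  "gt_array n p (rho2 \<Lambda> \<nu> (\<mu>, A)) i j = (if 1 \<le> i \<and> i \<le> n \<and> j \<le> p then int (Bc j i) else 0)"
  unfolding rho2_eq B_def
proof (cases "i \<le> n")
  case True
  have *: "(\<lambda>i. Bc 0 i) = Bc 0" by simp
  have "gt_array n p (entry \<nu>, tab_of p Bc) i j = gt_array n p (Bc 0, tab_of p Bc) i j"
    using True by (simp add: gt_array_def Bc_def)
  then show "gt_array n p (entry \<nu>, tab_of p Bc) i j = (if 1 \<le> i \<and> i \<le> n \<and> j \<le> p then int (Bc j i) else 0)"
    using gt_array_tab_of[OF Bc_chain, of "Bc 0" p n i j] by simp
qed (simp add: gt_array_def)

text \<open>Counting from the right avoids the weight \<open>\<nu>\<close>, which is not part of the input.\<close>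

lemma Bc_from_right:
  assumes "1 \<le> i" "i \<le> n" "j \<le> p"
  shows "int (Bc j i) = int (\<Lambda> i) - (\<Sum>q=Suc j..p. int (X i q) - int (X (i - 1) q))"
proof -
  have "(\<Sum>q=1..p. int (X i q) - int (X (i - 1) q)) =
     (\<Sum>q=1..j. int (X i q) - int (X (i - 1) q)) + (\<Sum>q=Suc j..p. int (X i q) - int (X (i - 1) q))"
    using assms(3) sum.ub_add_nat[of 1 j "\<lambda>q. int (X i q) - int (X (i - 1) q)" "p - j"] by simp
  then show ?thesis using Bc_int[OF assms(1,2), of j] Bc_int[OF assms(1,2), of p] Bc_top[OF assms(1,2)] by simp
qed

end

section \<open>Row insertion of words\<close>

text \<open>The bumped entries are collected in the order of bumping; they form the word that enters
  the next row.\<close>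

fun insert_word :: "nat list \<Rightarrow> nat list \<Rightarrow> nat list \<times> nat list" where
  "insert_word p [] = (p, [])"
| "insert_word p (x # xs) =
     (let (p', z) = row_insert x p; (p'', zs) = insert_word p' xs
      in (p'', (case z of None \<Rightarrow> zs | Some y \<Rightarrow> y # zs)))"

definition cnt :: "nat list \<Rightarrow> nat \<Rightarrow> nat" where
  "cnt p j = length (filter (\<lambda>x. x \<le> j) p)"

lemma cnt_Nil [simp]: "cnt [] j = 0" and cnt_Cons: "cnt (x # xs) j = (if x \<le> j then 1 else 0) + cnt xs j"
  by (auto simp: cnt_def)

lemma cnt_Suc: "cnt p (Suc j) = cnt p j + count_list p (Suc j)"
  by (induction p) (auto simp: cnt_Cons le_Suc_eq)

lemma cnt_mono: "j \<le> j' \<Longrightarrow> cnt p j \<le> cnt p j'"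
  by (induction p) (auto simp: cnt_Cons)

lemma cnt_0: "(\<And>x. x \<in> set p \<Longrightarrow> j < x) \<Longrightarrow> cnt p j = 0"
  by (induction p) (force simp: cnt_Cons)+

lemma cnt_all: "(\<And>x. x \<in> set p \<Longrightarrow> x \<le> j) \<Longrightarrow> cnt p j = length p"
  by (induction p) (auto simp: cnt_Cons)

lemma cnt_le_length: "cnt p j \<le> length p"
  by (simp add: cnt_def)

lemma row_insert_props:
  assumes "row_insert x p = (p', z)"
  shows "length p' = length p + (if z = None then 1 else 0)"
    "set p' \<subseteq> insert x (set p)" "set_option z \<subseteq> set p"
    "count_list p' j + (if z = Some j then 1 else 0) = count_list p j + (if x = j then 1 else 0)"
  using assms
proof (induction p arbitrary: p' z)
  case (Cons y ys)
  { case 1 then show ?case using Cons.IH(1) by (auto split: if_splits prod.splits) }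
  { case 2 then show ?case using Cons.IH(2) by (fastforce split: if_splits prod.splits) }
  { case 3 then show ?case using Cons.IH(3) by (fastforce split: if_splits prod.splits) }
  { case 4 then show ?case using Cons.IH(4) by (fastforce split: if_splits prod.splits) }
qed auto

text \<open>For the last claim: x displaces the first entry above x, so for j \<ge> x the number of
  entries up to j grows iff the row had no entry from x + 1 to j. The third claim is the reason why
  later bumped entries are at least as large as earlier ones.\<close>

lemma row_insert_sorted:
  assumes "sorted p" "row_insert x p = (p', z)"
  shows "sorted p'" "\<And>y. z = Some y \<Longrightarrow> x < y" "\<And>y e. z = Some y \<Longrightarrow> e \<in> set p' \<Longrightarrow> x < e \<Longrightarrow> y \<le> e"
    "cnt p' j = (if x \<le> j \<and> cnt p j = cnt p x then Suc (cnt p j) else cnt p j)"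
  using assms
proof (induction p arbitrary: p' z)
  case Nil
  { case 1 then show ?case by auto }
  { case 2 then show ?case by simp }
  { case 3 then show ?case by simp }
  { case 4 then show ?case by (auto simp: cnt_Cons) }
next
  case (Cons a ys)
  have s: "sorted ys" "\<And>e. e \<in> set ys \<Longrightarrow> a \<le> e" if "sorted (a # ys)" using that by auto
  obtain q w where qw: "row_insert x ys = (q, w)" by force
  { case 1
    show ?case
    proof (cases "x < a")
      case True
      then show ?thesis using 1 by fastforce
    next
      case False
      then have "p' = a # q" using 1 qw by auto
      then show ?thesis using Cons.IH(1)[OF s(1)[OF 1(1)] qw] row_insert_props(2)[OF qw] s(2)[OF 1(1)] False by auto
    qed }
  { case (2 y)
    then show ?case using Cons.IH(2)[OF _ s(1)[OF 2(2)] qw] qw by (auto split: if_splits) }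
  { case (3 y e)
    show ?case
    proof (cases "x < a")
      case True
      then show ?thesis using 3 s(2)[OF 3(4)] by auto
    next
      case False
      then have "p' = a # q" "z = w" using 3 qw by auto
      then show ?thesis using Cons.IH(3)[OF _ _ _ s(1)[OF 3(4)] qw, of y e] 3 False by auto
    qed }
  { case 4
    show ?case
    proof (cases "x < a")
      case True
      then have p': "p' = x # ys" using 4 by auto
      have z: "cnt ys i = 0" if "i < a" for i using s(2)[OF 4(1)] that by (intro cnt_0) force
      show ?thesis using True z[of x] z[of j] unfolding p' by (auto simp: cnt_Cons)
    next
      case False
      then have p': "p' = a # q" using 4 qw by auto
      show ?thesis using False Cons.IH(4)[OF s(1)[OF 4(1)] qw] unfolding p' by (auto simp: cnt_Cons)
    qed }
qed

lemma insert_word_append: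
  "insert_word p (us @ vs) = (fst (insert_word (fst (insert_word p us)) vs),
     snd (insert_word p us) @ snd (insert_word (fst (insert_word p us)) vs))"
  by (induction us arbitrary: p) (auto simp: case_prod_beta split: option.splits)

lemma insert_word_props_aux:
  "length p \<le> length (fst (insert_word p ws)) \<and> length (fst (insert_word p ws)) \<le> length p + length ws \<and>
    length (snd (insert_word p ws)) \<le> length ws \<and>
    set (fst (insert_word p ws)) \<subseteq> set p \<union> set ws \<and> set (snd (insert_word p ws)) \<subseteq> set p \<union> set ws \<and>
    count_list (fst (insert_word p ws)) j + count_list (snd (insert_word p ws)) j = count_list p j + count_list ws j"
proof (induction ws arbitrary: p)
  case (Cons x xs)
  obtain q w where qw: "row_insert x p = (q, w)" by force
  note R = row_insert_props[OF qw]
  obtain q2 zs where iw: "insert_word q xs = (q2, zs)" by force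
  have e: "insert_word p (x # xs) = (q2, (case w of None \<Rightarrow> zs | Some y \<Rightarrow> y # zs))"
    by (simp add: qw iw)
  show ?case
    using Cons[of q] R(1-3) R(4)[of j] unfolding e iw by (auto split: if_splits option.splits)
qed simp

lemma insert_word_props:
  "length p \<le> length (fst (insert_word p ws))"
  "length (fst (insert_word p ws)) \<le> length p + length ws"
  "length (snd (insert_word p ws)) \<le> length ws"
  "set (fst (insert_word p ws)) \<subseteq> set p \<union> set ws"
  "set (snd (insert_word p ws)) \<subseteq> set p \<union> set ws"
  "count_list (fst (insert_word p ws)) j + count_list (snd (insert_word p ws)) j = count_list p j + count_list ws j"
  using insert_word_props_aux by blast+

lemma insert_word_sorted: "sorted p \<Longrightarrow> sorted (fst (insert_word p ws))"
proof (induction ws arbitrary: p)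
  case (Cons x xs)
  obtain q w where qw: "row_insert x p = (q, w)" by force
  show ?case using Cons.IH[OF row_insert_sorted(1)[OF Cons.prems qw]] qw by (simp add: case_prod_beta)
qed simp

text \<open>Serves \<open>bumped_sorted\<close>, where y is the entry bumped by x. The hypotheses
  concern an arbitrary lower bound x of the word, so that they pass to the next letter.\<close>

lemma bumped_ge:
  "(\<And>e. e \<in> set p \<Longrightarrow> x < e \<Longrightarrow> y \<le> e) \<Longrightarrow> sorted p \<Longrightarrow> sorted ws \<Longrightarrow> (\<And>u. u \<in> set ws \<Longrightarrow> x \<le> u) \<Longrightarrow>
    z \<in> set (snd (insert_word p ws)) \<Longrightarrow> y \<le> z"
proof (induction ws arbitrary: p x)
  case (Cons u us)
  obtain q w where qw: "row_insert u p = (q, w)" by force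
  have xu: "x \<le> u" using Cons.prems(4)[of u] by simp
  have q: "y \<le> e" if "e \<in> set q" "u < e" for e
    using row_insert_props(2)[OF qw] Cons.prems(1)[of e] that xu by auto
  have sq: "sorted q" by (rule row_insert_sorted(1)[OF Cons.prems(2) qw])
  show ?case
  proof (cases "z \<in> set (snd (insert_word q us))")
    case True
    show ?thesis
      by (rule Cons.IH[of q u, OF _ sq _ _ True]) (use q Cons.prems(3) in auto)
  next
    case False
    then have "w = Some z" using Cons.prems(5) qw by (auto simp: case_prod_beta split: option.splits)
    then have "u < z" "z \<in> set p" using row_insert_sorted(2)[OF Cons.prems(2) qw] row_insert_props(3)[OF qw] by auto
    then show ?thesis using Cons.prems(1)[of z] xu by simp
  qed
qed simp

text \<open>Sortedness passes to the word that enters the next row, so that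
  \<open>cnt_insert_word\<close> applies there again.\<close>

lemma bumped_sorted: "sorted p \<Longrightarrow> sorted ws \<Longrightarrow> sorted (snd (insert_word p ws))"
proof (induction ws arbitrary: p)
  case (Cons x xs)
  obtain q w where qw: "row_insert x p = (q, w)" by force
  have sq: "sorted q" by (rule row_insert_sorted(1)[OF Cons.prems(1) qw])
  have IH: "sorted (snd (insert_word q xs))" using Cons.IH[OF sq] Cons.prems by simp
  show ?case
  proof (cases w)
    case None
    then show ?thesis using IH qw by (simp add: case_prod_beta)
  next
    case (Some y)
    have "y \<le> z" if "z \<in> set (snd (insert_word q xs))" for z
      by (rule bumped_ge[OF _ sq _ _ that, of x]) (use row_insert_sorted(3)[OF Cons.prems(1) qw Some] Cons.prems(2) in auto)
    then show ?thesis using IH qw Some by (simp add: case_prod_beta)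
  qed
qed simp

text \<open>Induction on the word from its end, so that the new letter x is the largest one. It
  changes the count at x and at those larger j whose count equals that at x; the cases compare
  \<open>Suc j\<close> with x.\<close>

lemma cnt_insert_word:
  assumes "sorted p" "sorted ws"
  shows "cnt (fst (insert_word p ws)) (Suc j) =
    max (cnt (fst (insert_word p ws)) j) (cnt p (Suc j)) + count_list ws (Suc j)"
  using assms(2)
proof (induction ws arbitrary: j rule: rev_induct)
  case Nil
  then show ?case using cnt_mono[of j "Suc j" p] by simp
next
  case (snoc x us)
  let ?q = "fst (insert_word p us)"
  obtain r w where rw: "row_insert x ?q = (r, w)" by force
  have sq: "sorted ?q" by (rule insert_word_sorted[OF assms(1)])
  have r: "fst (insert_word p (us @ [x])) = r" by (simp add: insert_word_append rw)
  note C = row_insert_sorted(4)[OF sq rw]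
  have IH: "cnt ?q (Suc j) = max (cnt ?q j) (cnt p (Suc j)) + count_list us (Suc j)" for j
    using snoc by (simp add: sorted_append)
  have z: "count_list us i = 0" if "x < i" for i
    using snoc.prems that by (fastforce simp: sorted_append count_list_0_iff)
  have m: "cnt ?q x \<le> cnt ?q j" if "x \<le> j" for j using cnt_mono[OF that] .
  have mj: "cnt ?q j \<le> cnt ?q (Suc j)" by (rule cnt_mono) simp
  consider "Suc j < x" | "Suc j = x" | "x \<le> j" by linarith
  then show ?case
  proof cases
    case 1
    then show ?thesis unfolding r C using IH[of j] by simp
  next
    case 2
    then show ?thesis unfolding r C using IH[of j] by auto
  next
    case 3
    have "count_list (us @ [x]) (Suc j) = 0" using z[of "Suc j"] 3 by simp
    then show ?thesis unfolding r C using IH[of j] z[of "Suc j"] m[OF 3] mj 3 by (auto simp: max_def split: if_splits)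
  qed
qed

section \<open>Row insertion of a whole matrix\<close>

definition rsk_word :: "nat \<Rightarrow> nat list \<Rightarrow> nat list list \<times> nat list list \<Rightarrow> nat list list \<times> nat list list" where
  "rsk_word i ws = fold (\<lambda>j (P, Q). rsk_insert i j P Q) ws"

definition row :: "nat list list \<Rightarrow> nat \<Rightarrow> nat list" where
  "row P r = (if r < length P then P ! r else [])"

lemma row_Nil [simp]: "row [] r = []" and row_Cons_0 [simp]: "row (p # P) 0 = p"
  and row_Cons_Suc [simp]: "row (p # P) (Suc r) = row P r"
  by (auto simp: row_def)

fun bumped :: "nat list list \<Rightarrow> nat list \<Rightarrow> nat \<Rightarrow> nat list" where
  "bumped P ws 0 = ws"
| "bumped P ws (Suc r) = snd (insert_word (row P r) (bumped P ws r))"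

lemma row_tl: "row P (Suc r) = row (tl P) r"
  by (cases P) auto

lemma bumped_tl: "bumped P ws (Suc r) = bumped (tl P) (snd (insert_word (row P 0) ws)) r"
  by (induction r) (simp_all add: row_tl)

text \<open>A row is affected only by the letters that enter it, in their order, so a word can be
  inserted into the first row completely before the bumped word is passed on. All new cells receive
  the same i, so it does not matter when they are created.\<close>

lemma rsk_word_Cons:
  "rsk_word i ws (p # P, q # Q) = (let (p', zs) = insert_word p ws; (P', Q') = rsk_word i zs (P, Q)
     in (p' # P', (q @ replicate (length p' - length p) i) # Q'))"
proof (induction ws arbitrary: p P q Q)
  case (Cons x xs)
  obtain p1 w where pw: "row_insert x p = (p1, w)" by force
  have l: "length p1 = length p + (if w = None then 1 else 0)" by (rule row_insert_props(1)[OF pw])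
  have ge: "length p1 \<le> length (fst (insert_word p1 xs))" by (rule insert_word_props(1))
  obtain p2 zs where iw: "insert_word p1 xs = (p2, zs)" by force
  show ?case
  proof (cases w)
    case None
    have "length p2 - length p = Suc (length p2 - length p1)" using l ge None iw by simp
    then show ?thesis using Cons[of p1 P "q @ [i]" Q] pw iw None
      by (simp add: rsk_word_def case_prod_beta)
  next
    case (Some y)
    obtain P1 Q1 where PQ: "rsk_insert i y P Q = (P1, Q1)" by force
    show ?thesis using Cons[of p1 P1 q Q1] pw iw Some l PQ
      by (simp add: rsk_word_def case_prod_beta)
  qed
qed (simp add: rsk_word_def)

text \<open>If tableau and word are both empty, nothing is inserted, whereas the right-hand side
  would create an empty row; hence the second assumption.\<close>

lemma rsk_word_step:
  assumes "length P = length Q" "P \<noteq> [] \<or> ws \<noteq> []"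
  shows "rsk_word i ws (P, Q) = (let (p', zs) = insert_word (row P 0) ws; (P', Q') = rsk_word i zs (tl P, tl Q)
     in (p' # P', (row Q 0 @ replicate (length p' - length (row P 0)) i) # Q'))"
proof (cases P)
  case Nil
  then obtain x xs where ws: "ws = x # xs" and Q: "Q = []" using assms by (cases ws) auto
  have "rsk_word i ws ([], []) = rsk_word i ws ([[]], [[]])" by (simp add: ws rsk_word_def)
  then show ?thesis using rsk_word_Cons[of i ws "[]" "[]" "[]" "[]"] Nil Q by simp
next
  case (Cons p P')
  then obtain q Q' where "Q = q # Q'" using assms by (cases Q) auto
  then show ?thesis using rsk_word_Cons Cons by simp
qed

lemma rsk_word_length:
  "length P = length Q \<Longrightarrow> length (fst (rsk_word i ws (P, Q))) = length (snd (rsk_word i ws (P, Q)))"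
proof -
  have 1: "length P = length Q \<Longrightarrow> length (fst (rsk_insert i j P Q)) = length (snd (rsk_insert i j P Q))" for j P Q
    by (induction i j P Q rule: rsk_insert.induct) (auto split: option.splits prod.splits)
  show "length P = length Q \<Longrightarrow> length (fst (rsk_word i ws (P, Q))) = length (snd (rsk_word i ws (P, Q)))"
  proof (induction ws arbitrary: P Q)
    case (Cons x xs)
    obtain P1 Q1 where PQ: "rsk_insert i x P Q = (P1, Q1)" by force
    then have "length P1 = length Q1" using 1[OF Cons.prems, of x] by simp
    then show ?case using Cons.IH[of P1 Q1] PQ by (simp add: rsk_word_def)
  qed (simp add: rsk_word_def)
qed

lemma rsk_word_rows:
  assumes "length P = length Q"
  shows "row (fst (rsk_word i ws (P, Q))) r = fst (insert_word (row P r) (bumped P ws r)) \<and>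
    row (snd (rsk_word i ws (P, Q))) r =
      row Q r @ replicate (length (fst (insert_word (row P r) (bumped P ws r))) - length (row P r)) i"
  using assms
proof (induction r arbitrary: P Q ws)
  case 0
  show ?case
  proof (cases "P \<noteq> [] \<or> ws \<noteq> []")
    case True
    then show ?thesis by (subst (1 2) rsk_word_step[OF 0 True]) (simp add: case_prod_beta)
  next
    case False
    then show ?thesis using 0 by (simp add: rsk_word_def)
  qed
next
  case (Suc r)
  have l: "length (tl P) = length (tl Q)" using Suc.prems by simp
  show ?case
  proof (cases "P \<noteq> [] \<or> ws \<noteq> []")
    case True
    show ?thesis
      using Suc.IH[OF l, of "snd (insert_word (row P 0) ws)"]
      by (subst (1 2) rsk_word_step[OF Suc.prems True]) (simp add: case_prod_beta row_tl[symmetric] bumped_tl[symmetric] del: bumped.simps)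
  next
    case False
    have "bumped [] [] r = []" for r by (induction r) auto
    then show ?thesis using False Suc.prems by (simp add: rsk_word_def)
  qed
qed

definition line_word :: "nat \<Rightarrow> (nat \<Rightarrow> nat \<Rightarrow> nat) \<Rightarrow> nat \<Rightarrow> nat list" where
  "line_word k V i = concat (map (\<lambda>j. replicate (V i j) j) [1..<Suc k])"

definition rsk_state :: "nat \<Rightarrow> (nat \<Rightarrow> nat \<Rightarrow> nat) \<Rightarrow> nat \<Rightarrow> nat list list \<times> nat list list" where
  "rsk_state k V i = fold (\<lambda>i. rsk_word i (line_word k V i)) [1..<Suc i] ([], [])"

definition P_row where "P_row k V i r = row (fst (rsk_state k V i)) r"
definition Q_row where "Q_row k V i r = row (snd (rsk_state k V i)) r"
definition bump_row where "bump_row k V i r = bumped (fst (rsk_state k V (i - 1))) (line_word k V i) r"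

lemma rsk_state_Suc: "rsk_state k V (Suc i) = rsk_word (Suc i) (line_word k V (Suc i)) (rsk_state k V i)"
  by (simp add: rsk_state_def)

lemma rsk_state_length: "length (fst (rsk_state k V i)) = length (snd (rsk_state k V i))"
proof (induction i)
  case (Suc i)
  then show ?case unfolding rsk_state_Suc by (metis prod.collapse rsk_word_length)
qed (simp add: rsk_state_def)

lemma rows_0: "P_row k V 0 r = []" "Q_row k V 0 r = []"
  by (simp_all add: P_row_def Q_row_def rsk_state_def)

lemma rows_Suc:
  "P_row k V (Suc i) r = fst (insert_word (P_row k V i r) (bump_row k V (Suc i) r))"
  "Q_row k V (Suc i) r = Q_row k V i r @ replicate (length (P_row k V (Suc i) r) - length (P_row k V i r)) (Suc i)"
  using rsk_word_rows[OF rsk_state_length[of k V i], where i = "Suc i" and ws = "line_word k V (Suc i)" and r = r]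
  by (simp_all add: P_row_def Q_row_def bump_row_def rsk_state_Suc)

lemma bump_row_0: "bump_row k V i 0 = line_word k V i"
  and bump_row_Suc: "bump_row k V (Suc i) (Suc r) = snd (insert_word (P_row k V i r) (bump_row k V (Suc i) r))"
  by (simp_all add: bump_row_def P_row_def)

lemma set_line_word: "set (line_word k V i) \<subseteq> {1..k}"
  by (auto simp: line_word_def simp del: upt_Suc)

lemma sorted_line_word: "sorted (line_word k V i)"
proof (induction k)
  case (Suc k)
  have "line_word (Suc k) V i = line_word k V i @ replicate (V i (Suc k)) (Suc k)" by (simp add: line_word_def)
  then show ?case using Suc set_line_word[of k V i] by (auto simp: sorted_append)
qed (simp add: line_word_def)

lemma count_line_word: "count_list (line_word k V i) j = (if 1 \<le> j \<and> j \<le> k then V i j else 0)"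
proof (induction k)
  case (Suc k)
  have "line_word (Suc k) V i = line_word k V i @ replicate (V i (Suc k)) (Suc k)" by (simp add: line_word_def)
  moreover have "count_list (replicate x y) z = (if y = z then x else 0)" for x and y z :: nat by (induction x) auto
  ultimately show ?case using Suc by auto
qed (simp add: line_word_def)

lemma length_line_word: "length (line_word k V i) = (\<Sum>j=1..k. V i j)"
  by (induction k) (auto simp: line_word_def)

lemma bump_row_props_aux:
  assumes "\<And>r. sorted (P_row k V i r)" "\<And>r. set (P_row k V i r) \<subseteq> {1..k}"
  shows "sorted (bump_row k V (Suc i) r)" "set (bump_row k V (Suc i) r) \<subseteq> {1..k}"
    "length (bump_row k V (Suc i) r) \<le> length (line_word k V (Suc i))"
proof (induction r)
  case 0
  { case 1 show ?case by (simp add: bump_row_0 sorted_line_word) }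
  { case 2 show ?case unfolding bump_row_0 by (rule set_line_word) }
  { case 3 show ?case by (simp add: bump_row_0) }
next
  case (Suc r)
  { case 1 show ?case unfolding bump_row_Suc using Suc(1) assms(1) by (intro bumped_sorted) }
  { case 2 show ?case unfolding bump_row_Suc using insert_word_props(5)[of "P_row k V i r" "bump_row k V (Suc i) r"] Suc(2) assms(2)[of r] by blast }
  { case 3 show ?case unfolding bump_row_Suc using insert_word_props(3)[of "P_row k V i r" "bump_row k V (Suc i) r"] Suc(3) by simp }
qed

lemma P_row_props:
  "sorted (P_row k V i r)" "set (P_row k V i r) \<subseteq> {1..k}"
  "length (P_row k V i r) \<le> (\<Sum>i=1..i. length (line_word k V i))"
proof -
  have "\<forall>r. sorted (P_row k V i r) \<and> set (P_row k V i r) \<subseteq> {1..k} \<and>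
      length (P_row k V i r) \<le> (\<Sum>i=1..i. length (line_word k V i))"
  proof (induction i)
    case (Suc i)
    have b: "sorted (bump_row k V (Suc i) r)" "set (bump_row k V (Suc i) r) \<subseteq> {1..k}"
      "length (bump_row k V (Suc i) r) \<le> length (line_word k V (Suc i))" for r
      by (rule bump_row_props_aux; use Suc in simp)+
    show ?case
    proof (intro allI conjI)
      fix r
      note I = insert_word_props[where p = "P_row k V i r" and ws = "bump_row k V (Suc i) r"]
      show "sorted (P_row k V (Suc i) r)" unfolding rows_Suc by (rule insert_word_sorted) (use Suc in simp)
      show "set (P_row k V (Suc i) r) \<subseteq> {1..k}" unfolding rows_Suc using I(4) b(2)[of r] Suc by blast
      have "length (P_row k V i r) \<le> (\<Sum>i=1..i. length (line_word k V i))" using Suc by simp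
      then show "length (P_row k V (Suc i) r) \<le> (\<Sum>i=1..Suc i. length (line_word k V i))"
        unfolding rows_Suc using I(2) b(3)[of r] by simp
    qed
  qed (simp add: rows_0)
  then show "sorted (P_row k V i r)" "set (P_row k V i r) \<subseteq> {1..k}"
    "length (P_row k V i r) \<le> (\<Sum>i=1..i. length (line_word k V i))" by auto
qed


text \<open>For row r, counted from 0: after line i of the matrix, \<open>RR\<close> is the number
  of entries up to j, and \<open>WW\<close> is the multiplicity of j in the word that line i sends
  into the row.\<close>

definition RR where "RR k V i r j = cnt (P_row k V i r) j"
definition WW where "WW k V i r j = count_list (bump_row k V i r) j"

lemma bump_row_props:
  "sorted (bump_row k V (Suc i) r)" "set (bump_row k V (Suc i) r) \<subseteq> {1..k}"
  "length (bump_row k V (Suc i) r) \<le> length (line_word k V (Suc i))"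
  by (rule bump_row_props_aux, (rule P_row_props)+)+

lemma RR_init: "RR k V 0 r j = 0"
  by (simp add: RR_def rows_0)

lemma RR_0: "RR k V i r 0 = 0"
  unfolding RR_def using P_row_props(2)[of k V i r] by (intro cnt_0) auto

lemma RR_Suc: "RR k V (Suc i) r (Suc j) = max (RR k V (Suc i) r j) (RR k V i r (Suc j)) + WW k V (Suc i) r (Suc j)"
  unfolding RR_def WW_def rows_Suc by (rule cnt_insert_word[OF P_row_props(1) bump_row_props(1)])

lemma WW_0: "1 \<le> j \<Longrightarrow> j \<le> k \<Longrightarrow> WW k V i 0 j = V i j"
  by (simp add: WW_def bump_row_0 count_line_word)

text \<open>Every letter contained in the row or inserted into it is afterwards either in the row or
  bumped.\<close>

lemma WW_Suc:
  "int (WW k V (Suc i) (Suc r) (Suc j)) = int (WW k V (Suc i) r (Suc j)) + (int (RR k V i r (Suc j)) - int (RR k V i r j))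
     - (int (RR k V (Suc i) r (Suc j)) - int (RR k V (Suc i) r j))"
  using insert_word_props(6)[of "P_row k V i r" "bump_row k V (Suc i) r" "Suc j"]
  unfolding RR_def WW_def cnt_Suc bump_row_Suc rows_Suc by simp

lemma Mat_D:
  assumes "V \<in> Mat a b"
  shows "1 \<le> i \<Longrightarrow> i \<le> max (length a) (length b) \<Longrightarrow> (\<Sum>j=1..max (length a) (length b). V i j) = entry a i"
  using assms by (simp add: Mat_def Let_def)

lemma sum_entry: "(\<Sum>i=1..m. entry a i) \<le> sum_list a"
proof -
  have "(\<Sum>i=1..m. entry a i) \<le> (\<Sum>i=1..m + length a. entry a i)" by (rule sum_mono2) auto
  also have "\<dots> = (\<Sum>i=1..length a. entry a i)"
    by (rule sum.mono_neutral_right) (auto simp: entry_def)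
  also have "\<dots> = (\<Sum>i<length a. a ! i)"
    by (rule sum.reindex_bij_witness[of _ Suc "\<lambda>i. i - 1"]) (auto simp: entry_def)
  also have "\<dots> = sum_list a" by (simp add: sum_list_sum_nth atLeast0LessThan)
  finally show ?thesis .
qed

lemma length_words_le:
  assumes V: "V \<in> Mat a b" and "i \<le> max (length a) (length b)"
  shows "(\<Sum>i=1..i. length (line_word (max (length a) (length b)) V i)) \<le> sum_list a"
proof -
  have "(\<Sum>i=1..i. length (line_word (max (length a) (length b)) V i)) = (\<Sum>i=1..i. entry a i)"
    by (rule sum.cong) (use Mat_D[OF V] assms(2) in \<open>auto simp: length_line_word\<close>)
  then show ?thesis using sum_entry[of a i] by simp
qed

lemma RR_le:
  assumes "V \<in> Mat a b" "i \<le> max (length a) (length b)"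
  shows "RR (max (length a) (length b)) V i r j \<le> sum_list a"
  unfolding RR_def using cnt_le_length P_row_props(3) length_words_le[OF assms] by (meson le_trans)

lemma WW_le:
  assumes "V \<in> Mat a b" "Suc i \<le> max (length a) (length b)"
  shows "WW (max (length a) (length b)) V (Suc i) r j \<le> sum_list a"
proof -
  have "WW (max (length a) (length b)) V (Suc i) r j \<le> length (bump_row (max (length a) (length b)) V (Suc i) r)"
    unfolding WW_def by (rule count_le_length)
  also have "\<dots> \<le> length (line_word (max (length a) (length b)) V (Suc i))" by (rule bump_row_props(3))
  also have "\<dots> \<le> (\<Sum>i=1..Suc i. length (line_word (max (length a) (length b)) V i))" by simp
  also have "\<dots> \<le> sum_list a" by (rule length_words_le[OF assms])
  finally show ?thesis .
qed

text \<open>The cells added by line j carry j, so a row of \<open>Q\<close> has as many entries up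
  to j as the same row of \<open>P\<close> has cells after line j. The recording tableau is thus
  given by the same numbers \<open>RR\<close>, with the line in the role of the letter.\<close>

lemma Q_row_props:
  "set (Q_row k V i r) \<subseteq> {1..i} \<and> length (Q_row k V i r) = length (P_row k V i r) \<and>
    (\<forall>j\<le>i. length (filter (\<lambda>x. 1 \<le> x \<and> x \<le> j) (Q_row k V i r)) = length (P_row k V j r))"
proof (induction i)
  case 0
  then show ?case by (simp add: rows_0)
next
  case (Suc i)
  have l: "length (P_row k V i r) \<le> length (P_row k V (Suc i) r)"
    unfolding rows_Suc by (rule insert_word_props(1))
  have s: "set (Q_row k V (Suc i) r) \<subseteq> {1..Suc i}" using Suc unfolding rows_Suc(2) by auto
  have len: "length (Q_row k V (Suc i) r) = length (P_row k V (Suc i) r)"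
    using Suc l unfolding rows_Suc(2) by simp
  have "length (filter (\<lambda>x. 1 \<le> x \<and> x \<le> j) (Q_row k V (Suc i) r)) = length (P_row k V j r)" if "j \<le> Suc i" for j
  proof (cases "j = Suc i")
    case True
    have "filter (\<lambda>x. 1 \<le> x \<and> x \<le> j) (Q_row k V (Suc i) r) = Q_row k V (Suc i) r"
      using s True by (intro filter_True) auto
    then show ?thesis using len True by simp
  next
    case False
    then show ?thesis using Suc that unfolding rows_Suc(2) by simp
  qed
  then show ?case using s len by blast
qed

lemma gt_array_tab_of_rows:
  "gt_array n k (empty_ptn, tab_of_rows R) i j =
     (if 1 \<le> i \<and> i \<le> n \<and> j \<le> k then int (length (filter (\<lambda>x. 1 \<le> x \<and> x \<le> j) (row R (i - 1)))) else 0)"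
proof (cases "1 \<le> i")
  case True
  let ?xs = "row R (i - 1)"
  have "{c. 1 \<le> tab_of_rows R i c \<and> tab_of_rows R i c \<le> j} = Suc ` {c. c < length ?xs \<and> 1 \<le> ?xs ! c \<and> ?xs ! c \<le> j}"
    (is "?L = ?R")
  proof (rule set_eqI)
    fix c
    show "c \<in> ?L \<longleftrightarrow> c \<in> ?R"
      using True by (cases c) (auto simp: tab_of_rows_def row_def image_iff split: if_splits)
  qed
  then have "card ?L = card {c. c < length ?xs \<and> 1 \<le> ?xs ! c \<and> ?xs ! c \<le> j}"
    by (simp add: card_image)
  then show ?thesis using True
    by (simp add: gt_array_def empty_ptn_def length_filter_conv_card)
qed (simp add: gt_array_def)

lemma RSK_eq: "RSK k V = ((empty_ptn, tab_of_rows (fst (rsk_state k V k))), (empty_ptn, tab_of_rows (snd (rsk_state k V k))))"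
proof -
  have 1: "fold (\<lambda>(i, j) (P, Q). rsk_insert i j P Q) (concat (map (\<lambda>j. replicate (V i j) (i, j)) js)) s
     = fold (\<lambda>j (P, Q). rsk_insert i j P Q) (concat (map (\<lambda>j. replicate (V i j) j) js)) s" for i js s
  proof -
    have "concat (map (\<lambda>j. replicate (V i j) (i, j)) js) = map (Pair i) (concat (map (\<lambda>j. replicate (V i j) j) js))"
      by (induction js) auto
    then show ?thesis by (simp add: fold_map comp_def)
  qed
  have "fold (\<lambda>(i, j) (P, Q). rsk_insert i j P Q) (concat (map (\<lambda>i. concat (map (\<lambda>j. replicate (V i j) (i, j)) [1..<Suc k])) is)) s
     = fold (\<lambda>i. rsk_word i (line_word k V i)) is s" for "is" s
    by (induction "is" arbitrary: s) (simp_all add: 1 rsk_word_def line_word_def del: upt_Suc)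
  then show ?thesis
    by (simp add: RSK_def biword_def rsk_state_def case_prod_beta del: upt_Suc)
qed

theorem gt_array_RSK:
  "gt_array k k (fst (RSK k V)) i j = (if 1 \<le> i \<and> i \<le> k \<and> j \<le> k then int (RR k V k (i - 1) j) else 0)"
  "gt_array k k (snd (RSK k V)) i j = (if 1 \<le> i \<and> i \<le> k \<and> j \<le> k then int (RR k V j (i - 1) k) else 0)"
proof -
  have "filter (\<lambda>x. 1 \<le> x \<and> x \<le> j) (P_row k V k r) = filter (\<lambda>x. x \<le> j) (P_row k V k r)" for r
    using P_row_props(2)[of k V k r] by (intro filter_cong) auto
  then show "gt_array k k (fst (RSK k V)) i j = (if 1 \<le> i \<and> i \<le> k \<and> j \<le> k then int (RR k V k (i - 1) j) else 0)"
    by (simp add: RSK_eq gt_array_tab_of_rows P_row_def RR_def cnt_def)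
  have "RR k V j r k = length (P_row k V j r)" for r
    unfolding RR_def using P_row_props(2)[of k V j r] by (intro cnt_all) auto
  then show "gt_array k k (snd (RSK k V)) i j = (if 1 \<le> i \<and> i \<le> k \<and> j \<le> k then int (RR k V j (i - 1) k) else 0)"
    using Q_row_props[of k V k "i - 1"] by (simp add: RSK_eq gt_array_tab_of_rows Q_row_def)
qed

section \<open>A cost-aware program logic\<close>

text \<open>
  Instead of bit operations we count elementary steps; as long as all operands are bounded by \<open>B\<close>,
  a step costs at most \<open>1 + 2 * bits B\<close>.
\<close>

definition wp :: "int \<Rightarrow> com \<Rightarrow> (nat \<Rightarrow> store \<Rightarrow> bool) \<Rightarrow> store \<Rightarrow> bool" where
  "wp B p Q s \<longleftrightarrow> (\<exists>t n s'. run p s t s' \<and> t \<le> n * (1 + 2 * bits B) \<and> Q n s')"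

lemma bits_mono: "\<bar>z\<bar> \<le> B \<Longrightarrow> bits z \<le> bits B"
  unfolding bits_def bitlen_def by (auto intro!: floorlog_mono nat_mono)

lemma wp_I: "run p s t s' \<Longrightarrow> t \<le> n * (1 + 2 * bits B) \<Longrightarrow> Q n s' \<Longrightarrow> wp B p Q s"
  by (auto simp: wp_def)

lemma wp_conseq: "wp B p Q s \<Longrightarrow> (\<And>n s'. Q n s' \<Longrightarrow> Q' n s') \<Longrightarrow> wp B p Q' s"
  unfolding wp_def by blast

lemma wp_Skip: "Q 1 s \<Longrightarrow> wp B Skip Q s"
  by (rule wp_I[OF run.intros(1)]) auto

lemma wp_IdxZero: "Q 1 (set_idx u 0 s) \<Longrightarrow> wp B (IdxZero u) Q s"
  by (rule wp_I[OF run.intros(2)]) auto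

lemma wp_IdxCopy: "Q 1 (set_idx u (idx s v) s) \<Longrightarrow> wp B (IdxCopy u v) Q s"
  by (rule wp_I[OF run.intros(3)]) auto

lemma wp_IdxSucc: "Q 1 (set_idx u (idx s u + 1) s) \<Longrightarrow> wp B (IdxSucc u) Q s"
  by (rule wp_I[OF run.intros(4)]) auto

lemma wp_IdxPred: "Q 1 (set_idx u (idx s u - 1) s) \<Longrightarrow> wp B (IdxPred u) Q s"
  by (rule wp_I[OF run.intros(5)]) auto

lemma wp_Const: "\<bar>z\<bar> \<le> B \<Longrightarrow> Q 1 (set_val x z s) \<Longrightarrow> wp B (Const x z) Q s"
  by (rule wp_I[OF run.intros(6)]) (auto dest: bits_mono)

lemma wp_Copy: "\<bar>val s y\<bar> \<le> B \<Longrightarrow> Q 1 (set_val x (val s y) s) \<Longrightarrow> wp B (Copy x y) Q s"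
  by (rule wp_I[OF run.intros(7)]) (auto dest: bits_mono)

lemma wp_Add: "\<bar>val s y\<bar> \<le> B \<Longrightarrow> \<bar>val s z\<bar> \<le> B \<Longrightarrow> Q 1 (set_val x (val s y + val s z) s) \<Longrightarrow> wp B (Add x y z) Q s"
  using bits_mono[of "val s y" B] bits_mono[of "val s z" B]
  by (intro wp_I[where n = 1, OF run.intros(8)]) auto

lemma wp_Sub: "\<bar>val s y\<bar> \<le> B \<Longrightarrow> \<bar>val s z\<bar> \<le> B \<Longrightarrow> Q 1 (set_val x (val s y - val s z) s) \<Longrightarrow> wp B (Sub x y z) Q s"
  using bits_mono[of "val s y" B] bits_mono[of "val s z" B]
  by (intro wp_I[where n = 1, OF run.intros(9)]) auto

lemma wp_Seq:
  assumes "wp B p (\<lambda>n s'. wp B q (\<lambda>n'. Q (n + n')) s') s"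
  shows "wp B (Seq p q) Q s"
proof -
  obtain t n s' t' n' s'' where "run p s t s'" "t \<le> n * (1 + 2 * bits B)" "run q s' t' s''"
    "t' \<le> n' * (1 + 2 * bits B)" "Q (n + n') s''" using assms unfolding wp_def by blast
  then show ?thesis by (intro wp_I[OF run.intros(10)]) (auto simp: algebra_simps)
qed

fun test_le :: "int \<Rightarrow> test \<Rightarrow> store \<Rightarrow> bool" where
  "test_le B (IdxLess u v) s \<longleftrightarrow> True"
| "test_le B (ValLess x y) s \<longleftrightarrow> \<bar>val s x\<bar> \<le> B \<and> \<bar>val s y\<bar> \<le> B"

lemma test_cost_le: "test_le B b s \<Longrightarrow> test_cost b s \<le> 1 + 2 * bits B"
proof (cases b)
  case (ValLess x y)
  assume "test_le B b s"
  then show ?thesis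
    using ValLess bits_mono[of "val s x" B] bits_mono[of "val s y" B] by simp
qed simp

lemma wp_Cond:
  assumes "test_le B b s" "holds b s \<Longrightarrow> wp B p (\<lambda>n. Q (Suc n)) s" "\<not> holds b s \<Longrightarrow> wp B q (\<lambda>n. Q (Suc n)) s"
  shows "wp B (Cond b p q) Q s"
proof (cases "holds b s")
  case True
  obtain t n s' where "run p s t s'" "t \<le> n * (1 + 2 * bits B)" "Q (Suc n) s'"
    using assms(2)[OF True] unfolding wp_def by blast
  then show ?thesis using test_cost_le[OF assms(1)]
    by (intro wp_I[OF run.intros(11)[OF True]]) auto
next
  case False
  obtain t n s' where "run q s t s'" "t \<le> n * (1 + 2 * bits B)" "Q (Suc n) s'"
    using assms(3)[OF False] unfolding wp_def by blast
  then show ?thesis using test_cost_le[OF assms(1)]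
    by (intro wp_I[OF run.intros(12)[OF False]]) auto
qed

lemmas wp_intros = wp_Skip wp_IdxZero wp_IdxCopy wp_IdxSucc wp_IdxPred wp_Const wp_Copy wp_Add wp_Sub wp_Seq wp_Cond

lemma set_idx_sel [simp]: "idx (set_idx u n s) = (idx s)(u := n)" "mem (set_idx u n s) = mem s"
  by simp_all

lemma set_val_sel [simp]: "idx (set_val r z s) = idx s"
  "mem (set_val (Ref x u v) z s) = (mem s)(x := (mem s x)(idx s u := (mem s x (idx s u))(idx s v := z)))"
  by (cases r) simp_all

declare set_idx.simps [simp del] set_val.simps [simp del]

text \<open>A syntax-directed version of \<open>wp\<close> that the simplifier can unfold on
  loop-free code; loops remain as \<open>wp\<close> goals.\<close>

fun vc :: "int \<Rightarrow> com \<Rightarrow> (nat \<Rightarrow> store \<Rightarrow> bool) \<Rightarrow> store \<Rightarrow> bool" where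
  "vc B Skip Q s \<longleftrightarrow> Q 1 s"
| "vc B (IdxZero u) Q s \<longleftrightarrow> Q 1 (set_idx u 0 s)"
| "vc B (IdxCopy u v) Q s \<longleftrightarrow> Q 1 (set_idx u (idx s v) s)"
| "vc B (IdxSucc u) Q s \<longleftrightarrow> Q 1 (set_idx u (idx s u + 1) s)"
| "vc B (IdxPred u) Q s \<longleftrightarrow> Q 1 (set_idx u (idx s u - 1) s)"
| "vc B (Const x z) Q s \<longleftrightarrow> \<bar>z\<bar> \<le> B \<and> Q 1 (set_val x z s)"
| "vc B (Copy x y) Q s \<longleftrightarrow> \<bar>val s y\<bar> \<le> B \<and> Q 1 (set_val x (val s y) s)"
| "vc B (Add x y z) Q s \<longleftrightarrow> \<bar>val s y\<bar> \<le> B \<and> \<bar>val s z\<bar> \<le> B \<and> Q 1 (set_val x (val s y + val s z) s)"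
| "vc B (Sub x y z) Q s \<longleftrightarrow> \<bar>val s y\<bar> \<le> B \<and> \<bar>val s z\<bar> \<le> B \<and> Q 1 (set_val x (val s y - val s z) s)"
| "vc B (Seq p q) Q s \<longleftrightarrow> vc B p (\<lambda>n s'. vc B q (\<lambda>n'. Q (n + n')) s') s"
| "vc B (Cond b p q) Q s \<longleftrightarrow> test_le B b s \<and>
     (if holds b s then vc B p (\<lambda>n. Q (Suc n)) s else vc B q (\<lambda>n. Q (Suc n)) s)"
| "vc B (While b p) Q s \<longleftrightarrow> wp B (While b p) Q s"

lemma vc_wp: "vc B p Q s \<Longrightarrow> wp B p Q s"
proof (induction p arbitrary: Q s)
  case (Seq p q)
  have "wp B p (\<lambda>n s'. vc B q (\<lambda>n'. Q (n + n')) s') s" using Seq by simp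
  then have "wp B p (\<lambda>n s'. wp B q (\<lambda>n'. Q (n + n')) s') s" using Seq.IH(2) by (blast intro: wp_conseq)
  then show ?case by (rule wp_Seq)
next
  case (Cond b p q)
  then show ?case by (intro wp_Cond) auto
qed (auto intro: wp_intros)

text \<open>A round takes the steps of the body, one for the test and one for the counter; one more
  test ends the loop. The invariant speaks of the store after the increment.\<close>

lemma wp_up:
  assumes step: "\<And>i s. i < N \<Longrightarrow> I i s \<Longrightarrow> idx s u = i \<Longrightarrow> idx s v = N \<Longrightarrow>
      wp B p (\<lambda>n s'. n \<le> c \<and> idx s' u = i \<and> idx s' v = N \<and> I (Suc i) (set_idx u (Suc i) s')) s"
    and uv: "u \<noteq> v" and start: "I i s" "idx s u = i" "idx s v = N" "i \<le> N"
  shows "wp B (While (IdxLess u v) (Seq p (IdxSucc u))) (\<lambda>n s'. n \<le> (N - i) * (c + 2) + 1 \<and> I N s' \<and> idx s' u = N) s"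
  using start
proof (induction "N - i" arbitrary: i s)
  case 0
  then show ?case by (intro wp_I[where n = 1, OF run.intros(13)]) auto
next
  case (Suc x)
  then have i: "i < N" "x = N - Suc i" by auto
  obtain t n s1 where r1: "run p s t s1" "t \<le> n * (1 + 2 * bits B)" "n \<le> c" "idx s1 u = i" "idx s1 v = N"
    "I (Suc i) (set_idx u (Suc i) s1)"
    using step[OF i(1) Suc.prems(1-3)] unfolding wp_def by blast
  let ?s = "set_idx u (Suc i) s1"
  obtain t' n' s2 where r2: "run (While (IdxLess u v) (Seq p (IdxSucc u))) ?s t' s2" "t' \<le> n' * (1 + 2 * bits B)"
    "n' \<le> (N - Suc i) * (c + 2) + 1" "I N s2" "idx s2 u = N"
    using Suc.hyps(1)[OF i(2) r1(6)] r1 uv i(1) unfolding wp_def by auto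
  have h: "holds (IdxLess u v) s" using Suc.prems i by simp
  have "run (IdxSucc u) s1 1 ?s" using run.intros(4)[of u s1] r1(4) by simp
  from run.intros(14)[OF h run.intros(10)[OF r1(1) this] r2(1)]
  have 1: "run (While (IdxLess u v) (Seq p (IdxSucc u))) s (1 + (t + 1) + t') s2" by simp
  have 2: "1 + (t + 1) + t' \<le> (n + n' + 2) * (1 + 2 * bits B)"
    using r1(2) r2(2) by (simp add: algebra_simps)
  have "n + n' + 2 \<le> (N - i) * (c + 2) + 1"
  proof -
    have "N - i = Suc (N - Suc i)" using i by simp
    then show ?thesis using r1(3) r2(3) by simp
  qed
  then show ?case using r2(4,5) by (intro wp_I[OF 1 2]) simp
qed

text \<open>A further level of nesting raises the exponent by one. Of the 3 additional units two pay
  for test and counter of each round, the third one for the final test.\<close>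

lemma loop_count:
  fixes K :: nat
  assumes "n \<le> (N - i) * (c * K ^ e + 2) + 1" "N \<le> K" "1 \<le> K"
  shows "n \<le> (c + 3) * K ^ Suc e"
proof -
  have e: "1 \<le> K ^ e" "1 \<le> K * K ^ e" using assms(3) by simp_all
  have "c * K ^ e + 2 \<le> (c + 2) * K ^ e" unfolding distrib_right using e(1) by linarith
  then have "(N - i) * (c * K ^ e + 2) \<le> K * ((c + 2) * K ^ e)"
    using assms(2) by (intro mult_le_mono) auto
  moreover have "(c + 3) * K ^ Suc e = K * ((c + 2) * K ^ e) + K * K ^ e" by (simp add: algebra_simps)
  ultimately show ?thesis using assms(1) e(2) by linarith
qed

lemma wp_up_K:
  assumes "1 \<le> K" "N \<le> K"
    and step: "\<And>i s. i < N \<Longrightarrow> I i s \<Longrightarrow> idx s u = i \<Longrightarrow> idx s v = N \<Longrightarrow>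
      wp B p (\<lambda>n s'. n \<le> c * K ^ e \<and> idx s' u = i \<and> idx s' v = N \<and> I (Suc i) (set_idx u (Suc i) s')) s"
    and uv: "u \<noteq> v" and start: "I i s" "idx s u = i" "idx s v = N" "i \<le> N"
  shows "wp B (While (IdxLess u v) (Seq p (IdxSucc u))) (\<lambda>n s'. n \<le> (c + 3) * K ^ Suc e \<and> I N s' \<and> idx s' u = N) s"
  by (rule wp_conseq[OF wp_up[OF step uv start]]) (use loop_count assms(1,2) in auto)

section \<open>Frame conditions and arithmetic with subscripts\<close>

fun written_idx :: "com \<Rightarrow> nat set" where
  "written_idx (IdxZero u) = {u}"
| "written_idx (IdxCopy u v) = {u}"
| "written_idx (IdxSucc u) = {u}"
| "written_idx (IdxPred u) = {u}"
| "written_idx (Seq p q) = written_idx p \<union> written_idx q"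
| "written_idx (Cond b p q) = written_idx p \<union> written_idx q"
| "written_idx (While b p) = written_idx p"
| "written_idx _ = {}"

fun arr_of :: "ref \<Rightarrow> nat" where
  "arr_of (Ref x u v) = x"

fun written_arr :: "com \<Rightarrow> nat set" where
  "written_arr (Const x z) = {arr_of x}"
| "written_arr (Copy x y) = {arr_of x}"
| "written_arr (Add x y z) = {arr_of x}"
| "written_arr (Sub x y z) = {arr_of x}"
| "written_arr (Seq p q) = written_arr p \<union> written_arr q"
| "written_arr (Cond b p q) = written_arr p \<union> written_arr q"
| "written_arr (While b p) = written_arr p"
| "written_arr _ = {}"

definition same :: "nat set \<Rightarrow> nat set \<Rightarrow> store \<Rightarrow> store \<Rightarrow> bool" where
  "same U X s s' \<longleftrightarrow> (\<forall>u. u \<notin> U \<longrightarrow> idx s' u = idx s u) \<and> (\<forall>x. x \<notin> X \<longrightarrow> mem s' x = mem s x)"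

lemma same_idx: "same U X s s' \<Longrightarrow> u \<notin> U \<Longrightarrow> idx s' u = idx s u"
  and same_mem: "same U X s s' \<Longrightarrow> x \<notin> X \<Longrightarrow> mem s' x = mem s x"
  by (auto simp: same_def)

lemma same_refl [simp]: "same U X s s"
  by (simp add: same_def)

lemma run_frame: "run p s t s' \<Longrightarrow> same (written_idx p) (written_arr p) s s'"
proof (induction rule: run.induct)
  case (6 x z s) then show ?case by (cases x) (auto simp: same_def)
next
  case (7 x y s) then show ?case by (cases x) (auto simp: same_def)
next
  case (8 x y z s) then show ?case by (cases x) (auto simp: same_def)
next
  case (9 x y z s) then show ?case by (cases x) (auto simp: same_def)
qed (auto simp: same_def)

lemma wp_frame: "wp B p Q s \<Longrightarrow> wp B p (\<lambda>n s'. Q n s' \<and> same (written_idx p) (written_arr p) s s') s"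
  unfolding wp_def using run_frame by blast

lemma wp_framed:
  "wp B p Q s \<Longrightarrow> (\<And>n s'. Q n s' \<Longrightarrow> same (written_idx p) (written_arr p) s s' \<Longrightarrow> Q' n s') \<Longrightarrow> wp B p Q' s"
  using wp_frame wp_conseq by (metis (mono_tags, lifting))

text \<open>Addition by repeated increment, as registers admit no other arithmetic; register 24 is
  the counter.\<close>

definition add_idx :: "nat \<Rightarrow> nat \<Rightarrow> nat \<Rightarrow> com" where
  "add_idx q u v = Seq (IdxCopy q u) (Seq (IdxZero 24) (While (IdxLess 24 v) (Seq (IdxSucc q) (IdxSucc 24))))"

definition sub_idx :: "nat \<Rightarrow> nat \<Rightarrow> nat \<Rightarrow> com" where
  "sub_idx q u v = Seq (IdxCopy q u) (Seq (IdxZero 24) (While (IdxLess 24 v) (Seq (IdxPred q) (IdxSucc 24))))"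

lemma written_add_idx [simp]: "written_idx (add_idx q u v) = {q, 24}" "written_arr (add_idx q u v) = {}"
  and written_sub_idx [simp]: "written_idx (sub_idx q u v) = {q, 24}" "written_arr (sub_idx q u v) = {}"
  by (auto simp: add_idx_def sub_idx_def)

lemma wp_add_idx:
  assumes "1 \<le> K" "idx s v \<le> K" "q \<noteq> v" "q \<noteq> 24" "v \<noteq> 24" "u \<noteq> 24"
  shows "wp B (add_idx q u v) (\<lambda>n t. n \<le> 6 * K \<and> idx t q = idx s u + idx s v) s"
  unfolding add_idx_def
proof (rule wp_intros)+
  let ?s = "set_idx 24 0 (set_idx q (idx s u) s)"
  show "wp B (While (IdxLess 24 v) (Seq (IdxSucc q) (IdxSucc 24)))
     (\<lambda>n' t. 1 + (1 + n') \<le> 6 * K \<and> idx t q = idx s u + idx s v) ?s"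
  proof (rule wp_conseq)
    show "wp B (While (IdxLess 24 v) (Seq (IdxSucc q) (IdxSucc 24)))
       (\<lambda>n s'. n \<le> (1 + 3) * K ^ Suc 0 \<and> idx s' q = idx s u + idx s v \<and> idx s' 24 = idx s v) ?s"
      by (rule wp_up_K[where i = 0 and N = "idx s v" and I = "\<lambda>i s'. idx s' q = idx s u + i"])
        (use assms in \<open>auto intro!: vc_wp\<close>)
  qed (use assms(1) in auto)
qed

lemma wp_sub_idx:
  assumes "1 \<le> K" "idx s v \<le> K" "q \<noteq> v" "q \<noteq> 24" "v \<noteq> 24" "u \<noteq> 24"
  shows "wp B (sub_idx q u v) (\<lambda>n t. n \<le> 6 * K \<and> idx t q = idx s u - idx s v) s"
  unfolding sub_idx_def
proof (rule wp_intros)+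
  let ?s = "set_idx 24 0 (set_idx q (idx s u) s)"
  show "wp B (While (IdxLess 24 v) (Seq (IdxPred q) (IdxSucc 24)))
     (\<lambda>n' t. 1 + (1 + n') \<le> 6 * K \<and> idx t q = idx s u - idx s v) ?s"
  proof (rule wp_conseq)
    show "wp B (While (IdxLess 24 v) (Seq (IdxPred q) (IdxSucc 24)))
       (\<lambda>n s'. n \<le> (1 + 3) * K ^ Suc 0 \<and> idx s' q = idx s u - idx s v \<and> idx s' 24 = idx s v) ?s"
      by (rule wp_up_K[where i = 0 and N = "idx s v" and I = "\<lambda>i s'. idx s' q = idx s u - i"])
        (use assms in \<open>auto intro!: vc_wp\<close>)
  qed (use assms(1) in auto)
qed

section \<open>Filling an array\<close>

definition fill :: "com \<Rightarrow> com" where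
  "fill body = Seq (IdxZero 20) (While (IdxLess 20 22) (Seq
     (Seq (IdxZero 21) (While (IdxLess 21 23) (Seq body (IdxSucc 21)))) (IdxSucc 20)))"

lemma written_fill [simp]: "written_idx (fill body) = written_idx body \<union> {20, 21}" "written_arr (fill body) = written_arr body"
  by (auto simp: fill_def)

text \<open>The body may take linearly many steps, as a computed subscript requires; with at most
  \<open>K ^ 2\<close> entries the total is of order \<open>K ^ 3\<close>.\<close>

lemma wp_fill:
  assumes K: "1 \<le> K" "I \<le> K" "J \<le> K" and s: "idx s 22 = I" "idx s 23 = J"
    and disj: "written_idx body \<inter> {20, 21, 22, 23} = {}"
    and body: "\<And>s' i p. i < I \<Longrightarrow> p < J \<Longrightarrow> same (written_idx body \<union> {20, 21}) (written_arr body) s s' \<Longrightarrow>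
      idx s' 20 = i \<Longrightarrow> idx s' 21 = p \<Longrightarrow>
      wp B body (\<lambda>n t. n \<le> c * K \<and> mem t X = (mem s' X)(i := (mem s' X i)(p := f i p))) s'"
  shows "wp B (fill body) (\<lambda>n t. n \<le> (c + 8) * K ^ 3 \<and>
     (\<forall>i p. mem t X i p = (if i < I \<and> p < J then f i p else mem s X i p))) s"
proof -
  let ?U = "written_idx body \<union> {20, 21}" and ?A = "written_arr body"
  define Inv where "Inv i p s' \<longleftrightarrow> same ?U ?A s s' \<and>
    (\<forall>i' p'. mem s' X i' p' = (if (i' < i \<or> i' = i \<and> p' < p) \<and> i' < I \<and> p' < J then f i' p' else mem s X i' p'))" for i p s'
  have inner: "wp B (While (IdxLess 21 23) (Seq body (IdxSucc 21)))
     (\<lambda>n t. n \<le> (c + 3) * K ^ Suc 1 \<and> (Inv i J t \<and> idx t 20 = i) \<and> idx t 21 = J) s'"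
    if i: "i < I" and s': "Inv i 0 s'" "idx s' 20 = i" "idx s' 21 = 0" for i s'
  proof (rule wp_up_K[where i = 0 and N = J and I = "\<lambda>p t. Inv i p t \<and> idx t 20 = i"])
    fix p t assume p: "p < J" and t: "Inv i p t \<and> idx t 20 = i" "idx t 21 = p" "idx t 23 = J"
    have sm: "same ?U ?A s t" using t by (simp add: Inv_def)
    show "wp B body (\<lambda>n s'. n \<le> c * K ^ 1 \<and> idx s' 21 = p \<and> idx s' 23 = J \<and>
       Inv i (Suc p) (set_idx 21 (Suc p) s') \<and> idx (set_idx 21 (Suc p) s') 20 = i) t"
    proof (rule wp_framed[OF body[OF i p sm]])
      fix n s'' assume *: "n \<le> c * K \<and> mem s'' X = (mem t X)(i := (mem t X i)(p := f i p))"
        "same (written_idx body) (written_arr body) t s''"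
      have "same ?U ?A s (set_idx 21 (Suc p) s'')"
        using sm *(2) by (auto simp: same_def)
      moreover have "20 \<notin> written_idx body" "21 \<notin> written_idx body" "23 \<notin> written_idx body" using disj by auto
      then have "idx s'' 20 = i" "idx s'' 21 = p" "idx s'' 23 = J" using same_idx[OF *(2)] t by auto
      moreover have "mem s'' X i' p' = (if (i' < i \<or> i' = i \<and> p' < Suc p) \<and> i' < I \<and> p' < J then f i' p' else mem s X i' p')" for i' p'
        using * t(1) i p by (auto simp: Inv_def less_Suc_eq)
      ultimately show "n \<le> c * K ^ 1 \<and> idx s'' 21 = p \<and> idx s'' 23 = J \<and>
       Inv i (Suc p) (set_idx 21 (Suc p) s'') \<and> idx (set_idx 21 (Suc p) s'') 20 = i"
        using * by (simp add: Inv_def)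
    qed (use t in auto)
  next
    have "23 \<notin> ?U" using disj by auto
    then show "idx s' 23 = J" using same_idx[of ?U ?A s s' 23] s' s by (simp add: Inv_def)
  qed (use K s' in auto)
  have "wp B (While (IdxLess 20 22) (Seq (Seq (IdxZero 21) (While (IdxLess 21 23) (Seq body (IdxSucc 21)))) (IdxSucc 20)))
     (\<lambda>n t. n \<le> (c + 4 + 3) * K ^ Suc 2 \<and> Inv I 0 t \<and> idx t 20 = I) (set_idx 20 0 s)"
  proof (rule wp_up_K[where i = 0 and N = I and I = "\<lambda>i t. Inv i 0 t"])
    fix i t assume i: "i < I" and t: "Inv i 0 t" "idx t 20 = i" "idx t 22 = I"
    have t': "Inv i 0 (set_idx 21 0 t)" "idx (set_idx 21 0 t) 20 = i" "idx (set_idx 21 0 t) 21 = 0"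
      using t by (auto simp: Inv_def same_def)
    have k: "1 \<le> K ^ 2" using K by simp
    show "wp B (Seq (IdxZero 21) (While (IdxLess 21 23) (Seq body (IdxSucc 21))))
       (\<lambda>n s'. n \<le> (c + 4) * K ^ 2 \<and> idx s' 20 = i \<and> idx s' 22 = I \<and> Inv (Suc i) 0 (set_idx 20 (Suc i) s')) t"
    proof (rule wp_Seq, rule wp_IdxZero, rule wp_conseq[OF inner[OF i t']])
      fix n s' assume *: "n \<le> (c + 3) * K ^ Suc 1 \<and> (Inv i J s' \<and> idx s' 20 = i) \<and> idx s' 21 = J"
      have "22 \<notin> ?U" using disj by auto
      then have "idx s' 22 = I" using same_idx[of ?U ?A s s' 22] * s by (simp add: Inv_def)
      moreover have "Inv (Suc i) 0 (set_idx 20 (Suc i) s')"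
        using * by (auto simp: Inv_def same_def less_Suc_eq)
      moreover have "(c + 3) * K ^ Suc 1 + K ^ 2 = (c + 4) * K ^ 2" by (simp add: power2_eq_square algebra_simps)
      then have "1 + n \<le> (c + 4) * K ^ 2" using * k by linarith
      ultimately show "1 + n \<le> (c + 4) * K ^ 2 \<and> idx s' 20 = i \<and> idx s' 22 = I \<and> Inv (Suc i) 0 (set_idx 20 (Suc i) s')"
        using * by simp
    qed
  next
    show "Inv 0 0 (set_idx 20 0 s)" by (auto simp: Inv_def same_def)
  qed (use K s in auto)
  then have "wp B (While (IdxLess 20 22) (Seq (Seq (IdxZero 21) (While (IdxLess 21 23) (Seq body (IdxSucc 21)))) (IdxSucc 20)))
     (\<lambda>n t. 1 + n \<le> (c + 8) * K ^ 3 \<and>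
     (\<forall>i p. mem t X i p = (if i < I \<and> p < J then f i p else mem s X i p))) (set_idx 20 0 s)"
  proof (rule wp_conseq)
    fix n t assume *: "n \<le> (c + 4 + 3) * K ^ Suc 2 \<and> Inv I 0 t \<and> idx t 20 = I"
    have "1 \<le> K ^ 3" using K by simp
    moreover have "(c + 4 + 3) * K ^ Suc 2 + K ^ 3 = (c + 8) * K ^ 3" by (simp add: eval_nat_numeral algebra_simps)
    ultimately have "1 + n \<le> (c + 8) * K ^ 3" using * by linarith
    then show "1 + n \<le> (c + 8) * K ^ 3 \<and> (\<forall>i p. mem t X i p = (if i < I \<and> p < J then f i p else mem s X i p))"
      using * by (auto simp: Inv_def)
  qed
  then show ?thesis unfolding fill_def by (intro wp_Seq wp_IdxZero)
qed

section \<open>The switching program\<close>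

text \<open>
  Array 10 always holds the current chain, row \<open>i\<close> of shape \<open>p\<close> at position \<open>(i, p)\<close>, and register 10
  its number of rows; register 13 is never written and serves as a subscript for scratch variables.
\<close>

definition toggle_cell :: com where
  "toggle_cell =
     Seq (Cond (ValLess (Ref 10 36 32) (Ref 10 35 33)) (Copy (Ref 11 13 13) (Ref 10 36 32)) (Copy (Ref 11 13 13) (Ref 10 35 33)))
    (Seq (Cond (ValLess (Ref 10 35 32) (Ref 10 37 33)) (Copy (Ref 12 13 13) (Ref 10 37 33)) (Copy (Ref 12 13 13) (Ref 10 35 32)))
    (Seq (Add (Ref 11 13 13) (Ref 11 13 13) (Ref 12 13 13))
    (Seq (Sub (Ref 10 35 31) (Ref 11 13 13) (Ref 10 35 31))
    (Seq (IdxSucc 35) (IdxSucc 37)))))"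

text \<open>Registers 36, 35, 37 run through the rows r, r + 1, r + 2, while 31, 32, 33 hold the
  columns p, p - 1, p + 1.\<close>

definition toggle_column :: com where
  "toggle_column = Seq (IdxZero 36) (Seq (IdxZero 35) (Seq (IdxSucc 35) (Seq (IdxCopy 37 35) (Seq (IdxSucc 37)
     (While (IdxLess 36 10) (Seq toggle_cell (IdxSucc 36)))))))"

definition pass_prog :: com where
  "pass_prog = Seq (IdxCopy 31 38) (Seq (IdxCopy 32 38) (Seq (IdxPred 32) (Seq (IdxCopy 33 38) (Seq (IdxSucc 33)
     (Seq (IdxZero 34) (While (IdxLess 34 12)
       (Seq (Seq toggle_column (Seq (IdxSucc 31) (Seq (IdxSucc 32) (IdxSucc 33)))) (IdxSucc 34))))))))"

definition switch_prog :: com where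
  "switch_prog = Seq (IdxCopy 38 11) (Seq (IdxZero 30) (While (IdxLess 30 11)
     (Seq (Seq pass_prog (IdxPred 38)) (IdxSucc 30))))"

lemma written_toggle_column [simp]: "written_idx toggle_column = {35, 36, 37}" "written_arr toggle_column = {10, 11, 12}"
  by (auto simp: toggle_column_def toggle_cell_def)

lemma written_pass_prog [simp]: "written_idx pass_prog = {31, 32, 33, 34, 35, 36, 37}" "written_arr pass_prog = {10, 11, 12}"
  by (auto simp: pass_prog_def)

lemma written_switch_prog [simp]:
  "written_idx switch_prog = {30, 31, 32, 33, 34, 35, 36, 37, 38}" "written_arr switch_prog = {10, 11, 12}"
  by (auto simp: switch_prog_def)

text \<open>The rows 0 and n + 1 are included: toggling row 1 reads the bound in row 0, and toggling
  row n reads the zero in row n + 1.\<close>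

definition stores :: "nat \<Rightarrow> nat \<Rightarrow> nat \<Rightarrow> (nat \<Rightarrow> ptn) \<Rightarrow> store \<Rightarrow> bool" where
  "stores x n L D s \<longleftrightarrow> (\<forall>i\<le>Suc n. \<forall>p\<le>L. mem s x i p = int (D p i))"

text \<open>The column can be overwritten in place, since a toggle reads it only in the row being
  changed. Operands reach twice the bound M because minimum and maximum are added before the
  subtraction.\<close>

lemma wp_toggle_column:
  assumes D: "chain M n L D" and p: "1 \<le> p" "p < L" and K: "1 \<le> K" "n \<le> K" and B: "2 * int M \<le> B"
    and s: "stores 10 n L D s" "idx s 10 = n" "idx s 31 = p" "idx s 32 = p - 1" "idx s 33 = Suc p"
  shows "wp B toggle_column (\<lambda>m t. m \<le> 18 * K \<and> stores 10 n L (tog p D) t) s"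
proof -
  define T where "T = toggle (D (p - 1)) (D p) (D (Suc p))"
  define Inv where "Inv r t \<longleftrightarrow> same {35, 36, 37} {10, 11, 12} s t \<and> idx t 35 = Suc r \<and> idx t 37 = Suc (Suc r) \<and>
     (\<forall>i\<le>Suc n. \<forall>q\<le>L. mem t 10 i q = (if q = p \<and> 1 \<le> i \<and> i \<le> r then int (T i) else int (D q i)))" for r t
  have le: "int (D q i) \<le> int M" if "q \<le> L" for q i using chain_le[OF D that] by simp
  have I: "interlace (D (p - 1)) (D p)" "interlace (D p) (D (Suc p))"
    using chain_interlace[OF D, of "p - 1"] chain_interlace[OF D, of p] p by auto
  have step: "wp B toggle_cell (\<lambda>m t'. m \<le> 8 * K ^ 0 \<and> idx t' 36 = r \<and> idx t' 10 = n \<and> Inv (Suc r) (set_idx 36 (Suc r) t')) t"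
    if r: "r < n" and t: "Inv r t" "idx t 36 = r" "idx t 10 = n" for r t
  proof -
    have sm: "same {35, 36, 37} {10, 11, 12} s t" using t by (simp add: Inv_def)
    have ix: "idx t 31 = p" "idx t 32 = p - 1" "idx t 33 = Suc p" "idx t 35 = Suc r" "idx t 37 = Suc (Suc r)"
      using same_idx[OF sm, of 31] same_idx[OF sm, of 32] same_idx[OF sm, of 33] s t by (auto simp: Inv_def)
    have m: "mem t 10 i q = (if q = p \<and> 1 \<le> i \<and> i \<le> r then int (T i) else int (D q i))" if "i \<le> Suc n" "q \<le> L" for i q
      using t(1) that by (simp add: Inv_def)
    have m1: "mem t 10 r (p - 1) = int (D (p - 1) r)" using m[of r "p - 1"] r p by auto
    have m2: "mem t 10 (Suc r) (Suc p) = int (D (Suc p) (Suc r))" using m[of "Suc r" "Suc p"] r p by auto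
    have m3: "mem t 10 (Suc r) (p - 1) = int (D (p - 1) (Suc r))" using m[of "Suc r" "p - 1"] r p by auto
    have m4: "mem t 10 (Suc (Suc r)) (Suc p) = int (D (Suc p) (Suc (Suc r)))" using m[of "Suc (Suc r)" "Suc p"] r p by auto
    have m5: "mem t 10 (Suc r) p = int (D p (Suc r))" using m[of "Suc r" p] r p by auto
    have b: "int (D (p - 1) r) \<le> int M" "int (D (Suc p) (Suc r)) \<le> int M" "int (D (p - 1) (Suc r)) \<le> int M"
      "int (D (Suc p) (Suc (Suc r))) \<le> int M" "int (D p (Suc r)) \<le> int M" using le p by auto
    have T: "int (T (Suc r)) = min (int (D (p - 1) r)) (int (D (Suc p) (Suc r)))
      + max (int (D (p - 1) (Suc r))) (int (D (Suc p) (Suc (Suc r)))) - int (D p (Suc r))"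
      unfolding T_def by (rule toggle_int[OF I])
    have fin: "Inv (Suc r) (set_idx 36 (Suc r) t')"
      if "same {35, 36, 37} {10, 11, 12} t t'" "idx t' 35 = Suc (Suc r)" "idx t' 37 = Suc (Suc (Suc r))"
        "mem t' 10 = (mem t 10)(Suc r := (mem t 10 (Suc r))(p := int (T (Suc r))))" for t'
      unfolding Inv_def
    proof (intro conjI allI impI)
      show "same {35, 36, 37} {10, 11, 12} s (set_idx 36 (Suc r) t')" using sm that(1) by (auto simp: same_def)
      fix i q assume "i \<le> Suc n" "q \<le> L"
      then show "mem (set_idx 36 (Suc r) t') 10 i q = (if q = p \<and> 1 \<le> i \<and> i \<le> Suc r then int (T i) else int (D q i))"
        using m[of i q] that(4) by (auto simp: le_Suc_eq)
    qed (use that in auto)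
    show ?thesis
      unfolding toggle_cell_def
      by (rule vc_wp)
        (use b B T in \<open>auto intro!: fin simp: m1[unfolded One_nat_def] m2 m3[unfolded One_nat_def] m4 m5 ix t(2,3) same_def min_def max_def\<close>)
  qed
  have k: "1 \<le> K" using K by simp
  let ?s = "set_idx 37 (Suc (Suc 0)) (set_idx 37 (Suc 0) (set_idx 35 (Suc 0) (set_idx 35 0 (set_idx 36 0 s))))"
  have "Inv 0 ?s" using s(1) by (auto simp: Inv_def same_def stores_def)
  have "wp B (While (IdxLess 36 10) (Seq toggle_cell (IdxSucc 36)))
    (\<lambda>m t. m \<le> (8 + 3) * K ^ Suc 0 \<and> Inv n t \<and> idx t 36 = n) ?s"
    by (rule wp_up_K[where i = 0 and I = Inv, OF K step _ \<open>Inv 0 ?s\<close>]) (use s in auto)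
  then have "wp B (While (IdxLess 36 10) (Seq toggle_cell (IdxSucc 36)))
    (\<lambda>m t. 5 + m \<le> 18 * K \<and> stores 10 n L (tog p D) t) ?s"
  proof (rule wp_conseq)
    fix m t assume *: "m \<le> (8 + 3) * K ^ Suc 0 \<and> Inv n t \<and> idx t 36 = n"
    \<comment> \<open>The loop covers only the rows 1, ..., n, which suffices because a toggle keeps
      row 0 and leaves row n + 1 zero.\<close>
    have z: "T 0 = D p 0" "T (Suc n) = D p (Suc n)"
      using interlaceD(1)[OF interlace_toggle(2)[OF I], of "Suc n"] chain_rows[OF D, of "Suc p" "Suc n"] chain_rows[OF D, of p "Suc n"] p
      by (auto simp: T_def)
    have tg: "tog p D = D(p := T)" by (simp add: tog_def T_def)
    have "mem t 10 i q = int (tog p D q i)" if "i \<le> Suc n" "q \<le> L" for i q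
    proof (cases "i = 0 \<or> i = Suc n")
      case True
      then show ?thesis using * that z by (auto simp: Inv_def tg)
    next
      case False
      then show ?thesis using * that by (auto simp: Inv_def tg)
    qed
    then show "5 + m \<le> 18 * K \<and> stores 10 n L (tog p D) t" using * K by (simp add: stores_def)
  qed
  then show ?thesis unfolding toggle_column_def
    by (intro wp_Seq wp_IdxZero wp_IdxCopy wp_IdxSucc) (simp add: numeral_eq_Suc)
qed


lemma wp_pass:
  assumes D: "chain M n L D" and x: "1 \<le> x" "x + c \<le> L" and K: "1 \<le> K" "n \<le> K" "c \<le> K" and B: "2 * int M \<le> B"
    and s: "stores 10 n L D s" "idx s 10 = n" "idx s 12 = c" "idx s 38 = x"
  shows "wp B pass_prog (\<lambda>m t. m \<le> 30 * K ^ 2 \<and> stores 10 n L (pass x c D) t) s"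
proof -
  let ?U = "{31, 32, 33, 34, 35, 36, 37}" and ?A = "{10, 11, 12}"
  define Inv where "Inv j t \<longleftrightarrow> same ?U ?A s t \<and> idx t 31 = x + j \<and> idx t 32 = x + j - 1 \<and> idx t 33 = Suc (x + j) \<and>
     stores 10 n L (pass x j D) t" for j t
  have step: "wp B (Seq toggle_column (Seq (IdxSucc 31) (Seq (IdxSucc 32) (IdxSucc 33))))
     (\<lambda>m t'. m \<le> 21 * K ^ 1 \<and> idx t' 34 = j \<and> idx t' 12 = c \<and> Inv (Suc j) (set_idx 34 (Suc j) t')) t"
    if j: "j < c" and t: "Inv j t" "idx t 34 = j" "idx t 12 = c" for j t
  proof (rule wp_Seq, rule wp_framed)
    have sm: "same ?U ?A s t" using t by (simp add: Inv_def)
    show "wp B toggle_column (\<lambda>m t'. m \<le> 18 * K \<and> stores 10 n L (tog (x + j) (pass x j D)) t') t"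
    proof (rule wp_toggle_column[where M = M])
      show "chain M n L (pass x j D)" by (rule chain_pass[OF D]) (use x j in auto)
      show "idx t 10 = n" using same_idx[OF sm, of 10] s by simp
    qed (use x j t K B in \<open>auto simp: Inv_def\<close>)
    fix m t' assume *: "m \<le> 18 * K \<and> stores 10 n L (tog (x + j) (pass x j D)) t'"
      "same (written_idx toggle_column) (written_arr toggle_column) t t'"
    have sm2: "same {35, 36, 37} {10, 11, 12} t t'" using *(2) by simp
    have ix: "idx t' 31 = x + j" "idx t' 32 = x + j - 1" "idx t' 33 = Suc (x + j)" "idx t' 34 = j" "idx t' 12 = c"
      using same_idx[OF sm2, of 31] same_idx[OF sm2, of 32] same_idx[OF sm2, of 33] same_idx[OF sm2, of 34]
        same_idx[OF sm2, of 12] t by (auto simp: Inv_def)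
    have sm3: "same ?U ?A s t'" using sm sm2 by (auto simp: same_def)
    have st: "stores 10 n L (pass x (Suc j) D) t'" using * by simp
    have fin: "Inv (Suc j) u" if "same ?U ?A t' u" "mem u 10 = mem t' 10" "idx u 31 = Suc (x + j)"
      "idx u 32 = x + j" "idx u 33 = Suc (Suc (x + j))" for u
      unfolding Inv_def using that sm3 st by (auto simp: same_def stores_def simp del: pass.simps)
    show "wp B (Seq (IdxSucc 31) (Seq (IdxSucc 32) (IdxSucc 33)))
      (\<lambda>n'. (\<lambda>m t'. m \<le> 21 * K ^ 1 \<and> idx t' 34 = j \<and> idx t' 12 = c \<and> Inv (Suc j) (set_idx 34 (Suc j) t')) (m + n')) t'"
      by (rule vc_wp) (use * K x(1) in \<open>auto intro!: fin simp: ix same_def\<close>)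
  qed
  define s0 where "s0 = set_idx 34 0 (set_idx 33 (Suc x) (set_idx 33 x (set_idx 32 (x - 1) (set_idx 32 x (set_idx 31 x s)))))"
  have I0: "Inv 0 s0" using s by (auto simp: Inv_def s0_def same_def stores_def)
  have "wp B (While (IdxLess 34 12) (Seq (Seq toggle_column (Seq (IdxSucc 31) (Seq (IdxSucc 32) (IdxSucc 33)))) (IdxSucc 34)))
    (\<lambda>m t. m \<le> (21 + 3) * K ^ Suc 1 \<and> Inv c t \<and> idx t 34 = c) s0"
    by (rule wp_up_K[where i = 0 and I = Inv, OF K(1) K(3) step _ I0]) (use s in \<open>auto simp: s0_def\<close>)
  then have *: "wp B (While (IdxLess 34 12) (Seq (Seq toggle_column (Seq (IdxSucc 31) (Seq (IdxSucc 32) (IdxSucc 33)))) (IdxSucc 34)))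
    (\<lambda>m t. m + 6 \<le> 30 * K ^ 2 \<and> stores 10 n L (pass x c D) t) s0"
  proof (rule wp_conseq)
    have k: "1 \<le> K ^ 2" using K by simp
    have e: "K ^ Suc 1 = K ^ 2" by (simp add: power2_eq_square)
    show "m + 6 \<le> 30 * K ^ 2 \<and> stores 10 n L (pass x c D) t"
      if "m \<le> (21 + 3) * K ^ Suc 1 \<and> Inv c t \<and> idx t 34 = c" for m t
      using that[unfolded e] k by (simp add: Inv_def)
  qed
  show ?thesis
    unfolding pass_prog_def
    by (rule vc_wp, simp add: s(4), rule wp_conseq[OF *[unfolded s0_def One_nat_def]], auto)
qed

lemma wp_switch:
  assumes D: "chain M n L D" and x: "d + c \<le> L" and K: "1 \<le> K" "n \<le> K" "c \<le> K" "d \<le> K" and B: "2 * int M \<le> B"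
    and s: "stores 10 n L D s" "idx s 10 = n" "idx s 11 = d" "idx s 12 = c"
  shows "wp B switch_prog (\<lambda>m t. m \<le> 40 * K ^ 3 \<and> stores 10 n L (switches d c d D) t) s"
proof -
  let ?U = "{30, 31, 32, 33, 34, 35, 36, 37, 38}" and ?A = "{10, 11, 12}"
  define Inv where "Inv y t \<longleftrightarrow> same ?U ?A s t \<and> idx t 38 = d - y \<and> stores 10 n L (switches d c y D) t" for y t
  have k: "1 \<le> K ^ 2" "1 \<le> K ^ 3" using K by simp_all
  have step: "wp B (Seq pass_prog (IdxPred 38))
     (\<lambda>m t'. m \<le> 31 * K ^ 2 \<and> idx t' 30 = y \<and> idx t' 11 = d \<and> Inv (Suc y) (set_idx 30 (Suc y) t')) t"
    if y: "y < d" and t: "Inv y t" "idx t 30 = y" "idx t 11 = d" for y t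
  proof (rule wp_Seq, rule wp_framed)
    have sm: "same ?U ?A s t" using t by (simp add: Inv_def)
    show "wp B pass_prog (\<lambda>m t'. m \<le> 30 * K ^ 2 \<and> stores 10 n L (pass (d - y) c (switches d c y D)) t') t"
    proof (rule wp_pass[where M = M])
      show "chain M n L (switches d c y D)" by (rule chain_switches[OF D]) (use x y in auto)
      show "idx t 10 = n" "idx t 12 = c" using same_idx[OF sm, of 10] same_idx[OF sm, of 12] s by auto
    qed (use x y t K B in \<open>auto simp: Inv_def\<close>)
    fix m t' assume *: "m \<le> 30 * K ^ 2 \<and> stores 10 n L (pass (d - y) c (switches d c y D)) t'"
      "same (written_idx pass_prog) (written_arr pass_prog) t t'"
    have sm2: "same {31, 32, 33, 34, 35, 36, 37} {10, 11, 12} t t'" using *(2) by simp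
    have ix: "idx t' 38 = d - y" "idx t' 30 = y" "idx t' 11 = d"
      using same_idx[OF sm2, of 38] same_idx[OF sm2, of 30] same_idx[OF sm2, of 11] t by (auto simp: Inv_def)
    have sm3: "same ?U ?A s t'" using sm sm2 by (auto simp: same_def)
    have st: "stores 10 n L (switches d c (Suc y) D) t'" using * by simp
    have fin: "Inv (Suc y) u" if "same ?U ?A t' u" "mem u 10 = mem t' 10" "idx u 38 = d - Suc y" for u
      unfolding Inv_def using that sm3 st by (auto simp: same_def stores_def simp del: switches.simps)
    show "wp B (IdxPred 38)
      (\<lambda>n'. (\<lambda>m t'. m \<le> 31 * K ^ 2 \<and> idx t' 30 = y \<and> idx t' 11 = d \<and> Inv (Suc y) (set_idx 30 (Suc y) t')) (m + n')) t'"
      by (rule vc_wp) (use * k in \<open>auto intro!: fin simp: ix same_def\<close>)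
  qed
  define s0 where "s0 = set_idx 30 0 (set_idx 38 d s)"
  have I0: "Inv 0 s0" using s by (auto simp: Inv_def s0_def same_def stores_def)
  have "wp B (While (IdxLess 30 11) (Seq (Seq pass_prog (IdxPred 38)) (IdxSucc 30)))
    (\<lambda>m t. m \<le> (31 + 3) * K ^ Suc 2 \<and> Inv d t \<and> idx t 30 = d) s0"
    by (rule wp_up_K[where i = 0 and I = Inv, OF K(1) K(4) step _ I0]) (use s in \<open>auto simp: s0_def\<close>)
  then have *: "wp B (While (IdxLess 30 11) (Seq (Seq pass_prog (IdxPred 38)) (IdxSucc 30)))
    (\<lambda>m t. m + 2 \<le> 40 * K ^ 3 \<and> stores 10 n L (switches d c d D) t) s0"
  proof (rule wp_conseq)
    have e: "K ^ Suc 2 = K ^ 3" by (simp add: power3_eq_cube power2_eq_square)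
    show "m + 2 \<le> 40 * K ^ 3 \<and> stores 10 n L (switches d c d D) t"
      if "m \<le> (31 + 3) * K ^ Suc 2 \<and> Inv d t \<and> idx t 30 = d" for m t
      using that[unfolded e] k by (simp add: Inv_def)
  qed
  show ?thesis
    unfolding switch_prog_def
    by (rule vc_wp, simp add: s(3), rule wp_conseq[OF *[unfolded s0_def]], auto)
qed

section \<open>Programs for rectification and evacuation\<close>

text \<open>Within the body of a table, registers 15 and 14 hold 0 and 1, and 20 and 21 the position to be filled.\<close>

definition table :: "nat \<Rightarrow> nat \<Rightarrow> com \<Rightarrow> com" where
  "table r q body = Seq (IdxZero 15) (Seq (IdxZero 14) (Seq (IdxSucc 14) (Seq (IdxCopy 22 r) (Seq (IdxSucc 22)
     (Seq (IdxSucc 22) (Seq (IdxCopy 23 q) (Seq (IdxSucc 23) (fill body))))))))"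

abbreviation table_idx :: "nat set" where
  "table_idx \<equiv> {14, 15, 20, 21, 22, 23}"

lemma written_table [simp]: "written_idx (table r q body) = written_idx body \<union> table_idx"
  "written_arr (table r q body) = written_arr body"
  by (auto simp: table_def)

lemma wp_table:
  assumes K: "idx s r + 2 \<le> K" "idx s q + 1 \<le> K" and rq: "r \<notin> table_idx" "q \<notin> table_idx"
    and disj: "written_idx body \<inter> table_idx = {}"
    and body: "\<And>s' i p. i < idx s r + 2 \<Longrightarrow> p < idx s q + 1 \<Longrightarrow>
      same (written_idx body \<union> table_idx) (written_arr body) s s' \<Longrightarrow>
      idx s' 20 = i \<Longrightarrow> idx s' 21 = p \<Longrightarrow> idx s' 14 = 1 \<Longrightarrow> idx s' 15 = 0 \<Longrightarrow>
      wp B body (\<lambda>n t. n \<le> c * K \<and> mem t X = (mem s' X)(i := (mem s' X i)(p := f i p))) s'"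
  shows "wp B (table r q body) (\<lambda>n t. n \<le> (c + 16) * K ^ 3 \<and>
     (\<forall>i p. mem t X i p = (if i < idx s r + 2 \<and> p < idx s q + 1 then f i p else mem s X i p))) s"
proof -
  define s0 where "s0 = set_idx 23 (Suc (idx s q)) (set_idx 23 (idx s q) (set_idx 22 (Suc (Suc (idx s r))) (set_idx 22 (Suc (idx s r))
     (set_idx 22 (idx s r) (set_idx 14 1 (set_idx 14 0 (set_idx 15 0 s)))))))"
  have K1: "1 \<le> K" "1 \<le> K ^ 3" using K by simp_all
  have "wp B (fill body) (\<lambda>n t. n \<le> (c + 8) * K ^ 3 \<and>
     (\<forall>i p. mem t X i p = (if i < idx s r + 2 \<and> p < idx s q + 1 then f i p else mem s0 X i p))) s0"
  proof (rule wp_fill[OF K1(1) K])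
    show "written_idx body \<inter> {20, 21, 22, 23} = {}" using disj by auto
    fix s' i p assume *: "i < idx s r + 2" "p < idx s q + 1" "same (written_idx body \<union> {20, 21}) (written_arr body) s0 s'"
      "idx s' 20 = i" "idx s' 21 = p"
    have "14 \<notin> written_idx body \<union> {20, 21}" "15 \<notin> written_idx body \<union> {20, 21}" using disj by auto
    then have "idx s' 14 = 1" "idx s' 15 = 0" using same_idx[OF *(3)] by (auto simp: s0_def)
    moreover have "same (written_idx body \<union> table_idx) (written_arr body) s s'"
      using *(3) by (auto simp: same_def s0_def)
    ultimately show "wp B body (\<lambda>n t. n \<le> c * K \<and> mem t X = (mem s' X)(i := (mem s' X i)(p := f i p))) s'"
      using body * by blast
  qed (use rq in \<open>auto simp: s0_def\<close>)
  then have "wp B (fill body) (\<lambda>n t. n + 8 \<le> (c + 16) * K ^ 3 \<and>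
     (\<forall>i p. mem t X i p = (if i < idx s r + 2 \<and> p < idx s q + 1 then f i p else mem s X i p))) s0"
  proof (rule wp_conseq)
    fix n t assume *: "n \<le> (c + 8) * K ^ 3 \<and>
     (\<forall>i p. mem t X i p = (if i < idx s r + 2 \<and> p < idx s q + 1 then f i p else mem s0 X i p))"
    have "(c + 16) * K ^ 3 = (c + 8) * K ^ 3 + 8 * K ^ 3" by (simp add: algebra_simps)
    then have "n + 8 \<le> (c + 16) * K ^ 3" using * K1(2) by linarith
    then show "n + 8 \<le> (c + 16) * K ^ 3 \<and>
     (\<forall>i p. mem t X i p = (if i < idx s r + 2 \<and> p < idx s q + 1 then f i p else mem s X i p))"
      using * by (simp add: s0_def)
  qed
  then have fl: "wp B (fill body) (\<lambda>n t. Suc (Suc (Suc (Suc (Suc (Suc (Suc (Suc n))))))) \<le> (c + 16) * K ^ 3 \<and>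
     (\<forall>i p. mem t X i p = (if i < idx s r + 2 \<and> p < idx s q + 1 then f i p else mem s X i p))) s0"
    by (rule wp_conseq) auto
  show ?thesis
    unfolding table_def
    by (intro wp_Seq wp_IdxZero wp_IdxSucc wp_IdxCopy, rule wp_conseq[where Q = "\<lambda>n t. Suc (Suc (Suc (Suc (Suc (Suc (Suc (Suc n))))))) \<le> (c + 16) * K ^ 3 \<and>
     (\<forall>i p. mem t X i p = (if i < idx s r + 2 \<and> p < idx s q + 1 then f i p else mem s X i p))"])
      (use fl rq in \<open>auto simp: s0_def\<close>)
qed

text \<open>The rows from 1 on, as an input array provides them; in contrast to
  \<open>stores\<close>, the bound in row 0 is missing.\<close>

definition holds_rows :: "nat \<Rightarrow> nat \<Rightarrow> nat \<Rightarrow> (nat \<Rightarrow> ptn) \<Rightarrow> store \<Rightarrow> bool" where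
  "holds_rows x n k G s \<longleftrightarrow> (\<forall>i j. 1 \<le> i \<longrightarrow> i \<le> Suc n \<longrightarrow> j \<le> k \<longrightarrow> mem s x i j = int (G j i))"

lemma holds_rowsD: "holds_rows x n k G s \<Longrightarrow> 1 \<le> i \<Longrightarrow> i \<le> Suc n \<Longrightarrow> j \<le> k \<Longrightarrow> mem s x i j = int (G j i)"
  by (simp add: holds_rows_def)

text \<open>Row 0 is filled with the first row of the last shape, which registers 14 and 12 address
  as entry (1, k) of the source. This is where the bound M comes from.\<close>

definition canon_body :: "nat \<Rightarrow> com" where
  "canon_body S = Cond (IdxLess 15 20)
     (Cond (IdxLess 21 10)
        (Cond (IdxLess 21 20) (Const (Ref 10 20 21) 0) (Copy (Ref 10 20 21) (Ref S 20 15)))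
        (Seq (sub_idx 25 21 10) (Copy (Ref 10 20 21) (Ref S 20 25))))
     (Copy (Ref 10 20 21) (Ref S 14 12))"

lemma written_canon_body [simp]: "written_idx (canon_body S) = {24, 25}" "written_arr (canon_body S) = {10}"
  by (auto simp: canon_body_def)

definition jdt_prog :: "nat \<Rightarrow> com" where
  "jdt_prog S = Seq (add_idx 16 10 12) (Seq (table 10 16 (canon_body S)) (Seq (IdxCopy 11 10) switch_prog))"

abbreviation jdt_idx :: "nat set" where
  "jdt_idx \<equiv> {11, 14, 15, 16, 20, 21, 22, 23, 24, 25, 30, 31, 32, 33, 34, 35, 36, 37, 38}"

lemma written_jdt_prog [simp]: "written_idx (jdt_prog S) = jdt_idx" "written_arr (jdt_prog S) = {10, 11, 12}"
  by (auto simp: jdt_prog_def)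

lemma wp_jdt:
  assumes G: "chain M n k G" and M: "M = G k 1" and S: "S \<notin> {10, 11, 12}"
    and K: "n + 2 \<le> K" "n + k + 1 \<le> K" and B: "2 * int M \<le> B"
    and s: "holds_rows S n k G s" "idx s 10 = n" "idx s 12 = k"
  shows "wp B (jdt_prog S) (\<lambda>m t. m \<le> 100 * K ^ 3 \<and> stores 10 n (n + k) (jdt n k M G) t) s"
proof -
  let ?D = "prepend_canon n M G"
  have K1: "1 \<le> K" using K by simp
  have KK: "K \<le> K ^ 3" "1 \<le> K ^ 3" using K1 by (simp_all add: self_le_power)
  have le: "int (G j i) \<le> int M" if "j \<le> k" for i j using chain_le[OF G that] by simp
  have Bp: "\<bar>int (G j i)\<bar> \<le> B" if "j \<le> k" for i j using le[OF that, of i] B by simp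
  have 1: "wp B (add_idx 16 10 12) (\<lambda>m t. m \<le> 6 * K \<and> idx t 16 = n + k) s"
    by (rule wp_conseq[OF wp_add_idx[OF K1]]) (use s K in auto)
  have 2: "wp B (table 10 16 (canon_body S)) (\<lambda>m t. m \<le> (10 + 16) * K ^ 3 \<and> stores 10 n (n + k) ?D t) t"
    if t: "idx t 16 = n + k" "same {16, 24} {} s t" for t
  proof -
    have ix: "idx t 10 = n" "idx t 12 = k" and m: "mem t = mem s"
      using t(2) s by (auto simp: same_def)
    have "wp B (table 10 16 (canon_body S)) (\<lambda>m t'. m \<le> (10 + 16) * K ^ 3 \<and>
      (\<forall>i p. mem t' 10 i p = (if i < idx t 10 + 2 \<and> p < idx t 16 + 1 then int (?D p i) else mem t 10 i p))) t"
    proof (rule wp_table)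
      fix s' i p assume i: "i < idx t 10 + 2" "p < idx t 16 + 1"
        and sm: "same (written_idx (canon_body S) \<union> table_idx) (written_arr (canon_body S)) t s'"
        and r: "idx s' 20 = i" "idx s' 21 = p" "idx s' 14 = 1" "idx s' 15 = 0"
      have ix': "idx s' 10 = n" "idx s' 12 = k" and m': "mem s' S = mem s S"
        using sm ix m S by (auto simp: same_def)
      have S1: "mem s S 1 k = int M" using holds_rowsD[OF s(1), of 1 k] M by simp
      have S0: "mem s S i 0 = int (G 0 i)" if "1 \<le> i" using holds_rowsD[OF s(1), of i 0] i ix that by simp
      have Sp: "mem s S i (p - n) = int (G (p - n) i)" if "1 \<le> i" using holds_rowsD[OF s(1), of i "p - n"] i ix t that by simp
      have DM: "?D p 0 = M"
        using chain_row0[OF chain_prepend_canon[OF G], of p] i t by simp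

      show "wp B (canon_body S) (\<lambda>n t. n \<le> 10 * K \<and> mem t 10 = (mem s' 10)(i := (mem s' 10 i)(p := int (?D p i)))) s'"
      proof (cases "i = 0")
        case True
        then show ?thesis unfolding canon_body_def using K1 S1 DM B r ix' m' by (intro vc_wp) auto
      next
        case False
        then have i1: "1 \<le> i" by simp
        show ?thesis
        proof (cases "p < n")
          case True
          then show ?thesis unfolding canon_body_def
            using K1 False S0[OF i1] Bp[of 0 i] r ix' m' B by (intro vc_wp) (auto simp: prepend_canon_def canon_def)
        next
          case False
          have D: "?D p i = G (p - n) i" using False by (simp add: prepend_canon_def)
          have "wp B (Seq (sub_idx 25 21 10) (Copy (Ref 10 20 21) (Ref S 20 25)))
             (\<lambda>n t. n + 2 \<le> 10 * K \<and> mem t 10 = (mem s' 10)(i := (mem s' 10 i)(p := int (?D p i)))) s'"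
          proof (rule wp_Seq, rule wp_framed[OF wp_sub_idx[OF K1]])
            show "idx s' 10 \<le> K" using ix' K by simp
            fix n' t' assume a: "n' \<le> 6 * K \<and> idx t' 25 = idx s' 21 - idx s' 10"
              "same (written_idx (sub_idx 25 21 10)) (written_arr (sub_idx 25 21 10)) s' t'"
            have ix2: "idx t' 20 = i" "idx t' 21 = p" "mem t' = mem s'" "idx t' 25 = p - n"
              using a r ix' by (auto simp: same_def)
            have "mem s' S i (p - n) = int (?D p i)" using Sp[OF i1] m' D by simp
            moreover have "\<bar>int (?D p i)\<bar> \<le> B" using Bp[of "p - n" i] i t D by simp
            ultimately show "wp B (Copy (Ref 10 20 21) (Ref S 20 25))
             (\<lambda>n''. (\<lambda>n t. n + 2 \<le> 10 * K \<and> mem t 10 = (mem s' 10)(i := (mem s' 10 i)(p := int (?D p i)))) (n' + n'')) t'"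
              using a(1) K1 ix2 by (intro vc_wp) simp
          qed simp_all
          then show ?thesis unfolding canon_body_def using False i1 r ix'
            by (intro wp_Cond) (auto intro: wp_conseq)
        qed
      qed
    qed (use ix t K in auto)
    then show ?thesis
      by (rule wp_conseq) (use ix t in \<open>auto simp: stores_def\<close>)
  qed
  have 3: "wp B switch_prog (\<lambda>m t. m \<le> 40 * K ^ 3 \<and> stores 10 n (n + k) (jdt n k M G) t) t"
    if "stores 10 n (n + k) ?D t" "idx t 10 = n" "idx t 11 = n" "idx t 12 = k" for t
    unfolding jdt_def by (rule wp_switch[OF chain_prepend_canon[OF G] order_refl K1]) (use that K B in auto)
  show ?thesis
    unfolding jdt_prog_def
  proof (rule wp_Seq, rule wp_framed[OF 1])
    fix m1 t1 assume a: "m1 \<le> 6 * K \<and> idx t1 16 = n + k" "same (written_idx (add_idx 16 10 12)) (written_arr (add_idx 16 10 12)) s t1"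
    show "wp B (Seq (table 10 16 (canon_body S)) (Seq (IdxCopy 11 10) switch_prog))
      (\<lambda>n'. (\<lambda>m t. m \<le> 100 * K ^ 3 \<and> stores 10 n (n + k) (jdt n k M G) t) (m1 + n')) t1"
    proof (rule wp_Seq, rule wp_framed[OF 2])
      show "idx t1 16 = n + k" "same {16, 24} {} s t1" using a by auto
      fix m2 t2 assume b: "m2 \<le> (10 + 16) * K ^ 3 \<and> stores 10 n (n + k) ?D t2"
        "same (written_idx (table 10 16 (canon_body S))) (written_arr (table 10 16 (canon_body S))) t1 t2"
      have ix: "idx t2 10 = n" "idx t2 12 = k" using a b s by (auto simp: same_def)
      show "wp B (Seq (IdxCopy 11 10) switch_prog)
        (\<lambda>n'. (\<lambda>n'. (\<lambda>m t. m \<le> 100 * K ^ 3 \<and> stores 10 n (n + k) (jdt n k M G) t) (m1 + n')) (m2 + n')) t2"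
      proof (rule wp_Seq, rule wp_IdxCopy, rule wp_conseq[OF 3])
        show "stores 10 n (n + k) ?D (set_idx 11 (idx t2 10) t2)" using b by (simp add: stores_def)
      qed (use ix a b KK in auto)
    qed
  qed
qed

section \<open>Extracting tableaux from the current chain\<close>

definition extract_body :: "nat \<Rightarrow> nat \<Rightarrow> com" where
  "extract_body x u = Cond (IdxLess 15 20) (Seq (add_idx 25 21 u) (Copy (Ref x 20 21) (Ref 10 20 25))) (Const (Ref x 20 21) 0)"

definition extract_cols :: "nat \<Rightarrow> nat \<Rightarrow> nat \<Rightarrow> com" where
  "extract_cols x u q = table 10 q (extract_body x u)"

lemma written_extract [simp]: "written_idx (extract_cols x u q) = {14, 15, 20, 21, 22, 23, 24, 25}" "written_arr (extract_cols x u q) = {x}"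
  by (auto simp: extract_cols_def extract_body_def)

lemma wp_extract_body:
  assumes K: "1 \<le> K" "off \<le> K" and B: "0 \<le> B" "1 \<le> i \<Longrightarrow> \<bar>mem s 10 i (p + off)\<bar> \<le> B" and x: "x \<noteq> 10"
    and r: "idx s 20 = i" "idx s 21 = p" "idx s 15 = 0" "idx s u = off" and u: "u \<noteq> 24" "u \<noteq> 25"
  shows "wp B (extract_body x u) (\<lambda>n t. n \<le> 8 * K \<and>
     mem t x = (mem s x)(i := (mem s x i)(p := if i = 0 then 0 else mem s 10 i (p + off)))) s"
  unfolding extract_body_def
proof (rule wp_Cond)
  assume "\<not> holds (IdxLess 15 20) s"
  then show "wp B (Const (Ref x 20 21) 0) (\<lambda>n t. Suc n \<le> 8 * K \<and>
     mem t x = (mem s x)(i := (mem s x i)(p := if i = 0 then 0 else mem s 10 i (p + off)))) s"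
    using K B r by (intro vc_wp) auto
next
  assume "holds (IdxLess 15 20) s"
  then have i: "1 \<le> i" using r by simp
  show "wp B (Seq (add_idx 25 21 u) (Copy (Ref x 20 21) (Ref 10 20 25))) (\<lambda>n t. Suc n \<le> 8 * K \<and>
     mem t x = (mem s x)(i := (mem s x i)(p := if i = 0 then 0 else mem s 10 i (p + off)))) s"
  proof (rule wp_Seq, rule wp_framed[OF wp_add_idx[OF K(1)]])
    show "idx s u \<le> K" using r K by simp
    show "25 \<noteq> u" "u \<noteq> 24" using u by auto
    fix n t assume a: "n \<le> 6 * K \<and> idx t 25 = idx s 21 + idx s u"
      "same (written_idx (add_idx 25 21 u)) (written_arr (add_idx 25 21 u)) s t"
    have "idx t 20 = i" "idx t 21 = p" "mem t = mem s" "idx t 25 = p + off"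
      using a r by (auto simp: same_def)
    then show "wp B (Copy (Ref x 20 21) (Ref 10 20 25)) (\<lambda>n'. (\<lambda>n t. Suc n \<le> 8 * K \<and>
       mem t x = (mem s x)(i := (mem s x i)(p := if i = 0 then 0 else mem s 10 i (p + off)))) (n + n')) t"
      using a(1) K(1) B(2)[OF i] i by (intro vc_wp) auto
  qed simp_all
qed simp

text \<open>The offset 0 is supplied by register 15, which \<open>table\<close> resets; any other
  offset has to be in a register that the program does not write.\<close>

lemma wp_extract:
  assumes x: "x \<noteq> 10" and u: "u = 15 \<and> off = 0 \<or> u \<notin> {14, 15, 20, 21, 22, 23, 24, 25} \<and> idx s u = off"
    and q: "q \<notin> {14, 15, 20, 21, 22, 23, 24, 25}"
    and K: "idx s 10 + 2 \<le> K" "idx s q + 1 \<le> K" "off \<le> K"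
    and B: "0 \<le> B" "\<And>i p. 1 \<le> i \<Longrightarrow> i < idx s 10 + 2 \<Longrightarrow> p \<le> idx s q \<Longrightarrow> \<bar>mem s 10 i (p + off)\<bar> \<le> B"
  shows "wp B (extract_cols x u q) (\<lambda>m t. m \<le> 30 * K ^ 3 \<and> (\<forall>i p. mem t x i p =
     (if i < idx s 10 + 2 \<and> p < idx s q + 1 then (if i = 0 then 0 else mem s 10 i (p + off)) else mem s x i p))) s"
  unfolding extract_cols_def
proof (rule wp_conseq[OF wp_table[where c = 8 and X = x and f = "\<lambda>i p. if i = 0 then 0 else mem s 10 i (p + off)"]])
  have K1: "1 \<le> K" using K by simp
  show "written_idx (extract_body x u) \<inter> table_idx = {}" by (auto simp: extract_body_def)
  fix s' i p assume i: "i < idx s 10 + 2" "p < idx s q + 1"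
    and sm: "same (written_idx (extract_body x u) \<union> table_idx) (written_arr (extract_body x u)) s s'"
    and r: "idx s' 20 = i" "idx s' 21 = p" "idx s' 14 = 1" "idx s' 15 = 0"
  have ix: "idx s' u = off" and m: "mem s' 10 = mem s 10"
    using sm u x r by (auto simp: same_def extract_body_def)
  have "u \<noteq> 24" "u \<noteq> 25" using u by auto
  from wp_extract_body[OF K1 K(3) B(1) _ x r(1,2,4) ix this]
  show "wp B (extract_body x u) (\<lambda>n t. n \<le> 8 * K \<and>
     mem t x = (mem s' x)(i := (mem s' x i)(p := if i = 0 then 0 else mem s 10 i (p + off)))) s'"
    using B(2)[of i p] i unfolding m by simp
next
  fix n t assume *: "n \<le> (8 + 16) * K ^ 3 \<and> (\<forall>i p. mem t x i p =
     (if i < idx s 10 + 2 \<and> p < idx s q + 1 then (if i = 0 then 0 else mem s 10 i (p + off)) else mem s x i p))"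
  then have "n \<le> (30::nat) * K ^ 3" by (intro order_trans[OF conjunct1[OF *]] mult_le_mono1) simp
  then show "n \<le> 30 * K ^ 3 \<and> (\<forall>i p. mem t x i p =
     (if i < idx s 10 + 2 \<and> p < idx s q + 1 then (if i = 0 then 0 else mem s 10 i (p + off)) else mem s x i p))"
    using * by blast
qed (use K q in auto)

text \<open>Array 19 is never written, so that its entries supply the constant 0.\<close>

definition extract_if_body :: "nat \<Rightarrow> nat \<Rightarrow> nat \<Rightarrow> com" where
  "extract_if_body x u y = Cond (IdxLess 15 21)
     (Cond (ValLess (Ref 19 15 15) (Ref y 21 15)) (extract_body x u) (Const (Ref x 20 21) 0)) (extract_body x u)"

text \<open>An output array for as many letters as a partition has parts must vanish in all later
  columns, but this number is in no register. So column p is copied iff part p, found in column 0 of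
  array y, is positive; column 0 is always copied.\<close>

definition extract_if :: "nat \<Rightarrow> nat \<Rightarrow> nat \<Rightarrow> nat \<Rightarrow> com" where
  "extract_if x u q y = table 10 q (extract_if_body x u y)"

lemma written_extract_if [simp]: "written_idx (extract_if x u q y) = {14, 15, 20, 21, 22, 23, 24, 25}" "written_arr (extract_if x u q y) = {x}"
  by (auto simp: extract_if_def extract_if_body_def extract_body_def)

lemma wp_extract_if:
  assumes x: "x \<notin> {10, 19}" "x \<noteq> y" and u: "u \<notin> {14, 15, 20, 21, 22, 23, 24, 25}" "idx s u = off"
    and q: "q \<notin> {14, 15, 20, 21, 22, 23, 24, 25}"
    and K: "idx s 10 + 2 \<le> K" "idx s q + 1 \<le> K" "off \<le> K" and z: "mem s 19 = (\<lambda>_ _. 0)"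
    and B: "0 \<le> B" "\<And>i p. 1 \<le> i \<Longrightarrow> i < idx s 10 + 2 \<Longrightarrow> p \<le> idx s q \<Longrightarrow> \<bar>mem s 10 i (p + off)\<bar> \<le> B"
      "\<And>p. 1 \<le> p \<Longrightarrow> p \<le> idx s q \<Longrightarrow> \<bar>mem s y p 0\<bar> \<le> B"
  shows "wp B (extract_if x u q y) (\<lambda>m t. m \<le> 30 * K ^ 3 \<and> (\<forall>i p. mem t x i p =
     (if i < idx s 10 + 2 \<and> p < idx s q + 1 then
       (if i \<noteq> 0 \<and> (p = 0 \<or> 0 < mem s y p 0) then mem s 10 i (p + off) else 0) else mem s x i p))) s"
  unfolding extract_if_def
proof (rule wp_conseq[OF wp_table[where c = 12 and X = x
    and f = "\<lambda>i p. if i \<noteq> 0 \<and> (p = 0 \<or> 0 < mem s y p 0) then mem s 10 i (p + off) else 0"]])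
  have K1: "1 \<le> K" using K by simp
  show "written_idx (extract_if_body x u y) \<inter> table_idx = {}" by (auto simp: extract_if_body_def extract_body_def)
  fix s' i p assume i: "i < idx s 10 + 2" "p < idx s q + 1"
    and sm: "same (written_idx (extract_if_body x u y) \<union> table_idx) (written_arr (extract_if_body x u y)) s s'"
    and r: "idx s' 20 = i" "idx s' 21 = p" "idx s' 14 = 1" "idx s' 15 = 0"
  have ix: "idx s' u = off" and m: "mem s' 10 = mem s 10" "mem s' 19 = (\<lambda>_ _. 0)" "mem s' y = mem s y"
    using sm u x r z by (auto simp: same_def extract_if_body_def extract_body_def)
  have u': "u \<noteq> 24" "u \<noteq> 25" and x10: "x \<noteq> 10" using u x by auto
  have "wp B (extract_body x u) (\<lambda>n t. n \<le> 8 * K \<and>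
     mem t x = (mem s' x)(i := (mem s' x i)(p := if i = 0 then 0 else mem s 10 i (p + off)))) s'"
    using wp_extract_body[OF K1 K(3) B(1) _ x10 r(1,2,4) ix u'] B(2)[of i p] i unfolding m(1) by simp
  then have ex: "wp B (extract_body x u) (\<lambda>n t. n + 2 \<le> 12 * K \<and>
     mem t x = (mem s' x)(i := (mem s' x i)(p := if i = 0 then 0 else mem s 10 i (p + off)))) s'"
    by (rule wp_conseq) (use K1 in auto)
  show "wp B (extract_if_body x u y) (\<lambda>n t. n \<le> 12 * K \<and>
     mem t x = (mem s' x)(i := (mem s' x i)(p := if i \<noteq> 0 \<and> (p = 0 \<or> 0 < mem s y p 0) then mem s 10 i (p + off) else 0))) s'"
    unfolding extract_if_body_def
  proof (rule wp_Cond)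
    assume "\<not> holds (IdxLess 15 21) s'"
    then have "p = 0" using r by simp
    then show "wp B (extract_body x u) (\<lambda>n t. Suc n \<le> 12 * K \<and>
      mem t x = (mem s' x)(i := (mem s' x i)(p := if i \<noteq> 0 \<and> (p = 0 \<or> 0 < mem s y p 0) then mem s 10 i (p + off) else 0))) s'"
      by (intro wp_conseq[OF ex]) auto
  next
    assume "holds (IdxLess 15 21) s'"
    then have p: "p \<noteq> 0" using r by simp
    show "wp B (Cond (ValLess (Ref 19 15 15) (Ref y 21 15)) (extract_body x u) (Const (Ref x 20 21) 0)) (\<lambda>n t. Suc n \<le> 12 * K \<and>
      mem t x = (mem s' x)(i := (mem s' x i)(p := if i \<noteq> 0 \<and> (p = 0 \<or> 0 < mem s y p 0) then mem s 10 i (p + off) else 0))) s'"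
    proof (rule wp_Cond)
      show "test_le B (ValLess (Ref 19 15 15) (Ref y 21 15)) s'" using B(1) B(3)[of p] p i r m by simp
      assume "holds (ValLess (Ref 19 15 15) (Ref y 21 15)) s'"
      then have "0 < mem s y p 0" using r m by simp
      then show "wp B (extract_body x u) (\<lambda>n t. Suc (Suc n) \<le> 12 * K \<and>
        mem t x = (mem s' x)(i := (mem s' x i)(p := if i \<noteq> 0 \<and> (p = 0 \<or> 0 < mem s y p 0) then mem s 10 i (p + off) else 0))) s'"
        by (intro wp_conseq[OF ex]) auto
    next
      assume "\<not> holds (ValLess (Ref 19 15 15) (Ref y 21 15)) s'"
      then have "\<not> 0 < mem s y p 0" using r m by simp
      then show "wp B (Const (Ref x 20 21) 0) (\<lambda>n t. Suc (Suc n) \<le> 12 * K \<and>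
        mem t x = (mem s' x)(i := (mem s' x i)(p := if i \<noteq> 0 \<and> (p = 0 \<or> 0 < mem s y p 0) then mem s 10 i (p + off) else 0))) s'"
        using p r K1 B by (intro vc_wp) auto
    qed
  qed simp
next
  fix n t assume *: "n \<le> (12 + 16) * K ^ 3 \<and> (\<forall>i p. mem t x i p =
     (if i < idx s 10 + 2 \<and> p < idx s q + 1 then
       (if i \<noteq> 0 \<and> (p = 0 \<or> 0 < mem s y p 0) then mem s 10 i (p + off) else 0) else mem s x i p))"
  then have "n \<le> (30::nat) * K ^ 3" by (intro order_trans[OF conjunct1[OF *]] mult_le_mono1) simp
  then show "n \<le> 30 * K ^ 3 \<and> (\<forall>i p. mem t x i p =
     (if i < idx s 10 + 2 \<and> p < idx s q + 1 then
       (if i \<noteq> 0 \<and> (p = 0 \<or> 0 < mem s y p 0) then mem s 10 i (p + off) else 0) else mem s x i p))"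
    using * by blast
qed (use K q in auto)

section \<open>Cubic cost\<close>

definition takes :: "int \<Rightarrow> nat \<Rightarrow> nat \<Rightarrow> com \<Rightarrow> (store \<Rightarrow> bool) \<Rightarrow> store \<Rightarrow> bool" where
  "takes B K c p Q s \<longleftrightarrow> wp B p (\<lambda>n t. n \<le> c * K ^ 3 \<and> Q t) s"

lemma takes_Seq:
  assumes "takes B K a p P s" "a \<le> c"
    "\<And>t. P t \<Longrightarrow> same (written_idx p) (written_arr p) s t \<Longrightarrow> takes B K (c - a) q Q t"
  shows "takes B K c (Seq p q) Q s"
  unfolding takes_def
proof (rule wp_Seq, rule wp_framed[OF assms(1)[unfolded takes_def]])
  fix n t assume *: "n \<le> a * K ^ 3 \<and> P t" "same (written_idx p) (written_arr p) s t"
  have "n + n' \<le> c * K ^ 3" if "n' \<le> (c - a) * K ^ 3" for n'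
  proof -
    have "n + n' \<le> (a + (c - a)) * K ^ 3" unfolding distrib_right using *(1) that by linarith
    then show ?thesis using assms(2) by simp
  qed
  then show "wp B q (\<lambda>n'. (\<lambda>n t. n \<le> c * K ^ 3 \<and> Q t) (n + n')) t"
    using assms(3)[OF conjunct2[OF *(1)] *(2)] unfolding takes_def by (auto intro: wp_conseq)
qed

lemma takes_weaken:
  assumes "takes B K a p P s" "a \<le> c" "\<And>t. P t \<Longrightarrow> same (written_idx p) (written_arr p) s t \<Longrightarrow> Q t"
  shows "takes B K c p Q s"
  unfolding takes_def
proof (rule wp_framed[OF assms(1)[unfolded takes_def]])
  fix n t assume *: "n \<le> a * K ^ 3 \<and> P t" "same (written_idx p) (written_arr p) s t"
  have "a * K ^ 3 \<le> c * K ^ 3" by (rule mult_le_mono1[OF assms(2)])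
  then show "n \<le> c * K ^ 3 \<and> Q t" using * assms(3)[of t] by (meson le_trans)
qed

lemma takes_IdxCopy:
  assumes "1 \<le> K" "1 \<le> c" "takes B K (c - 1) q Q (set_idx u (idx s v) s)"
  shows "takes B K c (Seq (IdxCopy u v) q) Q s"
proof -
  have "takes B K 1 (IdxCopy u v) (\<lambda>t. t = set_idx u (idx s v) s) s"
    unfolding takes_def by (rule wp_IdxCopy) (use assms(1) in auto)
  then show ?thesis by (rule takes_Seq) (use assms in auto)
qed

text \<open>The constant is 1000 * 64 * 9: the number of steps, the cube of the 4 that bounds K, and
  9 because numbers up to 4 * m + 4 have at most 3 + log 2 (m + 2) bits, where the logarithm is at
  least 1.\<close>

lemma cost_le_cube_log:
  assumes "t \<le> n * (1 + 2 * bits (4 * int m + 4))" "n \<le> 1000 * K ^ 3" "K \<le> 4 * max 1 k"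
  shows "real t \<le> 576000 * cube_log k m"
proof -
  have L: "1 \<le> log 2 (real m + 2)" by simp
  have "bits (4 * int m + 4) = nat \<lfloor>log 2 (4 * real m + 4)\<rfloor> + 1"
    by (simp add: bits_def bitlen_def floorlog_def nat_add_distrib)
  moreover have "real (nat \<lfloor>log 2 (4 * real m + 4)\<rfloor>) \<le> log 2 (4 * real m + 4)"
    using zero_le_log_cancel_iff[of 2 "4 * real m + 4"] by simp
  moreover have "log 2 (4 * real m + 4) \<le> log 2 (4 * (real m + 2))" by simp
  moreover have "log 2 (4 * (real m + 2)) = log 2 4 + log 2 (real m + 2)"
    by (subst log_mult) auto
  moreover have "log 2 (4::real) = 2" using log_pow_cancel[of 2 2] by simp
  ultimately have "real (bits (4 * int m + 4)) \<le> 3 + log 2 (real m + 2)" by linarith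
  then have b: "1 + 2 * real (bits (4 * int m + 4)) \<le> 9 * log 2 (real m + 2)"
    using L by linarith
  have "K ^ 3 \<le> (4 * max 1 k) ^ 3" by (rule power_mono[OF assms(3)]) simp
  then have "n \<le> 1000 * (4 * max 1 k) ^ 3" using assms(2) by linarith
  then have "n \<le> 64000 * max 1 k ^ 3" by (simp add: power_mult_distrib)
  then have n: "real n \<le> 64000 * real (max 1 k) ^ 3"
    by (metis of_nat_le_iff of_nat_mult of_nat_numeral of_nat_power)
  have "real t \<le> real (n * (1 + 2 * bits (4 * int m + 4)))" using assms(1) by (simp only: of_nat_le_iff)
  also have "\<dots> = real n * (1 + 2 * real (bits (4 * int m + 4)))" by (simp add: distrib_left)
  also have "\<dots> \<le> (64000 * real (max 1 k) ^ 3) * (9 * log 2 (real m + 2))"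
    by (rule mult_mono[OF n b]) auto
  finally show ?thesis by (simp add: cube_log_def)
qed

lemma computes_I:
  assumes "takes (4 * int m + 4) K 1000 p (\<lambda>t. \<forall>x<length outs. mem t (length ins + x) = outs ! x) (input_store dims ins)"
    and "K \<le> 4 * max 1 k"
  shows "computes p dims ins outs (576000 * cube_log k m)"
proof -
  obtain t n s where *: "run p (input_store dims ins) t s" "t \<le> n * (1 + 2 * bits (4 * int m + 4))" "n \<le> 1000 * K ^ 3"
    "\<forall>x<length outs. mem s (length ins + x) = outs ! x"
    using assms(1) unfolding takes_def wp_def by blast
  show ?thesis unfolding computes_def using *(1,4) cost_le_cube_log[OF *(2,3) assms(2)] by blast
qed

section \<open>Loading and unloading chains\<close>

lemma stores_shorter: "stores x n L D s \<Longrightarrow> l \<le> L \<Longrightarrow> stores x n l D s"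
  by (auto simp: stores_def)

lemma stores_same: "stores x n L D s \<Longrightarrow> mem t x = mem s x \<Longrightarrow> stores x n L D t"
  by (simp add: stores_def)

definition contents :: "nat \<Rightarrow> nat \<Rightarrow> (nat \<Rightarrow> ptn) \<Rightarrow> arr" where
  "contents n l D i p = (if 1 \<le> i \<and> i \<le> n \<and> p \<le> l then int (D p i) else 0)"

lemma contents_gt_array:
  assumes "chain M n k G" "\<And>i. 1 \<le> i \<Longrightarrow> \<mu> i = G 0 i" "l \<le> k"
  shows "gt_array N l (\<mu>, tab_of k G) = contents N l G"
  by (intro ext) (simp add: gt_array_tab_of[OF assms] contents_def)

lemma holds_rows_contents:
  assumes "chain M n k G" "mem s x = contents n l G" "k \<le> l"
  shows "holds_rows x n k G s"
  unfolding holds_rows_def using assms chain_rows[OF assms(1)] by (auto simp: contents_def)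

lemma takes_extract_cols:
  assumes D: "chain M n L D" and s: "stores 10 n L D s" "idx s 10 = n" "idx s q = l" "off + l \<le> L" "mem s x = (\<lambda>_ _. 0)"
    and x: "x \<noteq> 10" and u: "u = 15 \<and> off = 0 \<or> u \<notin> {14, 15, 20, 21, 22, 23, 24, 25} \<and> idx s u = off"
    and q: "q \<notin> {14, 15, 20, 21, 22, 23, 24, 25}" and K: "n + 2 \<le> K" "off + l + 1 \<le> K" and B: "int M \<le> B"
  shows "takes B K 30 (extract_cols x u q) (\<lambda>t. mem t x = contents n l (\<lambda>p. D (off + p))) s"
  unfolding takes_def
proof (rule wp_conseq[OF wp_extract[OF x u q]])
  fix i p :: nat assume "i < idx s 10 + 2" "p \<le> idx s q"
  then show "\<bar>mem s 10 i (p + off)\<bar> \<le> B" using s B chain_le[OF D, of "p + off" i] by (simp add: stores_def)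
next
  fix n' t assume *: "n' \<le> 30 * K ^ 3 \<and> (\<forall>i p. mem t x i p =
     (if i < idx s 10 + 2 \<and> p < idx s q + 1 then (if i = 0 then 0 else mem s 10 i (p + off)) else mem s x i p))"
  have "mem t x i p = contents n l (\<lambda>p. D (off + p)) i p" for i p
    using conjunct2[OF *, rule_format, of i p] s chain_rows[OF D, of "p + off" i]
    by (auto simp: stores_def contents_def add.commute)
  then show "n' \<le> 30 * K ^ 3 \<and> mem t x = contents n l (\<lambda>p. D (off + p))" using * by blast
qed (use s K B in auto)

lemma takes_extract_if:
  assumes D: "chain M n L D" and s: "stores 10 n L D s" "idx s 10 = n" "idx s q = l" "off + l \<le> L" "mem s x = (\<lambda>_ _. 0)"
    and x: "x \<notin> {10, 19}" "x \<noteq> y" and u: "u \<notin> {14, 15, 20, 21, 22, 23, 24, 25}" "idx s u = off"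
    and q: "q \<notin> {14, 15, 20, 21, 22, 23, 24, 25}" and K: "n + 2 \<le> K" "off + l + 1 \<le> K" and B: "int M \<le> B"
    and z: "mem s 19 = (\<lambda>_ _. 0)" and y: "\<And>i. 1 \<le> i \<Longrightarrow> i \<le> l \<Longrightarrow> mem s y i 0 = int (\<mu> i)" "\<And>i. 1 \<le> i \<Longrightarrow> i \<le> l \<Longrightarrow> \<mu> i \<le> M"
    and \<mu>: "is_partition \<mu>" "plen \<mu> \<le> l"
  shows "takes B K 30 (extract_if x u q y) (\<lambda>t. mem t x = contents n (plen \<mu>) (\<lambda>p. D (off + p))) s"
  unfolding takes_def
proof (rule wp_conseq[OF wp_extract_if[OF x u q]])
  fix i p :: nat assume "i < idx s 10 + 2" "p \<le> idx s q"
  then show "\<bar>mem s 10 i (p + off)\<bar> \<le> B" using s B chain_le[OF D, of "p + off" i] by (simp add: stores_def)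
next
  fix p :: nat assume "1 \<le> p" "p \<le> idx s q"
  then show "\<bar>mem s y p 0\<bar> \<le> B" using y[of p] B s by simp
next
  fix n' t assume *: "n' \<le> 30 * K ^ 3 \<and> (\<forall>i p. mem t x i p =
     (if i < idx s 10 + 2 \<and> p < idx s q + 1 then
       (if i \<noteq> 0 \<and> (p = 0 \<or> 0 < mem s y p 0) then mem s 10 i (p + off) else 0) else mem s x i p))"
  have "mem t x i p = contents n (plen \<mu>) (\<lambda>p. D (off + p)) i p" for i p
  proof -
    have "p \<le> l \<and> (p = 0 \<or> 0 < mem s y p 0) \<longleftrightarrow> p \<le> plen \<mu>"
      using y(1)[of p] plen_iff[OF \<mu>(1), of p] \<mu>(2) by (cases "p = 0") auto
    then show ?thesis
      using conjunct2[OF *, rule_format, of i p] s chain_rows[OF D, of "p + off" i]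
      by (auto simp: stores_def contents_def add.commute)
  qed
  then show "n' \<le> 30 * K ^ 3 \<and> mem t x = contents n (plen \<mu>) (\<lambda>p. D (off + p))" using * by blast
qed (use s K B z in auto)

definition pair_body :: "nat \<Rightarrow> nat \<Rightarrow> com" where
  "pair_body x y = Cond (IdxLess 15 20)
     (Cond (IdxLess 21 11) (Copy (Ref 10 20 21) (Ref x 20 21))
        (Seq (sub_idx 25 21 11) (Copy (Ref 10 20 21) (Ref y 20 25))))
     (Copy (Ref 10 20 21) (Ref y 14 12))"

lemma written_pair_body [simp]: "written_idx (pair_body x y) = {24, 25}" "written_arr (pair_body x y) = {10}"
  by (auto simp: pair_body_def)

definition load_pair :: "nat \<Rightarrow> nat \<Rightarrow> com" where
  "load_pair x y = Seq (add_idx 16 11 12) (table 10 16 (pair_body x y))"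

lemma written_load_pair [simp]: "written_idx (load_pair x y) = {14, 15, 16, 20, 21, 22, 23, 24, 25}" "written_arr (load_pair x y) = {10}"
  by (auto simp: load_pair_def)

text \<open>Column d belongs to both chains. It is taken from the second one, which also supplies
  the bound in row 0; so the first array only has to be correct in the columns before d.\<close>

lemma takes_load_pair:
  assumes D: "chain M n (d + c) D" and M: "M = D (d + c) 1" and xy: "x \<noteq> 10" "y \<noteq> 10"
    and K: "n + 2 \<le> K" "d + c + 1 \<le> K" and B: "int M \<le> B"
    and s: "\<And>i j. 1 \<le> i \<Longrightarrow> i \<le> Suc n \<Longrightarrow> j < d \<Longrightarrow> mem s x i j = int (D j i)"
      "holds_rows y n c (\<lambda>j. D (d + j)) s" "idx s 10 = n" "idx s 11 = d" "idx s 12 = c"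
  shows "takes B K 40 (load_pair x y) (stores 10 n (d + c) D) s"
  unfolding load_pair_def
proof (rule takes_Seq)
  have K1: "1 \<le> K" and Bp: "0 \<le> B" using K B by simp_all
  have KK: "K \<le> K ^ 3" using K1 by (simp add: self_le_power)
  show "takes B K 6 (add_idx 16 11 12) (\<lambda>t. idx t 16 = d + c) s"
    unfolding takes_def by (rule wp_conseq[OF wp_add_idx[OF K1]]) (use s(4,5) K KK in auto)
  fix t assume t: "idx t 16 = d + c" "same (written_idx (add_idx 16 11 12)) (written_arr (add_idx 16 11 12)) s t"
  have m: "mem t = mem s" and ix: "idx t 10 = n" "idx t 11 = d" "idx t 12 = c"
    using t(2) s by (auto simp: same_def)
  have "wp B (table 10 16 (pair_body x y)) (\<lambda>m t'. m \<le> (10 + 16) * K ^ 3 \<and>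
    (\<forall>i p. mem t' 10 i p = (if i < idx t 10 + 2 \<and> p < idx t 16 + 1 then int (D p i) else mem t 10 i p))) t"
  proof (rule wp_table)
    fix s' i p assume i: "i < idx t 10 + 2" "p < idx t 16 + 1"
      and sm: "same (written_idx (pair_body x y) \<union> table_idx) (written_arr (pair_body x y)) t s'"
      and r: "idx s' 20 = i" "idx s' 21 = p" "idx s' 14 = 1" "idx s' 15 = 0"
    have ix': "idx s' 11 = d" "idx s' 12 = c" and m': "mem s' x = mem s x" "mem s' y = mem s y"
      using sm ix m xy by (auto simp: same_def)
    have le: "\<bar>int (D p i)\<bar> \<le> B" using chain_le[OF D, of p i] B i t by simp
    show "wp B (pair_body x y) (\<lambda>n t. n \<le> 10 * K \<and> mem t 10 = (mem s' 10)(i := (mem s' 10 i)(p := int (D p i)))) s'"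
      unfolding pair_body_def
    proof (rule wp_Cond)
      assume "\<not> holds (IdxLess 15 20) s'"
      then have i0: "i = 0" using r by simp
      have "mem s y 1 c = int M" using holds_rowsD[OF s(2), of 1 c] M by simp
      then show "wp B (Copy (Ref 10 20 21) (Ref y 14 12)) (\<lambda>n t. Suc n \<le> 10 * K \<and>
        mem t 10 = (mem s' 10)(i := (mem s' 10 i)(p := int (D p i)))) s'"
        using chain_row0[OF D, of p] i0 i t r ix' m' B K1 by (intro vc_wp) auto
    next
      assume "holds (IdxLess 15 20) s'"
      then have i1: "1 \<le> i" using r by simp
      show "wp B (Cond (IdxLess 21 11) (Copy (Ref 10 20 21) (Ref x 20 21))
        (Seq (sub_idx 25 21 11) (Copy (Ref 10 20 21) (Ref y 20 25)))) (\<lambda>n t. Suc n \<le> 10 * K \<and>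
        mem t 10 = (mem s' 10)(i := (mem s' 10 i)(p := int (D p i)))) s'"
      proof (rule wp_Cond)
        assume "holds (IdxLess 21 11) s'"
        then have "mem s x i p = int (D p i)" using s(1)[OF i1, of p] i ix r ix' by simp
        then show "wp B (Copy (Ref 10 20 21) (Ref x 20 21)) (\<lambda>n t. Suc (Suc n) \<le> 10 * K \<and>
          mem t 10 = (mem s' 10)(i := (mem s' 10 i)(p := int (D p i)))) s'"
          using r m' le K1 by (intro vc_wp) auto
      next
        assume "\<not> holds (IdxLess 21 11) s'"
        then have dp: "d \<le> p" using r ix' by simp
        then have e: "mem s y i (p - d) = int (D p i)" using holds_rowsD[OF s(2) i1, of "p - d"] i ix t by simp
        show "wp B (Seq (sub_idx 25 21 11) (Copy (Ref 10 20 21) (Ref y 20 25))) (\<lambda>n t. Suc (Suc n) \<le> 10 * K \<and>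
          mem t 10 = (mem s' 10)(i := (mem s' 10 i)(p := int (D p i)))) s'"
        proof (rule wp_Seq, rule wp_framed[OF wp_sub_idx[OF K1]])
          show "idx s' 11 \<le> K" using ix' K by simp
          fix n' t' assume a: "n' \<le> 6 * K \<and> idx t' 25 = idx s' 21 - idx s' 11"
            "same (written_idx (sub_idx 25 21 11)) (written_arr (sub_idx 25 21 11)) s' t'"
          have "idx t' 20 = i" "idx t' 21 = p" "mem t' = mem s'" "idx t' 25 = p - d"
            using a r ix' by (auto simp: same_def)
          then show "wp B (Copy (Ref 10 20 21) (Ref y 20 25)) (\<lambda>n''. (\<lambda>n t. Suc (Suc n) \<le> 10 * K \<and>
            mem t 10 = (mem s' 10)(i := (mem s' 10 i)(p := int (D p i)))) (n' + n'')) t'"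
            using a(1) K1 e m' le by (intro vc_wp) simp
        qed simp_all
      qed simp
    qed simp
  qed (use ix t K in auto)
  then show "takes B K (40 - 6) (table 10 16 (pair_body x y)) (stores 10 n (d + c) D) t"
    unfolding takes_def by (rule wp_conseq) (use ix t in \<open>auto simp: stores_def\<close>)
qed simp

section \<open>Skew tableaux as input\<close>

lemma computes_one:
  assumes "takes (4 * int m + 4) K 1000 p (\<lambda>t. mem t (length ins) = out) (input_store dims ins)" "K \<le> 4 * max 1 k"
  shows "computes p dims ins [out] (576000 * cube_log k m)"
  by (rule computes_I[OF _ assms(2)]) (use assms(1) in simp)

lemma computes_two:
  assumes "takes (4 * int m + 4) K 1000 p (\<lambda>t. mem t (length ins) = out \<and> mem t (Suc (length ins)) = out') (input_store dims ins)"
    "K \<le> 4 * max 1 k"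
  shows "computes p dims ins [out, out'] (576000 * cube_log k m)"
proof (rule computes_I[OF _ assms(2)])
  have "(\<forall>x<length [out, out']. mem t (length ins + x) = [out, out'] ! x) \<longleftrightarrow>
    mem t (length ins) = out \<and> mem t (Suc (length ins)) = out'" for t :: store
    by (auto simp: less_Suc_eq)
  then show "takes (4 * int m + 4) K 1000 p (\<lambda>t. \<forall>x<length [out, out']. mem t (length ins + x) = [out, out'] ! x) (input_store dims ins)"
    using assms(1) by presburger
qed

definition load_jdt :: com where
  "load_jdt = Seq (IdxCopy 10 0) (Seq (IdxCopy 12 1) (jdt_prog 0))"

locale skew_tableau =
  fixes \<Lambda> \<mu> :: ptn and a :: "nat list" and A :: tab
  assumes con: "contains \<Lambda> \<mu>" and YT: "A \<in> YT \<Lambda> \<mu> a"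
begin

definition n where "n = plen \<Lambda>"
definition k where "k = length a"
definition M where "M = \<Lambda> 1"
definition G where "G = gt_chain M (\<mu>, A)"
definition S where "S = jdt n k M G"
text \<open>Large enough for all tables that occur: they have up to n + 2 rows, and the chains
  consist of n + k + 1 or n + n + 1 shapes.\<close>

definition K where "K = 2 * max k n + 2"
definition bnd where "bnd = 4 * int M + 4"
definition s0 where "s0 = input_store [n, k] [gt_array n k (\<mu>, A)]"

lemma G_chain: "chain M n k G" and A_eq: "A = tab_of k G"
  and G_0: "1 \<le> i \<Longrightarrow> G 0 i = \<mu> i" and G_top: "1 \<le> i \<Longrightarrow> G k i = \<Lambda> i"
  using YT_chain[OF con YT, of M n] by (auto simp: n_def k_def M_def G_def)

lemma \<mu>_G: "1 \<le> i \<Longrightarrow> \<mu> i = G 0 i" using G_0 by simp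

lemma M_top: "M = G k 1" using G_top[of 1] by (simp add: M_def)

lemma S_chain: "chain M n (k + n) S" unfolding S_def using jdt_chain(1)[OF G_chain] by (simp add: add.commute)

lemma S_0: "1 \<le> i \<Longrightarrow> S 0 i = 0" unfolding S_def by (rule jdt_chain(2)[OF G_chain])

lemma S_top: "S (k + n) = G k" unfolding S_def by (rule jdt_chain(3)[OF G_chain])

lemma outer_S: "1 \<le> i \<Longrightarrow> outer (empty_ptn, tab_of k S) i = S k i"
  by (rule outer_tab_of[OF chain_part[OF S_chain, of 0 k, simplified]]) (auto simp: S_0 empty_ptn_def)

lemma K_ge: "1 \<le> K" "n + 2 \<le> K" "n + k + 1 \<le> K" "n + n + 1 \<le> K" "K \<le> 4 * max 1 (max k n)"
  by (auto simp: K_def)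

lemma bnd_ge: "2 * int M \<le> bnd" "int M \<le> bnd" "0 \<le> bnd" by (auto simp: bnd_def)

lemma input_eq: "gt_array n k (\<mu>, A) = contents n k G"
  by (rule contents_gt_array[OF G_chain, of \<mu>, folded A_eq]) (auto simp: \<mu>_G)

lemma s0_idx: "idx s0 0 = n" "idx s0 (Suc 0) = k" and s0_mem: "mem s0 0 = contents n k G" "x \<noteq> 0 \<Longrightarrow> mem s0 x = (\<lambda>_ _. 0)"
  by (auto simp: s0_def input_store_def input_eq)

lemma takes_load_jdt:
  "takes bnd K 110 load_jdt (\<lambda>t. stores 10 n (k + n) S t \<and> idx t 0 = n \<and> idx t (Suc 0) = k \<and> idx t 10 = n \<and> idx t 12 = k \<and>
     mem t 0 = contents n k G \<and> (\<forall>x. x \<notin> {0, 10, 11, 12} \<longrightarrow> mem t x = (\<lambda>_ _. 0))) s0"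
  unfolding load_jdt_def
proof (rule takes_IdxCopy[OF K_ge(1)], simp, rule takes_IdxCopy[OF K_ge(1)], simp)
  let ?s = "set_idx 12 (idx (set_idx 10 (idx s0 0) s0) 1) (set_idx 10 (idx s0 0) s0)"
  show "takes bnd K (110 - 1 - 1) (jdt_prog 0) (\<lambda>t. stores 10 n (k + n) S t \<and> idx t 0 = n \<and> idx t (Suc 0) = k \<and> idx t 10 = n \<and> idx t 12 = k \<and>
     mem t 0 = contents n k G \<and> (\<forall>x. x \<notin> {0, 10, 11, 12} \<longrightarrow> mem t x = (\<lambda>_ _. 0))) ?s"
  proof (rule takes_weaken)
    show "takes bnd K 100 (jdt_prog 0) (stores 10 n (n + k) (jdt n k M G)) ?s"
      unfolding takes_def
    proof (rule wp_jdt[OF G_chain M_top _ K_ge(2,3) bnd_ge(1)])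
      show "holds_rows 0 n k G ?s" by (rule holds_rows_contents[OF G_chain]) (use s0_mem in auto)
    qed (use s0_idx in auto)
    fix t assume t: "stores 10 n (n + k) (jdt n k M G) t" "same (written_idx (jdt_prog 0)) (written_arr (jdt_prog 0)) ?s t"
    have "idx t u = idx ?s u" if "u \<notin> jdt_idx" for u using same_idx[OF t(2)] that by simp
    from this[of 0] this[of "Suc 0"] this[of 10] this[of 12]
    have "idx t 0 = n" "idx t (Suc 0) = k" "idx t 10 = n" "idx t 12 = k" by (simp_all add: s0_idx)
    moreover have "mem t x = mem s0 x" if "x \<notin> {10, 11, 12}" for x using same_mem[OF t(2)] that by simp
    ultimately show "stores 10 n (k + n) S t \<and> idx t 0 = n \<and> idx t (Suc 0) = k \<and> idx t 10 = n \<and> idx t 12 = k \<and>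
      mem t 0 = contents n k G \<and> (\<forall>x. x \<notin> {0, 10, 11, 12} \<longrightarrow> mem t x = (\<lambda>_ _. 0))"
      using t(1) s0_mem by (simp add: S_def add.commute)
  qed simp
qed

end

section \<open>Rectification, the Littlewood--Robinson map and switching\<close>

definition rectify_prog :: com where
  "rectify_prog = Seq load_jdt (extract_cols 1 15 12)"

lemma (in skew_tableau) computes_rectify:
  "computes rectify_prog [n, k] [gt_array n k (\<mu>, A)] [gt_array n k (rectify (\<mu>, A))] (576000 * cube_log (max k n) M)"
proof (rule computes_one[OF _ K_ge(5)], fold bnd_def s0_def)
  show "takes bnd K 1000 rectify_prog (\<lambda>t. mem t (length [gt_array n k (\<mu>, A)]) = gt_array n k (rectify (\<mu>, A))) s0"
    unfolding rectify_prog_def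
  proof (rule takes_Seq[OF takes_load_jdt], simp)
    fix t assume t: "stores 10 n (k + n) S t \<and> idx t 0 = n \<and> idx t (Suc 0) = k \<and> idx t 10 = n \<and> idx t 12 = k \<and>
      mem t 0 = contents n k G \<and> (\<forall>x. x \<notin> {0, 10, 11, 12} \<longrightarrow> mem t x = (\<lambda>_ _. 0))"
    have r: "rectify (\<mu>, A) = (empty_ptn, tab_of k S)"
      by (rule rectify_tab_of[OF G_chain, of \<mu>, folded A_eq S_def]) (rule \<mu>_G)
    have e: "gt_array n k (rectify (\<mu>, A)) = contents n k S"
      unfolding r
      by (rule contents_gt_array[OF chain_part[OF S_chain, of 0 k, simplified]]) (auto simp: S_0 empty_ptn_def)
    show "takes bnd K (1000 - 110) (extract_cols 1 15 12) (\<lambda>t. mem t (length [gt_array n k (\<mu>, A)]) = gt_array n k (rectify (\<mu>, A))) t"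
      unfolding e
      by (rule takes_weaken[OF takes_extract_cols[where off = 0 and l = k and x = 1 and u = 15 and q = 12,
          OF S_chain]]) (use t K_ge bnd_ge in auto)
  qed
qed

definition littlewood_robinson_prog :: com where
  "littlewood_robinson_prog = Seq load_jdt (Seq (extract_cols 1 15 1) (Seq (extract_cols 17 1 0)
     (Seq (IdxCopy 12 0) (Seq (jdt_prog 17) (extract_if 2 0 0 17)))))"

text \<open>Array 17 keeps the shapes from number k on. Its column 0 is the shape of the first
  output and decides how many letters of the second one are copied.\<close>

lemma (in skew_tableau) computes_littlewood_robinson:
  "computes littlewood_robinson_prog [n, k] [gt_array n k (\<mu>, A)]
     [gt_array n k (fst (littlewood_robinson (\<mu>, A))),
      gt_array n (plen (outer (fst (littlewood_robinson (\<mu>, A))))) (snd (littlewood_robinson (\<mu>, A)))]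
     (576000 * cube_log (max k n) M)"
proof (rule computes_two[OF _ K_ge(5)], fold bnd_def s0_def)
  let ?T = "jdt n n M (\<lambda>x. S (k + x))" and ?o = "outer (fst (littlewood_robinson (\<mu>, A)))"
  have C: "chain M n n (\<lambda>x. S (k + x))" by (rule chain_part[OF S_chain]) simp
  have lr: "littlewood_robinson (\<mu>, A) = ((empty_ptn, tab_of k S), (outer (empty_ptn, tab_of n ?T), tab_of n (\<lambda>x. ?T (n + x))))"
    by (rule littlewood_robinson_tab_of(2)[OF G_chain, of \<mu>, folded A_eq S_def]) (rule \<mu>_G)
  have fst: "fst (littlewood_robinson (\<mu>, A)) = (empty_ptn, tab_of k S)" using lr by simp
  have T: "chain M n (n + n) ?T" by (rule jdt_chain(1)[OF C])
  have o: "?o i = S k i" if "1 \<le> i" for i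
    unfolding fst by (rule outer_S[OF that])
  have part: "is_partition ?o" "plen ?o \<le> n"
    using partition_chain[OF S_chain, of k ?o] plen_le_chain[OF S_chain, of k ?o] o by auto
  have e1: "gt_array n k (fst (littlewood_robinson (\<mu>, A))) = contents n k S"
    unfolding fst by (rule contents_gt_array[OF chain_part[OF S_chain, of 0 k, simplified]]) (auto simp: S_0 empty_ptn_def)
  have Tn: "chain M n n (\<lambda>x. ?T (n + x))" using chain_part[OF T, of n n] by simp
  have "outer (empty_ptn, tab_of n ?T) i = ?T n i" if "1 \<le> i" for i
    by (rule outer_tab_of[OF chain_part[OF T, of 0 n, simplified] that])
      (use jdt_chain(2)[OF C that] in \<open>simp add: empty_ptn_def\<close>)
  then have e2: "gt_array n (plen ?o) (snd (littlewood_robinson (\<mu>, A))) = contents n (plen ?o) (\<lambda>x. ?T (n + x))"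
    unfolding lr snd_conv using part by (intro contents_gt_array[OF Tn]) (auto simp: fst lr)
  show "takes bnd K 1000 littlewood_robinson_prog (\<lambda>t. mem t (length [gt_array n k (\<mu>, A)]) = gt_array n k (fst (littlewood_robinson (\<mu>, A)))
    \<and> mem t (Suc (length [gt_array n k (\<mu>, A)])) = gt_array n (plen ?o) (snd (littlewood_robinson (\<mu>, A)))) s0"
    unfolding littlewood_robinson_prog_def e1 e2
  proof (rule takes_Seq[OF takes_load_jdt], simp)
    fix t1 assume t1: "stores 10 n (k + n) S t1 \<and> idx t1 0 = n \<and> idx t1 (Suc 0) = k \<and> idx t1 10 = n \<and> idx t1 12 = k \<and>
      mem t1 0 = contents n k G \<and> (\<forall>x. x \<notin> {0, 10, 11, 12} \<longrightarrow> mem t1 x = (\<lambda>_ _. 0))"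
    have x1: "takes bnd K 30 (extract_cols 1 15 1) (\<lambda>t. mem t 1 = contents n k (\<lambda>p. S (0 + p))) t1"
      by (rule takes_extract_cols[OF S_chain]) (use t1 K_ge bnd_ge in auto)
    show "takes bnd K (1000 - 110) (Seq (extract_cols 1 15 1) (Seq (extract_cols 17 1 0)
      (Seq (IdxCopy 12 0) (Seq (jdt_prog 17) (extract_if 2 0 0 17)))))
      (\<lambda>t. mem t (length [gt_array n k (\<mu>, A)]) = contents n k S
    \<and> mem t (Suc (length [gt_array n k (\<mu>, A)])) = contents n (plen ?o) (\<lambda>x. ?T (n + x))) t1"
    proof (rule takes_Seq[OF x1], simp)
      fix t2 assume t2: "mem t2 1 = contents n k (\<lambda>p. S (0 + p))" "same (written_idx (extract_cols 1 15 1)) (written_arr (extract_cols 1 15 1)) t1 t2"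
      have ix2: "idx t2 0 = n" "idx t2 (Suc 0) = k" "idx t2 10 = n" and m2: "mem t2 10 = mem t1 10" "\<And>x. x \<notin> {0, 1, 10, 11, 12} \<Longrightarrow> mem t2 x = (\<lambda>_ _. 0)"
        using t1 t2(2) by (auto simp: same_def)
      have st2: "stores 10 n (k + n) S t2" using stores_same[OF conjunct1[OF t1]] m2(1) by blast
      have x2: "takes bnd K 30 (extract_cols 17 1 0) (\<lambda>t. mem t 17 = contents n n (\<lambda>p. S (k + p))) t2"
        by (rule takes_extract_cols[OF S_chain]) (use st2 ix2 m2 K_ge bnd_ge in auto)
      show "takes bnd K (1000 - 110 - 30) (Seq (extract_cols 17 1 0)
        (Seq (IdxCopy 12 0) (Seq (jdt_prog 17) (extract_if 2 0 0 17))))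
        (\<lambda>t. mem t (length [gt_array n k (\<mu>, A)]) = contents n k S
        \<and> mem t (Suc (length [gt_array n k (\<mu>, A)])) = contents n (plen ?o) (\<lambda>x. ?T (n + x))) t2"
      proof (rule takes_Seq[OF x2], simp, rule takes_IdxCopy[OF K_ge(1)], simp)
        fix t3 assume t3: "mem t3 17 = contents n n (\<lambda>p. S (k + p))" "same (written_idx (extract_cols 17 1 0)) (written_arr (extract_cols 17 1 0)) t2 t3"
        let ?s = "set_idx 12 (idx t3 0) t3"
        have ix3: "idx ?s 0 = n" "idx ?s 10 = n" "idx ?s 12 = n" and m3: "mem ?s 1 = contents n k S" "mem ?s 17 = contents n n (\<lambda>p. S (k + p))"
            "\<And>x. x \<notin> {0, 1, 10, 11, 12, 17} \<Longrightarrow> mem ?s x = (\<lambda>_ _. 0)"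
          using t2(1) ix2 m2 t3 by (auto simp: same_def)
        have x3: "takes bnd K 100 (jdt_prog 17) (stores 10 n (n + n) ?T) ?s"
          unfolding takes_def
        proof (rule wp_jdt[OF C _ _ K_ge(2,4) bnd_ge(1)])
          show "M = S (k + n) 1" using S_top M_top by simp
          show "holds_rows 17 n n (\<lambda>x. S (k + x)) ?s" by (rule holds_rows_contents[OF C m3(2)]) simp
        qed (use ix3 in auto)
        show "takes bnd K (1000 - 110 - 30 - 30 - 1) (Seq (jdt_prog 17) (extract_if 2 0 0 17))
          (\<lambda>t. mem t (length [gt_array n k (\<mu>, A)]) = contents n k S
          \<and> mem t (Suc (length [gt_array n k (\<mu>, A)])) = contents n (plen ?o) (\<lambda>x. ?T (n + x))) ?s"
        proof (rule takes_Seq[OF x3], simp)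
          fix t4 assume t4: "stores 10 n (n + n) ?T t4" "same (written_idx (jdt_prog 17)) (written_arr (jdt_prog 17)) ?s t4"
          have "idx t4 u = idx ?s u" if "u \<notin> jdt_idx" for u using same_idx[OF t4(2)] that by simp
          from this[of 0] this[of 10] have ix4: "idx t4 0 = n" "idx t4 10 = n" using ix3 by simp_all
          have "mem t4 x = mem ?s x" if "x \<notin> {10, 11, 12}" for x using same_mem[OF t4(2)] that by simp
          from this[of 1] this[of 2] this[of 17] this[of 19]
          have m4: "mem t4 1 = contents n k S" "mem t4 2 = (\<lambda>_ _. 0)" "mem t4 17 = contents n n (\<lambda>p. S (k + p))" "mem t4 19 = (\<lambda>_ _. 0)"
            using m3 by simp_all
          have x4: "takes bnd K 30 (extract_if 2 0 0 17) (\<lambda>t. mem t 2 = contents n (plen ?o) (\<lambda>p. ?T (n + p))) t4"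
          proof (rule takes_extract_if[OF T t4(1)])
            fix i assume "1 \<le> i" "i \<le> n"
            then show "mem t4 17 i 0 = int (?o i)" "?o i \<le> M" using o[of i] chain_le[OF S_chain, of k i] m4 by (auto simp: contents_def)
          qed (use ix4 m4 K_ge bnd_ge part in auto)
          show "takes bnd K (1000 - 110 - 30 - 30 - 1 - 100) (extract_if 2 0 0 17)
            (\<lambda>t. mem t (length [gt_array n k (\<mu>, A)]) = contents n k S
            \<and> mem t (Suc (length [gt_array n k (\<mu>, A)])) = contents n (plen ?o) (\<lambda>x. ?T (n + x))) t4"
            by (rule takes_weaken[OF x4]) (use m4 in \<open>auto simp: same_def numeral_2_eq_2[symmetric]\<close>)
        qed
      qed
    qed
  qed
qed

definition rho1_prog :: com where
  "rho1_prog = Seq load_jdt (extract_if 1 1 0 0)"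

text \<open>The conditional copy consults column 0 of the input array, which is \<mu>.\<close>

lemma (in skew_tableau) computes_rho1:
  "computes rho1_prog [n, k] [gt_array n k (\<mu>, A)] [gt_array n (plen \<mu>) (rho1 (\<mu>, A))] (576000 * cube_log (max k n) M)"
proof (rule computes_one[OF _ K_ge(5)], fold bnd_def s0_def)
  have part: "is_partition \<mu>" "plen \<mu> \<le> n"
    using plen_le_chain[OF G_chain, of 0 \<mu>] con \<mu>_G by (auto simp: contains_def)
  have "switch (Can \<mu>) (\<mu>, A) = ((empty_ptn, tab_of k S), (outer (empty_ptn, tab_of k S), tab_of n (\<lambda>x. S (k + x))))"
    by (rule switch_Can[OF G_chain, of \<mu>, folded A_eq S_def]) (rule \<mu>_G)
  then have "rho1 (\<mu>, A) = (outer (empty_ptn, tab_of k S), tab_of n (\<lambda>x. S (k + x)))"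
    by (simp add: rho1_def)
  then have e: "gt_array n (plen \<mu>) (rho1 (\<mu>, A)) = contents n (plen \<mu>) (\<lambda>x. S (k + x))"
    using contents_gt_array[OF chain_part[OF S_chain, of k n]] outer_S part by simp
  show "takes bnd K 1000 rho1_prog (\<lambda>t. mem t (length [gt_array n k (\<mu>, A)]) = gt_array n (plen \<mu>) (rho1 (\<mu>, A))) s0"
    unfolding rho1_prog_def e
  proof (rule takes_Seq[OF takes_load_jdt], simp)
    fix t assume t: "stores 10 n (k + n) S t \<and> idx t 0 = n \<and> idx t (Suc 0) = k \<and> idx t 10 = n \<and> idx t 12 = k \<and>
      mem t 0 = contents n k G \<and> (\<forall>x. x \<notin> {0, 10, 11, 12} \<longrightarrow> mem t x = (\<lambda>_ _. 0))"
    have x: "takes bnd K 30 (extract_if 1 1 0 0) (\<lambda>t. mem t 1 = contents n (plen \<mu>) (\<lambda>p. S (k + p))) t"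
    proof (rule takes_extract_if[OF S_chain])
      fix i assume "1 \<le> i" "i \<le> n"
      then show "mem t 0 i 0 = int (\<mu> i)" "\<mu> i \<le> M" using \<mu>_G[of i] chain_le[OF G_chain, of 0 i] t by (auto simp: contents_def)
    qed (use t K_ge bnd_ge part in auto)
    show "takes bnd K (1000 - 110) (extract_if 1 1 0 0) (\<lambda>t. mem t (length [gt_array n k (\<mu>, A)]) = contents n (plen \<mu>) (\<lambda>x. S (k + x))) t"
      by (rule takes_weaken[OF x]) auto
  qed
qed

definition switch_tableaux_prog :: com where
  "switch_tableaux_prog = Seq (IdxCopy 10 0) (Seq (IdxCopy 11 1) (Seq (IdxCopy 12 2) (Seq (load_pair 0 1)
     (Seq switch_prog (Seq (extract_cols 2 15 2) (extract_cols 3 2 1))))))"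

lemma computes_switch:
  assumes \<pi>\<mu>: "contains \<pi> \<mu>" and \<Lambda>\<pi>: "contains \<Lambda> \<pi>" and B: "B \<in> YT \<pi> \<mu> d" and A: "A \<in> YT \<Lambda> \<pi> c"
  shows "computes switch_tableaux_prog [plen \<Lambda>, length d, length c]
     [gt_array (plen \<Lambda>) (length d) (\<mu>, B), gt_array (plen \<Lambda>) (length c) (\<pi>, A)]
     [gt_array (plen \<Lambda>) (length c) (fst (switch (\<mu>, B) (\<pi>, A))), gt_array (plen \<Lambda>) (length d) (snd (switch (\<mu>, B) (\<pi>, A)))]
     (576000 * cube_log (max (max (length c) (length d)) (plen \<Lambda>)) (\<Lambda> 1))"
proof -
  define n M d' c' where "n = plen \<Lambda>" and "M = \<Lambda> 1" and "d' = length d" and "c' = length c"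
  define GB GA where "GB = gt_chain M (\<mu>, B)" and "GA = gt_chain M (\<pi>, A)"
  have le: "\<pi> 1 \<le> M" using \<Lambda>\<pi> by (simp add: contains_def M_def)
  have part: "is_partition \<Lambda>" "is_partition \<pi>" using \<Lambda>\<pi> by (auto simp: contains_def)
  note YA = YT_chain[OF \<Lambda>\<pi> A, of M n, folded GA_def c'_def]
  have A': "chain M n c' GA" "A = tab_of c' GA" "\<And>i. 1 \<le> i \<Longrightarrow> GA 0 i = \<pi> i" "\<And>i. 1 \<le> i \<Longrightarrow> GA c' i = \<Lambda> i"
    using YA by (auto simp: n_def M_def)
  have "plen \<pi> \<le> n" using plen_le_chain[OF A'(1), of 0 \<pi>] A'(3) by simp
  from YT_chain[OF \<pi>\<mu> B le this, folded GB_def d'_def]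
  have B': "chain M n d' GB" "B = tab_of d' GB" "\<And>i. 1 \<le> i \<Longrightarrow> GB 0 i = \<mu> i" "\<And>i. 1 \<le> i \<Longrightarrow> GB d' i = \<pi> i" by auto
  \<comment> \<open>The common shape \<pi> is the last one of \<open>GB\<close> and the first one of
    \<open>GA\<close>, so the two chains can be joined.\<close>
  define D where "D j = (if j < d' then GB j else GA (j - d'))" for j
  have D0: "D j = GB j" if "j \<le> d'" for j
  proof (cases "j = d'")
    case True
    have "GB d' i = GA 0 i" for i
      using A'(3)[of i] B'(4)[of i] chain_row0[OF A'(1), of 0] chain_row0[OF B'(1), of d'] by (cases "i = 0") auto
    then show ?thesis using True by (simp add: D_def fun_eq_iff)
  qed (use that in \<open>simp add: D_def\<close>)
  have D1: "D (d' + j) = GA j" for j by (simp add: D_def)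
  have D: "chain M n (d' + c') D"
    unfolding chain_def
  proof (intro conjI allI impI)
    fix j i assume "j \<le> d' + c'"
    then have "D j = GB j \<and> j \<le> d' \<or> D j = GA (j - d') \<and> j - d' \<le> c'" by (auto simp: D_def)
    then show "D j 0 = M" "n < i \<Longrightarrow> D j i = 0" "D j (Suc i) \<le> D j i"
      using A'(1) B'(1) by (auto simp: chain_def)
  next
    fix j assume j: "j < d' + c'"
    show "interlace (D j) (D (Suc j))"
    proof (cases "j < d'")
      case True
      then show ?thesis using D0[of j] D0[of "Suc j"] chain_interlace[OF B'(1), of j] by simp
    next
      case False
      then show ?thesis using chain_interlace[OF A'(1), of "j - d'"] j by (simp add: D_def Suc_diff_le)
    qed
  qed
  have MD: "M = D (d' + c') 1" using D1[of c'] A'(4)[of 1] by (simp add: M_def)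
  let ?E = "switches d' c' d' D"
  have E: "chain M n (d' + c') ?E" by (rule chain_switches[OF D]) auto
  have Bt: "tab_of d' GB = tab_of d' D" by (rule tab_of_cong') (simp add: D0)
  have At: "tab_of c' GA = tab_of c' (\<lambda>j. D (d' + j))" by (rule tab_of_cong') (simp add: D1)
  have sw: "switch (\<mu>, B) (\<pi>, A) = ((\<mu>, tab_of c' ?E), (outer (\<mu>, tab_of c' ?E), tab_of d' (\<lambda>x. ?E (c' + x))))"
  proof -
    have 1: "tab_of c' (grid d' D d') = tab_of c' ?E" by (rule tab_of_cong') (simp add: switches_final)
    have 2: "tab_of d' (\<lambda>x. grid d' D (d' - x) c') = tab_of d' (\<lambda>x. ?E (c' + x))" by (rule tab_of_cong') (simp add: switches_final)
    show ?thesis unfolding A'(2) B'(2) Bt At switch_tab_of[OF D] 1 2 ..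
  qed
  have E0: "?E 0 i = \<mu> i" if "1 \<le> i" for i
  proof -
    have "?E 0 = grid d' D d' 0" by (simp add: switches_final)
    also have "\<dots> = D 0" by simp
    finally show ?thesis using D0[of 0] B'(3)[OF that] by simp
  qed
  have E1: "chain M n c' ?E" "chain M n d' (\<lambda>x. ?E (c' + x))"
    using chain_part[OF E, of 0 c'] chain_part[OF E, of c' d'] by auto
  have o1: "gt_array n c' (fst (switch (\<mu>, B) (\<pi>, A))) = contents n c' ?E"
    unfolding sw fst_conv by (rule contents_gt_array[OF E1(1)]) (use E0 in auto)
  have o2: "gt_array n d' (snd (switch (\<mu>, B) (\<pi>, A))) = contents n d' (\<lambda>x. ?E (c' + x))"
    unfolding sw snd_conv
  proof (rule contents_gt_array[OF E1(2)])
    fix i :: nat assume "1 \<le> i"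
    then show "outer (\<mu>, tab_of c' ?E) i = ?E (c' + 0) i" using outer_tab_of[OF E1(1)] E0 by simp
  qed simp
  define K where "K = 2 * max (max c' d') n + 2"
  define bnd where "bnd = 4 * int M + 4"
  define s0 where "s0 = input_store [n, d', c'] [gt_array n d' (\<mu>, B), gt_array n c' (\<pi>, A)]"
  have K: "1 \<le> K" "n + 2 \<le> K" "d' + c' + 1 \<le> K" "K \<le> 4 * max 1 (max (max c' d') n)" by (auto simp: K_def)
  have bnd: "2 * int M \<le> bnd" "int M \<le> bnd" by (auto simp: bnd_def)
  have in1: "gt_array n d' (\<mu>, B) = contents n d' GB"
    unfolding B'(2) by (rule contents_gt_array[OF B'(1)]) (simp_all add: B'(3))
  have in2: "gt_array n c' (\<pi>, A) = contents n c' GA"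
    unfolding A'(2) by (rule contents_gt_array[OF A'(1)]) (simp_all add: A'(3))
  have s0: "idx s0 0 = n" "idx s0 (Suc 0) = d'" "idx s0 2 = c'" "mem s0 0 = contents n d' GB" "mem s0 (Suc 0) = contents n c' GA"
    "\<And>x. x \<notin> {0, 1} \<Longrightarrow> mem s0 x = (\<lambda>_ _. 0)"
    by (auto simp: s0_def input_store_def in1 in2)
  let ?ins = "[gt_array n d' (\<mu>, B), gt_array n c' (\<pi>, A)]"
  let ?Q = "\<lambda>t. mem t (length ?ins) = contents n c' ?E \<and> mem t (Suc (length ?ins)) = contents n d' (\<lambda>x. ?E (c' + x))"
  have "takes bnd K 1000 switch_tableaux_prog ?Q s0"
    unfolding switch_tableaux_prog_def
  proof (rule takes_IdxCopy[OF K(1)], simp, rule takes_IdxCopy[OF K(1)], simp, rule takes_IdxCopy[OF K(1)], simp)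
    let ?s' = "set_idx 11 (idx (set_idx 10 (idx s0 0) s0) 1) (set_idx 10 (idx s0 0) s0)"
    let ?s = "set_idx 12 (idx ?s' 2) ?s'"
    have ix: "idx ?s 0 = n" "idx ?s (Suc 0) = d'" "idx ?s 2 = c'" "idx ?s 10 = n" "idx ?s 11 = d'" "idx ?s 12 = c'" and m: "mem ?s = mem s0"
      using s0 by simp_all
    have x1: "takes bnd K 40 (load_pair 0 1) (stores 10 n (d' + c') D) ?s"
    proof (rule takes_load_pair[OF D MD])
      fix i j assume "1 \<le> i" "i \<le> Suc n" "j < d'"
      then show "mem ?s 0 i j = int (D j i)"
        using chain_rows[OF B'(1), of j i] unfolding m by (auto simp: s0 contents_def D0)
    next
      have "holds_rows 1 n c' GA ?s" by (rule holds_rows_contents[OF A'(1)]) (use s0 in auto)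
      then show "holds_rows 1 n c' (\<lambda>j. D (d' + j)) ?s" by (simp add: D1)
    qed (use ix K bnd in auto)
    show "takes bnd K (1000 - 1 - 1 - 1) (Seq (load_pair 0 1)
     (Seq switch_prog (Seq (extract_cols 2 15 2) (extract_cols 3 2 1)))) ?Q ?s"
    proof (rule takes_Seq[OF x1], simp)
      fix t1 assume t1: "stores 10 n (d' + c') D t1" "same (written_idx (load_pair 0 1)) (written_arr (load_pair 0 1)) ?s t1"
      have ix1: "idx t1 u = idx ?s u" if "u \<in> {0, 1, 2, 10, 11, 12}" for u using same_idx[OF t1(2), of u] that by auto
      have m1: "mem t1 x = (\<lambda>_ _. 0)" if "x \<in> {2, 3}" for x using same_mem[OF t1(2), of x] that s0(6) by auto
      have x2: "takes bnd K 40 switch_prog (stores 10 n (d' + c') ?E) t1"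
        unfolding takes_def by (rule wp_switch[OF D order_refl K(1) _ _ _ bnd(1) t1(1)]) (use ix ix1 K in auto)
      show "takes bnd K (1000 - 1 - 1 - 1 - 40) (Seq switch_prog (Seq (extract_cols 2 15 2) (extract_cols 3 2 1))) ?Q t1"
      proof (rule takes_Seq[OF x2], simp)
        fix t2 assume t2: "stores 10 n (d' + c') ?E t2" "same (written_idx switch_prog) (written_arr switch_prog) t1 t2"
        have "idx t2 u = idx t1 u" if "u \<in> {0, 1, 2, 10}" for u using same_idx[OF t2(2), of u] that by auto
        then have ix2: "idx t2 (Suc 0) = d'" "idx t2 2 = c'" "idx t2 10 = n" using ix ix1 by auto
        have m2: "mem t2 x = (\<lambda>_ _. 0)" if "x \<in> {2, 3}" for x using same_mem[OF t2(2), of x] m1[OF that] that by auto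
        have x3: "takes bnd K 30 (extract_cols 2 15 2) (\<lambda>t. mem t 2 = contents n c' (\<lambda>p. ?E (0 + p))) t2"
          by (rule takes_extract_cols[OF E t2(1)]) (use ix2 m2 K bnd in auto)
        show "takes bnd K (1000 - 1 - 1 - 1 - 40 - 40) (Seq (extract_cols 2 15 2) (extract_cols 3 2 1)) ?Q t2"
        proof (rule takes_Seq[OF x3], simp)
          fix t3 assume t3: "mem t3 2 = contents n c' (\<lambda>p. ?E (0 + p))" "same (written_idx (extract_cols 2 15 2)) (written_arr (extract_cols 2 15 2)) t2 t3"
          have ix3: "idx t3 (Suc 0) = d'" "idx t3 2 = c'" "idx t3 10 = n" and m3: "mem t3 3 = (\<lambda>_ _. 0)" "mem t3 10 = mem t2 10"
            using t3(2) ix2 m2 by (auto simp: same_def)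
          have "takes bnd K 30 (extract_cols 3 2 1) (\<lambda>t. mem t 3 = contents n d' (\<lambda>p. ?E (c' + p))) t3"
            by (rule takes_extract_cols[OF E stores_same[OF t2(1) m3(2)]]) (use ix3 m3 K bnd in auto)
          then show "takes bnd K (1000 - 1 - 1 - 1 - 40 - 40 - 30) (extract_cols 3 2 1) ?Q t3"
            by (rule takes_weaken) (use t3(1) in \<open>auto simp: same_def numeral_2_eq_2[symmetric] numeral_3_eq_3[symmetric]\<close>)
        qed
      qed
    qed
  qed
  from computes_two[OF this[unfolded bnd_def s0_def] K(4)]
  show ?thesis by (simp only: o1 o2 n_def[symmetric] M_def[symmetric] d'_def[symmetric] c'_def[symmetric])
qed

section \<open>Evacuation and the maps built on it\<close>

text \<open>The nonzero rows come first, so the length is the last row with a positive entry in the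
  final column; array 19 supplies the 0.\<close>

definition plen_prog :: "nat \<Rightarrow> com" where
  "plen_prog x = Seq (IdxZero 28) (Seq (IdxZero 35) (Seq (IdxZero 36) (While (IdxLess 36 10)
     (Seq (Seq (IdxSucc 35) (Cond (ValLess (Ref 19 36 36) (Ref x 35 12)) (IdxCopy 28 35) Skip)) (IdxSucc 36)))))"

lemma written_plen_prog [simp]: "written_idx (plen_prog x) = {28, 35, 36}" "written_arr (plen_prog x) = {}"
  by (auto simp: plen_prog_def)

lemma takes_plen:
  assumes G: "chain M n k G" and K: "n + 2 \<le> K" and B: "int M \<le> B"
    and s: "holds_rows x n k G s" "idx s 10 = n" "idx s 12 = k" "mem s 19 = (\<lambda>_ _. 0)"
  shows "takes B K 15 (plen_prog x) (\<lambda>t. idx t 28 = plen (G k)) s"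
proof -
  define p where "p = plen (G k)"
  have part: "is_partition (G k)" by (rule partition_chain[OF G, of k]) auto
  have pn: "p \<le> n" unfolding p_def by (rule plen_le_chain[OF G, of k]) auto
  have K1: "1 \<le> K" using K by simp
  have KK: "K \<le> K ^ 3" "1 \<le> K ^ 3" using K1 by (simp_all add: self_le_power)
  define Inv where "Inv i t \<longleftrightarrow> same {28, 35, 36} {} s t \<and> idx t 35 = i \<and> idx t 28 = min i p" for i t
  let ?s = "set_idx 36 0 (set_idx 35 0 (set_idx 28 0 s))"
  have "wp B (While (IdxLess 36 10) (Seq (Seq (IdxSucc 35) (Cond (ValLess (Ref 19 36 36) (Ref x 35 12)) (IdxCopy 28 35) Skip)) (IdxSucc 36)))
    (\<lambda>m t. m \<le> (5 + 3) * K ^ Suc 0 \<and> Inv n t \<and> idx t 36 = n) ?s"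
  proof (rule wp_up_K[where i = 0 and I = Inv])
    fix i t assume i: "i < n" and t: "Inv i t" "idx t 36 = i" "idx t 10 = n"
    have m: "mem t = mem s" and ix: "idx t 12 = k" "idx t 35 = i" "idx t 28 = min i p"
      using t s by (auto simp: Inv_def same_def)
    have v: "mem t x (Suc i) k = int (G k (Suc i))" using holds_rowsD[OF s(1), of "Suc i" k] i m by simp
    have pos: "0 < G k (Suc i) \<longleftrightarrow> Suc i \<le> p" using plen_iff[OF part, of "Suc i"] by (simp add: p_def)
    have le: "int (G k (Suc i)) \<le> B" using chain_le[OF G, of k "Suc i"] B by simp
    show "wp B (Seq (IdxSucc 35) (Cond (ValLess (Ref 19 36 36) (Ref x 35 12)) (IdxCopy 28 35) Skip))
      (\<lambda>m t'. m \<le> 5 * K ^ 0 \<and> idx t' 36 = i \<and> idx t' 10 = n \<and> Inv (Suc i) (set_idx 36 (Suc i) t')) t"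
      by (rule vc_wp) (use t m s(4) ix v pos le B in \<open>auto simp: Inv_def same_def min_def\<close>)
  qed (use K s in \<open>auto simp: Inv_def same_def\<close>)
  then have *: "wp B (While (IdxLess 36 10) (Seq (Seq (IdxSucc 35) (Cond (ValLess (Ref 19 36 36) (Ref x 35 12)) (IdxCopy 28 35) Skip)) (IdxSucc 36)))
    (\<lambda>m t. m + 3 \<le> 15 * K ^ 3 \<and> idx t 28 = p) ?s"
  proof (rule wp_conseq)
    fix m t assume a: "m \<le> (5 + 3) * K ^ Suc 0 \<and> Inv n t \<and> idx t 36 = n"
    have "m \<le> 8 * K" using a by simp
    then show "m + 3 \<le> 15 * K ^ 3 \<and> idx t 28 = p" using a KK pn by (auto simp: Inv_def min_def)
  qed
  show ?thesis unfolding takes_def plen_prog_def p_def[symmetric]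
    by (rule vc_wp, simp, rule wp_conseq[OF *]) auto
qed

definition rot_body :: "nat \<Rightarrow> com" where
  "rot_body x = Cond (IdxLess 15 20) (Cond (IdxLess 28 20) (Const (Ref 16 20 21) 0)
     (Seq (sub_idx 25 12 21) (Seq (sub_idx 26 28 20) (Seq (IdxSucc 26) (Sub (Ref 16 20 21) (Ref x 14 12) (Ref x 26 25))))))
     (Const (Ref 16 20 21) 0)"

lemma written_rot_body [simp]: "written_idx (rot_body x) = {24, 25, 26}" "written_arr (rot_body x) = {16}"
  by (auto simp: rot_body_def)

definition xi_prog :: "nat \<Rightarrow> com" where
  "xi_prog x = Seq (plen_prog x) (Seq (table 28 12 (rot_body x)) (Seq (IdxCopy 10 28) (jdt_prog 16)))"

lemma written_xi_prog [simp]: "written_idx (xi_prog x) = jdt_idx \<union> {10, 26, 28}" "written_arr (xi_prog x) = {10, 11, 12, 16}"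
  by (auto simp: xi_prog_def)

lemma takes_rot:
  assumes G: "chain M n k G" and x: "x \<noteq> 16" and K: "p + 2 \<le> K" "n + k + 1 \<le> K" and B: "int M \<le> B" and p: "p \<le> n"
    and N: "N = G k 1"
    and s: "holds_rows x n k G s" "idx s 28 = p" "idx s 12 = k"
  shows "takes B K 40 (table 28 12 (rot_body x)) (holds_rows 16 p k (rot N p k G)) s"
proof -
  have K1: "1 \<le> K" using K by simp
  have Nle: "G j i \<le> N" if "1 \<le> i" "j \<le> k" for i j
    using chain_antimono[OF G that(2), of 1 i] chain_mono[OF G that(2), of 1] that N by simp
  have NB: "int N \<le> B" using chain_le[OF G, of k 1] N B by simp
  let ?f = "\<lambda>i j. if i = 0 then 0 else int (rot N p k G j i)"
  have "wp B (table 28 12 (rot_body x)) (\<lambda>m t. m \<le> (20 + 16) * K ^ 3 \<and>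
    (\<forall>i j. mem t 16 i j = (if i < idx s 28 + 2 \<and> j < idx s 12 + 1 then ?f i j else mem s 16 i j))) s"
  proof (rule wp_table)
    fix s' i j assume i: "i < idx s 28 + 2" "j < idx s 12 + 1"
      and sm: "same (written_idx (rot_body x) \<union> table_idx) (written_arr (rot_body x)) s s'"
      and r: "idx s' 20 = i" "idx s' 21 = j" "idx s' 14 = 1" "idx s' 15 = 0"
    have ix: "idx s' 28 = p" "idx s' 12 = k" and m: "mem s' x = mem s x"
      using sm s x by (auto simp: same_def)
    show "wp B (rot_body x) (\<lambda>n t. n \<le> 20 * K \<and> mem t 16 = (mem s' 16)(i := (mem s' 16 i)(j := ?f i j))) s'"
    proof (cases "i = 0 \<or> p < i")
      case True
      then show ?thesis unfolding rot_body_def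
        using K1 B ix r by (intro vc_wp) (auto simp: rot_def)
    next
      case False
      let ?Q = "\<lambda>n t. n \<le> 20 * K \<and> mem t 16 = (mem s' 16)(i := (mem s' 16 i)(j := ?f i j))"
      have v1: "mem s x 1 k = int N" using holds_rowsD[OF s(1), of 1 k] N by simp
      have v2: "mem s x (Suc (p - i)) (k - j) = int (G (k - j) (p + 1 - i))"
        using holds_rowsD[OF s(1), of "Suc (p - i)" "k - j"] False p by (simp add: Suc_diff_le)
      have le: "G (k - j) (p + 1 - i) \<le> N" by (rule Nle) (use False in auto)
      then have f: "?f i j = int N - int (G (k - j) (p + 1 - i))" using False by (simp add: rot_def)
      have "wp B (Seq (sub_idx 25 12 21) (Seq (sub_idx 26 28 20) (Seq (IdxSucc 26) (Sub (Ref 16 20 21) (Ref x 14 12) (Ref x 26 25)))))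
        (\<lambda>n. ?Q (Suc (Suc n))) s'"
      proof (rule wp_Seq, rule wp_framed[OF wp_sub_idx[OF K1]])
        show "idx s' 21 \<le> K" using r i s K by simp
        fix n1 t1 assume a: "n1 \<le> 6 * K \<and> idx t1 25 = idx s' 12 - idx s' 21" "same (written_idx (sub_idx 25 12 21)) (written_arr (sub_idx 25 12 21)) s' t1"
        show "wp B (Seq (sub_idx 26 28 20) (Seq (IdxSucc 26) (Sub (Ref 16 20 21) (Ref x 14 12) (Ref x 26 25))))
          (\<lambda>n'. (\<lambda>n. ?Q (Suc (Suc n))) (n1 + n')) t1"
        proof (rule wp_Seq, rule wp_framed[OF wp_sub_idx[OF K1]])
          show "idx t1 20 \<le> K" using r i s K a by (simp add: same_def)
          fix n2 t2 assume b: "n2 \<le> 6 * K \<and> idx t2 26 = idx t1 28 - idx t1 20" "same (written_idx (sub_idx 26 28 20)) (written_arr (sub_idx 26 28 20)) t1 t2"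
          have "idx t2 20 = i" "idx t2 21 = j" "idx t2 14 = 1" "idx t2 12 = k" "idx t2 25 = k - j" "idx t2 26 = p - i" "mem t2 = mem s'"
            using a b r ix by (auto simp: same_def)
          then show "wp B (Seq (IdxSucc 26) (Sub (Ref 16 20 21) (Ref x 14 12) (Ref x 26 25)))
            (\<lambda>n'. (\<lambda>n'. (\<lambda>n. ?Q (Suc (Suc n))) (n1 + n')) (n2 + n')) t2"
            using conjunct1[OF a(1)] conjunct1[OF b(1)] K1 m v1 v2 NB le unfolding f by (intro vc_wp) auto
        qed simp_all
      qed simp_all
      then show ?thesis unfolding rot_body_def
        by (intro wp_Cond) (use False r ix in auto)
    qed
  qed (use K s in auto)
  then show ?thesis unfolding takes_def
    by (rule wp_conseq) (use s in \<open>auto simp: holds_rows_def\<close>)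
qed

text \<open>Register 10 ends up as \<open>plen (G k)\<close>, since the evacuation works in the rows
  of the bounding rectangle; programs that continue with n rows have to restore it.\<close>

lemma takes_xi:
  assumes G: "chain M n k G" and 0: "\<And>i. 1 \<le> i \<Longrightarrow> G 0 i = 0" and x: "x \<notin> {10, 11, 12, 16}"
    and K: "n + 2 \<le> K" "n + k + 1 \<le> K" and B: "2 * int M \<le> B"
    and s: "holds_rows x n k G s" "idx s 10 = n" "idx s 12 = k" "mem s 19 = (\<lambda>_ _. 0)"
  shows "takes B K 160 (xi_prog x) (\<lambda>t. stores 10 (plen (G k)) (plen (G k) + k) (evac k G) t \<and>
    idx t 28 = plen (G k) \<and> idx t 10 = plen (G k)) s"
proof -
  define p N where "p = plen (G k)" and "N = G k 1"
  let ?R = "rot N p k G"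
  have part: "is_partition (G k)" by (rule partition_chain[OF G, of k]) auto
  have pn: "p \<le> n" unfolding p_def by (rule plen_le_chain[OF G, of k]) auto
  have K1: "1 \<le> K" and BM: "int M \<le> B" using K B by simp_all
  have NM: "N \<le> M" using chain_le[OF G, of k 1] N_def by simp
  have "G j i \<le> N" if "1 \<le> i" "j \<le> k" for i j
    using chain_antimono[OF G that(2), of 1 i] chain_mono[OF G that(2), of 1] that N_def by simp
  then have R: "chain N p k ?R" by (rule chain_rot[OF G pn])
  have NR: "N = ?R k 1" using plen_iff[OF part, of 1] 0[of p] by (auto simp: rot_def N_def p_def)
  have E: "evac k G = jdt p k N ?R" by (simp add: evac_def Let_def p_def N_def)
  show ?thesis unfolding xi_prog_def p_def[symmetric]
  proof (rule takes_Seq[OF takes_plen[OF G K(1) BM s]], simp)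
    fix t1 assume t1: "idx t1 28 = plen (G k)" "same (written_idx (plen_prog x)) (written_arr (plen_prog x)) s t1"
    have ix1: "idx t1 28 = p" "idx t1 12 = k" and m1: "mem t1 = mem s" using t1 s by (auto simp: same_def p_def)
    have h1: "holds_rows x n k G t1" using s(1) m1 by (simp add: holds_rows_def)
    have x1: "takes B K 40 (table 28 12 (rot_body x)) (holds_rows 16 p k ?R) t1"
      by (rule takes_rot[OF G _ _ K(2) BM pn N_def h1]) (use x pn K ix1 in auto)
    show "takes B K (160 - 15) (Seq (table 28 12 (rot_body x)) (Seq (IdxCopy 10 28) (jdt_prog 16)))
      (\<lambda>t. stores 10 p (p + k) (evac k G) t \<and> idx t 28 = p \<and> idx t 10 = p) t1"
    proof (rule takes_Seq[OF x1], simp, rule takes_IdxCopy[OF K1], simp)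
      fix t2 assume t2: "holds_rows 16 p k ?R t2" "same (written_idx (table 28 12 (rot_body x))) (written_arr (table 28 12 (rot_body x))) t1 t2"
      let ?s = "set_idx 10 (idx t2 28) t2"
      have ix2: "idx ?s 10 = p" "idx ?s 12 = k" "idx ?s 28 = p" using t2(2) ix1 by (auto simp: same_def)
      have "takes B K 100 (jdt_prog 16) (stores 10 p (p + k) (evac k G)) ?s"
        unfolding takes_def E
        by (rule wp_jdt[OF R NR]) (use t2(1) ix2 K pn NM B in \<open>auto simp: holds_rows_def\<close>)
      then show "takes B K (160 - 15 - 40 - 1) (jdt_prog 16)
        (\<lambda>t. stores 10 p (p + k) (evac k G) t \<and> idx t 28 = p \<and> idx t 10 = p) ?s"
      proof (rule takes_weaken)
        fix t assume t: "stores 10 p (p + k) (evac k G) t" "same (written_idx (jdt_prog 16)) (written_arr (jdt_prog 16)) ?s t"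
        have "idx t u = idx ?s u" if "u \<notin> jdt_idx" for u using same_idx[OF t(2)] that by simp
        from this[of 10] this[of 28] t(1) ix2 show "stores 10 p (p + k) (evac k G) t \<and> idx t 28 = p \<and> idx t 10 = p" by simp
      qed simp
    qed
  qed
qed

definition schuetzenberger_prog :: com where
  "schuetzenberger_prog = Seq (IdxCopy 10 0) (Seq (IdxCopy 12 1) (Seq (xi_prog 0) (extract_cols 1 15 12)))"

text \<open>By interlacing each letter adds at most one row. For \<open>xi\<close> this gives n
  \<le> k and hence a cost bound in terms of k alone.\<close>

lemma chain_normal:
  assumes G: "chain M n k G" and 0: "\<And>i. 1 \<le> i \<Longrightarrow> G 0 i = 0"
  shows "j \<le> k \<Longrightarrow> j < i \<Longrightarrow> G j i = 0"
proof (induction j arbitrary: i)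
  case (Suc j)
  then obtain i' where i: "i = Suc i'" "j < i'" by (cases i) auto
  have "G (Suc j) (Suc i') \<le> G j i'" using chain_interlace[OF G, of j] Suc.prems by (simp add: interlace_def)
  then show ?case using Suc.IH[OF _ i(2)] Suc.prems i by simp
qed (use 0 in auto)

lemma computes_xi:
  assumes \<Lambda>: "is_partition \<Lambda>" and A: "A \<in> YT \<Lambda> empty_ptn a"
  shows "computes schuetzenberger_prog [plen \<Lambda>, length a] [gt_array (plen \<Lambda>) (length a) (empty_ptn, A)]
    [gt_array (plen \<Lambda>) (length a) (xi (length a) (empty_ptn, A))] (576000 * cube_log (length a) (\<Lambda> 1))"
proof -
  have c: "contains \<Lambda> empty_ptn" using \<Lambda> by (simp add: contains_def is_partition_def empty_ptn_def)
  interpret skew_tableau \<Lambda> empty_ptn a A using c A by unfold_locales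
  have 0: "G 0 i = 0" if "1 \<le> i" for i using G_0[OF that] by (simp add: empty_ptn_def)
  have p: "plen (G k) = n" unfolding n_def by (rule plen_cong) (rule G_top)
  have "n \<le> k"
  proof (rule ccontr)
    assume "\<not> n \<le> k"
    then have "G k n \<noteq> 0" using plen_iff[of "G k" n] partition_chain[OF G_chain, of k "G k"] p by simp
    then show False using chain_normal[OF G_chain 0, of k n] \<open>\<not> n \<le> k\<close> by simp
  qed
  then have K: "K \<le> 4 * max 1 k" using K_ge(5) by (simp add: max_def)
  have X: "xi k (empty_ptn, A) = (empty_ptn, tab_of k (evac k G))"
    by (rule xi_tab_of(1)[OF G_chain, folded A_eq]) (rule 0)
  have C: "chain M n k (evac k G)" using xi_tab_of(2)[OF G_chain 0] by (simp add: p M_top)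
  have e: "gt_array n k (xi k (empty_ptn, A)) = contents n k (evac k G)"
    unfolding X by (rule contents_gt_array[OF C]) (use xi_tab_of(3)[OF G_chain 0] in \<open>auto simp: empty_ptn_def\<close>)
  have "takes bnd K 1000 schuetzenberger_prog (\<lambda>t. mem t (length [gt_array n k (empty_ptn, A)]) = gt_array n k (xi k (empty_ptn, A))) s0"
    unfolding schuetzenberger_prog_def e
  proof (rule takes_IdxCopy[OF K_ge(1)], simp, rule takes_IdxCopy[OF K_ge(1)], simp)
    let ?s = "set_idx 12 (idx (set_idx 10 (idx s0 0) s0) 1) (set_idx 10 (idx s0 0) s0)"
    have ix: "idx ?s 10 = n" "idx ?s 12 = k" and m: "mem ?s = mem s0" by (simp_all add: s0_idx)
    have h: "holds_rows 0 n k G ?s" by (rule holds_rows_contents[OF G_chain]) (use s0_mem in auto)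
    have x1: "takes bnd K 160 (xi_prog 0) (\<lambda>t. stores 10 n (n + k) (evac k G) t \<and> idx t 28 = n \<and> idx t 10 = n) ?s"
      by (rule takes_xi[OF G_chain 0, unfolded p]) (use ix m h s0_mem K_ge bnd_ge in auto)
    show "takes bnd K (1000 - 1 - 1) (Seq (xi_prog 0) (extract_cols 1 15 12))
      (\<lambda>t. mem t (length [gt_array n k (empty_ptn, A)]) = contents n k (evac k G)) ?s"
    proof (rule takes_Seq[OF x1], simp)
      fix t assume t: "stores 10 n (n + k) (evac k G) t \<and> idx t 28 = n \<and> idx t 10 = n"
        "same (written_idx (xi_prog 0)) (written_arr (xi_prog 0)) ?s t"
      have i: "idx t 12 = k" using same_idx[OF t(2), of 12] ix by simp
      have m1: "mem t 1 = (\<lambda>_ _. 0)" using same_mem[OF t(2), of 1] s0_mem by simp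
      have st: "stores 10 n k (evac k G) t" using stores_shorter[OF conjunct1[OF t(1)]] by simp
      show "takes bnd K (1000 - 1 - 1 - 160) (extract_cols 1 15 12)
        (\<lambda>t. mem t (length [gt_array n k (empty_ptn, A)]) = contents n k (evac k G)) t"
        by (rule takes_weaken[OF takes_extract_cols[where off = 0 and l = k and x = 1 and u = 15 and q = 12, OF C st]])
          (use t(1) i m1 K_ge bnd_ge in auto)
    qed
  qed
  from computes_one[OF this[unfolded bnd_def s0_def] K] show ?thesis by (simp add: n_def k_def M_def)
qed

text \<open>Evacuation uses only p rows of array 10, and the rows below may still contain an earlier
  chain. The copy replaces them by 0 before it is joined to a chain with n rows.\<close>

definition mask_body :: com where
  "mask_body = Cond (IdxLess 15 20) (Cond (IdxLess 28 20) (Const (Ref 20 20 21) 0) (Copy (Ref 20 20 21) (Ref 10 20 21)))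
     (Const (Ref 20 20 21) 0)"

lemma written_mask_body [simp]: "written_idx mask_body = {}" "written_arr mask_body = {20}"
  by (auto simp: mask_body_def)

lemma takes_mask:
  assumes X: "chain N p L X" and st: "stores 10 p L X s" and ix: "idx s 0 = n" "idx s 1 = k" "idx s 28 = p"
    and k: "k \<le> L" and K: "n + 2 \<le> K" "k + 1 \<le> K" and B: "int N \<le> B"
  shows "takes B K 30 (table 0 1 mask_body) (\<lambda>t. \<forall>i j. 1 \<le> i \<longrightarrow> i \<le> Suc n \<longrightarrow> j \<le> k \<longrightarrow> mem t 20 i j = int (X j i)) s"
proof -
  have K1: "1 \<le> K" using K by simp
  let ?f = "\<lambda>i j. if i = 0 then 0 else int (X j i)"
  have "wp B (table 0 1 mask_body) (\<lambda>m t. m \<le> (6 + 16) * K ^ 3 \<and>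
    (\<forall>i j. mem t 20 i j = (if i < idx s 0 + 2 \<and> j < idx s 1 + 1 then ?f i j else mem s 20 i j))) s"
  proof (rule wp_table)
    fix s' i j assume i: "i < idx s 0 + 2" "j < idx s 1 + 1"
      and sm: "same (written_idx mask_body \<union> table_idx) (written_arr mask_body) s s'"
      and r: "idx s' 20 = i" "idx s' 21 = j" "idx s' 14 = 1" "idx s' 15 = 0"
    have ix': "idx s' 28 = p" and m: "mem s' 10 = mem s 10" using sm ix by (auto simp: same_def)
    have jL: "j \<le> L" using i ix k by simp
    have le: "int (X j i) \<le> B" using chain_le[OF X jL, of i] B by simp
    have v: "mem s 10 i j = int (X j i)" if "i \<le> p" using st that jL by (simp add: stores_def)
    show "wp B mask_body (\<lambda>n t. n \<le> 6 * K \<and> mem t 20 = (mem s' 20)(i := (mem s' 20 i)(j := ?f i j))) s'"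
      unfolding mask_body_def using chain_rows[OF X jL, of i] le v r ix' m K1 B by (intro vc_wp) auto
  qed (use ix K in auto)
  then show ?thesis unfolding takes_def
    by (rule wp_conseq) (use ix in auto)
qed

definition reversal_prog :: com where
  "reversal_prog = Seq load_jdt (Seq (extract_cols 18 15 1) (Seq (extract_cols 17 1 0) (Seq (xi_prog 18)
     (Seq (table 0 1 mask_body) (Seq (IdxCopy 10 0) (Seq (IdxCopy 11 1) (Seq (IdxCopy 12 0)
     (Seq (load_pair 20 17) (Seq switch_prog (extract_cols 1 0 1))))))))))"

lemma (in skew_tableau) computes_reversal:
  "computes reversal_prog [n, k] [gt_array n k (\<mu>, A)] [gt_array n k (reversal k (\<mu>, A))] (576000 * cube_log (max k n) M)"
proof (rule computes_one[OF _ K_ge(5)], fold bnd_def s0_def)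
  define X where "X = evac k S"
  define p where "p = plen (S k)"
  define D where "D = (\<lambda>j i. if j < k then (if i = 0 then M else X j i) else S j i)"
  let ?E = "switches k n k D"
  have Sk: "chain M n k S" using chain_part[OF S_chain, of 0 k] by simp
  have C: "chain M n n (\<lambda>x. S (k + x))" by (rule chain_part[OF S_chain]) simp
  have D: "chain M n (k + n) D"
    using reversal_tab_of(1)[OF G_chain, of "G 0"] unfolding D_def X_def S_def by simp
  obtain \<mu>' where \<mu>': "\<And>i. 1 \<le> i \<Longrightarrow> \<mu>' i = ?E n i" "reversal k (\<mu>, A) = (\<mu>', tab_of k (\<lambda>x. ?E (n + x)))"
  proof -
    have "\<exists>\<mu>'. (\<forall>i\<ge>1. \<mu>' i = ?E n i) \<and> reversal k (\<mu>, A) = (\<mu>', tab_of k (\<lambda>x. ?E (n + x)))"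
      unfolding D_def X_def by (rule reversal_tab_of(2)[OF G_chain, of \<mu>, folded A_eq S_def]) (rule \<mu>_G)
    then show ?thesis using that by blast
  qed
  have X: "chain (S k 1) p k X" "\<And>i. 1 \<le> i \<Longrightarrow> X 0 i = 0" unfolding X_def p_def
    by (rule xi_tab_of(2)[OF Sk S_0]) (auto intro: xi_tab_of(3)[OF Sk S_0])
  have pn: "p \<le> n" unfolding p_def by (rule plen_le_chain[OF Sk, of k]) auto
  have Sk1: "S k 1 \<le> M" using chain_le[OF Sk, of k 1] by simp
  have MD: "M = D (k + n) 1" using S_top M_top by (simp add: D_def)
  have E: "chain M n (k + n) ?E" by (rule chain_switches[OF D]) auto
  have e: "gt_array n k (reversal k (\<mu>, A)) = contents n k (\<lambda>x. ?E (n + x))"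
    unfolding \<mu>'(2) by (rule contents_gt_array[OF chain_part[OF E, of n k]]) (auto simp: \<mu>'(1))
  let ?Q = "\<lambda>t. mem t (length [gt_array n k (\<mu>, A)]) = contents n k (\<lambda>x. ?E (n + x))"
  show "takes bnd K 1000 reversal_prog (\<lambda>t. mem t (length [gt_array n k (\<mu>, A)]) = gt_array n k (reversal k (\<mu>, A))) s0"
    unfolding reversal_prog_def e
  proof (rule takes_Seq[OF takes_load_jdt], simp)
    fix t1 assume t1: "stores 10 n (k + n) S t1 \<and> idx t1 0 = n \<and> idx t1 (Suc 0) = k \<and> idx t1 10 = n \<and> idx t1 12 = k \<and>
      mem t1 0 = contents n k G \<and> (\<forall>x. x \<notin> {0, 10, 11, 12} \<longrightarrow> mem t1 x = (\<lambda>_ _. 0))"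
    have x1: "takes bnd K 30 (extract_cols 18 15 1) (\<lambda>t. mem t 18 = contents n k (\<lambda>p. S (0 + p))) t1"
      by (rule takes_extract_cols[OF S_chain]) (use t1 K_ge bnd_ge in auto)
    show "takes bnd K (1000 - 110) (Seq (extract_cols 18 15 1) (Seq (extract_cols 17 1 0) (Seq (xi_prog 18)
     (Seq (table 0 1 mask_body) (Seq (IdxCopy 10 0) (Seq (IdxCopy 11 1) (Seq (IdxCopy 12 0)
     (Seq (load_pair 20 17) (Seq switch_prog (extract_cols 1 0 1)))))))))) ?Q t1"
    proof (rule takes_Seq[OF x1], simp)
      fix t2 assume t2: "mem t2 18 = contents n k (\<lambda>p. S (0 + p))" "same (written_idx (extract_cols 18 15 1)) (written_arr (extract_cols 18 15 1)) t1 t2"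
      have ix2: "idx t2 0 = n" "idx t2 (Suc 0) = k" "idx t2 10 = n" "idx t2 12 = k" and m2: "mem t2 10 = mem t1 10"
        "\<And>x. x \<notin> {0, 10, 11, 12, 18} \<Longrightarrow> mem t2 x = (\<lambda>_ _. 0)"
        using t1 t2(2) by (auto simp: same_def)
      have st2: "stores 10 n (k + n) S t2" using stores_same[OF conjunct1[OF t1]] m2(1) by blast
      have x2: "takes bnd K 30 (extract_cols 17 1 0) (\<lambda>t. mem t 17 = contents n n (\<lambda>p. S (k + p))) t2"
        by (rule takes_extract_cols[OF S_chain]) (use st2 ix2 m2 K_ge bnd_ge in auto)
      show "takes bnd K (1000 - 110 - 30) (Seq (extract_cols 17 1 0) (Seq (xi_prog 18)
       (Seq (table 0 1 mask_body) (Seq (IdxCopy 10 0) (Seq (IdxCopy 11 1) (Seq (IdxCopy 12 0)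
       (Seq (load_pair 20 17) (Seq switch_prog (extract_cols 1 0 1))))))))) ?Q t2"
      proof (rule takes_Seq[OF x2], simp)
        fix t3 assume t3: "mem t3 17 = contents n n (\<lambda>p. S (k + p))" "same (written_idx (extract_cols 17 1 0)) (written_arr (extract_cols 17 1 0)) t2 t3"
        have ix3: "idx t3 0 = n" "idx t3 (Suc 0) = k" "idx t3 10 = n" "idx t3 12 = k"
          and m3: "mem t3 18 = contents n k S" "\<And>x. x \<notin> {0, 10, 11, 12, 17, 18} \<Longrightarrow> mem t3 x = (\<lambda>_ _. 0)"
          using ix2 m2 t2(1) t3(2) by (auto simp: same_def)
        have x3: "takes bnd K 160 (xi_prog 18) (\<lambda>t. stores 10 p (p + k) X t \<and> idx t 28 = p \<and> idx t 10 = p) t3"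
          unfolding X_def p_def
        proof (rule takes_xi[OF Sk S_0])
          show "holds_rows 18 n k S t3" by (rule holds_rows_contents[OF Sk m3(1)]) simp
        qed (use ix3 m3 K_ge bnd_ge in auto)
        show "takes bnd K (1000 - 110 - 30 - 30) (Seq (xi_prog 18)
         (Seq (table 0 1 mask_body) (Seq (IdxCopy 10 0) (Seq (IdxCopy 11 1) (Seq (IdxCopy 12 0)
         (Seq (load_pair 20 17) (Seq switch_prog (extract_cols 1 0 1)))))))) ?Q t3"
        proof (rule takes_Seq[OF x3], simp)
          fix t4 assume t4: "stores 10 p (p + k) X t4 \<and> idx t4 28 = p \<and> idx t4 10 = p" "same (written_idx (xi_prog 18)) (written_arr (xi_prog 18)) t3 t4"
          have "idx t4 0 = idx t3 0" "idx t4 (Suc 0) = idx t3 (Suc 0)" using same_idx[OF t4(2), of 0] same_idx[OF t4(2), of "Suc 0"] by auto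
          then have ix4: "idx t4 0 = n" "idx t4 (Suc 0) = k" "idx t4 28 = p" using ix3 t4 by auto
          have m4: "mem t4 17 = contents n n (\<lambda>p. S (k + p))" "mem t4 1 = (\<lambda>_ _. 0)"
            using same_mem[OF t4(2), of 17] same_mem[OF t4(2), of 1] t3(1) m3(2)[of 1] by auto
          have st4: "stores 10 p k X t4" using stores_shorter[OF conjunct1[OF t4(1)]] by simp
          have x4: "takes bnd K 30 (table 0 1 mask_body) (\<lambda>t. \<forall>i j. 1 \<le> i \<longrightarrow> i \<le> Suc n \<longrightarrow> j \<le> k \<longrightarrow> mem t 20 i j = int (X j i)) t4"
            by (rule takes_mask[OF X(1) st4]) (use ix4 K_ge bnd_ge Sk1 in auto)
          show "takes bnd K (1000 - 110 - 30 - 30 - 160)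
           (Seq (table 0 1 mask_body) (Seq (IdxCopy 10 0) (Seq (IdxCopy 11 1) (Seq (IdxCopy 12 0)
           (Seq (load_pair 20 17) (Seq switch_prog (extract_cols 1 0 1))))))) ?Q t4"
          proof (rule takes_Seq[OF x4], simp, rule takes_IdxCopy[OF K_ge(1)], simp, rule takes_IdxCopy[OF K_ge(1)], simp,
              rule takes_IdxCopy[OF K_ge(1)], simp)
            fix t5 assume t5: "\<forall>i j. 1 \<le> i \<longrightarrow> i \<le> Suc n \<longrightarrow> j \<le> k \<longrightarrow> mem t5 20 i j = int (X j i)"
              "same (written_idx (table 0 1 mask_body)) (written_arr (table 0 1 mask_body)) t4 t5"
            let ?s' = "set_idx 11 (idx (set_idx 10 (idx t5 0) t5) 1) (set_idx 10 (idx t5 0) t5)"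
            let ?s = "set_idx 12 (idx ?s' 0) ?s'"
            have ix5: "idx ?s 0 = n" "idx ?s (Suc 0) = k" "idx ?s 10 = n" "idx ?s 11 = k" "idx ?s 12 = n"
              and m5: "mem ?s 17 = contents n n (\<lambda>p. S (k + p))" "mem ?s 1 = (\<lambda>_ _. 0)"
              using t5(2) ix4 m4 by (auto simp: same_def)
            have x5: "takes bnd K 40 (load_pair 20 17) (stores 10 n (k + n) D) ?s"
            proof (rule takes_load_pair[OF D MD])
              fix i j assume "1 \<le> i" "i \<le> Suc n" "j < k"
              then show "mem ?s 20 i j = int (D j i)" using t5(1) by (simp add: D_def)
            next
              have "holds_rows 17 n n (\<lambda>x. S (k + x)) ?s" by (rule holds_rows_contents[OF C m5(1)]) simp
              then show "holds_rows 17 n n (\<lambda>j. D (k + j)) ?s" by (simp add: D_def)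
            qed (use ix5 K_ge bnd_ge in auto)
            show "takes bnd K (1000 - 110 - 30 - 30 - 160 - 30 - 1 - 1 - 1)
              (Seq (load_pair 20 17) (Seq switch_prog (extract_cols 1 0 1))) ?Q ?s"
            proof (rule takes_Seq[OF x5], simp)
              fix t6 assume t6: "stores 10 n (k + n) D t6" "same (written_idx (load_pair 20 17)) (written_arr (load_pair 20 17)) ?s t6"
              have "idx t6 u = idx ?s u" if "u \<in> {0, 1, 10, 11, 12}" for u using same_idx[OF t6(2), of u] that by auto
              then have ix6: "idx t6 0 = n" "idx t6 (Suc 0) = k" "idx t6 10 = n" "idx t6 11 = k" "idx t6 12 = n" using ix5 by auto
              have m6: "mem t6 1 = (\<lambda>_ _. 0)" using same_mem[OF t6(2), of 1] m5 by simp
              have x6: "takes bnd K 40 switch_prog (stores 10 n (k + n) ?E) t6"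
                unfolding takes_def by (rule wp_switch[OF D order_refl K_ge(1) _ _ _ bnd_ge(1) t6(1)]) (use ix6 K_ge in auto)
              show "takes bnd K (1000 - 110 - 30 - 30 - 160 - 30 - 1 - 1 - 1 - 40) (Seq switch_prog (extract_cols 1 0 1)) ?Q t6"
              proof (rule takes_Seq[OF x6], simp)
                fix t7 assume t7: "stores 10 n (k + n) ?E t7" "same (written_idx switch_prog) (written_arr switch_prog) t6 t7"
                have "idx t7 u = idx t6 u" if "u \<in> {0, 1, 10}" for u using same_idx[OF t7(2), of u] that by auto
                then have ix7: "idx t7 0 = n" "idx t7 (Suc 0) = k" "idx t7 10 = n" using ix6 by auto
                have m7: "mem t7 1 = (\<lambda>_ _. 0)" using same_mem[OF t7(2), of 1] m6 by simp
                show "takes bnd K (1000 - 110 - 30 - 30 - 160 - 30 - 1 - 1 - 1 - 40 - 40) (extract_cols 1 0 1) ?Q t7"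
                  by (rule takes_weaken[OF takes_extract_cols[where off = n and l = k and x = 1 and u = 0 and q = 1, OF E t7(1)]])
                    (use ix7 m7 K_ge bnd_ge in auto)
              qed
            qed
          qed
        qed
      qed
    qed
  qed
qed

section \<open>A program for the second fundamental symmetry map\<close>

text \<open>The shape number n - j may lie beyond the last column of the input; as the shapes are
  constant from there on, the subscript is cut off at the number of letters in register 1.\<close>

definition gam_body :: com where
  "gam_body = Seq (sub_idx 25 0 21) (Seq (add_idx 26 25 20) (Seq (Cond (IdxLess 1 25) (IdxCopy 25 1) Skip)
     (Copy (Ref 18 20 21) (Ref 0 26 25))))"

lemma written_gam_body [simp]: "written_idx gam_body = {24, 25, 26}" "written_arr gam_body = {18}"
  by (auto simp: gam_body_def)

text \<open>Subtracts the sum in \<open>Bc_from_right\<close> from the entry, which starts as row i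
  of \<Lambda>: register 27 runs over the letters q, and register 26 holds i - 1.\<close>

definition row_loop :: com where
  "row_loop = While (IdxLess 25 28) (Seq (Seq (IdxSucc 27) (Seq (Sub (Ref 1 20 21) (Ref 1 20 21) (Ref 10 27 20))
     (Add (Ref 1 20 21) (Ref 1 20 21) (Ref 10 27 26)))) (IdxSucc 25))"

definition row_body :: com where
  "row_body = Cond (IdxLess 15 20) (Cond (IdxLess 0 20) (Const (Ref 1 20 21) 0)
     (Seq (Copy (Ref 1 20 21) (Ref 0 20 1)) (Seq (IdxCopy 26 20) (Seq (IdxPred 26) (Seq (IdxCopy 25 21) (Seq (IdxCopy 27 21) row_loop))))))
     (Const (Ref 1 20 21) 0)"

lemma written_row_body [simp]: "written_idx row_body = {25, 26, 27}" "written_arr row_body = {1}"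
  by (auto simp: row_body_def row_loop_def)

definition rho2_prog :: com where
  "rho2_prog = Seq (table 0 0 gam_body) (Seq (IdxCopy 10 0) (Seq (IdxCopy 12 0) (Seq (xi_prog 18) (table 0 28 row_body))))"

sublocale LR_tableau \<subseteq> sk: skew_tableau \<Lambda> \<mu> \<nu> A
  using con YT by unfold_locales

context LR_tableau
begin

lemma sk_simps [simp]: "sk.n = n" "sk.M = M" "sk.G = G" "sk.k = length \<nu>"
  by (simp_all add: sk.n_def n_def sk.M_def M_def sk.G_def G_def sk.k_def)

lemma Kn: "1 \<le> sk.K" "n + 2 \<le> sk.K" "n + length \<nu> + 1 \<le> sk.K" "n + n + 1 \<le> sk.K"
  using sk.K_ge by simp_all

lemma Bn: "2 * int M \<le> sk.bnd" "int M \<le> sk.bnd" "0 \<le> sk.bnd"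
  using sk.bnd_ge by simp_all

lemma takes_gam:
  assumes s: "mem s 0 = contents n (length \<nu>) G" "idx s 0 = n" "idx s 1 = length \<nu>"
  shows "takes sk.bnd sk.K 40 (table 0 0 gam_body) (holds_rows 18 n n Gam) s"
proof -
  let ?k = "length \<nu>" and ?K = sk.K and ?B = sk.bnd
  let ?f = "\<lambda>i j. contents n ?k G (n - j + i) (min ?k (n - j))"
  have "wp ?B (table 0 0 gam_body) (\<lambda>m t. m \<le> (20 + 16) * ?K ^ 3 \<and>
    (\<forall>i j. mem t 18 i j = (if i < idx s 0 + 2 \<and> j < idx s 0 + 1 then ?f i j else mem s 18 i j))) s"
  proof (rule wp_table)
    fix s' i j assume i: "i < idx s 0 + 2" "j < idx s 0 + 1"
      and sm: "same (written_idx gam_body \<union> table_idx) (written_arr gam_body) s s'"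
      and r: "idx s' 20 = i" "idx s' 21 = j" "idx s' 14 = 1" "idx s' 15 = 0"
    have ix: "idx s' 0 = n" "idx s' (Suc 0) = ?k" and m: "mem s' 0 = contents n ?k G"
      using sm s by (auto simp: same_def)
    have le: "\<bar>?f i j\<bar> \<le> ?B" using chain_le[OF G_chain, of "min ?k (n - j)" "n - j + i"] Bn by (auto simp: contents_def)
    let ?Q = "\<lambda>n t. n \<le> 20 * ?K \<and> mem t 18 = (mem s' 18)(i := (mem s' 18 i)(j := ?f i j))"
    show "wp ?B gam_body ?Q s'"
      unfolding gam_body_def
    proof (rule wp_Seq, rule wp_framed[OF wp_sub_idx[OF Kn(1)]])
      show "idx s' 21 \<le> ?K" using r i s Kn by simp
      fix n1 t1 assume a: "n1 \<le> 6 * ?K \<and> idx t1 25 = idx s' 0 - idx s' 21" "same (written_idx (sub_idx 25 0 21)) (written_arr (sub_idx 25 0 21)) s' t1"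
      show "wp ?B (Seq (add_idx 26 25 20) (Seq (Cond (IdxLess 1 25) (IdxCopy 25 1) Skip) (Copy (Ref 18 20 21) (Ref 0 26 25))))
        (\<lambda>n'. ?Q (n1 + n')) t1"
      proof (rule wp_Seq, rule wp_framed[OF wp_add_idx[OF Kn(1)]])
        show "idx t1 20 \<le> ?K" using r i s Kn a by (simp add: same_def)
        fix n2 t2 assume b: "n2 \<le> 6 * ?K \<and> idx t2 26 = idx t1 25 + idx t1 20" "same (written_idx (add_idx 26 25 20)) (written_arr (add_idx 26 25 20)) t1 t2"
        have "idx t2 20 = i" "idx t2 21 = j" "idx t2 (Suc 0) = ?k" "idx t2 25 = n - j" "idx t2 26 = n - j + i" "mem t2 = mem s'"
          using a b r ix by (auto simp: same_def)
        then show "wp ?B (Seq (Cond (IdxLess 1 25) (IdxCopy 25 1) Skip) (Copy (Ref 18 20 21) (Ref 0 26 25)))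
          (\<lambda>n'. (\<lambda>n'. ?Q (n1 + n')) (n2 + n')) t2"
          using conjunct1[OF a(1)] conjunct1[OF b(1)] Kn(1) m le by (intro vc_wp) (auto simp: min_def)
      qed simp_all
    qed simp_all
  qed (use s Kn in auto)
  then show ?thesis unfolding takes_def
  proof (rule wp_conseq)
    fix m and t :: store assume *: "m \<le> (20 + 16) * ?K ^ 3 \<and>
      (\<forall>i j. mem t 18 i j = (if i < idx s 0 + 2 \<and> j < idx s 0 + 1 then ?f i j else mem s 18 i j))"
    have "mem t 18 i j = int (Gam j i)" if "1 \<le> i" "i \<le> Suc n" "j \<le> n" for i j
    proof -
      have "G (min ?k (n - j)) (n - j + i) = G (n - j) (n - j + i)" using G_ge[of "n - j" "n - j + i"] by (simp add: min_def)
      then show ?thesis using conjunct2[OF *, rule_format, of i j] s that G_rows[of "n - j + i"] by (auto simp: contents_def Gam_def)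
    qed
    then show "m \<le> 40 * ?K ^ 3 \<and> holds_rows 18 n n Gam t" using * by (simp add: holds_rows_def)
  qed
qed

text \<open>The cost of an operation depends on its operands, so the intermediate values need bounds
  too; they decrease from row i of \<Lambda> to \<open>Bc j i\<close>.\<close>

lemma partial_bounds:
  assumes i: "1 \<le> i" "i \<le> n" and r: "j \<le> r" "r \<le> p"
  defines "acc \<equiv> int (\<Lambda> i) - (\<Sum>q=Suc j..r. int (X i q) - int (X (i - 1) q))"
  shows "0 \<le> acc" "acc \<le> int M"
proof -
  have nn: "0 \<le> int (X i q) - int (X (i - 1) q)" for q using X_mono[OF i(2), of q] by simp
  have "0 \<le> (\<Sum>q=Suc j..r. int (X i q) - int (X (i - 1) q))" by (rule sum_nonneg) (rule nn)
  moreover have "int (\<Lambda> i) \<le> int M" using partition_antimono[OF parts(1), of 1 i] i by (simp add: M_def)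
  ultimately show "acc \<le> int M" unfolding acc_def by linarith
  have "(\<Sum>q=Suc j..r. int (X i q) - int (X (i - 1) q)) \<le> (\<Sum>q=Suc j..p. int (X i q) - int (X (i - 1) q))"
    by (rule sum_mono2) (use r nn in auto)
  then show "0 \<le> acc" unfolding acc_def using Bc_from_right[OF i, of j] r by linarith
qed

lemma wp_row_loop:
  assumes i: "1 \<le> i" "i \<le> n" and j: "j \<le> p" and st: "stores 10 p n X s"
    and ix: "idx s 20 = i" "idx s 21 = j" "idx s 25 = j" "idx s 26 = i - 1" "idx s 27 = j" "idx s 28 = p"
    and m: "mem s 1 i j = int (\<Lambda> i)"
  shows "wp sk.bnd row_loop (\<lambda>c t. c \<le> 10 * sk.K \<and> mem t 1 = (mem s 1)(i := (mem s 1 i)(j := int (Bc j i)))) s"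
proof -
  define acc where "acc r = int (\<Lambda> i) - (\<Sum>q=Suc j..r. int (X i q) - int (X (i - 1) q))" for r
  define Inv where "Inv r t \<longleftrightarrow> same {25, 27} {1} s t \<and> idx t 27 = r \<and> j \<le> r \<and>
    mem t 1 = (mem s 1)(i := (mem s 1 i)(j := acc r))" for r t
  have "wp sk.bnd row_loop (\<lambda>c t. c \<le> (4 + 3) * sk.K ^ Suc 0 \<and> Inv p t \<and> idx t 25 = p) s"
    unfolding row_loop_def
  proof (rule wp_up_K[where i = j and I = Inv])
    fix r t assume r: "r < p" and t: "Inv r t" "idx t 25 = r" "idx t 28 = p"
    have ix': "idx t 20 = i" "idx t 21 = j" "idx t 26 = i - 1" "idx t 27 = r" and m10: "mem t 10 = mem s 10"
      and m1: "mem t 1 = (mem s 1)(i := (mem s 1 i)(j := acc r))" and jr: "j \<le> r"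
      using t ix by (auto simp: Inv_def same_def)
    have x: "mem s 10 (Suc r) i = int (X i (Suc r))" "mem s 10 (Suc r) (i - 1) = int (X (i - 1) (Suc r))"
      using st i r by (auto simp: stores_def)
    have "\<mu> 1 \<le> M" using con by (simp add: contains_def M_def)
    then have "X i (Suc r) \<le> M" "X (i - 1) (Suc r) \<le> M"
      using chain_le[OF X_chain, of i "Suc r"] chain_le[OF X_chain, of "i - 1" "Suc r"] i by linarith+
    moreover have "0 \<le> acc r" "acc r \<le> int M" unfolding acc_def using partial_bounds[OF i jr] r by auto
    ultimately have b: "\<bar>acc r\<bar> \<le> sk.bnd" "int (X i (Suc r)) \<le> sk.bnd" "int (X (i - 1) (Suc r)) \<le> sk.bnd"
      "\<bar>acc r - int (X i (Suc r))\<bar> \<le> sk.bnd"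
      using Bn by auto
    have acc: "acc (Suc r) = acc r - int (X i (Suc r)) + int (X (i - 1) (Suc r))" using jr by (simp add: acc_def)
    have fin: "Inv (Suc r) u" if "same {25, 27} {1} t u" "idx u 27 = Suc r" "mem u 1 = (mem s 1)(i := (mem s 1 i)(j := acc (Suc r)))" for u
      using that t(1) by (auto simp: Inv_def same_def)
    show "wp sk.bnd (Seq (IdxSucc 27) (Seq (Sub (Ref 1 20 21) (Ref 1 20 21) (Ref 10 27 20)) (Add (Ref 1 20 21) (Ref 1 20 21) (Ref 10 27 26))))
      (\<lambda>c t'. c \<le> 4 * sk.K ^ 0 \<and> idx t' 25 = r \<and> idx t' 28 = p \<and> Inv (Suc r) (set_idx 25 (Suc r) t')) t"
    proof (rule vc_wp)
      show "vc sk.bnd (Seq (IdxSucc 27) (Seq (Sub (Ref 1 20 21) (Ref 1 20 21) (Ref 10 27 20)) (Add (Ref 1 20 21) (Ref 1 20 21) (Ref 10 27 26))))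
        (\<lambda>c t'. c \<le> 4 * sk.K ^ 0 \<and> idx t' 25 = r \<and> idx t' 28 = p \<and> Inv (Suc r) (set_idx 25 (Suc r) t')) t"
        by (simp add: ix' m10 m1[unfolded One_nat_def] x[unfolded One_nat_def] b[unfolded One_nat_def] t(2,3))
          (rule fin, simp_all add: same_def ix' m10 m1[unfolded One_nat_def] x[unfolded One_nat_def] acc)
    qed
  next
    have "acc j = int (\<Lambda> i)" by (simp add: acc_def)
    then have "(mem s 1)(i := (mem s 1 i)(j := acc j)) = mem s 1" using m by (simp add: fun_upd_idem)
    then show "Inv j s" using ix by (simp add: Inv_def)
  qed (use j ix Kn p_le_n in auto)
  then show ?thesis
  proof (rule wp_conseq)
    fix c t assume *: "c \<le> (4 + 3) * sk.K ^ Suc 0 \<and> Inv p t \<and> idx t 25 = p"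
    have "acc p = int (Bc j i)" unfolding acc_def using Bc_from_right[OF i j] by simp
    then show "c \<le> 10 * sk.K \<and> mem t 1 = (mem s 1)(i := (mem s 1 i)(j := int (Bc j i)))" using * by (auto simp: Inv_def)
  qed
qed

lemma takes_rows:
  assumes st: "stores 10 p n X s" and ix: "idx s 0 = n" "idx s 1 = length \<nu>" "idx s 28 = p"
    and m: "mem s 0 = contents n (length \<nu>) G" "mem s 1 = (\<lambda>_ _. 0)"
  shows "takes sk.bnd sk.K 50 (table 0 28 row_body) (\<lambda>t. mem t 1 = contents n p Bc) s"
proof -
  have "wp sk.bnd (table 0 28 row_body) (\<lambda>c t. c \<le> (20 + 16) * sk.K ^ 3 \<and>
    (\<forall>i j. mem t 1 i j = (if i < idx s 0 + 2 \<and> j < idx s 28 + 1 then contents n p Bc i j else mem s 1 i j))) s"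
  proof (rule wp_table)
    fix s' i j assume i: "i < idx s 0 + 2" "j < idx s 28 + 1"
      and sm: "same (written_idx row_body \<union> table_idx) (written_arr row_body) s s'"
      and r: "idx s' 20 = i" "idx s' 21 = j" "idx s' 14 = 1" "idx s' 15 = 0"
    have ix': "idx s' 0 = n" "idx s' (Suc 0) = length \<nu>" "idx s' 28 = p" and m': "mem s' 0 = mem s 0" "mem s' 10 = mem s 10"
      using sm ix by (auto simp: same_def)
    let ?Q = "\<lambda>c t. c \<le> 20 * sk.K \<and> mem t 1 = (mem s' 1)(i := (mem s' 1 i)(j := contents n p Bc i j))"
    show "wp sk.bnd row_body ?Q s'"
    proof (cases "i = 0 \<or> n < i")
      case True
      then show ?thesis unfolding row_body_def using Kn Bn r ix' by (intro vc_wp) (auto simp: contents_def)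
    next
      case False
      then have i1: "1 \<le> i" "i \<le> n" and jp: "j \<le> p" using i ix by auto
      have v: "mem s 0 i (length \<nu>) = int (\<Lambda> i)" using i1 sk.G_top[OF i1(1)] m by (simp add: contents_def)
      have b: "int (\<Lambda> i) \<le> sk.bnd" using partial_bounds(2)[OF i1, of p p] Bn by simp
      let ?s = "set_idx 27 j (set_idx 25 j (set_idx 26 (i - 1) (set_idx 26 i (set_val (Ref 1 20 21) (int (\<Lambda> i)) s'))))"
      have "wp sk.bnd row_loop (\<lambda>c t. c \<le> 10 * sk.K \<and> mem t 1 = (mem ?s 1)(i := (mem ?s 1 i)(j := int (Bc j i)))) ?s"
        by (rule wp_row_loop[OF i1 jp]) (use st m' r ix' in \<open>auto simp: stores_def\<close>)
      then have "wp sk.bnd row_loop (\<lambda>c t. ?Q (Suc (Suc (Suc (Suc (Suc (Suc (Suc c)))))))  t) ?s"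
        by (rule wp_conseq) (use r i1 jp Kn(1) in \<open>auto simp: contents_def\<close>)
      then show ?thesis unfolding row_body_def
        by (intro wp_Cond wp_Seq wp_IdxCopy wp_IdxPred wp_Copy) (use False r ix' m' v b in auto)
    qed
  qed (use ix Kn p_le_n in auto)
  then show ?thesis unfolding takes_def
  proof (rule wp_conseq)
    fix c t assume *: "c \<le> (20 + 16) * sk.K ^ 3 \<and>
      (\<forall>i j. mem t 1 i j = (if i < idx s 0 + 2 \<and> j < idx s 28 + 1 then contents n p Bc i j else mem s 1 i j))"
    have "mem t 1 i j = contents n p Bc i j" for i j using conjunct2[OF *, rule_format, of i j] m ix by (auto simp: contents_def)
    then show "c \<le> 50 * sk.K ^ 3 \<and> mem t 1 = contents n p Bc" using * by (auto simp: fun_eq_iff)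
  qed
qed

lemma computes_rho2:
  "computes rho2_prog [n, length \<nu>] [gt_array n (length \<nu>) (\<mu>, A)] [gt_array n p (rho2 \<Lambda> \<nu> (\<mu>, A))]
     (576000 * cube_log (max (length \<nu>) n) M)"
proof -
  note s0 = sk.s0_idx[simplified] sk.s0_mem[simplified]
  have e: "gt_array n p (rho2 \<Lambda> \<nu> (\<mu>, A)) = contents n p Bc"
    by (intro ext) (simp add: gt_array_rho2 contents_def)
  let ?Q = "\<lambda>t. mem t (Suc 0) = contents n p Bc"
  have "takes sk.bnd sk.K 1000 rho2_prog (\<lambda>t. mem t (length [gt_array n (length \<nu>) (\<mu>, A)]) = gt_array n p (rho2 \<Lambda> \<nu> (\<mu>, A))) sk.s0"
    unfolding rho2_prog_def e list.size add_0 plus_nat.add_0 plus_1_eq_Suc One_nat_def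
  proof (rule takes_Seq[OF takes_gam], use s0 in simp, use s0 in simp, use s0 in simp, simp,
      rule takes_IdxCopy[OF Kn(1)], simp, rule takes_IdxCopy[OF Kn(1)], simp)
    fix t1 assume t1: "holds_rows 18 n n Gam t1" "same (written_idx (table 0 0 gam_body)) (written_arr (table 0 0 gam_body)) sk.s0 t1"
    let ?s = "set_idx 12 (idx (set_idx 10 (idx t1 0) t1) 0) (set_idx 10 (idx t1 0) t1)"
    have ix: "idx ?s 0 = n" "idx ?s (Suc 0) = length \<nu>" "idx ?s 10 = n" "idx ?s 12 = n"
      and m: "mem ?s 0 = contents n (length \<nu>) G" "\<And>x. x \<notin> {0, 18} \<Longrightarrow> mem ?s x = (\<lambda>_ _. 0)"
      using t1(2) s0 by (auto simp: same_def)
    have x1: "takes sk.bnd sk.K 160 (xi_prog 18) (\<lambda>t. stores 10 p (p + n) X t \<and> idx t 28 = p \<and> idx t 10 = p) ?s"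
      unfolding X_def
      by (rule takes_xi[OF Gam_chain Gam_0, unfolded plen_Gam]) (use t1(1) ix m Kn Bn in \<open>auto simp: holds_rows_def\<close>)
    show "takes sk.bnd sk.K (1000 - 40 - 1 - 1) (Seq (xi_prog 18) (table 0 28 row_body)) ?Q ?s"
    proof (rule takes_Seq[OF x1], simp)
      fix t2 assume t2: "stores 10 p (p + n) X t2 \<and> idx t2 28 = p \<and> idx t2 10 = p" "same (written_idx (xi_prog 18)) (written_arr (xi_prog 18)) ?s t2"
      have st: "stores 10 p n X t2" using stores_shorter[OF conjunct1[OF t2(1)]] by simp
      have "idx t2 0 = idx ?s 0" "idx t2 (Suc 0) = idx ?s (Suc 0)" using same_idx[OF t2(2), of 0] same_idx[OF t2(2), of "Suc 0"] by auto
      then have ix2: "idx t2 0 = n" "idx t2 (Suc 0) = length \<nu>" "idx t2 28 = p" using ix t2(1) by auto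
      have m2: "mem t2 0 = contents n (length \<nu>) G" "mem t2 (Suc 0) = (\<lambda>_ _. 0)"
        using same_mem[OF t2(2), of 0] same_mem[OF t2(2), of "Suc 0"] m by auto
      show "takes sk.bnd sk.K (1000 - 40 - 1 - 1 - 160) (table 0 28 row_body) ?Q t2"
        by (rule takes_weaken[OF takes_rows[OF st]]) (use ix2 m2 in auto)
    qed
  qed
  from computes_one[OF this[unfolded sk.bnd_def sk.s0_def sk_simps], of "max (length \<nu>) n"]
  show ?thesis using sk.K_ge(5) by simp
qed

end

section \<open>The RSK program\<close>

text \<open>The old \<open>RR\<close> values are overwritten, so array 11 keeps the one for the
  present letter and array 12 the one for the preceding letter; both are needed for
  \<open>WW_Suc\<close>. The word for the next row replaces the present one in array 3 entry by
  entry.\<close>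

definition rsk_cell :: com where
  "rsk_cell = Seq (IdxCopy 26 22) (Seq (IdxSucc 26) (Seq (Copy (Ref 11 15 15) (Ref 1 27 26))
     (Seq (Cond (ValLess (Ref 11 15 15) (Ref 1 27 22)) (Copy (Ref 1 27 26) (Ref 1 27 22)) Skip)
     (Seq (Add (Ref 1 27 26) (Ref 1 27 26) (Ref 3 15 26))
     (Seq (Add (Ref 3 15 26) (Ref 3 15 26) (Ref 11 15 15)) (Seq (Sub (Ref 3 15 26) (Ref 3 15 26) (Ref 12 15 15))
     (Seq (Sub (Ref 3 15 26) (Ref 3 15 26) (Ref 1 27 26)) (Seq (Add (Ref 3 15 26) (Ref 3 15 26) (Ref 1 27 22))
     (Copy (Ref 12 15 15) (Ref 11 15 15))))))))))"

definition rsk_row :: com where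
  "rsk_row = Seq (IdxCopy 27 21) (Seq (IdxSucc 27) (Seq (Const (Ref 12 15 15) 0) (Seq (IdxZero 22)
     (Seq (While (IdxLess 22 0) (Seq rsk_cell (IdxSucc 22))) (Copy (Ref 2 27 25) (Ref 1 27 0))))))"

definition copy_line :: com where
  "copy_line = Seq (IdxZero 22) (While (IdxLess 22 0)
     (Seq (Seq (IdxCopy 26 22) (Seq (IdxSucc 26) (Copy (Ref 3 15 26) (Ref 0 25 26)))) (IdxSucc 22)))"

definition rsk_line :: com where
  "rsk_line = Seq (IdxCopy 25 20) (Seq (IdxSucc 25) (Seq copy_line
     (Seq (IdxZero 21) (While (IdxLess 21 0) (Seq rsk_row (IdxSucc 21))))))"

definition rsk_prog :: com where
  "rsk_prog = Seq (IdxZero 15) (Seq (IdxZero 20) (While (IdxLess 20 0) (Seq rsk_line (IdxSucc 20))))"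

lemma written_rsk [simp]:
  "written_idx rsk_cell = {26}" "written_arr rsk_cell = {1, 3, 11, 12}"
  "written_idx rsk_row = {22, 26, 27}" "written_arr rsk_row = {1, 2, 3, 11, 12}"
  "written_idx copy_line = {22, 26}" "written_arr copy_line = {3}"
  "written_idx rsk_line = {21, 22, 25, 26, 27}" "written_arr rsk_line = {1, 2, 3, 11, 12}"
  by (auto simp: rsk_cell_def rsk_row_def copy_line_def rsk_line_def)

locale rsk_input =
  fixes k m :: nat and V :: "nat \<Rightarrow> nat \<Rightarrow> nat"
  assumes RR_bound: "\<And>i r j. i \<le> k \<Longrightarrow> RR k V i r j \<le> m"
    and WW_bound: "\<And>i r j. i < k \<Longrightarrow> WW k V (Suc i) r j \<le> m"
begin

definition B where "B = 4 * int m + 4"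
definition K where "K = Suc k"

text \<open>The state when line \<open>i + 1\<close> of the matrix has passed through \<open>r\<close> rows and \<open>j\<close> letters of the next row.\<close>

definition P_arr :: "nat \<Rightarrow> nat \<Rightarrow> nat \<Rightarrow> arr" where
  "P_arr i r j r' j' = (if 1 \<le> r' \<and> r' \<le> k \<and> 1 \<le> j' \<and> j' \<le> k
     then int (RR k V (if r' \<le> r \<or> r' = Suc r \<and> j' \<le> j then Suc i else i) (r' - 1) j') else 0)"

definition Q_arr :: "nat \<Rightarrow> nat \<Rightarrow> arr" where
  "Q_arr i r r' i' = (if 1 \<le> r' \<and> r' \<le> k \<and> 1 \<le> i' \<and> (i' \<le> i \<or> i' = Suc i \<and> r' \<le> r) then int (RR k V i' (r' - 1) k) else 0)"

definition word_ok :: "nat \<Rightarrow> nat \<Rightarrow> nat \<Rightarrow> store \<Rightarrow> bool" where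
  "word_ok i r j t \<longleftrightarrow> (\<forall>j'. 1 \<le> j' \<longrightarrow> j' \<le> k \<longrightarrow> mem t 3 0 j' = int (WW k V (Suc i) (if j' \<le> j then Suc r else r) j'))"

definition ready :: "store \<Rightarrow> bool" where
  "ready t \<longleftrightarrow> mem t 0 = mat_array k V \<and> idx t 0 = k \<and> idx t 15 = 0"

lemma P_arr_Suc: "r < k \<Longrightarrow> j < k \<Longrightarrow>
    P_arr i r (Suc j) = (P_arr i r j)(Suc r := (P_arr i r j (Suc r))(Suc j := int (RR k V (Suc i) r (Suc j))))"
  by (auto simp: P_arr_def fun_eq_iff le_Suc_eq)

lemma P_arr_row: "P_arr i r k = P_arr i (Suc r) 0"
  by (auto simp: P_arr_def fun_eq_iff le_Suc_eq)

lemma P_arr_line: "P_arr i k 0 = P_arr (Suc i) 0 0"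
  by (auto simp: P_arr_def fun_eq_iff le_Suc_eq)

lemma P_arr_0: "P_arr 0 0 0 = (\<lambda>_ _. 0)"
  by (auto simp: P_arr_def fun_eq_iff RR_init)

lemma Q_arr_Suc: "r < k \<Longrightarrow>
    Q_arr i (Suc r) = (Q_arr i r)(Suc r := (Q_arr i r (Suc r))(Suc i := int (RR k V (Suc i) r k)))"
  by (auto simp: Q_arr_def fun_eq_iff le_Suc_eq)

lemma Q_arr_line: "Q_arr i k = Q_arr (Suc i) 0"
  by (auto simp: Q_arr_def fun_eq_iff le_Suc_eq)

lemma Q_arr_0: "Q_arr 0 0 = (\<lambda>_ _. 0)"
  by (auto simp: Q_arr_def fun_eq_iff)

definition cell_state :: "nat \<Rightarrow> nat \<Rightarrow> nat \<Rightarrow> store \<Rightarrow> bool" where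
  "cell_state i r j t \<longleftrightarrow> ready t \<and> mem t 1 = P_arr i r j \<and> mem t 2 = Q_arr i r \<and> word_ok i r j t \<and>
     mem t 12 0 0 = int (RR k V i r j) \<and> idx t 20 = i \<and> idx t 21 = r \<and> idx t 25 = Suc i \<and> idx t 27 = Suc r"

lemma wp_rsk_cell:
  assumes i: "i < k" "r < k" "j < k" and t: "cell_state i r j t" "idx t 22 = j"
  shows "wp B rsk_cell (\<lambda>c t'. c \<le> 20 \<and> cell_state i r (Suc j) t' \<and> idx t' 22 = j) t"
proof -
  define old oldp new prev w where "old = int (RR k V i r (Suc j))" and "oldp = int (RR k V i r j)"
    and "new = int (RR k V (Suc i) r (Suc j))" and "prev = int (RR k V (Suc i) r j)" and "w = int (WW k V (Suc i) r (Suc j))"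
  have ix: "idx t 15 = 0" "idx t 27 = Suc r" "idx t 22 = j" using t by (auto simp: cell_state_def ready_def)
  have m1: "mem t 1 = P_arr i r j" using t by (simp add: cell_state_def)
  \<comment> \<open>Column 0 is 0 throughout, which is the value of \<open>RR\<close> for the letter
    0.\<close>
  have "mem t 1 (Suc r) j = prev" using i unfolding m1 by (cases j) (auto simp: P_arr_def prev_def RR_0)
  then have v: "mem t (Suc 0) (Suc r) (Suc j) = old" "mem t (Suc 0) (Suc r) j = prev" "mem t 3 0 (Suc j) = w" "mem t 12 0 0 = oldp"
    using t i by (auto simp: cell_state_def word_ok_def P_arr_def old_def w_def oldp_def)
  have b: "0 \<le> old" "old \<le> int m" "0 \<le> oldp" "oldp \<le> int m" "0 \<le> new" "new \<le> int m" "0 \<le> prev" "prev \<le> int m" "0 \<le> w" "w \<le> int m"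
    using RR_bound[of i r j] RR_bound[of i r "Suc j"] RR_bound[of "Suc i" r j] RR_bound[of "Suc i" r "Suc j"] WW_bound[of i r "Suc j"] i
    by (auto simp: old_def oldp_def new_def prev_def w_def)
  have new: "new = (if old < prev then prev else old) + w"
    using RR_Suc[of k V i r j] by (auto simp: new_def prev_def old_def w_def)
  have w': "int (WW k V (Suc i) (Suc r) (Suc j)) = w + old - oldp - new + prev"
    using WW_Suc[of k V i r j] by (simp add: old_def oldp_def new_def prev_def w_def)
  have fin: "cell_state i r (Suc j) t'" if "same {26} {1, 3, 11, 12} t t'"
    "mem t' 1 = (mem t 1)(Suc r := (mem t 1 (Suc r))(Suc j := new))"
    "mem t' 3 = (mem t 3)(0 := (mem t 3 0)(Suc j := w + old - oldp - new + prev))" "mem t' 12 0 0 = old" for t'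
    using that t i by (auto simp: cell_state_def ready_def word_ok_def same_def P_arr_Suc new_def w' old_def le_Suc_eq)
  have B: "B = 4 * int m + 4" by (rule B_def)
  have "wp B rsk_cell (\<lambda>c t'. c \<le> 20 \<and> mem t' 1 = (mem t 1)(Suc r := (mem t 1 (Suc r))(Suc j := new)) \<and>
     mem t' 3 = (mem t 3)(0 := (mem t 3 0)(Suc j := w + old - oldp - new + prev)) \<and> mem t' 12 0 0 = old) t"
    unfolding rsk_cell_def
    by (rule vc_wp; cases "old < prev"; use b B new in \<open>simp add: ix v\<close>)
  then show ?thesis
  proof (rule wp_framed)
    fix c t' assume *: "c \<le> 20 \<and> mem t' 1 = (mem t 1)(Suc r := (mem t 1 (Suc r))(Suc j := new)) \<and>
     mem t' 3 = (mem t 3)(0 := (mem t 3 0)(Suc j := w + old - oldp - new + prev)) \<and> mem t' 12 0 0 = old"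
      "same (written_idx rsk_cell) (written_arr rsk_cell) t t'"
    show "c \<le> 20 \<and> cell_state i r (Suc j) t' \<and> idx t' 22 = j"
      using * fin[of t'] same_idx[OF *(2), of 22] t(2) by simp
  qed
qed

definition row_state :: "nat \<Rightarrow> nat \<Rightarrow> store \<Rightarrow> bool" where
  "row_state i r t \<longleftrightarrow> ready t \<and> mem t 1 = P_arr i r 0 \<and> mem t 2 = Q_arr i r \<and> word_ok i r 0 t \<and>
     idx t 20 = i \<and> idx t 25 = Suc i"

lemma wp_rsk_row:
  assumes i: "i < k" "r < k" and t: "row_state i r t" "idx t 21 = r"
  shows "wp B rsk_row (\<lambda>c t'. c \<le> 30 * K ^ 1 \<and> row_state i (Suc r) t' \<and> idx t' 21 = r) t"
proof -
  let ?s = "set_idx 22 0 (set_val (Ref 12 15 15) 0 (set_idx 27 (Suc r) (set_idx 27 r t)))"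
  have K: "1 \<le> K" "k \<le> K" by (auto simp: K_def)
  have Bp: "0 \<le> B" by (simp add: B_def)
  have "wp B (While (IdxLess 22 0) (Seq rsk_cell (IdxSucc 22)))
    (\<lambda>c t. c \<le> (20 + 3) * K ^ Suc 0 \<and> cell_state i r k t \<and> idx t 22 = k) ?s"
  proof (rule wp_up_K[where i = 0 and I = "\<lambda>j. cell_state i r j", OF K])
    fix j t assume j: "j < k" and t: "cell_state i r j t" "idx t 22 = j" "idx t 0 = k"
    show "wp B rsk_cell (\<lambda>c t'. c \<le> 20 * K ^ 0 \<and> idx t' 22 = j \<and> idx t' 0 = k \<and> cell_state i r (Suc j) (set_idx 22 (Suc j) t')) t"
      by (rule wp_conseq[OF wp_rsk_cell[OF i j t(1,2)]]) (auto simp: cell_state_def ready_def word_ok_def)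
  next
    show "cell_state i r 0 ?s"
      using t by (auto simp: cell_state_def row_state_def ready_def word_ok_def RR_0)
  qed (use t in \<open>auto simp: row_state_def ready_def\<close>)
  then have "wp B (While (IdxLess 22 0) (Seq rsk_cell (IdxSucc 22)))
    (\<lambda>c t'. wp B (Copy (Ref 2 27 25) (Ref 1 27 0)) (\<lambda>c'. (\<lambda>c t'. c \<le> 30 * K ^ 1 \<and> row_state i (Suc r) t' \<and> idx t' 21 = r) (Suc (Suc (Suc (Suc (c + c')))))) t') ?s"
  proof (rule wp_conseq)
    fix c t' assume *: "c \<le> (20 + 3) * K ^ Suc 0 \<and> cell_state i r k t' \<and> idx t' 22 = k"
    have k: "mem t' 1 (Suc r) k = int (RR k V (Suc i) r k)" using * i by (auto simp: cell_state_def P_arr_def)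
    have le: "int (RR k V (Suc i) r k) \<le> B" using RR_bound[of "Suc i" r k] i by (simp add: B_def)
    have c: "c \<le> 23 * K" using * by simp
    have ix: "idx t' 27 = Suc r" "idx t' 25 = Suc i" "idx t' 0 = k" using * by (auto simp: cell_state_def ready_def)
    show "wp B (Copy (Ref 2 27 25) (Ref 1 27 0)) (\<lambda>c'. (\<lambda>c t'. c \<le> 30 * K ^ 1 \<and> row_state i (Suc r) t' \<and> idx t' 21 = r) (Suc (Suc (Suc (Suc (c + c')))))) t'"
    proof (rule wp_Copy)
      show "\<bar>val t' (Ref 1 27 0)\<bar> \<le> B" using k le ix by simp
      show "Suc (Suc (Suc (Suc (c + 1)))) \<le> 30 * K ^ 1 \<and> row_state i (Suc r) (set_val (Ref 2 27 25) (val t' (Ref 1 27 0)) t') \<and>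
        idx (set_val (Ref 2 27 25) (val t' (Ref 1 27 0)) t') 21 = r"
        using conjunct1[OF conjunct2[OF *]] c K k ix i(2)
        by (auto simp: cell_state_def row_state_def ready_def word_ok_def P_arr_row Q_arr_Suc)
    qed
  qed
  then show ?thesis unfolding rsk_row_def
    by (intro wp_Seq wp_IdxCopy wp_IdxSucc wp_Const wp_IdxZero) (use t Bp in auto)
qed

lemma wp_copy_line:
  assumes i: "i < k" and t: "ready t" "idx t 25 = Suc i"
  shows "wp B copy_line (\<lambda>c t'. c \<le> 10 * K \<and> word_ok i 0 0 t') t"
proof -
  let ?s = "set_idx 22 0 t"
  have K: "1 \<le> K" "k \<le> K" by (auto simp: K_def)
  define Inv where "Inv j t' \<longleftrightarrow> same {22, 26} {3} t t' \<and> (\<forall>j'. 1 \<le> j' \<longrightarrow> j' \<le> j \<longrightarrow> mem t' 3 0 j' = int (V (Suc i) j'))" for j t'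
  have "wp B (While (IdxLess 22 0) (Seq (Seq (IdxCopy 26 22) (Seq (IdxSucc 26) (Copy (Ref 3 15 26) (Ref 0 25 26)))) (IdxSucc 22)))
    (\<lambda>c t. c \<le> (5 + 3) * K ^ Suc 0 \<and> Inv k t \<and> idx t 22 = k) ?s"
  proof (rule wp_up_K[where i = 0 and I = Inv, OF K])
    fix j t' assume j: "j < k" and t': "Inv j t'" "idx t' 22 = j" "idx t' 0 = k"
    have ix: "idx t' 25 = Suc i" "idx t' 15 = 0" and m: "mem t' 0 = mat_array k V"
      using t' t by (auto simp: Inv_def same_def ready_def)
    have v: "mat_array k V (Suc i) (Suc j) = int (V (Suc i) (Suc j))" using i j by (simp add: mat_array_def)
    have le: "int (V (Suc i) (Suc j)) \<le> B" using WW_bound[OF i, of 0 "Suc j"] WW_0[of "Suc j" k V "Suc i"] j by (simp add: B_def)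
    have fin: "Inv (Suc j) u" if "same {22, 26} {3} t' u" "mem u 3 = (mem t' 3)(0 := (mem t' 3 0)(Suc j := int (V (Suc i) (Suc j))))" for u
      using that t'(1) by (auto simp: Inv_def same_def le_Suc_eq)
    show "wp B (Seq (IdxCopy 26 22) (Seq (IdxSucc 26) (Copy (Ref 3 15 26) (Ref 0 25 26))))
      (\<lambda>c t''. c \<le> 5 * K ^ 0 \<and> idx t'' 22 = j \<and> idx t'' 0 = k \<and> Inv (Suc j) (set_idx 22 (Suc j) t'')) t'"
      by (rule vc_wp, simp add: ix m v le t'(2,3)) (rule fin, simp_all add: same_def ix)
  qed (use t in \<open>auto simp: Inv_def same_def ready_def\<close>)
  then have *: "wp B (While (IdxLess 22 0) (Seq (Seq (IdxCopy 26 22) (Seq (IdxSucc 26) (Copy (Ref 3 15 26) (Ref 0 25 26)))) (IdxSucc 22)))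
    (\<lambda>c t'. Suc c \<le> 10 * K \<and> word_ok i 0 0 t') ?s"
    by (rule wp_conseq) (use K in \<open>auto simp: Inv_def word_ok_def WW_0\<close>)
  show ?thesis unfolding copy_line_def
    by (rule wp_Seq, rule wp_IdxZero, rule wp_conseq[OF *]) auto
qed

definition line_state :: "nat \<Rightarrow> store \<Rightarrow> bool" where
  "line_state i t \<longleftrightarrow> ready t \<and> mem t 1 = P_arr i 0 0 \<and> mem t 2 = Q_arr i 0"

lemma wp_rsk_line:
  assumes i: "i < k" and t: "line_state i t" "idx t 20 = i"
  shows "wp B rsk_line (\<lambda>c t'. c \<le> 60 * K ^ 2 \<and> line_state (Suc i) t' \<and> idx t' 20 = i) t"
  unfolding rsk_line_def
proof (rule wp_Seq, rule wp_IdxCopy, rule wp_Seq, rule wp_IdxSucc, rule wp_Seq, rule wp_framed)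
  let ?s = "set_idx 25 (idx (set_idx 25 (idx t 20) t) 25 + 1) (set_idx 25 (idx t 20) t)"
  have K: "1 \<le> K" "k \<le> K" "K \<le> K ^ 2" by (auto simp: K_def power2_eq_square)
  have rs: "ready ?s" "idx ?s 25 = Suc i" "idx ?s 20 = i" using t by (auto simp: line_state_def ready_def)
  show "wp B copy_line (\<lambda>c t'. c \<le> 10 * K \<and> word_ok i 0 0 t') ?s" by (rule wp_copy_line[OF i rs(1,2)])
  fix c1 t1 assume a: "c1 \<le> 10 * K \<and> word_ok i 0 0 t1" "same (written_idx copy_line) (written_arr copy_line) ?s t1"
  have st: "row_state i 0 (set_idx 21 0 t1)" using a t rs by (auto simp: row_state_def line_state_def ready_def same_def word_ok_def)
  have "wp B (While (IdxLess 21 0) (Seq rsk_row (IdxSucc 21))) (\<lambda>c t. c \<le> (30 + 3) * K ^ Suc 1 \<and> row_state i k t \<and> idx t 21 = k) (set_idx 21 0 t1)"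
  proof (rule wp_up_K[where i = 0 and I = "\<lambda>r. row_state i r", OF K(1,2) _ _ st])
    fix r u assume r: "r < k" and u: "row_state i r u" "idx u 21 = r" "idx u 0 = k"
    show "wp B rsk_row (\<lambda>c t'. c \<le> 30 * K ^ 1 \<and> idx t' 21 = r \<and> idx t' 0 = k \<and> row_state i (Suc r) (set_idx 21 (Suc r) t')) u"
      by (rule wp_conseq[OF wp_rsk_row[OF i r u(1,2)]]) (auto simp: row_state_def ready_def word_ok_def)
  qed (use st in \<open>auto simp: row_state_def ready_def\<close>)
  then show "wp B (Seq (IdxZero 21) (While (IdxLess 21 0) (Seq rsk_row (IdxSucc 21))))
    (\<lambda>n'. (\<lambda>n'. (\<lambda>n'. (\<lambda>c t'. c \<le> 60 * K ^ 2 \<and> line_state (Suc i) t' \<and> idx t' 20 = i) (1 + n')) (1 + n')) (c1 + n')) t1"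
  proof (intro wp_Seq wp_IdxZero, elim wp_conseq)
    fix c u assume b: "c \<le> (30 + 3) * K ^ Suc 1 \<and> row_state i k u \<and> idx u 21 = k"
    have "c \<le> 33 * K ^ 2" using b by (simp add: power2_eq_square)
    moreover have "c1 \<le> 10 * K" using a by simp
    ultimately have "1 + (1 + (c1 + (1 + c))) \<le> 60 * K ^ 2" using K by linarith
    then show "1 + (1 + (c1 + (1 + c))) \<le> 60 * K ^ 2 \<and> line_state (Suc i) u \<and> idx u 20 = i"
      using b by (auto simp: row_state_def line_state_def P_arr_line Q_arr_line)
  qed
qed

lemma takes_rsk:
  assumes s: "mem s 0 = mat_array k V" "idx s 0 = k" "mem s 1 = (\<lambda>_ _. 0)" "mem s 2 = (\<lambda>_ _. 0)"
  shows "takes B K 100 rsk_prog (\<lambda>t. mem t 1 = P_arr k 0 0 \<and> mem t 2 = Q_arr k 0) s"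
proof -
  have K: "1 \<le> K" "k \<le> K" "1 \<le> K ^ 3" by (auto simp: K_def)
  let ?s = "set_idx 20 0 (set_idx 15 0 s)"
  have st: "line_state 0 ?s" using s by (auto simp: line_state_def ready_def P_arr_0 Q_arr_0)
  have "wp B (While (IdxLess 20 0) (Seq rsk_line (IdxSucc 20))) (\<lambda>c t. c \<le> (60 + 3) * K ^ Suc 2 \<and> line_state k t \<and> idx t 20 = k) ?s"
  proof (rule wp_up_K[where i = 0 and I = line_state, OF K(1,2) _ _ st])
    fix i u assume i: "i < k" and u: "line_state i u" "idx u 20 = i" "idx u 0 = k"
    show "wp B rsk_line (\<lambda>c t'. c \<le> 60 * K ^ 2 \<and> idx t' 20 = i \<and> idx t' 0 = k \<and> line_state (Suc i) (set_idx 20 (Suc i) t')) u"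
      by (rule wp_conseq[OF wp_rsk_line[OF i u(1,2)]]) (auto simp: line_state_def ready_def)
  qed (use s in auto)
  then have *: "wp B (While (IdxLess 20 0) (Seq rsk_line (IdxSucc 20))) (\<lambda>c t. 1 + (1 + c) \<le> 100 * K ^ 3 \<and> mem t 1 = P_arr k 0 0 \<and> mem t 2 = Q_arr k 0) ?s"
  proof (rule wp_conseq)
    fix c u assume b: "c \<le> (60 + 3) * K ^ Suc 2 \<and> line_state k u \<and> idx u 20 = k"
    have "c \<le> 63 * K ^ 3" using b by (simp add: power2_eq_square power3_eq_cube)
    then have "1 + (1 + c) \<le> 100 * K ^ 3" using K(3) by linarith
    then show "1 + (1 + c) \<le> 100 * K ^ 3 \<and> mem u 1 = P_arr k 0 0 \<and> mem u 2 = Q_arr k 0"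
      using b by (simp add: line_state_def)
  qed
  show ?thesis unfolding takes_def rsk_prog_def
    by (intro wp_Seq wp_IdxZero) (use * in simp)
qed

end

text \<open>All values of \<open>RR\<close> and \<open>WW\<close> are bounded by the sum of the
  matrix entries, which controls the operands in \<open>rsk_cell\<close>.\<close>

lemma computes_RSK:
  assumes V: "V \<in> Mat a b"
  defines "k \<equiv> max (length a) (length b)" and "m \<equiv> max (sum_list a) (sum_list b)"
  shows "computes rsk_prog [k] [mat_array k V] [gt_array k k (fst (RSK k V)), gt_array k k (snd (RSK k V))] (576000 * cube_log k m)"
proof -
  interpret rsk_input k m V
  proof
    show "RR k V i r j \<le> m" if "i \<le> k" for i r j
      using RR_le[OF V that[unfolded k_def], of r j] by (simp add: m_def k_def)
    show "WW k V (Suc i) r j \<le> m" if "i < k" for i r j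
      using WW_le[OF V, of i r j] that by (simp add: m_def k_def)
  qed
  have e: "gt_array k k (fst (RSK k V)) = P_arr k 0 0" "gt_array k k (snd (RSK k V)) = Q_arr k 0"
    by (intro ext; auto simp: gt_array_RSK P_arr_def Q_arr_def RR_0 RR_init not_less_eq_eq)+
  let ?s = "input_store [k] [mat_array k V]"
  have "takes B K 100 rsk_prog (\<lambda>t. mem t 1 = P_arr k 0 0 \<and> mem t 2 = Q_arr k 0) ?s"
    by (rule takes_rsk) (auto simp: input_store_def)
  then have "takes B K 1000 rsk_prog (\<lambda>t. mem t (length [mat_array k V]) = P_arr k 0 0 \<and> mem t (Suc (length [mat_array k V])) = Q_arr k 0) ?s"
    by (rule takes_weaken) (auto simp: numeral_2_eq_2)
  from computes_two[OF this[unfolded B_def], of k] show ?thesis unfolding e by (simp add: K_def)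
qed

lemmas (in skew_tableau) computes_unfolded =
  computes_rectify[unfolded n_def k_def M_def] computes_littlewood_robinson[unfolded n_def k_def M_def]
  computes_reversal[unfolded n_def k_def M_def] computes_rho1[unfolded n_def k_def M_def]

lemmas (in LR_tableau) computes_rho2_unfolded = computes_rho2[unfolded n_def p_def M_def]

theorem theorem2:
  "(\<exists>p C. \<forall>a b. \<forall>V \<in> Mat a b.
       let k = max (length a) (length b);
           m = max (sum_list a) (sum_list b);
           (P, Q) = RSK k V
       in computes p [k] [mat_array k V] [gt_array k k P, gt_array k k Q] (C * cube_log k m)) \<and>
   (\<exists>p C. \<forall>\<Lambda> \<mu> a. contains \<Lambda> \<mu> \<longrightarrow> (\<forall>A \<in> YT \<Lambda> \<mu> a.
       let n = plen \<Lambda>; k = length a; m = \<Lambda> 1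
       in computes p [n, k] [gt_array n k (\<mu>, A)] [gt_array n k (rectify (\<mu>, A))]
            (C * cube_log (max k n) m))) \<and>
   (\<exists>p C. \<forall>\<Lambda> \<mu> a. contains \<Lambda> \<mu> \<longrightarrow> (\<forall>A \<in> YT \<Lambda> \<mu> a.
       let n = plen \<Lambda>; k = length a; m = \<Lambda> 1;
           (A', C') = littlewood_robinson (\<mu>, A)
       in computes p [n, k] [gt_array n k (\<mu>, A)]
            [gt_array n k A', gt_array n (plen (outer A')) C']
            (C * cube_log (max k n) m))) \<and>
   (\<exists>p C. \<forall>\<Lambda> \<pi> \<mu> c d. contains \<pi> \<mu> \<longrightarrow> contains \<Lambda> \<pi> \<longrightarrow> (\<forall>B \<in> YT \<pi> \<mu> d. \<forall>A \<in> YT \<Lambda> \<pi> c.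
       let n = plen \<Lambda>; k = max (length c) (length d); m = \<Lambda> 1;
           (A', B') = switch (\<mu>, B) (\<pi>, A)
       in computes p [n, length d, length c]
            [gt_array n (length d) (\<mu>, B), gt_array n (length c) (\<pi>, A)]
            [gt_array n (length c) A', gt_array n (length d) B']
            (C * cube_log (max k n) m))) \<and>
   (\<exists>p C. \<forall>\<Lambda> a. is_partition \<Lambda> \<longrightarrow> (\<forall>A \<in> YT \<Lambda> empty_ptn a.
       let n = plen \<Lambda>; k = length a; m = \<Lambda> 1
       in computes p [n, k] [gt_array n k (empty_ptn, A)] [gt_array n k (xi k (empty_ptn, A))]
            (C * cube_log k m))) \<and>
   (\<exists>p C. \<forall>\<Lambda> \<mu> a. contains \<Lambda> \<mu> \<longrightarrow> (\<forall>A \<in> YT \<Lambda> \<mu> a.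
       let n = plen \<Lambda>; k = length a; m = \<Lambda> 1
       in computes p [n, k] [gt_array n k (\<mu>, A)] [gt_array n k (reversal k (\<mu>, A))]
            (C * cube_log (max k n) m))) \<and>
   (\<exists>p C. \<forall>\<Lambda> \<mu> \<nu>. contains \<Lambda> \<mu> \<longrightarrow> is_partition (entry \<nu>) \<longrightarrow> (\<forall>A \<in> LR \<Lambda> \<mu> \<nu>.
       let n = plen \<Lambda>; k = length \<nu>; m = \<Lambda> 1
       in computes p [n, k] [gt_array n k (\<mu>, A)] [gt_array n (plen \<mu>) (rho1 (\<mu>, A))]
            (C * cube_log (max k n) m))) \<and>
   (\<exists>p C. \<forall>\<Lambda> \<mu> \<nu>. contains \<Lambda> \<mu> \<longrightarrow> is_partition (entry \<nu>) \<longrightarrow> (\<forall>A \<in> LR \<Lambda> \<mu> \<nu>.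
       let n = plen \<Lambda>; k = length \<nu>; m = \<Lambda> 1
       in computes p [n, k] [gt_array n k (\<mu>, A)] [gt_array n (plen \<mu>) (rho2 \<Lambda> \<nu> (\<mu>, A))]
            (C * cube_log (max k n) m)))"
proof (intro conjI)
  show "\<exists>p C. \<forall>a b. \<forall>V \<in> Mat a b.
       let k = max (length a) (length b);
           m = max (sum_list a) (sum_list b);
           (P, Q) = RSK k V
       in computes p [k] [mat_array k V] [gt_array k k P, gt_array k k Q] (C * cube_log k m)"
    by (intro exI[of _ rsk_prog] exI[of _ 576000] allI ballI) (unfold Let_def case_prod_beta, rule computes_RSK)
  show "\<exists>p C. \<forall>\<Lambda> \<mu> a. contains \<Lambda> \<mu> \<longrightarrow> (\<forall>A \<in> YT \<Lambda> \<mu> a.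
       let n = plen \<Lambda>; k = length a; m = \<Lambda> 1
       in computes p [n, k] [gt_array n k (\<mu>, A)] [gt_array n k (rectify (\<mu>, A))]
            (C * cube_log (max k n) m))"
    by (intro exI[of _ rectify_prog] exI[of _ 576000] allI impI ballI)
      (unfold Let_def, rule skew_tableau.computes_unfolded(1)[OF skew_tableau.intro])
  show "\<exists>p C. \<forall>\<Lambda> \<mu> a. contains \<Lambda> \<mu> \<longrightarrow> (\<forall>A \<in> YT \<Lambda> \<mu> a.
       let n = plen \<Lambda>; k = length a; m = \<Lambda> 1;
           (A', C') = littlewood_robinson (\<mu>, A)
       in computes p [n, k] [gt_array n k (\<mu>, A)]
            [gt_array n k A', gt_array n (plen (outer A')) C']
            (C * cube_log (max k n) m))"
    by (intro exI[of _ littlewood_robinson_prog] exI[of _ 576000] allI impI ballI)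
      (unfold Let_def case_prod_beta, rule skew_tableau.computes_unfolded(2)[OF skew_tableau.intro])
  show "\<exists>p C. \<forall>\<Lambda> \<pi> \<mu> c d. contains \<pi> \<mu> \<longrightarrow> contains \<Lambda> \<pi> \<longrightarrow> (\<forall>B \<in> YT \<pi> \<mu> d. \<forall>A \<in> YT \<Lambda> \<pi> c.
       let n = plen \<Lambda>; k = max (length c) (length d); m = \<Lambda> 1;
           (A', B') = switch (\<mu>, B) (\<pi>, A)
       in computes p [n, length d, length c]
            [gt_array n (length d) (\<mu>, B), gt_array n (length c) (\<pi>, A)]
            [gt_array n (length c) A', gt_array n (length d) B']
            (C * cube_log (max k n) m))"
    by (intro exI[of _ switch_tableaux_prog] exI[of _ 576000] allI impI ballI)
      (unfold Let_def case_prod_beta, rule computes_switch)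
  show "\<exists>p C. \<forall>\<Lambda> a. is_partition \<Lambda> \<longrightarrow> (\<forall>A \<in> YT \<Lambda> empty_ptn a.
       let n = plen \<Lambda>; k = length a; m = \<Lambda> 1
       in computes p [n, k] [gt_array n k (empty_ptn, A)] [gt_array n k (xi k (empty_ptn, A))]
            (C * cube_log k m))"
    by (intro exI[of _ schuetzenberger_prog] exI[of _ 576000] allI impI ballI) (unfold Let_def, rule computes_xi)
  show "\<exists>p C. \<forall>\<Lambda> \<mu> a. contains \<Lambda> \<mu> \<longrightarrow> (\<forall>A \<in> YT \<Lambda> \<mu> a.
       let n = plen \<Lambda>; k = length a; m = \<Lambda> 1
       in computes p [n, k] [gt_array n k (\<mu>, A)] [gt_array n k (reversal k (\<mu>, A))]
            (C * cube_log (max k n) m))"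
    by (intro exI[of _ reversal_prog] exI[of _ 576000] allI impI ballI)
      (unfold Let_def, rule skew_tableau.computes_unfolded(3)[OF skew_tableau.intro])
  show "\<exists>p C. \<forall>\<Lambda> \<mu> \<nu>. contains \<Lambda> \<mu> \<longrightarrow> is_partition (entry \<nu>) \<longrightarrow> (\<forall>A \<in> LR \<Lambda> \<mu> \<nu>.
       let n = plen \<Lambda>; k = length \<nu>; m = \<Lambda> 1
       in computes p [n, k] [gt_array n k (\<mu>, A)] [gt_array n (plen \<mu>) (rho1 (\<mu>, A))]
            (C * cube_log (max k n) m))"
    by (intro exI[of _ rho1_prog] exI[of _ 576000] allI impI ballI)
      (unfold Let_def, rule skew_tableau.computes_unfolded(4)[OF skew_tableau.intro],
        auto simp: LR_def)
  show "\<exists>p C. \<forall>\<Lambda> \<mu> \<nu>. contains \<Lambda> \<mu> \<longrightarrow> is_partition (entry \<nu>) \<longrightarrow> (\<forall>A \<in> LR \<Lambda> \<mu> \<nu>.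
       let n = plen \<Lambda>; k = length \<nu>; m = \<Lambda> 1
       in computes p [n, k] [gt_array n k (\<mu>, A)] [gt_array n (plen \<mu>) (rho2 \<Lambda> \<nu> (\<mu>, A))]
            (C * cube_log (max k n) m))"
    by (intro exI[of _ rho2_prog] exI[of _ 576000] allI impI ballI)
      (unfold Let_def, rule LR_tableau.computes_rho2_unfolded[OF LR_tableau.intro])
qed

end
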